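(* Let $\mathfrak X$ be an infinite-dimensional Banach space and let $p\in(1,\infty)$. Then there exists a function $B\in\mathrm{BMO}_{\mathrm{so}}(\mathbb R;\mathscr L(\mathfrak X))$ with $B^*\in\mathrm{BMO}_{\mathrm{so}}(\mathbb R;\mathscr L(\mathfrak X^* ))$ such that its commutator $[B,\mathcal H]$ with the Hilbert transform $$\mathcal Hf(x):=\lim_{\varepsilon\to0}\frac1\pi\Big(\int_{-\infty}^{x-\varepsilon}+\int_{x+\varepsilon}^{\infty}\Big)\frac{f(y)\,dy}{x-y}$$ is not bounded on $L^p(\mathbb R;\mathfrak X)$.
   Context: $\mathscr L(\mathfrak X)$ is the space of bounded linear operators on $\mathfrak X$. A function $f:\mathbb R\to\mathfrak X$ is strongly measurable if it is a pointwise limit of simple functions; $L^p(\mathbb R;\mathfrak X)$ consists of the strongly measurable $f$ with $\|f(\cdot)\|_{\mathfrak X}\in L^p(\mathbb R)$. $\mathrm{BMO}(\mathbb R;\mathfrak X)$ is the space of locally integrable strongly measurable $b:\mathbb R\to\mathfrak X$ with $\|b\|_{\mathrm{BMO}}:=\sup_I\inf_{c\in\mathfrak X}\frac1{|I|}\int_I\|b(x)-c\|\,dx<\infty$, the supremum being over bounded intervals $I$. A function $B:\mathbb R\to\mathscr L(\mathfrak X)$ belongs to $\mathrm{BMO}_{\mathrm{so}}(\mathbb R;\mathscr L(\mathfrak X))$ if $B(\cdot)\mathfrak e\in\mathrm{BMO}(\mathbb R;\mathfrak X)$ for every $\mathfrak e\in\mathfrak X$ and $\sup_{\|\mathfrak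 e\|\le1}\|B(\cdot)\mathfrak e\|_{\mathrm{BMO}(\mathbb R;\mathfrak X)}<\infty$. $B^*$ is the pointwise adjoint $B^*(x):=B(x)^*\in\mathscr L(\mathfrak X^* )$, and $\mathrm{BMO}_{\mathrm{so}}(\mathbb R;\mathscr L(\mathfrak X^* ))$ is defined likewise. The commutator is $[B,\mathcal H]f:=B\,\mathcal Hf-\mathcal H(Bf)$. Its boundedness on $L^p(\mathbb R;\mathfrak X)$ is understood in the weak sense: there is a constant $C$ such that $|\langle[B,\mathcal H]f,g\rangle|\le C\|f\|_{L^p(\mathbb R;\mathfrak X)}\|g\|_{L^{p'}(\mathbb R;\mathfrak X^* )}$, $p'=p/(p-1)$, for all $f\in C_c^\infty(\mathbb R)\otimes\mathfrak X$ and $g\in C_c^\infty(\mathbb R)\otimes\mathfrak X^*$ (finite sums of scalar test functions times vectors), where, since the transpose of $\mathcal H$ is $-\mathcal H$, $$\langle[B,\mathcal H]f,g\rangle:=\int_{\mathbb R}\Big(\langle B(x)\mathcal Hf(x),g(x)\rangle+\langle B(x)f(x),\mathcal Hg(x)\rangle\Big)\,dx .$$ *)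

theory Defs
  imports "HOL-Analysis.Analysis"
begin

text \<open>
  The scalar field \<open>'k\<close> ranges over the sort \<open>{real_normed_field, euclidean_space}\<close>, so that
  real and complex Banach spaces are covered simultaneously; the next lemma shows that
  \<open>\<real>\<close> and \<open>\<complex>\<close> are its only models.
\<close>

lemma scalar_field_real_or_complex:
  "(\<forall>z::'k::{real_normed_field,euclidean_space}. \<exists>a. z = of_real a) \<or>
   (\<exists>i::'k. i * i = -1 \<and> (\<forall>z. \<exists>a b. z = of_real a + of_real b * i))"
proof -
  have sq: "w * w = -1" if n: "norm w = 1" and o: "inner w 1 = 0" for w :: 'k
  proof -
    have ww1: "inner w w = 1" "inner (1::'k) 1 = 1"
      using n by (simp_all flip: power2_norm_eq_inner)
    have a: "(norm (w - 1))\<^sup>2 = 2" "(norm (w + 1))\<^sup>2 = 2"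
      using o ww1 by (simp_all add: power2_norm_eq_inner inner_diff inner_add inner_commute)
    have "w * w - 1 = (w - 1) * (w + 1)" by (simp add: algebra_simps)
    then have "(norm (w * w - 1))\<^sup>2 = 4" using a by (simp add: norm_mult power_mult_distrib)
    moreover have ww: "inner (w * w) (w * w) = 1" and oo: "inner (1::'k) 1 = 1"
      using n by (simp_all add: norm_mult flip: power2_norm_eq_inner)
    ultimately have "inner (w * w) 1 = -1"
      by (simp add: power2_norm_eq_inner inner_diff inner_commute)
    then have "(norm (w * w + 1))\<^sup>2 = 0"
      using ww oo by (simp add: power2_norm_eq_inner inner_add inner_commute)
    then show ?thesis by (simp add: eq_neg_iff_add_eq_0)
  qed
  have dec: "\<exists>a b w. z = of_real a + of_real b * w \<and> w * w = -1"
    if "\<nexists>a. z = of_real a" for z :: 'k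
  proof -
    define a where "a = inner z 1"
    define u where "u = z - of_real a"
    have "u \<noteq> 0" using that unfolding u_def by auto
    have "inner u 1 = 0"
      by (simp add: u_def a_def inner_diff of_real_def flip: power2_norm_eq_inner)
    then have "inner (u /\<^sub>R norm u) 1 = 0" by simp
    moreover have "norm (u /\<^sub>R norm u) = 1" using \<open>u \<noteq> 0\<close> by simp
    ultimately have "(u /\<^sub>R norm u) * (u /\<^sub>R norm u) = -1" by (rule sq[rotated])
    moreover have "of_real (norm u) * (u /\<^sub>R norm u) = u"
      using \<open>u \<noteq> 0\<close> by (simp flip: scaleR_conv_of_real)
    then have "z = of_real a + of_real (norm u) * (u /\<^sub>R norm u)"
      by (simp add: u_def)
    ultimately show ?thesis by blast
  qed
  show ?thesis
  proof (cases "\<forall>z::'k. \<exists>a. z = of_real a")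
    case False
    then obtain i :: 'k where i: "i * i = -1" using dec by blast
    have "\<exists>a b. z = of_real a + of_real b * i" for z :: 'k
    proof (cases "\<exists>a. z = of_real a")
      case True
      then show ?thesis by (metis add.right_neutral mult_zero_left of_real_0)
    next
      case False
      then obtain a b w where z: "z = of_real a + of_real b * w" "w * w = -1"
        using dec by blast
      then have "w = i \<or> w = - i" using i by (metis square_eq_iff)
      then show ?thesis
        using z by (metis mult_minus_left mult_minus_right of_real_minus)
    qed
    then show ?thesis using i by blast
  qed blast
qed

text \<open>
  A Banach space over \<open>'k\<close>. The last axiom says that the real structure of the type \<open>'a\<close> is the
  restriction of scalars; it has no content for real scalars.
\<close>

locale banach_space_over = vector_space smul
  for smul :: "'k::{real_normed_field,euclidean_space} \<Rightarrow> 'a::banach \<Rightarrow> 'a" +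
  assumes norm_scale: "norm (smul c x) = norm c * norm x"
    and scale_of_real: "smul (of_real r) x = r *\<^sub>R x"

lemma banach_space_over_scaleR: "banach_space_over (scaleR :: real \<Rightarrow> 'a::banach \<Rightarrow> 'a)"
  by unfold_locales (simp_all add: algebra_simps)

lemma banach_space_over_complex: "banach_space_over ((*) :: complex \<Rightarrow> complex \<Rightarrow> complex)"
  by unfold_locales (simp_all add: algebra_simps norm_mult scaleR_conv_of_real)

text \<open>
  Below, a space is given by a linear subspace \<open>E\<close> (the carrier) of a normed type together with a
  scalar multiplication: \<open>UNIV\<close> and \<open>smul\<close> for \<open>\<XX>\<close>; \<open>dual_space smul\<close> and \<open>dual_scale\<close> for
  \<open>\<XX>\<^sup>*\<close>. The type \<open>'a \<Rightarrow>\<^sub>L 'k\<close> carries the operator norm but consists of all real-linear bounded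
  maps, hence the carrier.
\<close>

definition dual_space :: "('k \<Rightarrow> 'a \<Rightarrow> 'a) \<Rightarrow>
    ('a::banach \<Rightarrow>\<^sub>L 'k::{real_normed_field,euclidean_space}) set" where
  "dual_space smul = {\<phi>. \<forall>c x. blinfun_apply \<phi> (smul c x) = c * blinfun_apply \<phi> x}"

definition dual_scale :: "'k \<Rightarrow> ('a \<Rightarrow>\<^sub>L 'k) \<Rightarrow>
    ('a::banach \<Rightarrow>\<^sub>L 'k::{real_normed_field,euclidean_space})" where
  "dual_scale c \<phi> = Blinfun (\<lambda>x. c * blinfun_apply \<phi> x)"

definition bounded_operators :: "('k \<Rightarrow> 'e \<Rightarrow> 'e) \<Rightarrow> 'e::real_normed_vector set \<Rightarrow> ('e \<Rightarrow> 'e) set" where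
  "bounded_operators smul E = {T.
     (\<forall>u\<in>E. T u \<in> E) \<and>
     (\<forall>u\<in>E. \<forall>v\<in>E. T (u + v) = T u + T v) \<and>
     (\<forall>c. \<forall>u\<in>E. T (smul c u) = smul c (T u)) \<and>
     (\<exists>K. \<forall>u\<in>E. norm (T u) \<le> K * norm u)}"

definition adjoint_operator :: "('a \<Rightarrow> 'a) \<Rightarrow> ('a \<Rightarrow>\<^sub>L 'k) \<Rightarrow>
    ('a::banach \<Rightarrow>\<^sub>L 'k::{real_normed_field,euclidean_space})" where
  "adjoint_operator T \<phi> = Blinfun (\<lambda>x. blinfun_apply \<phi> (T x))"

definition strongly_measurable :: "'e::real_normed_vector set \<Rightarrow> (real \<Rightarrow> 'e) \<Rightarrow> bool" where
  "strongly_measurable E f \<longleftrightarrow> range f \<subseteq> E \<and>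
     (\<exists>s. (\<forall>n. simple_function lebesgue (s n) \<and> range (s n) \<subseteq> E) \<and>
          (\<forall>x. (\<lambda>n::nat. s n x) \<longlonglongrightarrow> f x))"

definition bmo_norm :: "'e::real_normed_vector set \<Rightarrow> (real \<Rightarrow> 'e) \<Rightarrow> ennreal" where
  "bmo_norm E f = (SUP (l, r) \<in> {(l, r). l < r}. INF c\<in>E.
     (\<integral>\<^sup>+x\<in>{l..r}. ennreal (norm (f x - c)) \<partial>lebesgue) / ennreal (r - l))"

definition BMO :: "'e::real_normed_vector set \<Rightarrow> (real \<Rightarrow> 'e) set" where
  "BMO E = {f. strongly_measurable E f \<and>
     (\<forall>l r. set_integrable lebesgue {l..r} (\<lambda>x. norm (f x))) \<and>
     bmo_norm E f < \<infinity>}"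

definition BMO_so :: "('k \<Rightarrow> 'e \<Rightarrow> 'e) \<Rightarrow> 'e::real_normed_vector set \<Rightarrow> (real \<Rightarrow> 'e \<Rightarrow> 'e) set" where
  "BMO_so smul E = {B.
     (\<forall>x. B x \<in> bounded_operators smul E) \<and>
     (\<forall>e\<in>E. (\<lambda>x. B x e) \<in> BMO E) \<and>
     (SUP e\<in>{e\<in>E. norm e \<le> 1}. bmo_norm E (\<lambda>x. B x e)) < \<infinity>}"

definition test_function :: "(real \<Rightarrow> 'k::real_normed_vector) \<Rightarrow> bool" where
  "test_function \<phi> \<longleftrightarrow>
     (\<exists>D. D 0 = \<phi> \<and> (\<forall>n x. (D n has_vector_derivative D (Suc n) x) (at x))) \<and>
     compact (closure {x. \<phi> x \<noteq> 0})"

definition test_tensor :: "('k::real_normed_vector \<Rightarrow> 'e \<Rightarrow> 'e) \<Rightarrow> 'e::real_normed_vector set \<Rightarrow>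
    (real \<Rightarrow> 'e) set" where
  "test_tensor smul E = {f. \<exists>(n::nat) \<phi> e. (\<forall>i<n. test_function (\<phi> i) \<and> e i \<in> E) \<and>
     f = (\<lambda>x. \<Sum>i<n. smul (\<phi> i x) (e i))}"

text \<open>
  The inner integrals are Henstock--Kurzweil integrals, since the Bochner integral of the library
  is restricted to separable range types. On test functions the integrands are continuous with
  compact support in the half-lines, so the two notions agree.
\<close>

definition hilbert_transform :: "(real \<Rightarrow> 'e::banach) \<Rightarrow> real \<Rightarrow> 'e" where
  "hilbert_transform f x = Lim (at_right 0) (\<lambda>\<epsilon>. (1 / pi) *\<^sub>R
     (integral {..x - \<epsilon>} (\<lambda>y. f y /\<^sub>R (x - y)) + integral {x + \<epsilon>..} (\<lambda>y. f y /\<^sub>R (x - y))))"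

definition Lp_norm :: "real \<Rightarrow> (real \<Rightarrow> 'e::real_normed_vector) \<Rightarrow> real" where
  "Lp_norm p f = (LINT x|lebesgue. norm (f x) powr p) powr (1 / p)"

definition commutator_pairing :: "(real \<Rightarrow> 'a \<Rightarrow> 'a) \<Rightarrow> (real \<Rightarrow> 'a) \<Rightarrow>
    (real \<Rightarrow> ('a::banach \<Rightarrow>\<^sub>L 'k)) \<Rightarrow> 'k::{real_normed_field,euclidean_space}" where
  "commutator_pairing B f g = (LINT x|lebesgue.
     blinfun_apply (g x) (B x (hilbert_transform f x)) +
     blinfun_apply (hilbert_transform g x) (B x (f x)))"

definition commutator_bounded :: "('k::{real_normed_field,euclidean_space} \<Rightarrow> 'a \<Rightarrow> 'a) \<Rightarrow> real \<Rightarrow>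
    (real \<Rightarrow> 'a::banach \<Rightarrow> 'a) \<Rightarrow> bool" where
  "commutator_bounded smul p B \<longleftrightarrow>
     (\<exists>C. \<forall>f\<in>test_tensor smul UNIV. \<forall>g\<in>test_tensor dual_scale (dual_space smul).
        norm (commutator_pairing B f g) \<le> C * Lp_norm p f * Lp_norm (p / (p - 1)) g)"

end

theory Submission
  imports Defs "HOL-Computational_Algebra.Polynomial" "HOL-Probability.Sinc_Integral" "Jordan_Normal_Form.Determinant"
begin

text \<open>
  By Dvoretzky--Rogers and concentration, an infinite-dimensional \<open>\<XX>\<close> contains, for every \<open>n\<close>,
  vectors \<open>y k\<close> with \<open>norm (\<Sum>k<n. t k y k) \<le> C norm t\<close> in \<open>l2\<close> whose signed sums are so long that functionals
  \<open>g A\<close> of norm \<open>sqrt n\<close>, one for each choice of signs \<open>A\<close>, satisfy \<open>E (sg A k) (g A) (y k) = 1\<close>; the same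
  holds in the dual, with functionals \<open>\<phi> j\<close> and vectors \<open>f A\<close>.

  On a unit interval let \<open>B = (\<Sum>j<k. r k r' j / (k - j) \<phi> j \<otimes> y k)\<close> with lacunary trigonometric functions \<open>r k\<close>,
  \<open>r' j\<close>. On an interval of length \<open>\<delta>\<close> the functions of frequency below \<open>1 / \<delta>\<close> are almost constant and the
  others almost orthogonal. The interaction of the two kinds is a corner of the triangular Hilbert matrix,
  which is a block of the bounded Hilbert matrix, so \<open>B\<close> and its adjoint have strong oscillation bounds
  independent of \<open>n\<close>.

  Test the commutator on Riesz products: the function \<open>E (\<Prod>j<n. 1 + sg A j s' j) f A\<close>, cut off by a bump,
  is bounded by \<open>sqrt n\<close> because the products are nonnegative with mean one, and likewise with \<open>g A\<close>. The Hilbert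
  transform turns the top sine of each Walsh term into a cosine. As the base frequency tends to infinity only
  the linear terms contribute, and the pairing tends to a multiple of the sum of the entries \<open>1 / (k - j)\<close>,
  of order \<open>n log n\<close>, against \<open>n\<close> for the product of the norms. Unit intervals with growing \<open>n\<close> are
  glued together; all \<open>r k\<close> vanish at the integers.
\<close>

section \<open>The weak Dvoretzky--Rogers lemma\<close>

text \<open>With only upper l2 estimates for the \<open>y k\<close> and \<open>\<phi> j\<close> at
  hand, all bounds on \<open>B\<close> rest on scalar coefficients. For a fixed vector they see the
  kernel in three blocks. With both frequencies low, the block is absorbed into the constant of the
  oscillation, so its size is not counted, only its variation. With a high inner frequency,
  square-summable columns suffice. Only the remaining block, low inside and high outside, asks for a
  bounded corner. The kernel \<open>1 / (k - j)\<close> for \<open>j < k\<close> passes all three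
  tests, although the triangular matrix as a whole has a logarithmic divergence; this logarithm is
  what the commutator detects. The distribution of sines and cosines keeps the two terms of the
  commutator from cancelling. Both test functions are built from sines; \<open>B\<close> carries
  sines on its range side and cosines on its argument side. Transforming the first test function
  creates the cosine that matches \<open>B\<close>, while transforming the second creates a cosine
  that meets only sines and has mean zero. The frequencies \<open>16 ^ k\<close> and
  \<open>4 * 16 ^ j\<close> interleave as powers of 4, so that all these means factor
  exactly.\<close>

lemma det_rank_one_update:
  fixes q :: "nat \<Rightarrow> real"
  shows "det (mat n n (\<lambda>(i, j). (if i = j then 1 else 0) - c * q i * q j)) = 1 - c * (\<Sum>i<n. (q i)\<^sup>2)"
proof -
  define A where "A = mat n n (\<lambda>(i, j). (if i = j then 1 else 0) - c * q i * q j)"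
  define Q where "Q = mat n 1 (\<lambda>(i, j). q i)"
  define R where "R = mat 1 n (\<lambda>(i, j). c * q j)"
  define s where "s = mat 1 1 (\<lambda>_. 1 - c * (\<Sum>i<n. (q i)\<^sup>2))"
  have carr: "A \<in> carrier_mat n n" "Q \<in> carrier_mat n 1" "R \<in> carrier_mat 1 n" "s \<in> carrier_mat 1 1"
    by (auto simp: A_def Q_def R_def s_def)
  have AQR: "A + Q * R = 1\<^sub>m n"
    by (rule eq_matI) (auto simp: A_def Q_def R_def scalar_prod_def)
  have RQs: "R * Q + s = 1\<^sub>m 1"
    by (rule eq_matI) (auto simp: s_def Q_def R_def scalar_prod_def sum_distrib_left power2_eq_square lessThan_atLeast0 mult_ac)
  \<comment> \<open>One block matrix is factored through either of its two Schur complements;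
    comparing the determinants gives the formula.\<close>
  have m1: "four_block_mat A Q (0\<^sub>m 1 n) (1\<^sub>m 1) * four_block_mat (1\<^sub>m n) (0\<^sub>m n 1) R (1\<^sub>m 1)
    = four_block_mat (1\<^sub>m n) Q R (1\<^sub>m 1)"
    using mult_four_block_mat[OF carr(1,2) zero_carrier_mat one_carrier_mat one_carrier_mat zero_carrier_mat carr(3) one_carrier_mat] carr AQR by auto
  have m2: "four_block_mat (1\<^sub>m n) (0\<^sub>m n 1) R (1\<^sub>m 1) * four_block_mat (1\<^sub>m n) Q (0\<^sub>m 1 n) s
    = four_block_mat (1\<^sub>m n) Q R (1\<^sub>m 1)"
    using mult_four_block_mat[OF one_carrier_mat zero_carrier_mat carr(3) one_carrier_mat one_carrier_mat carr(2) zero_carrier_mat carr(4)] carr RQs by auto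
  have d1: "det (four_block_mat (1\<^sub>m n) (0\<^sub>m n 1) R (1\<^sub>m 1)) = 1"
    by (subst det_four_block_mat_upper_right_zero_col[where n=n]) (use carr in auto)
  have d2: "det (four_block_mat A Q (0\<^sub>m 1 n) (1\<^sub>m 1)) = det A"
    by (subst det_four_block_mat_lower_left_zero[where n=n and m=1]) (use carr in auto)
  have d3: "det (four_block_mat (1\<^sub>m n) Q (0\<^sub>m 1 n) s) = det s"
    by (subst det_four_block_mat_lower_left_zero[where n=n and m=1]) (use carr in auto)
  have ds: "det s = 1 - c * (\<Sum>i<n. (q i)\<^sup>2)"
    by (subst det_single) (auto simp: s_def)
  have "det (four_block_mat (1\<^sub>m n) Q R (1\<^sub>m 1)) = det A"
    using arg_cong[OF m1, of det] carr d1 d2 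
    by (subst (asm) det_mult[where n="n+1"]) auto
  moreover have "det (four_block_mat (1\<^sub>m n) Q R (1\<^sub>m 1)) = det s"
    using arg_cong[OF m2, of det] carr d1 d3 
    by (subst (asm) det_mult[where n="n+1"]) auto
  ultimately show ?thesis using ds A_def by simp
qed

text \<open>Says that \<open>e_i \<mapsto> y i\<close> is an operator from l2 of norm at most
  \<open>C\<close>. Index sets are arbitrary because tensor products of systems occur later.\<close>

definition upper2 :: "real \<Rightarrow> 'i set \<Rightarrow> ('i \<Rightarrow> 'v::real_normed_vector) \<Rightarrow> bool" where
  "upper2 C I y \<longleftrightarrow> (\<forall>a. norm (\<Sum>i\<in>I. a i *\<^sub>R y i) \<le> C * L2_set a I)"

lemma upper2D: "upper2 C I y \<Longrightarrow> norm (\<Sum>i\<in>I. a i *\<^sub>R y i) \<le> C * L2_set a I"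
  by (simp add: upper2_def)

lemma upper2_imp_norm_le:
  assumes "upper2 C I y" "finite I" "i \<in> I"
  shows "norm (y i) \<le> C"
proof -
  have "(\<Sum>j\<in>I. (if j = i then 1 else 0) *\<^sub>R y j) = y i"
    using assms by (simp add: if_distrib[of "\<lambda>c. c *\<^sub>R _"] sum.delta cong: if_cong)
  moreover have "L2_set (\<lambda>j. if j = i then 1 else 0) I = 1"
    using assms by (simp add: L2_set_def if_distrib[of "\<lambda>c. c\<^sup>2"] sum.delta cong: if_cong)
  ultimately show ?thesis using upper2D[OF assms(1), of "\<lambda>j. if j = i then 1 else 0"] by simp
qed

text \<open>Its determinant plays the part of the volume of the tuple \<open>z\<close>, measured by
  the fixed functionals \<open>l\<close>.\<close>

definition gram_mat :: "nat \<Rightarrow> (nat \<Rightarrow> 'v \<Rightarrow> real) \<Rightarrow> (nat \<Rightarrow> 'v) \<Rightarrow> real mat" where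
  "gram_mat m l z = mat m m (\<lambda>(i, j). l i (z j))"

lemma gram_mat_carrier [simp]: "gram_mat m l z \<in> carrier_mat m m"
  by (simp add: gram_mat_def)

text \<open>The new tuple is \<open>z\<close> composed with the matrix \<open>1 - c q q^T\<close>,
  which multiplies the unit vector \<open>q\<close> by \<open>1 - c\<close> and fixes its
  complement; on Gram matrices this is multiplication from the right.\<close>

lemma det_gram_mat_rank_one:
  fixes z :: "nat \<Rightarrow> 'v::real_normed_vector"
  assumes l: "\<And>i. i < m \<Longrightarrow> bounded_linear (l i)" and q: "(\<Sum>j<m. (q j)\<^sup>2) = 1"
  shows "det (gram_mat m l (\<lambda>j. z j - (c * q j) *\<^sub>R (\<Sum>k<m. q k *\<^sub>R z k))) = (1 - c) * det (gram_mat m l z)"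
proof -
  define T where "T = mat m m (\<lambda>(i, j). (if i = j then 1 else 0) - c * q i * q j)"
  have "gram_mat m l (\<lambda>j. z j - (c * q j) *\<^sub>R (\<Sum>k<m. q k *\<^sub>R z k)) = gram_mat m l z * T"
  proof (rule eq_matI)
    fix i j assume ij: "i < dim_row (gram_mat m l z * T)" "j < dim_col (gram_mat m l z * T)"
    then have ij: "i < m" "j < m" by (auto simp: gram_mat_def T_def)
    interpret bounded_linear "l i" using l ij by auto
    have "(gram_mat m l z * T) $$ (i, j) = (\<Sum>k<m. l i (z k) * ((if k = j then 1 else 0) - c * q k * q j))"
      using ij by (simp add: gram_mat_def T_def scalar_prod_def lessThan_atLeast0)
    also have "\<dots> = (\<Sum>k<m. (if k = j then l i (z k) else 0)) - (\<Sum>k<m. c * q j * (q k * l i (z k)))"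
      by (subst sum_subtractf[symmetric]) (rule sum.cong, auto simp: algebra_simps)
    also have "\<dots> = l i (z j) - c * q j * (\<Sum>k<m. q k * l i (z k))"
      using ij by (simp add: sum_distrib_left)
    also have "\<dots> = gram_mat m l (\<lambda>j. z j - (c * q j) *\<^sub>R (\<Sum>k<m. q k *\<^sub>R z k)) $$ (i, j)"
      using ij by (simp add: gram_mat_def diff scaleR sum)
    finally show "gram_mat m l (\<lambda>j. z j - (c * q j) *\<^sub>R (\<Sum>k<m. q k *\<^sub>R z k)) $$ (i, j) = (gram_mat m l z * T) $$ (i, j)" ..
  qed (auto simp: gram_mat_def T_def)
  then have "det (gram_mat m l (\<lambda>j. z j - (c * q j) *\<^sub>R (\<Sum>k<m. q k *\<^sub>R z k))) = det (gram_mat m l z) * det T"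
    using det_mult[OF gram_mat_carrier, of T m l z] by (simp add: T_def)
  also have "det T = 1 - c" unfolding T_def det_rank_one_update using q by simp
  finally show ?thesis by simp
qed

lemma det_gram_mat_scaleR:
  assumes l: "\<And>i. i < m \<Longrightarrow> bounded_linear (l i)"
  shows "det (gram_mat m l (\<lambda>j. t *\<^sub>R z j)) = t ^ m * det (gram_mat m l z)"
proof -
  have "gram_mat m l (\<lambda>j. t *\<^sub>R z j) = t \<cdot>\<^sub>m gram_mat m l z"
    by (rule eq_matI) (auto simp: gram_mat_def bounded_linear.linear[OF l] linear_cmul)
  then show ?thesis by (simp add: gram_mat_def)
qed

text \<open>Leibniz expansion with crude bounds on the entries; finiteness is the point, as it makes
  the supremum of volumes exist.\<close>

lemma det_gram_mat_bounded:
  fixes l :: "nat \<Rightarrow> 'v::real_normed_vector \<Rightarrow> real"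
  assumes l: "\<And>i. i < m \<Longrightarrow> bounded_linear (l i)"
  shows "\<exists>K. \<forall>z. (\<forall>j<m. norm (z j) \<le> 1) \<longrightarrow> \<bar>det (gram_mat m l z)\<bar> \<le> K"
proof (intro exI allI impI)
  define L where "L = (\<Sum>i<m. onorm (l i))"
  fix z :: "nat \<Rightarrow> 'v" assume z: "\<forall>j<m. norm (z j) \<le> 1"
  have entry: "\<bar>l i (z j)\<bar> \<le> L" if "i < m" "j < m" for i j
  proof -
    have "\<bar>l i (z j)\<bar> \<le> onorm (l i) * norm (z j)"
      using onorm[OF l[OF that(1)], of "z j"] by simp
    also have "\<dots> \<le> onorm (l i)"
      using z that(2) onorm_pos_le[OF l[OF that(1)]] by (simp add: mult_left_le)
    also have "\<dots> \<le> L" unfolding L_def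
      by (rule member_le_sum) (use that onorm_pos_le[OF l] in auto)
    finally show ?thesis .
  qed
  have "\<bar>det (gram_mat m l z)\<bar> \<le> (\<Sum>p\<in>{p. p permutes {0..<m}}. \<bar>signof p * (\<Prod>i = 0..<m. gram_mat m l z $$ (i, p i))\<bar>)"
    unfolding det_def'[OF gram_mat_carrier] by (rule sum_abs)
  also have "\<dots> \<le> (\<Sum>p\<in>{p. p permutes {0..<m}}. L ^ m)"
  proof (rule sum_mono)
    fix p assume "p \<in> {p. p permutes {0..<m}}"
    then have p: "p i < m" if "i < m" for i using that by (auto dest: permutes_in_image)
    have s: "\<bar>signof p :: real\<bar> \<le> 1" by (simp add: sign_def)
    have "(\<Prod>i = 0..<m. \<bar>gram_mat m l z $$ (i, p i)\<bar>) \<le> (\<Prod>i = 0..<m. L)"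
      by (rule prod_mono) (use p entry in \<open>auto simp: gram_mat_def\<close>)
    then have "\<bar>signof p\<bar> * (\<Prod>i = 0..<m. \<bar>gram_mat m l z $$ (i, p i)\<bar>) \<le> 1 * L ^ m"
      by (intro mult_mono s) (auto intro: prod_nonneg)
    then show "\<bar>signof p * (\<Prod>i = 0..<m. gram_mat m l z $$ (i, p i))\<bar> \<le> L ^ m"
      by (simp add: abs_mult abs_prod)
  qed
  finally show "\<bar>det (gram_mat m l z)\<bar> \<le> (\<Sum>p\<in>{p. p permutes {0..<m}}. L ^ m)" .
qed

text \<open>Cauchy--Schwarz. The added 1 keeps the scaling factor positive even for
  \<open>b = 0\<close>, and positivity of the factor preserves a nonzero volume.\<close>

lemma upper2_scaled:
  fixes b :: "'i \<Rightarrow> 'v::real_normed_vector"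
  shows "upper2 1 I (\<lambda>j. (1 / (1 + L2_set (\<lambda>j. norm (b j)) I)) *\<^sub>R b j)"
proof (unfold upper2_def, rule allI)
  fix a :: "'i \<Rightarrow> real"
  define t where "t = 1 / (1 + L2_set (\<lambda>j. norm (b j)) I)"
  have t: "t \<ge> 0" "t * L2_set (\<lambda>j. norm (b j)) I \<le> 1"
    using L2_set_nonneg[of "\<lambda>j. norm (b j)" I] by (auto simp: t_def divide_le_eq_1 add_pos_nonneg)
  have "norm (\<Sum>j\<in>I. a j *\<^sub>R (t *\<^sub>R b j)) \<le> (\<Sum>j\<in>I. t * (\<bar>a j\<bar> * \<bar>norm (b j)\<bar>))"
    by (rule order_trans[OF norm_sum]) (use t in \<open>auto intro!: sum_mono simp: mult_ac abs_mult\<close>)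
  also have "\<dots> \<le> t * (L2_set a I * L2_set (\<lambda>j. norm (b j)) I)"
    unfolding sum_distrib_left[symmetric] by (intro mult_left_mono L2_set_mult_ineq t)
  also have "\<dots> = (t * L2_set (\<lambda>j. norm (b j)) I) * L2_set a I" by simp
  also have "\<dots> \<le> 1 * L2_set a I" by (intro mult_right_mono t) auto
  finally show "norm (\<Sum>j\<in>I. a j *\<^sub>R (1 / (1 + L2_set (\<lambda>j. norm (b j)) I)) *\<^sub>R b j) \<le> 1 * L2_set a I"
    unfolding t_def .
qed

definition dot :: "nat \<Rightarrow> (nat \<Rightarrow> real) \<Rightarrow> (nat \<Rightarrow> real) \<Rightarrow> real" where
  "dot m a b = (\<Sum>j<m. a j * b j)"

definition orthonormal :: "nat \<Rightarrow> nat \<Rightarrow> (nat \<Rightarrow> nat \<Rightarrow> real) \<Rightarrow> bool" where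
  "orthonormal m r q \<longleftrightarrow> (\<forall>s<r. \<forall>t<r. dot m (q s) (q t) = (if s = t then 1 else 0))"

lemma dot_commute: "dot m a b = dot m b a"
  by (simp add: dot_def mult.commute)

lemma dot_self: "dot m a a = (L2_set a {..<m})\<^sup>2"
  by (simp add: dot_def L2_set_def sum_nonneg power2_eq_square)

lemma dot_sum_left: "dot m (\<lambda>j. \<Sum>s\<in>S. c s * q s j) b = (\<Sum>s\<in>S. c s * dot m (q s) b)"
  unfolding dot_def sum_distrib_right sum_distrib_left by (subst sum.swap) (simp add: mult_ac)

lemma dot_diff_left: "dot m (\<lambda>j. a j - b j) c = dot m a c - dot m b c"
  by (simp add: dot_def algebra_simps sum_subtractf)

lemma orthonormal_combination:
  assumes "orthonormal m r q"
  shows "t < r \<Longrightarrow> dot m (\<lambda>j. \<Sum>s<r. c s * q s j) (q t) = c t"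
    and "L2_set (\<lambda>j. \<Sum>s<r. c s * q s j) {..<m} = L2_set c {..<r}"
proof -
  show 1: "dot m (\<lambda>j. \<Sum>s<r. c s * q s j) (q t) = c t" if "t < r" for t
    unfolding dot_sum_left using assms that
    by (simp add: orthonormal_def if_distrib[of "\<lambda>x. _ * x"] cong: if_cong)
  have "dot m (\<lambda>j. \<Sum>s<r. c s * q s j) (\<lambda>j. \<Sum>s<r. c s * q s j) = (\<Sum>s<r. c s * c s)"
    unfolding dot_sum_left by (rule sum.cong, simp, subst dot_commute, simp add: 1)
  then have "(L2_set (\<lambda>j. \<Sum>s<r. c s * q s j) {..<m})\<^sup>2 = (L2_set c {..<r})\<^sup>2"
    by (simp add: dot_self) (simp add: L2_set_def sum_nonneg power2_eq_square)
  then show "L2_set (\<lambda>j. \<Sum>s<r. c s * q s j) {..<m} = L2_set c {..<r}"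
    by (simp add: power2_eq_iff_nonneg)
qed

lemma orthonormal_projection:
  assumes q: "orthonormal m r q" and c: "\<And>s. s < r \<Longrightarrow> c s = dot m a (q s)"
    and h: "\<And>j. h j = a j - (\<Sum>s<r. c s * q s j)"
  shows "s < r \<Longrightarrow> dot m h (q s) = 0"
    and "(L2_set a {..<m})\<^sup>2 = (L2_set h {..<m})\<^sup>2 + (L2_set (\<lambda>j. \<Sum>s<r. c s * q s j) {..<m})\<^sup>2"
proof -
  have hh: "h = (\<lambda>j. a j - (\<Sum>s<r. c s * q s j))" using h by auto
  show 1: "dot m h (q s) = 0" if "s < r" for s
    unfolding hh dot_diff_left using orthonormal_combination(1)[OF q that] c[OF that] by simp
  define p where "p = (\<lambda>j. \<Sum>s<r. c s * q s j)"
  have ph: "dot m p h = 0"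
    unfolding p_def dot_sum_left using 1 by (intro sum.neutral) (simp add: dot_commute[of m _ h])
  have "dot m a a = dot m h h + dot m p p + 2 * dot m p h"
    unfolding dot_def hh p_def by (simp add: sum.distrib[symmetric] sum_distrib_left algebra_simps)
  then show "(L2_set a {..<m})\<^sup>2 = (L2_set h {..<m})\<^sup>2 + (L2_set (\<lambda>j. \<Sum>s<r. c s * q s j) {..<m})\<^sup>2"
    using ph by (simp add: dot_self p_def)
qed

text \<open>
  The determinant is multiplied by \<open>2 ^ m / 4 ^ r\<close> when the tuple is doubled on the orthogonal
  complement of \<open>r\<close> unit vectors and halved on their span.
\<close>

lemma det_gram_mat_orthonormal:
  fixes z :: "nat \<Rightarrow> 'v::real_normed_vector"
  assumes l: "\<And>i. i < m \<Longrightarrow> bounded_linear (l i)" and q: "orthonormal m r q"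
  shows "det (gram_mat m l (\<lambda>j. z j - (\<Sum>s<r. (3/4 * q s j) *\<^sub>R (\<Sum>k<m. q s k *\<^sub>R z k))))
    = (1/4) ^ r * det (gram_mat m l z)"
  using q
proof (induction r)
  case (Suc r)
  define w where "w = (\<lambda>j. z j - (\<Sum>s<r. (3/4 * q s j) *\<^sub>R (\<Sum>k<m. q s k *\<^sub>R z k)))"
  have o: "orthonormal m r q" using Suc.prems by (simp add: orthonormal_def)
  have n: "(\<Sum>j<m. (q r j)\<^sup>2) = 1"
    using Suc.prems by (auto simp: orthonormal_def dot_def power2_eq_square)
  have "(\<Sum>k<m. q r k *\<^sub>R w k) = (\<Sum>k<m. q r k *\<^sub>R z k) -
      (\<Sum>s<r. (3/4 * dot m (q s) (q r)) *\<^sub>R (\<Sum>k<m. q s k *\<^sub>R z k))"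
  proof -
    have "(\<Sum>k<m. \<Sum>s<r. q r k *\<^sub>R (3/4 * q s k) *\<^sub>R Y s) = (\<Sum>s<r. (3/4 * dot m (q s) (q r)) *\<^sub>R Y s)"
      for Y :: "nat \<Rightarrow> 'v"
      by (subst sum.swap) (simp add: dot_def sum_distrib_left scaleR_sum_left mult_ac)
    then show ?thesis unfolding w_def scaleR_diff_right sum_subtractf scaleR_sum_right[of _ _ "{..<r}"] by simp
  qed
  also have "\<dots> = (\<Sum>k<m. q r k *\<^sub>R z k)"
    using Suc.prems by (simp add: orthonormal_def)
  finally have u: "(\<Sum>k<m. q r k *\<^sub>R w k) = (\<Sum>k<m. q r k *\<^sub>R z k)" .
  have "det (gram_mat m l (\<lambda>j. w j - (3/4 * q r j) *\<^sub>R (\<Sum>k<m. q r k *\<^sub>R w k))) = (1/4) * det (gram_mat m l w)"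
    using det_gram_mat_rank_one[OF l n, where c="3/4" and z=w] by simp
  then show ?case using Suc.IH[OF o] unfolding u by (simp add: w_def algebra_simps)
qed simp

lemma orthonormal_extend:
  assumes q: "orthonormal m r q" and a: "\<And>s. s < r \<Longrightarrow> dot m a (q s) = 0" and n: "L2_set a {..<m} \<noteq> 0"
  shows "orthonormal m (Suc r) (q(r := (\<lambda>j. a j / L2_set a {..<m})))"
proof -
  have d1: "dot m (\<lambda>j. a j / L) b = dot m a b / L" for b L
    by (simp add: dot_def sum_divide_distrib)
  have d2: "dot m b (\<lambda>j. a j / L) = dot m b a / L" for b L
    by (simp add: dot_def sum_divide_distrib)
  show ?thesis
    using q a n dot_self[of m a] unfolding orthonormal_def
    by (auto simp: less_Suc_eq d1 d2 dot_commute[of m "q _" a] power2_eq_square)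
qed

text \<open>A contraction from l2 of dimension \<open>2 * n\<close> with nearly maximal volume
  cannot be smaller than 1/4 on a subspace of dimension above \<open>n\<close>, because stretching
  it there would increase the volume. The supremum need not be attained, so the volume is maximised
  up to a factor 2 and the contradiction produces a factor 4.\<close>

theorem weak_dvoretzky_rogers:
  fixes b :: "nat \<Rightarrow> 'v::real_normed_vector" and l :: "nat \<Rightarrow> 'v \<Rightarrow> real"
  assumes E: "subspace E" and b: "\<And>i. i < 2 * n \<Longrightarrow> b i \<in> E"
    and l: "\<And>i. i < 2 * n \<Longrightarrow> bounded_linear (l i)" and nz: "det (gram_mat (2 * n) l b) \<noteq> 0"
  shows "\<exists>z. (\<forall>i<n. z i \<in> E \<and> 1/4 \<le> norm (z i)) \<and> upper2 1 {..<n} z"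
proof (rule ccontr)
  assume neg: "\<not> ?thesis"
  define m where "m = 2 * n"
  define \<U> where "\<U> = {z. (\<forall>j<m. z j \<in> E) \<and> upper2 1 {..<m} z}"
  define vol where "vol z = \<bar>det (gram_mat m l z)\<bar>" for z
  have lm: "\<And>i. i < m \<Longrightarrow> bounded_linear (l i)" using l by (simp add: m_def)
  have "\<exists>K. \<forall>z. (\<forall>j<m. norm (z j) \<le> 1) \<longrightarrow> vol z \<le> K"
    unfolding vol_def by (rule det_gram_mat_bounded) (rule lm)
  then obtain K where K: "\<forall>z. (\<forall>j<m. norm (z j) \<le> 1) \<longrightarrow> vol z \<le> K" ..
  have bdd: "bdd_above (vol ` \<U>)"
  proof (rule bdd_aboveI2)
    fix z assume "z \<in> \<U>"
    then show "vol z \<le> K" using upper2_imp_norm_le[of 1 "{..<m}" z] K by (simp add: \<U>_def)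
  qed
  define t where "t = 1 / (1 + L2_set (\<lambda>j. norm (b j)) {..<m})"
  have "t > 0" using L2_set_nonneg[of "\<lambda>j. norm (b j)" "{..<m}"] by (simp add: t_def add_pos_nonneg)
  have tb: "(\<lambda>j. t *\<^sub>R b j) \<in> \<U>"
    using upper2_scaled[of "{..<m}" b] b E by (auto simp: \<U>_def m_def t_def intro: subspace_scale)
  have "vol (\<lambda>j. t *\<^sub>R b j) > 0"
    using nz \<open>t > 0\<close> unfolding vol_def by (simp add: det_gram_mat_scaleR[OF lm] m_def)
  then have pos: "Sup (vol ` \<U>) > 0"
    using cSUP_upper[OF tb bdd] by simp
  then obtain z where z: "z \<in> \<U>" "vol z > Sup (vol ` \<U>) / 2"
    using less_cSUP_iff[OF _ bdd, of "Sup (vol ` \<U>) / 2"] tb by auto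
  have zE: "\<And>j. j < m \<Longrightarrow> z j \<in> E" and zu: "upper2 1 {..<m} z" using z by (auto simp: \<U>_def)
  define U where "U a = (\<Sum>k<m. a k *\<^sub>R z k)" for a
  have Uc: "U (\<lambda>j. \<Sum>s<r. c s * q s j) = (\<Sum>s<r. c s *\<^sub>R U (q s))" for r c and q :: "nat \<Rightarrow> nat \<Rightarrow> real"
    unfolding U_def scaleR_sum_left scaleR_sum_right by (subst sum.swap) simp
  have UE: "U a \<in> E" for a unfolding U_def using E zE by (auto intro!: subspace_sum subspace_scale)
  \<comment> \<open>Orthonormal families whose images have norm at least 1/4. Images of orthonormal
    vectors keep the upper estimate, so \<open>n\<close> of them would be the desired
    system.\<close>
  define P where "P r q \<longleftrightarrow> orthonormal m r q \<and> (\<forall>s<r. 1/4 \<le> norm (U (q s)))" for r q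
  have Pn: "\<not> P n q" for q
  proof
    assume P: "P n q"
    have "upper2 1 {..<n} (\<lambda>s. U (q s))"
      unfolding upper2_def
    proof
      fix c :: "nat \<Rightarrow> real"
      show "norm (\<Sum>s<n. c s *\<^sub>R U (q s)) \<le> 1 * L2_set c {..<n}"
        using upper2D[OF zu, of "\<lambda>j. \<Sum>s<n. c s * q s j"] orthonormal_combination(2)[of m n q c] P
        unfolding Uc[symmetric] U_def[symmetric] P_def by simp
    qed
    then have "(\<forall>i<n. U (q i) \<in> E \<and> 1/4 \<le> norm (U (q i))) \<and> upper2 1 {..<n} (\<lambda>s. U (q s))"
      using P UE by (simp add: P_def)
    then have "\<exists>z. (\<forall>i<n. z i \<in> E \<and> 1/4 \<le> norm (z i)) \<and> upper2 1 {..<n} z"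
      by (rule exI[where x = "\<lambda>s. U (q s)"])
    from neg this show False by (rule notE)
  qed
  obtain r where r: "\<exists>q. P r q" "\<not> (\<exists>q. P (Suc r) q)" "r < n"
  proof -
    have ex: "\<exists>r. \<not> (\<exists>q. P r q)" using Pn by blast
    define k where "k = (LEAST r. \<not> (\<exists>q. P r q))"
    have k: "\<not> (\<exists>q. P k q)" unfolding k_def using LeastI_ex[OF ex] .
    have kn: "k \<le> n" unfolding k_def by (rule Least_le) (use Pn in blast)
    have "P 0 undefined" by (simp add: P_def orthonormal_def)
    then have "k \<noteq> 0" using k by metis
    then obtain r where kr: "k = Suc r" by (cases k) auto
    have "\<exists>q. P r q" using not_less_Least[of r "\<lambda>r. \<not> (\<exists>q. P r q)"] kr k_def by auto
    then show ?thesis using that k kr kn by auto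
  qed
  then obtain q where q: "orthonormal m r q" and P: "P r q" by (auto simp: P_def)
  \<comment> \<open>The family cannot be extended: a unit vector orthogonal to it whose image has
    norm at least 1/4 could be added.\<close>
  have small: "norm (U a) \<le> 1/4 * L2_set a {..<m}" if a: "\<And>s. s < r \<Longrightarrow> dot m a (q s) = 0" for a
  proof (cases "L2_set a {..<m} = 0")
    case True
    then show ?thesis using upper2D[OF zu, of a] by (simp add: U_def)
  next
    case False
    define a' where "a' = (\<lambda>j. a j / L2_set a {..<m})"
    have "orthonormal m (Suc r) (q(r := a'))"
      unfolding a'_def using orthonormal_extend[OF q a False] .
    then have "\<not> 1/4 \<le> norm (U a')" using P r(2) by (auto simp: P_def less_Suc_eq)
    moreover have "U a' = (1 / L2_set a {..<m}) *\<^sub>R U a"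
      by (simp add: U_def a'_def scaleR_sum_right)
    ultimately show ?thesis using False L2_set_nonneg[of a "{..<m}"] by (simp add: field_simps)
  qed
  define w where "w = (\<lambda>j. z j - (\<Sum>s<r. (3/4 * q s j) *\<^sub>R U (q s)))"
  define z' where "z' = (\<lambda>j. 2 *\<^sub>R w j)"
  have "vol z' = 2 ^ m * (1/4) ^ r * vol z"
    using det_gram_mat_scaleR[OF lm, where t=2 and z=w] det_gram_mat_orthonormal[OF lm q, where z=z]
    unfolding vol_def z'_def w_def U_def by (simp only: abs_mult) simp
  \<comment> \<open>The choice \<open>m = 2 * n\<close> enters here: the factor equals
    \<open>4 ^ (n - r)\<close>, and \<open>r < n\<close>.\<close>
  moreover have "(4::real) \<le> 2 ^ m * (1/4) ^ r"
  proof -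
    obtain d where "n = Suc (r + d)" using r less_imp_Suc_add by blast
    then have "(2::real) ^ m = 4 * 4 ^ r * 4 ^ d"
      by (simp add: m_def power_mult power_add)
    then show ?thesis by (simp add: power_divide)
  qed
  ultimately have "vol z' \<ge> 4 * vol z"
    using mult_right_mono[of 4 "2 ^ m * (1/4) ^ r" "vol z"] by (simp only: vol_def abs_ge_zero)
  moreover have "z' \<in> \<U>"
    unfolding \<U>_def mem_Collect_eq
  proof (intro conjI allI impI)
    show "z' j \<in> E" if "j < m" for j
      unfolding z'_def w_def using that E zE UE by (auto intro!: subspace_scale subspace_diff subspace_sum)
    show "upper2 1 {..<m} z'" unfolding upper2_def
    proof
      fix a :: "nat \<Rightarrow> real"
      define c where "c = (\<lambda>s. dot m a (q s))"
      define p where "p = (\<lambda>j. \<Sum>s<r. c s * q s j)"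
      define h where "h = (\<lambda>j. a j - p j)"
      have c1: "\<And>s. s < r \<Longrightarrow> c s = dot m a (q s)" by (simp add: c_def)
      have h1: "\<And>j. h j = a j - (\<Sum>s<r. c s * q s j)" by (simp add: h_def p_def)
      have py: "(L2_set a {..<m})\<^sup>2 = (L2_set h {..<m})\<^sup>2 + (L2_set p {..<m})\<^sup>2"
        and ho: "\<And>s. s < r \<Longrightarrow> dot m h (q s) = 0"
        using orthonormal_projection[OF q, of c a h, OF c1 h1] by (simp_all add: p_def)
      have "(\<Sum>j<m. a j *\<^sub>R w j) = U a - (\<Sum>s<r. (3/4 * c s) *\<^sub>R U (q s))"
      proof -
        have "(\<Sum>j<m. \<Sum>s<r. a j *\<^sub>R (3/4 * q s j) *\<^sub>R Y s) = (\<Sum>s<r. (3/4 * c s) *\<^sub>R Y s)"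
          for Y :: "nat \<Rightarrow> 'v"
          by (subst sum.swap) (simp add: c_def dot_def sum_distrib_left scaleR_sum_left mult_ac)
        then show ?thesis unfolding w_def scaleR_diff_right sum_subtractf scaleR_sum_right by (simp add: U_def)
      qed
      also have "(\<Sum>s<r. (3/4 * c s) *\<^sub>R U (q s)) = (3/4) *\<^sub>R U p"
        unfolding p_def Uc scaleR_sum_right by simp
      also have "U a = U h + U p" by (simp add: U_def h_def flip: sum.distrib scaleR_add_left)
      finally have aw: "(\<Sum>j<m. a j *\<^sub>R w j) = U h + U p - (3/4) *\<^sub>R U p" .
      have "(\<Sum>j<m. a j *\<^sub>R z' j) = 2 *\<^sub>R (\<Sum>j<m. a j *\<^sub>R w j)"
        by (simp add: z'_def scaleR_sum_right mult.commute)
      also have "\<dots> = 2 *\<^sub>R U h + (2 - 2 * (3/4)) *\<^sub>R U p"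
        unfolding aw scaleR_diff_left scaleR_diff_right scaleR_add_right by simp
      finally have "(\<Sum>j<m. a j *\<^sub>R z' j) = 2 *\<^sub>R U h + (1/2) *\<^sub>R U p" by simp
      then have "norm (\<Sum>j<m. a j *\<^sub>R z' j) \<le> 2 * norm (U h) + 1/2 * norm (U p)"
        using norm_triangle_ineq[of "2 *\<^sub>R U h" "(1/2) *\<^sub>R U p"] by simp
      \<comment> \<open>Each component costs one half: \<open>small\<close> turns the doubling on
        the complement into 2 * 1/4, and the span has been halved.\<close>
      also have "\<dots> \<le> 1/2 * L2_set h {..<m} + 1/2 * L2_set p {..<m}"
        using small[OF ho] upper2D[OF zu, of p] by (simp add: U_def)
      also have "\<dots> \<le> L2_set a {..<m}"
      proof -
        have "L2_set h {..<m} \<le> L2_set a {..<m}" "L2_set p {..<m} \<le> L2_set a {..<m}"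
          by (rule power2_le_imp_le; simp add: py)+
        then show ?thesis by simp
      qed
      finally show "norm (\<Sum>j<m. a j *\<^sub>R z' j) \<le> 1 * L2_set a {..<m}" by simp
    qed
  qed
  then have "vol z' \<le> Sup (vol ` \<U>)" using bdd by (intro cSUP_upper)
  ultimately show False using z(2) pos by simp
qed

section \<open>Random sign embeddings\<close>

text \<open>A sign vector is encoded by the set of its positive coordinates, so that
  \<open>cavg\<close> is the expectation over independent random signs and \<open>flip D\<close>
  changes the signs in \<open>D\<close>.\<close>

definition sg :: "'i set \<Rightarrow> 'i \<Rightarrow> real" where
  "sg A i = (if i \<in> A then 1 else - 1)"

definition cavg :: "'i set \<Rightarrow> ('i set \<Rightarrow> 'v::real_vector) \<Rightarrow> 'v" where
  "cavg J F = (1 / 2 ^ card J) *\<^sub>R (\<Sum>A\<in>Pow J. F A)"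

definition flip :: "'i set \<Rightarrow> 'i set \<Rightarrow> 'i set" where
  "flip D A = (A - D) \<union> (D - A)"

lemma sg_square [simp]: "sg A i * sg A i = 1" "(sg A i)\<^sup>2 = 1"
  by (simp_all add: sg_def)

lemma abs_sg [simp]: "\<bar>sg A i\<bar> = 1"
  by (simp add: sg_def)

lemma sg_flip: "sg (flip D A) i = (if i \<in> D then - sg A i else sg A i)"
  by (auto simp: sg_def flip_def)

lemma flip_flip [simp]: "flip D (flip D A) = A"
  by (auto simp: flip_def)

lemma cavg_cong: "(\<And>A. A \<subseteq> J \<Longrightarrow> F A = G A) \<Longrightarrow> cavg J F = cavg J G"
  unfolding cavg_def by (auto intro!: sum.cong arg_cong[where f="scaleR _"])

lemma cavg_empty [simp]: "cavg {} F = F {}"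
  by (simp add: cavg_def)

lemma cavg_insert:
  assumes "finite J" "j \<notin> J"
  shows "cavg (insert j J) F = (1/2) *\<^sub>R (cavg J F + cavg J (\<lambda>A. F (insert j A)))"
proof -
  have "(\<Sum>A\<in>Pow (insert j J). F A) = (\<Sum>A\<in>Pow J. F A) + (\<Sum>A\<in>insert j ` Pow J. F A)"
    unfolding Pow_insert by (rule sum.union_disjoint) (use assms in auto)
  also have "(\<Sum>A\<in>insert j ` Pow J. F A) = (\<Sum>A\<in>Pow J. F (insert j A))"
    by (subst sum.reindex) (use assms in \<open>auto intro!: inj_onI simp: o_def\<close>)
  finally show ?thesis using assms by (simp add: cavg_def scaleR_add_right)
qed

lemma cavg_const [simp]: "finite J \<Longrightarrow> cavg J (\<lambda>_. c) = c"
  by (simp add: cavg_def card_Pow scaleR_sum_left[symmetric] sum_constant_scaleR)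

lemma cavg_add: "cavg J (\<lambda>A. F A + G A) = cavg J F + cavg J G"
  by (simp add: cavg_def sum.distrib scaleR_add_right)

lemma cavg_diff: "cavg J (\<lambda>A. F A - G A) = cavg J F - cavg J G"
  by (simp add: cavg_def sum_subtractf scaleR_diff_right)

lemma cavg_scaleR: "cavg J (\<lambda>A. c *\<^sub>R F A) = c *\<^sub>R cavg J F"
  by (simp add: cavg_def scaleR_sum_right[symmetric])

lemma cavg_mult_left: "cavg J (\<lambda>A. c * F A) = c * cavg J F" for c :: real
  using cavg_scaleR[of J c F] by simp

lemma cavg_mult_right: "cavg J (\<lambda>A. F A * c) = cavg J F * c" for c :: real
  using cavg_mult_left[of J c F] by (simp add: mult.commute)

lemma cavg_divide: "cavg J (\<lambda>A. F A / c) = cavg J F / c" for c :: real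
  using cavg_mult_left[of J "1 / c" F] by simp

lemma cavg_sum: "cavg J (\<lambda>A. \<Sum>i\<in>I. F i A) = (\<Sum>i\<in>I. cavg J (F i))"
  unfolding cavg_def by (subst sum.swap) (simp add: scaleR_sum_right)

lemma cavg_swap: "cavg I (\<lambda>A. cavg J (\<lambda>B. F A B)) = cavg J (\<lambda>B. cavg I (\<lambda>A. F A B))"
  unfolding cavg_def scaleR_sum_right by (subst sum.swap) (simp add: mult.commute)

lemma cavg_bounded_linear: "bounded_linear f \<Longrightarrow> f (cavg J F) = cavg J (\<lambda>A. f (F A))"
  unfolding cavg_def
  by (simp add: linear_cmul[OF bounded_linear.linear] linear_sum[OF bounded_linear.linear])

lemma cavg_mono: "(\<And>A. A \<subseteq> J \<Longrightarrow> F A \<le> G A) \<Longrightarrow> cavg J F \<le> cavg J G" for F G :: "_ \<Rightarrow> real"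
  unfolding cavg_def by (auto intro!: mult_left_mono sum_mono simp: divide_simps)

lemma cavg_nonneg: "(\<And>A. A \<subseteq> J \<Longrightarrow> 0 \<le> F A) \<Longrightarrow> 0 \<le> cavg J F" for F :: "_ \<Rightarrow> real"
  unfolding cavg_def by (auto intro!: sum_nonneg divide_nonneg_pos)

lemma norm_cavg_le: "norm (cavg J F) \<le> cavg J (\<lambda>A. norm (F A))" for F :: "_ \<Rightarrow> 'v::real_normed_vector"
  unfolding cavg_def by (auto intro!: divide_right_mono norm_sum)

lemma cavg_flip:
  assumes "D \<subseteq> J"
  shows "cavg J (\<lambda>A. F (flip D A)) = cavg J F"
proof -
  have "(\<Sum>A\<in>Pow J. F (flip D A)) = (\<Sum>A\<in>Pow J. F A)"
    by (rule sum.reindex_bij_witness[of _ "flip D" "flip D"]) (use assms in \<open>auto simp: flip_def\<close>)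
  then show ?thesis by (simp add: cavg_def)
qed

lemma cavg_Un:
  assumes "finite I" "finite J" "I \<inter> J = {}"
  shows "cavg (I \<union> J) F = cavg I (\<lambda>A. cavg J (\<lambda>B. F (A \<union> B)))"
  using assms(2,3)
proof (induction J arbitrary: F rule: finite_induct)
  case (insert j J)
  have "cavg (I \<union> insert j J) F = (1/2) *\<^sub>R (cavg (I \<union> J) F + cavg (I \<union> J) (\<lambda>A. F (insert j A)))"
    using insert assms(1) by (simp add: cavg_insert)
  also have "\<dots> = (1/2) *\<^sub>R (cavg I (\<lambda>A. cavg J (\<lambda>B. F (A \<union> B)) + cavg J (\<lambda>B. F (insert j (A \<union> B)))))"
    using insert.IH[of F] insert.IH[of "\<lambda>A. F (insert j A)"] insert.prems by (simp add: cavg_add)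
  also have "\<dots> = cavg I (\<lambda>A. cavg (insert j J) (\<lambda>B. F (A \<union> B)))"
    using insert by (simp add: cavg_insert cavg_scaleR)
  finally show ?case .
qed simp

lemma cavg_marginal:
  assumes "finite J" "I \<subseteq> J" "\<And>A. A \<subseteq> J \<Longrightarrow> F A = F (A \<inter> I)"
  shows "cavg J F = cavg I F"
proof -
  have f: "finite I" "finite (J - I)" using assms finite_subset by auto
  have "cavg J F = cavg (I \<union> (J - I)) F" using assms(2) by (simp add: Un_absorb1)
  also have "\<dots> = cavg I (\<lambda>A. cavg (J - I) (\<lambda>B. F (A \<union> B)))"
    by (rule cavg_Un) (use f in auto)
  also have "\<dots> = cavg I F"
  proof (rule cavg_cong)
    fix A assume A: "A \<subseteq> I"
    have "cavg (J - I) (\<lambda>B. F (A \<union> B)) = cavg (J - I) (\<lambda>B. F A)"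
    proof (rule cavg_cong)
      fix B assume B: "B \<subseteq> J - I"
      then have "(A \<union> B) \<inter> I = A" "A \<inter> I = A" using A by auto
      moreover have "A \<union> B \<subseteq> J" using A B assms(2) by auto
      ultimately show "F (A \<union> B) = F A" using assms(3)[of "A \<union> B"] by simp
    qed
    then show "cavg (J - I) (\<lambda>B. F (A \<union> B)) = F A" using f by simp
  qed
  finally show ?thesis .
qed

lemma cavg_reindex:
  assumes "inj_on f I"
  shows "cavg (f ` I) F = cavg I (\<lambda>A. F (f ` A))"
proof -
  have "(\<Sum>A\<in>Pow (f ` I). F A) = (\<Sum>A\<in>Pow I. F (f ` A))"
    unfolding image_Pow_surj[OF refl, symmetric]
    by (subst sum.reindex) (use assms in \<open>auto intro: inj_on_image_Pow\<close>)
  then show ?thesis using assms by (simp add: cavg_def card_image)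
qed

lemma sg_image: "inj_on f I \<Longrightarrow> A \<subseteq> I \<Longrightarrow> i \<in> I \<Longrightarrow> sg (f ` A) (f i) = sg A i"
  by (auto simp: sg_def inj_on_def)

lemma cavg_sg_mult:
  assumes j: "j \<in> J" and F: "\<And>A. A \<subseteq> J \<Longrightarrow> F (flip {j} A) = F A"
  shows "cavg J (\<lambda>A. sg A j * F A) = 0"
proof -
  have "cavg J (\<lambda>A. sg A j * F A) = cavg J (\<lambda>A. sg (flip {j} A) j * F (flip {j} A))"
    using j by (subst cavg_flip) auto
  also have "\<dots> = cavg J (\<lambda>A. (-1) * (sg A j * F A))"
    by (rule cavg_cong) (simp add: F sg_flip)
  finally show ?thesis unfolding cavg_mult_left by simp
qed

text \<open>Induction over the coordinates. Averaging over the sign \<open>j\<close> splits off a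
  quarter of the mean squared difference in direction \<open>j\<close>, and by convexity the
  averaged function \<open>G\<close> has no larger mean squared differences in the other
  directions.\<close>

lemma efron_stein:
  fixes F :: "'i set \<Rightarrow> real"
  assumes "finite J"
  shows "cavg J (\<lambda>A. (F A)\<^sup>2) - (cavg J F)\<^sup>2 \<le> 1/4 * (\<Sum>j\<in>J. cavg J (\<lambda>A. (F A - F (flip {j} A))\<^sup>2))"
  using assms
proof (induction J arbitrary: F rule: finite_induct)
  case (insert j J)
  define F1 where "F1 = (\<lambda>A. F (insert j A))"
  define G where "G = (\<lambda>A. (F A + F1 A) / 2)"
  have G: "cavg (insert j J) F = cavg J G"
    using insert by (simp add: cavg_insert G_def F1_def cavg_add cavg_divide)
  have sq: "cavg (insert j J) (\<lambda>A. (F A)\<^sup>2) = cavg J (\<lambda>A. (G A)\<^sup>2) + cavg J (\<lambda>A. (F A - F1 A)\<^sup>2) / 4"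
  proof -
    have "cavg (insert j J) (\<lambda>A. (F A)\<^sup>2) = cavg J (\<lambda>A. (1/2) *\<^sub>R ((F A)\<^sup>2 + (F1 A)\<^sup>2))"
      using insert by (simp add: cavg_insert F1_def cavg_add cavg_divide)
    also have "(\<lambda>A. (1/2) *\<^sub>R ((F A)\<^sup>2 + (F1 A)\<^sup>2)) = (\<lambda>A. (G A)\<^sup>2 + (1/4) * (F A - F1 A)\<^sup>2)"
      by (rule ext) (simp add: G_def power2_eq_square field_simps)
    finally show ?thesis unfolding cavg_add cavg_mult_left by simp
  qed
  have step: "cavg J (\<lambda>A. (G A - G (flip {i} A))\<^sup>2) \<le> cavg (insert j J) (\<lambda>A. (F A - F (flip {i} A))\<^sup>2)"
    if i: "i \<in> J" for i
  proof -
    have ij: "i \<noteq> j" using i insert by auto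
    have "cavg (insert j J) (\<lambda>A. (F A - F (flip {i} A))\<^sup>2) =
        cavg J (\<lambda>A. (1/2) *\<^sub>R ((F A - F (flip {i} A))\<^sup>2 + (F (insert j A) - F (flip {i} (insert j A)))\<^sup>2))"
      using insert by (simp add: cavg_insert cavg_add cavg_divide)
    also have "\<dots> \<ge> cavg J (\<lambda>A. (G A - G (flip {i} A))\<^sup>2)"
    proof (rule cavg_mono)
      fix A assume "A \<subseteq> J"
      have e: "flip {i} (insert j A) = insert j (flip {i} A)" using ij by (auto simp: flip_def)
      have *: "((a + b) / 2)\<^sup>2 \<le> (1/2) *\<^sub>R (a\<^sup>2 + b\<^sup>2)" for a b :: real
        using zero_le_power2[of "a - b"] by (simp add: power2_eq_square field_simps)
      show "(G A - G (flip {i} A))\<^sup>2 \<le> (1/2) *\<^sub>R ((F A - F (flip {i} A))\<^sup>2 + (F (insert j A) - F (flip {i} (insert j A)))\<^sup>2)"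
        unfolding e using *[of "F A - F (flip {i} A)" "F1 A - F1 (flip {i} A)"]
        by (simp add: G_def F1_def diff_divide_distrib add_divide_distrib algebra_simps)
    qed
    finally show ?thesis .
  qed
  have stepj: "cavg (insert j J) (\<lambda>A. (F A - F (flip {j} A))\<^sup>2) = cavg J (\<lambda>A. (F A - F1 A)\<^sup>2)"
  proof -
    have "cavg (insert j J) (\<lambda>A. (F A - F (flip {j} A))\<^sup>2) =
        (1/2) *\<^sub>R (cavg J (\<lambda>A. (F A - F (flip {j} A))\<^sup>2) + cavg J (\<lambda>A. (F (insert j A) - F (flip {j} (insert j A)))\<^sup>2))"
      using insert by (simp add: cavg_insert)
    also have "cavg J (\<lambda>A. (F A - F (flip {j} A))\<^sup>2) = cavg J (\<lambda>A. (F A - F1 A)\<^sup>2)"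
    proof (rule cavg_cong)
      fix A assume "A \<subseteq> J"
      then have "flip {j} A = insert j A" using insert by (auto simp: flip_def)
      then show "(F A - F (flip {j} A))\<^sup>2 = (F A - F1 A)\<^sup>2" by (simp add: F1_def)
    qed
    also have "cavg J (\<lambda>A. (F (insert j A) - F (flip {j} (insert j A)))\<^sup>2) = cavg J (\<lambda>A. (F A - F1 A)\<^sup>2)"
    proof (rule cavg_cong)
      fix A assume "A \<subseteq> J"
      then have "flip {j} (insert j A) = A" using insert by (auto simp: flip_def)
      then show "(F (insert j A) - F (flip {j} (insert j A)))\<^sup>2 = (F A - F1 A)\<^sup>2"
        by (simp add: F1_def power2_commute)
    qed
    finally show ?thesis by simp
  qed
  have "cavg J (\<lambda>A. (G A)\<^sup>2) - (cavg J G)\<^sup>2 \<le> 1/4 * (\<Sum>i\<in>J. cavg (insert j J) (\<lambda>A. (F A - F (flip {i} A))\<^sup>2))"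
  proof -
    have "(\<Sum>i\<in>J. cavg J (\<lambda>A. (G A - G (flip {i} A))\<^sup>2)) \<le> (\<Sum>i\<in>J. cavg (insert j J) (\<lambda>A. (F A - F (flip {i} A))\<^sup>2))"
      by (rule sum_mono) (rule step)
    then show ?thesis using insert.IH[of G] by simp
  qed
  then show ?case
    using insert by (simp add: G sq stepj algebra_simps)
qed simp

text \<open>
  For a norm of a Rademacher sum only the decreases under a flip count, and their vector is
  bounded by testing against convex combinations of the flipped sums.
\<close>

lemma variance_norm_rademacher:
  fixes z :: "'i \<Rightarrow> 'v::real_normed_vector"
  assumes J: "finite J" and u: "upper2 \<sigma> J z" and "0 \<le> \<sigma>"
  defines "F \<equiv> (\<lambda>A. norm (\<Sum>i\<in>J. sg A i *\<^sub>R z i))"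
  shows "cavg J (\<lambda>A. (F A - cavg J F)\<^sup>2) \<le> 2 * \<sigma>\<^sup>2"
proof -
  \<comment> \<open>Of the two ends \<open>A\<close> and \<open>flip {j} A\<close> of an edge
    exactly one can see a decrease, so \<open>half\<close> recovers the full squared difference from
    \<open>d\<close> at the price of a factor 2.\<close>
  define d where "d = (\<lambda>A j. max 0 (F A - F (flip {j} A)))"
  have dd: "(\<Sum>j\<in>J. (d A j)\<^sup>2) \<le> 4 * \<sigma>\<^sup>2" for A
  proof -
    define S where "S = (\<Sum>i\<in>J. sg A i *\<^sub>R z i)"
    define T where "T = (\<Sum>j\<in>J. d A j)"
    have fl: "(\<Sum>i\<in>J. sg (flip {j} A) i *\<^sub>R z i) = S - (2 * sg A j) *\<^sub>R z j" if "j \<in> J" for j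
      unfolding S_def using J that by (simp add: sum.remove[of J j] sg_flip algebra_simps scaleR_2[symmetric])
    have "(\<Sum>j\<in>J. d A j * F A) - (\<Sum>j\<in>J. d A j * d A j) \<ge> (\<Sum>j\<in>J. d A j * F (flip {j} A))"
      unfolding sum_subtractf[symmetric]
    proof (rule sum_mono)
      fix j assume "j \<in> J"
      show "d A j * F (flip {j} A) \<le> d A j * F A - d A j * d A j"
        by (auto simp: d_def max_def algebra_simps)
    qed
    \<comment> \<open>The flipped sums, weighted by \<open>d A j\<close>, add up to
      \<open>T *\<^sub>R S\<close> minus a signed sum that \<open>upper2\<close> controls; the
      triangle inequality yields the lower bound.\<close>
    moreover have "(\<Sum>j\<in>J. d A j * F (flip {j} A)) \<ge> T * F A - 2 * (\<sigma> * L2_set (d A) J)"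
    proof -
      have "(\<Sum>j\<in>J. d A j * F (flip {j} A)) = (\<Sum>j\<in>J. norm (d A j *\<^sub>R (S - (2 * sg A j) *\<^sub>R z j)))"
        by (rule sum.cong) (auto simp: F_def fl d_def)
      also have "\<dots> \<ge> norm (\<Sum>j\<in>J. d A j *\<^sub>R (S - (2 * sg A j) *\<^sub>R z j))" by (rule norm_sum)
      also have "(\<Sum>j\<in>J. d A j *\<^sub>R (S - (2 * sg A j) *\<^sub>R z j)) = T *\<^sub>R S - 2 *\<^sub>R (\<Sum>j\<in>J. (d A j * sg A j) *\<^sub>R z j)"
        by (simp add: T_def scaleR_diff_right sum_subtractf scaleR_sum_left scaleR_sum_right mult_ac)
      also have "norm \<dots> \<ge> norm (T *\<^sub>R S) - norm (2 *\<^sub>R (\<Sum>j\<in>J. (d A j * sg A j) *\<^sub>R z j))"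
        by (rule norm_triangle_ineq2)
      moreover have "norm (\<Sum>j\<in>J. (d A j * sg A j) *\<^sub>R z j) \<le> \<sigma> * L2_set (d A) J"
        using upper2D[OF u, of "\<lambda>j. d A j * sg A j"] by (simp add: L2_set_def power_mult_distrib)
      moreover have "norm (T *\<^sub>R S) = T * F A" by (simp add: T_def F_def S_def sum_nonneg d_def)
      ultimately show ?thesis by simp
    qed
    moreover have "(\<Sum>j\<in>J. d A j * d A j) = (L2_set (d A) J)\<^sup>2"
      by (simp add: L2_set_def sum_nonneg power2_eq_square)
    ultimately have le: "(L2_set (d A) J)\<^sup>2 \<le> 2 * \<sigma> * L2_set (d A) J"
      by (simp add: T_def sum_distrib_right)
    have "L2_set (d A) J \<le> 2 * \<sigma>"
    proof (cases "L2_set (d A) J = 0")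
      case False
      then have "L2_set (d A) J > 0" using L2_set_nonneg[of "d A" J] by linarith
      with le show ?thesis by (simp add: power2_eq_square)
    qed (use \<open>0 \<le> \<sigma>\<close> in simp)
    then have "(L2_set (d A) J)\<^sup>2 \<le> (2 * \<sigma>)\<^sup>2" by (rule power_mono) simp
    then show ?thesis by (simp add: L2_set_def sum_nonneg)
  qed
  have half: "cavg J (\<lambda>A. (F A - F (flip {j} A))\<^sup>2) = 2 * cavg J (\<lambda>A. (d A j)\<^sup>2)" if j: "j \<in> J" for j
  proof -
    have ff: "flip {j} (flip {j} A) = A" for A by (auto simp: flip_def)
    have "cavg J (\<lambda>A. (F A - F (flip {j} A))\<^sup>2) = cavg J (\<lambda>A. (d A j)\<^sup>2 + (d (flip {j} A) j)\<^sup>2)"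
      by (rule cavg_cong) (simp add: d_def ff max_def power2_commute)
    also have "\<dots> = 2 * cavg J (\<lambda>A. (d A j)\<^sup>2)"
      using cavg_flip[of "{j}" J "\<lambda>A. (d A j)\<^sup>2"] j by (simp add: cavg_add)
    finally show ?thesis .
  qed
  have "cavg J (\<lambda>A. (F A - cavg J F)\<^sup>2) = cavg J (\<lambda>A. (F A)\<^sup>2 + (- 2 * cavg J F) * F A + (cavg J F)\<^sup>2)"
    by (simp add: power2_eq_square algebra_simps)
  also have "\<dots> = cavg J (\<lambda>A. (F A)\<^sup>2) - (cavg J F)\<^sup>2"
    unfolding cavg_add cavg_mult_left using J by (simp add: power2_eq_square)
  also have "\<dots> \<le> 1/4 * (\<Sum>j\<in>J. 2 * cavg J (\<lambda>A. (d A j)\<^sup>2))"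
    using efron_stein[OF J, of F] by (simp add: half)
  also have "\<dots> = 1/2 * cavg J (\<lambda>A. \<Sum>j\<in>J. (d A j)\<^sup>2)"
    by (simp add: cavg_sum sum_distrib_left[symmetric])
  also have "\<dots> \<le> 1/2 * cavg J (\<lambda>A. 4 * \<sigma>\<^sup>2)"
    by (intro mult_left_mono cavg_mono dd) auto
  finally show ?thesis using J by simp
qed

section \<open>Rademacher averages and their behaviour under copying\<close>

definition rad :: "'i set \<Rightarrow> ('i \<Rightarrow> 'v::real_normed_vector) \<Rightarrow> real" where
  "rad P z = cavg P (\<lambda>A. norm (\<Sum>p\<in>P. sg A p *\<^sub>R z p))"

lemma rad_reindex:
  assumes "inj_on f P"
  shows "rad (f ` P) z = rad P (\<lambda>p. z (f p))"
  unfolding rad_def cavg_reindex[OF assms]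
  by (rule cavg_cong) (simp add: sum.reindex[OF assms] sg_image[OF assms])

lemma rad_cong: "(\<And>p. p \<in> P \<Longrightarrow> z p = w p) \<Longrightarrow> rad P z = rad P w"
  unfolding rad_def by (rule cavg_cong) (auto intro!: arg_cong[where f=norm] sum.cong)

lemma rad_scaleR: "rad P (\<lambda>p. c *\<^sub>R z p) = \<bar>c\<bar> * rad P z"
proof -
  have "norm (\<Sum>p\<in>P. sg A p *\<^sub>R c *\<^sub>R z p) = \<bar>c\<bar> * norm (\<Sum>p\<in>P. sg A p *\<^sub>R z p)" for A
    by (subst norm_scaleR[symmetric]) (simp add: scaleR_sum_right mult.commute)
  then show ?thesis by (simp add: rad_def cavg_mult_left)
qed

lemma rad_nonneg: "rad P z \<ge> 0"
  unfolding rad_def by (rule cavg_nonneg) simp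

lemma rad_abs: "rad P (\<lambda>p. t p *\<^sub>R z p) = rad P (\<lambda>p. \<bar>t p\<bar> *\<^sub>R z p)"
proof -
  define D where "D = {p\<in>P. t p < 0}"
  have "rad P (\<lambda>p. t p *\<^sub>R z p) = cavg P (\<lambda>A. norm (\<Sum>p\<in>P. sg (flip D A) p *\<^sub>R t p *\<^sub>R z p))"
    unfolding rad_def by (subst cavg_flip) (auto simp: D_def)
  also have "\<dots> = rad P (\<lambda>p. \<bar>t p\<bar> *\<^sub>R z p)"
    unfolding rad_def by (rule cavg_cong) (auto intro!: arg_cong[where f=norm] sum.cong simp: sg_flip D_def)
  finally show ?thesis .
qed

lemma cavg_rademacher_square:
  assumes J: "finite J" and "K \<subseteq> J"
  shows "cavg J (\<lambda>A. (\<Sum>p\<in>K. sg A p * a p)\<^sup>2) = (\<Sum>p\<in>K. (a p)\<^sup>2)"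
  using finite_subset[OF assms(2,1)] assms(2)
proof (induction K rule: finite_induct)
  case (insert p K)
  have "cavg J (\<lambda>A. (\<Sum>p\<in>insert p K. sg A p * a p)\<^sup>2) =
     cavg J (\<lambda>A. (\<Sum>p\<in>K. sg A p * a p)\<^sup>2 + (2 * a p) * (sg A p * (\<Sum>p\<in>K. sg A p * a p)) + (a p)\<^sup>2)"
    using insert by (intro cavg_cong) (simp add: power2_sum power_mult_distrib algebra_simps)
  also have "\<dots> = (\<Sum>p\<in>insert p K. (a p)\<^sup>2)"
    unfolding cavg_add cavg_mult_left
    by (subst cavg_sg_mult) (use insert J in \<open>auto simp: sg_flip intro!: sum.cong\<close>)
  finally show ?case .
qed (simp add: J)

text \<open>Odd powers of a fresh sign average out, so adding an index raises the fourth moment by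
  \<open>6 * card K + 1\<close>.\<close>

lemma cavg_rademacher_fourth:
  assumes J: "finite J" and "K \<subseteq> J"
  shows "cavg J (\<lambda>A. (\<Sum>p\<in>K. sg A p) ^ 4) = 3 * (real (card K))\<^sup>2 - 2 * real (card K)"
  using finite_subset[OF assms(2,1)] assms(2)
proof (induction K rule: finite_induct)
  case (insert p K)
  define S where "S = (\<lambda>A. \<Sum>p\<in>K. sg A p)"
  have S2: "cavg J (\<lambda>A. (S A)\<^sup>2) = real (card K)"
    using cavg_rademacher_square[OF J, of K "\<lambda>_. 1"] insert by (simp add: S_def)
  have Sf: "S (flip {p} A) = S A" for A
    unfolding S_def using insert by (auto simp: sg_flip intro!: sum.cong)
  have e: "(s + x) ^ 4 = x ^ 4 + 6 * x\<^sup>2 + s * (4 * x + 4 * x ^ 3) + 1" if "s\<^sup>2 = 1" for s x :: real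
  proof -
    have "s ^ 4 = 1" "s ^ 3 = s" using that by (simp_all add: power4_eq_xxxx power3_eq_cube power2_eq_square)
    moreover have "(s + x) ^ 4 = x ^ 4 + 6 * s\<^sup>2 * x\<^sup>2 + 4 * s ^ 3 * x + 4 * s * x ^ 3 + s ^ 4"
      by (simp add: power4_eq_xxxx power3_eq_cube power2_eq_square algebra_simps)
    ultimately show ?thesis using that by (simp add: algebra_simps)
  qed
  have "cavg J (\<lambda>A. (\<Sum>p\<in>insert p K. sg A p) ^ 4) =
     cavg J (\<lambda>A. (S A) ^ 4 + 6 * (S A)\<^sup>2 + sg A p * (4 * S A + 4 * (S A) ^ 3) + 1)"
    using insert by (intro cavg_cong) (simp add: e S_def)
  also have "\<dots> = cavg J (\<lambda>A. (S A) ^ 4) + 6 * cavg J (\<lambda>A. (S A)\<^sup>2) + 0 + 1"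
    unfolding cavg_add cavg_mult_left
    by (subst cavg_sg_mult) (use insert J in \<open>auto simp: Sf\<close>)
  also have "\<dots> = 3 * (real (card (insert p K)))\<^sup>2 - 2 * real (card (insert p K))"
    using insert by (simp add: S2) (simp add: S_def power2_eq_square algebra_simps)
  finally show ?case .
qed (simp add: J)

text \<open>From \<open>\<bar>t\<bar> \<ge> 3/4 (t\<^sup>2 - t^4 / 12)\<close>.\<close>

lemma khinchine:
  assumes J: "finite J"
  shows "9/16 * sqrt (card J) \<le> cavg J (\<lambda>A. \<bar>\<Sum>p\<in>J. sg A p\<bar>)"
proof (cases "card J = 0")
  case True
  then show ?thesis by (simp add: cavg_nonneg)
next
  case False
  define c where "c = real (card J)"
  have c: "c > 0" using False by (simp add: c_def)
  have key: "\<bar>t\<bar> \<ge> 3/4 * (t\<^sup>2 - t ^ 4 / 12)" for t :: real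
  proof -
    define x where "x = \<bar>t\<bar>"
    have x: "x \<ge> 0" "t\<^sup>2 = x\<^sup>2" "t ^ 4 = x ^ 4" by (simp_all add: x_def power_even_abs)
    have "x - 3/4 * (x\<^sup>2 - x ^ 4 / 12) = x * ((x - 2)\<^sup>2 * (x + 4)) / 16"
      by (simp add: power2_eq_square power4_eq_xxxx field_simps)
    also have "\<dots> \<ge> 0" using x by simp
    finally show ?thesis unfolding x(2,3) x_def[symmetric] by linarith
  qed
  have "9/16 = 3/4 * (1 - 3/12 :: real)" by simp
  also have "\<dots> \<le> 3/4 * (1/c * c - 1/(12 * c\<^sup>2) * (3 * c\<^sup>2 - 2 * c))"
    using c by (simp add: field_simps)
  also have "\<dots> = cavg J (\<lambda>A. 3/4 * (1/c * (\<Sum>p\<in>J. sg A p)\<^sup>2 - 1/(12 * c\<^sup>2) * (\<Sum>p\<in>J. sg A p) ^ 4))"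
    unfolding cavg_mult_left cavg_diff
    using cavg_rademacher_fourth[OF J order_refl] cavg_rademacher_square[OF J order_refl, of "\<lambda>_. 1"]
    by (simp add: c_def)
  also have "\<dots> \<le> cavg J (\<lambda>A. 1 / sqrt c * \<bar>\<Sum>p\<in>J. sg A p\<bar>)"
  proof (rule cavg_mono)
    fix A
    define s where "s = (\<Sum>p\<in>J. sg A p)"
    have "sqrt c ^ 4 = c\<^sup>2" using c by (simp add: power4_eq_xxxx power2_eq_square flip: mult.assoc)
    then show "3/4 * (1/c * s\<^sup>2 - 1/(12 * c\<^sup>2) * s ^ 4) \<le> 1 / sqrt c * \<bar>s\<bar>"
      using key[of "s / sqrt c"] c by (simp add: power_divide)
  qed
  also have "\<dots> = 1 / sqrt c * cavg J (\<lambda>A. \<bar>\<Sum>p\<in>J. sg A p\<bar>)" by (rule cavg_mult_left)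
  finally show ?thesis using c by (simp add: c_def field_simps)
qed

text \<open>The \<open>N\<close> copies of \<open>z p\<close> add up to \<open>z p\<close> times a
  random walk \<open>\<eta> A p\<close> of mean modulus \<open>c\<close>, which is of order
  \<open>sqrt N\<close>. By symmetry the walk may be multiplied by independent signs, after which
  only its modulus matters, and Jensen's inequality replaces the moduli by their mean.\<close>

lemma rad_tensor_ones:
  fixes z :: "'i \<Rightarrow> 'v::real_normed_vector" and N :: nat
  assumes P: "finite P"
  shows "9/16 * sqrt N * rad P z \<le> rad ({..<N} \<times> P) (\<lambda>(k, p). z p)"
proof -
  define J where "J = {..<N} \<times> P"
  have J: "finite J" using P by (simp add: J_def)
  define \<eta> where "\<eta> = (\<lambda>A (p::'i). \<Sum>k<N. sg A (k, p))"
  define c where "c = cavg {..<N} (\<lambda>A. \<bar>\<Sum>k<N. sg A k\<bar>)"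
  have c: "9/16 * sqrt N \<le> c" using khinchine[of "{..<N}"] by (simp add: c_def)
  have sumJ: "(\<Sum>q\<in>J. sg A q *\<^sub>R (case q of (k, p) \<Rightarrow> z p)) = (\<Sum>p\<in>P. \<eta> A p *\<^sub>R z p)" for A
    unfolding J_def \<eta>_def scaleR_sum_left
    by (subst sum.swap, subst sum.cartesian_product) (simp add: case_prod_beta)
  have marg: "cavg J (\<lambda>A. \<bar>\<eta> A p\<bar>) = c" if p: "p \<in> P" for p
  proof -
    have "cavg J (\<lambda>A. \<bar>\<eta> A p\<bar>) = cavg ((\<lambda>k. (k, p)) ` {..<N}) (\<lambda>A. \<bar>\<eta> A p\<bar>)"
      by (rule cavg_marginal[OF J]) (use p in \<open>auto simp: J_def \<eta>_def sg_def\<close>)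
    also have "\<dots> = cavg {..<N} (\<lambda>A. \<bar>\<eta> ((\<lambda>k. (k, p)) ` A) p\<bar>)"
      by (rule cavg_reindex) (simp add: inj_on_def)
    also have "\<dots> = c"
      unfolding c_def \<eta>_def by (intro cavg_cong arg_cong[where f=abs] sum.cong refl) (auto simp: sg_def)
    finally show ?thesis .
  qed
  \<comment> \<open>Flipping all signs over a given \<open>p\<close> reverses its walk, so
    prescribing extra signs \<open>D\<close> does not change the average.\<close>
  have flipped: "rad J (\<lambda>(k, p). z p) = cavg J (\<lambda>A. norm (\<Sum>p\<in>P. (sg D p * \<eta> A p) *\<^sub>R z p))" if "D \<subseteq> P" for D
  proof -
    have s: "(if p \<in> P - D then - x else x) = sg D p * x" if "p \<in> P" for p and x :: real
      using that by (auto simp: sg_def)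
    have "rad J (\<lambda>(k, p). z p) = cavg J (\<lambda>A. norm (\<Sum>p\<in>P. \<eta> (flip ({..<N} \<times> (P - D)) A) p *\<^sub>R z p))"
      unfolding rad_def sumJ by (subst cavg_flip) (auto simp: J_def)
    also have "\<dots> = cavg J (\<lambda>A. norm (\<Sum>p\<in>P. (sg D p * \<eta> A p) *\<^sub>R z p))"
    proof (intro cavg_cong arg_cong[where f=norm] sum.cong refl)
      fix A p assume p: "p \<in> P"
      have "\<eta> (flip ({..<N} \<times> (P - D)) A) p = sg D p * \<eta> A p"
        unfolding \<eta>_def sum_distrib_left s[OF p, symmetric] by (rule sum.cong) (auto simp: sg_flip p)
      then show "\<eta> (flip ({..<N} \<times> (P - D)) A) p *\<^sub>R z p = (sg D p * \<eta> A p) *\<^sub>R z p" by simp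
    qed
    finally show ?thesis .
  qed
  have "9/16 * sqrt N * rad P z \<le> c * rad P z" using c rad_nonneg by (rule mult_right_mono)
  also have "\<dots> = cavg P (\<lambda>D. norm (\<Sum>p\<in>P. (sg D p * c) *\<^sub>R z p))"
    using rad_scaleR[of P c z] cavg_nonneg[of "{..<N}" "\<lambda>A. \<bar>\<Sum>k<N. sg A k\<bar>"]
    by (simp add: rad_def c_def)
  also have "\<dots> = cavg P (\<lambda>D. norm (cavg J (\<lambda>A. \<Sum>p\<in>P. (sg D p * \<bar>\<eta> A p\<bar>) *\<^sub>R z p)))"
  proof -
    have *: "cavg J (\<lambda>A. (s * \<bar>\<eta> A p\<bar>) *\<^sub>R z p) = (s * c) *\<^sub>R z p" if "p \<in> P" for s p
      using cavg_bounded_linear[OF bounded_linear_scaleR_left[of "z p"], of J "\<lambda>A. s * \<bar>\<eta> A p\<bar>"]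
      by (simp add: cavg_mult_left marg[OF that])
    show ?thesis unfolding cavg_sum by (intro cavg_cong arg_cong[where f=norm] sum.cong refl) (simp add: *)
  qed
  also have "\<dots> \<le> cavg P (\<lambda>D. cavg J (\<lambda>A. norm (\<Sum>p\<in>P. (sg D p * \<bar>\<eta> A p\<bar>) *\<^sub>R z p)))"
    by (intro cavg_mono norm_cavg_le)
  also have "\<dots> = cavg J (\<lambda>A. rad P (\<lambda>p. \<bar>\<eta> A p\<bar> *\<^sub>R z p))"
    by (subst cavg_swap) (simp add: rad_def)
  also have "\<dots> = cavg J (\<lambda>A. rad P (\<lambda>p. \<eta> A p *\<^sub>R z p))"
    by (rule cavg_cong) (rule rad_abs[symmetric])
  also have "\<dots> = cavg P (\<lambda>D. cavg J (\<lambda>A. norm (\<Sum>p\<in>P. (sg D p * \<eta> A p) *\<^sub>R z p)))"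
    by (subst cavg_swap) (simp add: rad_def)
  also have "\<dots> = cavg P (\<lambda>D. rad J (\<lambda>(k, p). z p))"
    by (rule cavg_cong) (simp add: flipped)
  also have "\<dots> = rad J (\<lambda>(k, p). z p)" using P by simp
  finally show ?thesis by (simp add: J_def)
qed

text \<open>All copies over \<open>i\<close> share the vector \<open>x i\<close>; Cauchy--Schwarz in
  the copies reduces to the estimate for \<open>x\<close>. This is what keeps variances bounded
  however many copies are taken.\<close>

lemma upper2_tensor:
  fixes x :: "'j \<Rightarrow> 'v::real_normed_vector"
  assumes x: "upper2 1 I x" and fin: "finite \<Lambda>" "finite I"
  shows "upper2 (L2_set a \<Lambda>) (\<Lambda> \<times> I) (\<lambda>(l, i). a l *\<^sub>R x i)"
  unfolding upper2_def
proof
  fix t :: "'a \<times> 'j \<Rightarrow> real"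
  have "(\<Sum>q\<in>\<Lambda> \<times> I. t q *\<^sub>R (case q of (l, i) \<Rightarrow> a l *\<^sub>R x i)) = (\<Sum>i\<in>I. (\<Sum>l\<in>\<Lambda>. t (l, i) * a l) *\<^sub>R x i)"
    unfolding scaleR_sum_left
    by (subst sum.swap, subst sum.cartesian_product) (simp add: case_prod_beta)
  also have "norm \<dots> \<le> L2_set (\<lambda>i. \<Sum>l\<in>\<Lambda>. t (l, i) * a l) I"
    using upper2D[OF x, of "\<lambda>i. \<Sum>l\<in>\<Lambda>. t (l, i) * a l"] by simp
  also have "\<dots> \<le> L2_set (\<lambda>i. L2_set a \<Lambda> * L2_set (\<lambda>l. t (l, i)) \<Lambda>) I"
  proof -
    have cs: "\<bar>\<Sum>l\<in>\<Lambda>. t (l, i) * a l\<bar> \<le> L2_set a \<Lambda> * L2_set (\<lambda>l. t (l, i)) \<Lambda>" for i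
    proof -
      have "\<bar>\<Sum>l\<in>\<Lambda>. t (l, i) * a l\<bar> \<le> (\<Sum>l\<in>\<Lambda>. \<bar>t (l, i)\<bar> * \<bar>a l\<bar>)"
        by (rule order_trans[OF sum_abs]) (simp add: abs_mult)
      also have "\<dots> \<le> L2_set (\<lambda>l. t (l, i)) \<Lambda> * L2_set a \<Lambda>" by (rule L2_set_mult_ineq)
      finally show ?thesis by (simp add: mult.commute)
    qed
    have "L2_set (\<lambda>i. \<Sum>l\<in>\<Lambda>. t (l, i) * a l) I = L2_set (\<lambda>i. \<bar>\<Sum>l\<in>\<Lambda>. t (l, i) * a l\<bar>) I"
      by (simp add: L2_set_def)
    also have "\<dots> \<le> L2_set (\<lambda>i. L2_set a \<Lambda> * L2_set (\<lambda>l. t (l, i)) \<Lambda>) I"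
      by (rule L2_set_mono) (use cs in auto)
    finally show ?thesis .
  qed
  also have "\<dots> = L2_set a \<Lambda> * L2_set (\<lambda>i. L2_set (\<lambda>l. t (l, i)) \<Lambda>) I"
    by (simp add: L2_set_right_distrib)
  also have "L2_set (\<lambda>i. L2_set (\<lambda>l. t (l, i)) \<Lambda>) I = L2_set t (\<Lambda> \<times> I)"
  proof -
    have "(\<Sum>i\<in>I. \<Sum>l\<in>\<Lambda>. (t (l, i))\<^sup>2) = (\<Sum>q\<in>\<Lambda> \<times> I. (t q)\<^sup>2)"
      by (subst sum.swap, subst sum.cartesian_product) (simp add: case_prod_beta)
    then show ?thesis by (simp add: L2_set_def sum_nonneg)
  qed
  finally show "norm (\<Sum>q\<in>\<Lambda> \<times> I. t q *\<^sub>R (case q of (l, i) \<Rightarrow> a l *\<^sub>R x i)) \<le> L2_set a \<Lambda> * L2_set t (\<Lambda> \<times> I)" .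
qed

text \<open>Columns are independent, and each consists of positive signs only with probability
  \<open>1 / 2 ^ card S\<close>.\<close>

lemma cavg_no_full_column:
  assumes S: "finite S"
  shows "cavg (S \<times> {..<n}) (\<lambda>A. if \<exists>i<n. S \<times> {i} \<subseteq> A then 0 else 1) = (1 - 1 / 2 ^ card S :: real) ^ n"
proof (induction n)
  case (Suc n)
  have one: "cavg (S \<times> {n}) (\<lambda>B. if S \<times> {n} \<subseteq> B then 0 else 1) = (1 - 1 / 2 ^ card S :: real)"
  proof -
    have "(\<Sum>B\<in>Pow (S \<times> {n}). if S \<times> {n} \<subseteq> B then 0 else 1::real) = (\<Sum>B\<in>Pow (S \<times> {n}). 1 - (if B = S \<times> {n} then 1 else 0))"
      by (rule sum.cong) auto
    also have "\<dots> = 2 ^ card S - 1"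
      using S by (simp add: sum_subtractf card_Pow card_cartesian_product)
    finally show ?thesis using S by (simp add: cavg_def card_cartesian_product field_simps)
  qed
  have U: "S \<times> {..<Suc n} = S \<times> {..<n} \<union> S \<times> {n}" by (auto simp: less_Suc_eq)
  have "cavg (S \<times> {..<Suc n}) (\<lambda>A. if \<exists>i<Suc n. S \<times> {i} \<subseteq> A then 0 else 1) =
      cavg (S \<times> {..<n}) (\<lambda>A. cavg (S \<times> {n}) (\<lambda>B. if \<exists>i<Suc n. S \<times> {i} \<subseteq> A \<union> B then 0 else 1 :: real))"
    unfolding U by (rule cavg_Un) (use S in auto)
  also have "\<dots> = cavg (S \<times> {..<n}) (\<lambda>A. cavg (S \<times> {n}) (\<lambda>B. (if \<exists>i<n. S \<times> {i} \<subseteq> A then 0 else 1) *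
      (if S \<times> {n} \<subseteq> B then 0 else 1 :: real)))"
  proof (intro cavg_cong)
    fix A B assume "A \<subseteq> S \<times> {..<n}" "B \<subseteq> S \<times> {n}"
    then have "S \<times> {i} \<subseteq> A \<union> B \<longleftrightarrow> S \<times> {i} \<subseteq> A" if "i < n" for i using that by fastforce
    moreover have "S \<times> {n} \<subseteq> A \<union> B \<longleftrightarrow> S \<times> {n} \<subseteq> B" using \<open>A \<subseteq> S \<times> {..<n}\<close> by fastforce
    ultimately show "(if \<exists>i<Suc n. S \<times> {i} \<subseteq> A \<union> B then 0 else 1) =
      (if \<exists>i<n. S \<times> {i} \<subseteq> A then 0 else 1) * (if S \<times> {n} \<subseteq> B then 0 else 1 :: real)"
      by (auto simp: less_Suc_eq)
  qed
  also have "\<dots> = (1 - 1 / 2 ^ card S :: real) ^ n * (1 - 1 / 2 ^ card S)"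
    unfolding cavg_mult_left one cavg_mult_right Suc.IH ..
  finally show ?case by simp
qed simp

text \<open>
  Flipping all columns but the first constant one preserves the position of that column; averaging
  over this involution isolates a single column.
\<close>

lemma rad_constant_column:
  fixes x :: "nat \<Rightarrow> 'v::real_normed_vector" and S :: "'l set" and c :: real
  assumes S: "finite S" and x: "\<And>i. i < n \<Longrightarrow> c \<le> norm (x i)" and "0 \<le> c"
  shows "rad (S \<times> {..<n}) (\<lambda>(l, i). x i) \<ge> card S * c * (1 - (1 - 1 / 2 ^ card S) ^ n)"
proof -
  define J where "J = S \<times> {..<n}"
  have J: "finite J" using S by (simp add: J_def)
  define F where "F = (\<lambda>A. norm (\<Sum>q\<in>J. sg A q *\<^sub>R (case q of (l, i) \<Rightarrow> x i)))"
  define Q where "Q = (\<lambda>(A::('l \<times> nat) set) i. i < n \<and> (S \<times> {i} \<subseteq> A \<or> S \<times> {i} \<inter> A = {}))"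
  define i0 where "i0 = (\<lambda>A. LEAST i. Q A i)"
  define G where "G = {A\<in>Pow J. \<exists>i. Q A i}"
  define \<Phi> where "\<Phi> = (\<lambda>A. flip (S \<times> ({..<n} - {i0 A})) A)"
  have finG: "finite G" using J by (simp add: G_def)
  have Q\<Phi>: "Q (\<Phi> A) i \<longleftrightarrow> Q A i" for A i
    unfolding Q_def \<Phi>_def flip_def by (cases "i = i0 A") auto
  have "Q (\<Phi> A) = Q A" for A by (rule ext) (rule Q\<Phi>)
  then have i0\<Phi>: "i0 (\<Phi> A) = i0 A" for A by (simp add: i0_def)
  have Q0: "Q A (i0 A)" if "A \<in> G" for A using that unfolding G_def i0_def by (auto intro: LeastI)
  have \<Phi>\<Phi>: "\<Phi> (\<Phi> A) = A" for A
  proof -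
    have "\<Phi> (\<Phi> A) = flip (S \<times> ({..<n} - {i0 (\<Phi> A)})) (\<Phi> A)" by (simp only: \<Phi>_def)
    also have "\<dots> = A" unfolding i0\<Phi> by (simp add: \<Phi>_def)
    finally show ?thesis .
  qed
  have \<Phi>G: "\<Phi> A \<in> G" if "A \<in> G" for A
    using that unfolding G_def mem_Collect_eq Q\<Phi> by (auto simp: \<Phi>_def flip_def J_def)
  have pair: "2 * (card S * c) \<le> F A + F (\<Phi> A)" if A: "A \<in> G" for A
  proof -
    define j where "j = i0 A"
    have j: "j < n" "S \<times> {j} \<subseteq> A \<or> S \<times> {j} \<inter> A = {}" using Q0[OF A] by (auto simp: Q_def j_def)
    define s :: real where "s = (if S \<times> {j} \<subseteq> A then 1 else -1)"
    have s: "\<bar>s\<bar> = 1" "\<And>l. l \<in> S \<Longrightarrow> sg A (l, j) = s"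
      using j by (auto simp: s_def sg_def)
    have "(\<Sum>q\<in>J. sg A q *\<^sub>R (case q of (l, i) \<Rightarrow> x i)) + (\<Sum>q\<in>J. sg (\<Phi> A) q *\<^sub>R (case q of (l, i) \<Rightarrow> x i))
        = (\<Sum>q\<in>J. if q \<in> S \<times> {j} then (2 * s) *\<^sub>R x j else 0)"
      unfolding sum.distrib[symmetric]
      by (rule sum.cong) (auto simp: \<Phi>_def sg_flip j_def[symmetric] J_def s scaleR_2[symmetric] scaleR_add_left[symmetric])
    also have "\<dots> = (\<Sum>q\<in>S \<times> {j}. (2 * s) *\<^sub>R x j)"
      using J j by (intro sum.mono_neutral_cong_right) (auto simp: J_def)
    also have "\<dots> = (2 * real (card S) * s) *\<^sub>R x j"
      using S by (simp add: card_cartesian_product sum_constant_scaleR)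
    finally have "norm ((2 * real (card S) * s) *\<^sub>R x j) \<le> F A + F (\<Phi> A)"
      unfolding F_def by (metis norm_triangle_ineq)
    moreover have "card S * c \<le> card S * norm (x j)" using x[OF j(1)] by (intro mult_left_mono) auto
    ultimately show ?thesis using s by (simp add: abs_mult)
  qed
  have "(\<Sum>A\<in>G. F (\<Phi> A)) = (\<Sum>A\<in>G. F A)"
    by (rule sum.reindex_bij_witness[of _ \<Phi> \<Phi>]) (auto simp: \<Phi>\<Phi> \<Phi>G)
  then have "2 * (\<Sum>A\<in>G. F A) = (\<Sum>A\<in>G. F A + F (\<Phi> A))" by (simp add: sum.distrib)
  also have "\<dots> \<ge> (\<Sum>A\<in>G. 2 * (card S * c))" by (rule sum_mono) (rule pair)
  finally have G1: "card G * (card S * c) \<le> (\<Sum>A\<in>G. F A)" by simp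
  have "card S * c * (1 - (1 - 1 / 2 ^ card S) ^ n) = card S * c * cavg J (\<lambda>A. 1 - (if \<exists>i<n. S \<times> {i} \<subseteq> A then 0 else 1))"
    unfolding cavg_diff J_def cavg_no_full_column[OF S] using S by simp
  also have "\<dots> = cavg J (\<lambda>A. card S * c * (1 - (if \<exists>i<n. S \<times> {i} \<subseteq> A then 0 else 1)))"
    by (rule cavg_mult_left[symmetric])
  also have "\<dots> \<le> cavg J (\<lambda>A. if A \<in> G then card S * c else 0)"
    by (rule cavg_mono) (use \<open>0 \<le> c\<close> in \<open>auto simp: G_def Q_def\<close>)
  also have "\<dots> \<le> cavg J (\<lambda>A. if A \<in> G then F A else 0)"
  proof -
    have "(\<Sum>A\<in>Pow J. if A \<in> G then h A else 0) = (\<Sum>A\<in>G. h A)" for h :: "_ \<Rightarrow> real"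
      using J by (intro sum.mono_neutral_cong_right) (auto simp: G_def)
    then show ?thesis using G1 unfolding cavg_def by (auto intro!: divide_right_mono)
  qed
  also have "\<dots> \<le> cavg J F" by (rule cavg_mono) (simp add: F_def)
  finally show ?thesis by (simp add: rad_def F_def J_def)
qed

text \<open>The supremum is the best constant in a bound of such averages by the l2 norm of
  \<open>a\<close>, over any number of copies. The class is stable under tensoring with another
  normalised sequence; a nearly extremal \<open>a\<close> therefore has \<open>rad\<close> bounded
  above and below by the same constant after further copying.\<close>

definition rads :: "nat \<Rightarrow> (nat \<Rightarrow> 'v::real_normed_vector) \<Rightarrow> real set" where
  "rads n x = {rad (\<Lambda> \<times> {..<n}) (\<lambda>(l::nat, i). a l *\<^sub>R x i) | \<Lambda> a. finite \<Lambda> \<and> L2_set a \<Lambda> = 1}"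

text \<open>A bound depending on \<open>n\<close> is enough: each \<open>S A i\<close> has mean
  square 1, \<open>norm (x i) \<le> 1\<close>, and
  \<open>\<bar>s\<bar> \<le> (1 + s\<^sup>2) / 2\<close>.\<close>

lemma rads_bdd_above:
  fixes x :: "nat \<Rightarrow> 'v::real_normed_vector"
  assumes x: "upper2 1 {..<n} x"
  shows "bdd_above (rads n x)"
proof (rule bdd_aboveI[of _ "real n"])
  fix r assume "r \<in> rads n x"
  then obtain \<Lambda> :: "nat set" and a where \<Lambda>: "finite \<Lambda>" "L2_set a \<Lambda> = 1"
    and r: "r = rad (\<Lambda> \<times> {..<n}) (\<lambda>(l, i). a l *\<^sub>R x i)" by (auto simp: rads_def)
  define J where "J = \<Lambda> \<times> {..<n}"
  have J: "finite J" using \<Lambda> by (simp add: J_def)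
  define S where "S = (\<lambda>A (i::nat). \<Sum>l\<in>\<Lambda>. sg A (l, i) * a l)"
  have a1: "(\<Sum>l\<in>\<Lambda>. (a l)\<^sup>2) = 1"
    using \<Lambda>(2) by (simp add: L2_set_def)
  have "r = cavg J (\<lambda>A. norm (\<Sum>i<n. S A i *\<^sub>R x i))"
  proof -
    have "(\<Sum>q\<in>J. sg A q *\<^sub>R (case q of (l, i) \<Rightarrow> a l *\<^sub>R x i)) = (\<Sum>i<n. S A i *\<^sub>R x i)" for A
      unfolding J_def S_def scaleR_sum_left
      by (subst sum.swap, subst sum.cartesian_product) (simp add: case_prod_beta)
    then show ?thesis unfolding r rad_def J_def[symmetric] by simp
  qed
  also have "\<dots> \<le> cavg J (\<lambda>A. \<Sum>i<n. (1 + (S A i)\<^sup>2) / 2)"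
  proof (rule cavg_mono)
    fix A
    have "norm (\<Sum>i<n. S A i *\<^sub>R x i) \<le> (\<Sum>i<n. \<bar>S A i\<bar>)"
      by (rule order_trans[OF norm_sum])
         (auto intro!: sum_mono mult_left_le upper2_imp_norm_le[OF x])
    also have "\<dots> \<le> (\<Sum>i<n. (1 + (S A i)\<^sup>2) / 2)"
    proof (rule sum_mono)
      fix i
      have "0 \<le> (\<bar>S A i\<bar> - 1)\<^sup>2" by simp
      then show "\<bar>S A i\<bar> \<le> (1 + (S A i)\<^sup>2) / 2" by (simp add: power2_diff)
    qed
    finally show "norm (\<Sum>i<n. S A i *\<^sub>R x i) \<le> (\<Sum>i<n. (1 + (S A i)\<^sup>2) / 2)" .
  qed
  also have "\<dots> = (\<Sum>i<n. (1 + cavg J (\<lambda>A. (S A i)\<^sup>2)) / 2)"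
    using J by (simp add: cavg_sum cavg_divide cavg_add)
  also have "\<dots> = n"
  proof -
    have "cavg J (\<lambda>A. (S A i)\<^sup>2) = 1" if i: "i < n" for i
    proof -
      have "S A i = (\<Sum>q\<in>(\<lambda>l. (l, i)) ` \<Lambda>. sg A q * a (fst q))" for A
        unfolding S_def by (subst sum.reindex) (auto intro: inj_onI)
      then have "cavg J (\<lambda>A. (S A i)\<^sup>2) = (\<Sum>q\<in>(\<lambda>l. (l, i)) ` \<Lambda>. (a (fst q))\<^sup>2)"
        using cavg_rademacher_square[OF J, of "(\<lambda>l. (l, i)) ` \<Lambda>" "\<lambda>q. a (fst q)"] i by (auto simp: J_def)
      also have "\<dots> = 1" using a1 by (subst sum.reindex) (auto intro: inj_onI)
      finally show ?thesis .
    qed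
    then show ?thesis by simp
  qed
  finally show "r \<le> n" by simp
qed

text \<open>The product of the normalised \<open>b\<close> with \<open>a\<close> is again
  normalised; \<open>prod_encode\<close> turns its pairs of indices into the natural numbers that
  \<open>rads\<close> uses.\<close>

lemma rad_tensor_le:
  fixes x :: "nat \<Rightarrow> 'v::real_normed_vector" and b :: "nat \<Rightarrow> real"
  assumes x: "upper2 1 {..<n} x" and \<Lambda>: "finite (\<Lambda>::nat set)" "L2_set a \<Lambda> = 1"
  shows "rad ({..<N} \<times> (\<Lambda> \<times> {..<n})) (\<lambda>(k, p). b k *\<^sub>R (case p of (l, i) \<Rightarrow> a l *\<^sub>R x i))
     \<le> Sup (rads n x) * L2_set b {..<N}"
proof (cases "L2_set b {..<N} = 0")
  case True
  then have "\<And>k. k < N \<Longrightarrow> b k = 0" by (simp add: L2_set_def sum_nonneg_eq_0_iff)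
  then have "rad ({..<N} \<times> (\<Lambda> \<times> {..<n})) (\<lambda>(k, p). b k *\<^sub>R (case p of (l, i) \<Rightarrow> a l *\<^sub>R x i)) =
      rad ({..<N} \<times> (\<Lambda> \<times> {..<n})) (\<lambda>q. 0 *\<^sub>R (0::'v))" by (intro rad_cong) auto
  then show ?thesis using True \<Lambda> by (simp add: rad_def)
next
  case False
  define B where "B = L2_set b {..<N}"
  have B: "B > 0" using False L2_set_nonneg[of b "{..<N}"] unfolding B_def by linarith
  define f where "f = (\<lambda>(k::nat, p::nat \<times> nat). (prod_encode (k, fst p), snd p))"
  define M where "M = prod_encode ` ({..<N} \<times> \<Lambda>)"
  define c where "c = (\<lambda>e. b (fst (prod_decode e)) / B * a (snd (prod_decode e)))"
  have inj: "inj_on f ({..<N} \<times> (\<Lambda> \<times> {..<n}))"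
    by (auto simp: inj_on_def f_def prod_encode_eq)
  have im: "f ` ({..<N} \<times> (\<Lambda> \<times> {..<n})) = M \<times> {..<n}"
    by (force simp: f_def M_def image_iff)
  have finM: "finite M" using \<Lambda> by (simp add: M_def)
  have "(\<Sum>e\<in>M. (c e)\<^sup>2) = (\<Sum>q\<in>{..<N} \<times> \<Lambda>. (b (fst q) / B * a (snd q))\<^sup>2)"
    unfolding M_def c_def by (subst sum.reindex) (auto intro!: inj_onI simp: prod_encode_eq)
  also have "\<dots> = (\<Sum>k<N. \<Sum>l\<in>\<Lambda>. (b k / B)\<^sup>2 * (a l)\<^sup>2)"
    by (simp only: sum.cartesian_product case_prod_unfold power_mult_distrib)
  also have "\<dots> = (\<Sum>k<N. (b k)\<^sup>2) / B\<^sup>2"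
  proof -
    have al: "(\<Sum>l\<in>\<Lambda>. (a l)\<^sup>2) = 1" using \<Lambda>(2) by (simp add: L2_set_def)
    show ?thesis unfolding sum_distrib_left[symmetric] al by (simp add: power_divide sum_divide_distrib)
  qed
  also have "\<dots> = 1"
    using B by (simp add: L2_set_def B_def sum_nonneg)
  finally have c1: "L2_set c M = 1" by (simp add: L2_set_def)
  have "rad ({..<N} \<times> (\<Lambda> \<times> {..<n})) (\<lambda>(k, p). b k *\<^sub>R (case p of (l, i) \<Rightarrow> a l *\<^sub>R x i)) =
      rad ({..<N} \<times> (\<Lambda> \<times> {..<n})) (\<lambda>q. B *\<^sub>R (\<lambda>(e, i). c e *\<^sub>R x i) (f q))"
    by (rule rad_cong) (use B in \<open>auto simp: f_def c_def\<close>)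
  also have "\<dots> = B * rad (M \<times> {..<n}) (\<lambda>(e, i). c e *\<^sub>R x i)"
    unfolding rad_scaleR using B by (simp add: rad_reindex[OF inj, unfolded im])
  also have "rad (M \<times> {..<n}) (\<lambda>(e, i). c e *\<^sub>R x i) \<le> Sup (rads n x)"
    by (rule cSup_upper[OF _ rads_bdd_above[OF x]]) (use finM c1 in \<open>auto simp: rads_def\<close>)
  finally show ?thesis using B by (simp add: B_def mult.commute)
qed

text \<open>With \<open>s\<close> equal coefficients \<open>1 / sqrt s\<close>, a constant column
  contributes at least \<open>sqrt s / 4\<close>, and for large \<open>n\<close> some column is
  constant with probability above 1/2. The resulting \<open>sqrt s / 8\<close> exceeds any
  bound.\<close>

lemma Sup_rads_unbounded:
  assumes "\<And>n. \<exists>x :: nat \<Rightarrow> 'v::real_normed_vector. (\<forall>i<n. x i \<in> E \<and> 1/4 \<le> norm (x i)) \<and> upper2 1 {..<n} x"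
  shows "\<exists>n (x :: nat \<Rightarrow> 'v). (\<forall>i<n. x i \<in> E) \<and> upper2 1 {..<n} x \<and> T \<le> Sup (rads n x)"
proof -
  obtain s0 :: nat where s0: "(8 * \<bar>T\<bar>)\<^sup>2 < s0" using reals_Archimedean2 by blast
  define s where "s = Suc s0"
  have s: "8 * \<bar>T\<bar> \<le> sqrt s" "s > 0" using s0 by (auto simp: s_def intro!: real_le_rsqrt)
  have "(1 - 1 / 2 ^ s :: real) < 1" by simp
  then obtain n where n: "(1 - 1 / 2 ^ s :: real) ^ n < 1/2"
    using real_arch_pow_inv[of "1/2" "1 - 1 / 2 ^ s :: real"] by auto
  obtain x :: "nat \<Rightarrow> 'v" where x: "\<forall>i<n. x i \<in> E \<and> 1/4 \<le> norm (x i)" "upper2 1 {..<n} x"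
    using assms[of n] by auto
  have "T \<le> sqrt s * (1/4) * (1/2)" using s by linarith
  also have "\<dots> = 1 / sqrt s * (s * (1/4) * (1/2))"
    using s by (simp add: real_div_sqrt)
  also have "\<dots> \<le> 1 / sqrt s * (s * (1/4) * (1 - (1 - 1 / 2 ^ s) ^ n))"
    using n by (intro mult_left_mono) auto
  also have "\<dots> \<le> 1 / sqrt s * rad ({..<s} \<times> {..<n}) (\<lambda>(l, i). x i)"
    using rad_constant_column[of "{..<s}" n "1/4" x] x by (intro mult_left_mono) auto
  also have "\<dots> = rad ({..<s} \<times> {..<n}) (\<lambda>q. (1 / sqrt s) *\<^sub>R (\<lambda>(l, i). x i) q)"
    unfolding rad_scaleR by simp
  also have "\<dots> = rad ({..<s} \<times> {..<n}) (\<lambda>(l, i). (1 / sqrt s) *\<^sub>R x i)"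
    by (rule rad_cong) auto
  also have "\<dots> \<le> Sup (rads n x)"
  proof (rule cSup_upper[OF _ rads_bdd_above[OF x(2)]])
    have "L2_set (\<lambda>l. 1 / sqrt s) {..<s} = 1" using s by (simp add: L2_set_def power_divide)
    then show "rad ({..<s} \<times> {..<n}) (\<lambda>(l, i). (1 / sqrt s) *\<^sub>R x i) \<in> rads n x"
      unfolding rads_def by (auto intro!: exI[of _ "{..<s}"] exI[of _ "\<lambda>l. 1 / sqrt s"])
  qed
  finally show ?thesis using x by auto
qed

lemma cavg_le_imp_exists:
  fixes F :: "'i set \<Rightarrow> real"
  assumes "finite J" "cavg J F \<le> c"
  shows "\<exists>A\<subseteq>J. F A \<le> c"
proof (rule ccontr)
  assume "\<not> ?thesis"
  then have "\<forall>A\<in>Pow J. c < F A" by auto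
  then have "(\<Sum>A\<in>Pow J. c) < (\<Sum>A\<in>Pow J. F A)" by (intro sum_strict_mono) (use assms in auto)
  then have "cavg J (\<lambda>_. c) < cavg J F" unfolding cavg_def by (auto intro!: divide_strict_right_mono)
  then show False using assms by simp
qed

text \<open>
  Randomly signed copies of a Dvoretzky--Rogers system concentrate around their means on a finite
  net once the mean is large, because their variance stays bounded.
\<close>

theorem sign_embedding:
  fixes E :: "'v::real_normed_vector set"
  assumes E: "subspace E"
    and dr: "\<And>n. \<exists>x. (\<forall>i<n. x i \<in> E \<and> 1/4 \<le> norm (x i)) \<and> upper2 1 {..<n::nat} x"
  shows "\<exists>y. (\<forall>k<N. y k \<in> E) \<and> upper2 1 {..<N} y \<and>
     (\<forall>D. sqrt (real N) / 32 \<le> norm (\<Sum>k<N. sg D k *\<^sub>R y k))"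
proof (cases "N = 0")
  case True
  then show ?thesis by (auto simp: upper2_def L2_set_def)
next
  case False
  \<comment> \<open>The points of the cube whose coordinates are multiples of \<open>1 / N\<close>:
    fine enough that rounding changes the l2 norm by at most 1.\<close>
  define grid :: "(nat \<Rightarrow> real) set" where
    "grid = (\<lambda>c k. real_of_int (c k) / N) ` ({..<N} \<rightarrow>\<^sub>E {- int N..int N})"
  define \<Gamma> where "\<Gamma> = grid \<union> (sg ` Pow {..<N})"
  have fin\<Gamma>: "finite \<Gamma>" by (auto simp: \<Gamma>_def grid_def intro!: finite_PiE)
  have b1: "\<bar>b k\<bar> \<le> 1" if "b \<in> \<Gamma>" "k < N" for b k
  proof (cases "b \<in> grid")
    case True
    then obtain c where c: "c \<in> {..<N} \<rightarrow>\<^sub>E {- int N..int N}" "b = (\<lambda>k. real_of_int (c k) / N)"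
      by (auto simp: grid_def)
    have "c k \<in> {- int N..int N}" using c(1) that(2) by (auto simp: PiE_iff)
    then have "\<bar>c k\<bar> \<le> int N" by auto
    then have "\<bar>real_of_int (c k)\<bar> \<le> real N" by linarith
    then show ?thesis using False by (simp add: c(2) divide_le_eq)
  next
    case False
    then show ?thesis using that by (auto simp: \<Gamma>_def)
  qed
  have b2: "(L2_set b {..<N})\<^sup>2 \<le> N" if "b \<in> \<Gamma>" for b
  proof -
    have "(\<Sum>k<N. (b k)\<^sup>2) \<le> (\<Sum>k<N. 1)"
      by (rule sum_mono) (use b1[OF that] in \<open>auto simp: abs_square_le_1\<close>)
    then show ?thesis by (simp add: L2_set_def sum_nonneg)
  qed
  \<comment> \<open>Once \<open>H \<ge> T\<close>, the sum of the variances over the net, at most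
    \<open>2 * N * card \<Gamma>\<close>, is below \<open>(H / 8)\<^sup>2\<close>.\<close>
  define T where "T = 8 * (2 * real N * card \<Gamma> + 1)"
  obtain n and x :: "nat \<Rightarrow> 'v" where x: "\<forall>i<n. x i \<in> E" "upper2 1 {..<n} x" "T \<le> Sup (rads n x)"
    using Sup_rads_unbounded[OF dr, of T] by blast
  define H where "H = Sup (rads n x)"
  have T8: "T \<ge> 8" by (simp add: T_def)
  have H: "T \<le> H" "H > 0" using x(3) T8 by (auto simp: H_def)
  \<comment> \<open>Coming within a factor 2 of the supremum \<open>H\<close> makes the lower bound
    \<open>m_sg\<close> on sign vectors comparable with the upper bound \<open>m_le\<close>.\<close>
  have "rads n x \<noteq> {}" by (auto simp: rads_def L2_set_def intro!: exI[of _ "{0::nat}"] exI[of _ "\<lambda>_. 1"])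
  then obtain r where r: "r \<in> rads n x" "H / 2 < r"
    using less_cSup_iff[OF _ rads_bdd_above[OF x(2)], of "H / 2"] H by (auto simp: H_def)
  obtain \<Lambda> :: "nat set" and a where \<Lambda>: "finite \<Lambda>" "L2_set a \<Lambda> = 1"
    and r': "r = rad (\<Lambda> \<times> {..<n}) (\<lambda>(l, i). a l *\<^sub>R x i)" using r by (auto simp: rads_def)
  define P where "P = \<Lambda> \<times> {..<n}"
  define z where "z = (\<lambda>(l, i). a l *\<^sub>R x i)"
  have P: "finite P" and zu: "upper2 1 P z"
    using upper2_tensor[OF x(2) \<Lambda>(1), of a] \<Lambda> by (auto simp: P_def z_def)
  define J where "J = {..<N} \<times> P"
  have J: "finite J" using P by (simp add: J_def)
  define W where "W = (\<lambda>b A. norm (\<Sum>q\<in>J. sg A q *\<^sub>R (\<lambda>(k, p). b k *\<^sub>R z p) q))"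
  define m where "m = (\<lambda>b. cavg J (W b))"
  have m_rad: "m b = rad J (\<lambda>(k, p). b k *\<^sub>R z p)" for b by (simp add: m_def W_def rad_def)
  have m_le: "m b \<le> H * L2_set b {..<N}" for b
    using rad_tensor_le[OF x(2) \<Lambda>, of N b] unfolding m_rad J_def P_def z_def H_def .
  have m_sg: "9/32 * sqrt N * H \<le> m (sg D)" for D
  proof -
    have "9/32 * sqrt N * H \<le> 9/16 * sqrt N * r"
      using mult_left_mono[of "H / 2" r "9/16 * sqrt N"] r by simp
    also have "\<dots> \<le> rad J (\<lambda>(k, p). z p)" using rad_tensor_ones[OF P, of N z] by (simp add: r' P_def z_def J_def)
    also have "\<dots> = rad J (\<lambda>q. \<bar>sg D (fst q)\<bar> *\<^sub>R z (snd q))" by (rule rad_cong) auto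
    also have "\<dots> = rad J (\<lambda>q. sg D (fst q) *\<^sub>R z (snd q))" by (rule rad_abs[symmetric])
    also have "\<dots> = m (sg D)" unfolding m_rad by (rule rad_cong) auto
    finally show ?thesis .
  qed
  have var: "cavg J (\<lambda>A. (W b A - m b)\<^sup>2) \<le> 2 * real N" if "b \<in> \<Gamma>" for b
  proof -
    have "upper2 (L2_set b {..<N}) J (\<lambda>(k, p). b k *\<^sub>R z p)"
      unfolding J_def by (rule upper2_tensor[OF zu _ P]) simp
    then have "cavg J (\<lambda>A. (W b A - m b)\<^sup>2) \<le> 2 * (L2_set b {..<N})\<^sup>2"
      unfolding W_def m_def by (rule variance_norm_rademacher[OF J]) simp
    also have "\<dots> \<le> 2 * real N" using b2[OF that] by simp
    finally show ?thesis .
  qed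
  \<comment> \<open>Averaging the total squared deviation produces one choice of signs that is good
    for the whole net at once.\<close>
  have "cavg J (\<lambda>A. \<Sum>b\<in>\<Gamma>. (W b A - m b)\<^sup>2) \<le> (\<Sum>b\<in>\<Gamma>. 2 * real N)"
    unfolding cavg_sum by (rule sum_mono) (rule var)
  then obtain A where A: "A \<subseteq> J" "(\<Sum>b\<in>\<Gamma>. (W b A - m b)\<^sup>2) \<le> (\<Sum>b\<in>\<Gamma>. 2 * real N)"
    using cavg_le_imp_exists[OF J] by blast
  have dev: "\<bar>W b A - m b\<bar> \<le> H / 8" if "b \<in> \<Gamma>" for b
  proof -
    define q where "q = 2 * real N * card \<Gamma>"
    have q: "q \<ge> 0" by (simp add: q_def)
    have "(W b A - m b)\<^sup>2 \<le> (\<Sum>b\<in>\<Gamma>. (W b A - m b)\<^sup>2)"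
      by (rule member_le_sum) (use that fin\<Gamma> in auto)
    also have "\<dots> \<le> q" using A by (simp add: q_def mult.commute)
    also have "\<dots> \<le> (q + 1)\<^sup>2" using q by (simp add: power2_eq_square algebra_simps)
    also have "\<dots> \<le> (H / 8)\<^sup>2" by (rule power_mono) (use H q in \<open>auto simp: T_def q_def\<close>)
    finally show ?thesis using H by (simp add: abs_le_square_iff[symmetric])
  qed
  have dev1: "W b A \<le> m b + H / 8" and dev2: "m b - H / 8 \<le> W b A" if "b \<in> \<Gamma>" for b
    using dev[OF that] by linarith+
  define u where "u = (\<lambda>k. \<Sum>p\<in>P. sg A (k, p) *\<^sub>R z p)"
  have uE: "u k \<in> E" for k
    unfolding u_def z_def P_def using x E by (auto intro!: subspace_sum subspace_scale)
  have Wu: "W b A = norm (\<Sum>k<N. b k *\<^sub>R u k)" for b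
    unfolding W_def u_def J_def scaleR_sum_right
    by (subst sum.cartesian_product) (simp add: case_prod_beta mult.commute)
  have u1: "norm (u k) \<le> 9/8 * H" if k: "k < N" for k
  proof -
    \<comment> \<open>Unit vectors belong to the grid; the restricted abstraction makes the integer
      coordinates extensional, as membership in the \<open>PiE\<close> set requires.\<close>
    define e :: "nat \<Rightarrow> real" where
      "e = (\<lambda>j. real_of_int ((\<lambda>j\<in>{..<N}. if j = k then int N else 0) j) / N)"
    have "e \<in> \<Gamma>" unfolding \<Gamma>_def grid_def e_def by (intro UnI1 imageI PiE_I) auto
    have ej: "e j = (if j = k then 1 else 0)" if "j < N" for j using that False by (simp add: e_def)
    have "L2_set e {..<N} = 1"
      using k by (simp add: L2_set_def ej if_distrib[of "\<lambda>c. c\<^sup>2"] cong: if_cong)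
    moreover have "(\<Sum>j<N. e j *\<^sub>R u j) = u k"
      using k by (simp add: ej if_distrib[of "\<lambda>c. c *\<^sub>R _"] cong: if_cong)
    ultimately show ?thesis using dev1[OF \<open>e \<in> \<Gamma>\<close>] m_le[of e] by (simp add: Wu)
  qed
  \<comment> \<open>Rounding down gives a grid point \<open>g\<close> of l2 norm at most 2, which
    costs \<open>2 * H + H / 8\<close>; the remainder costs \<open>9/8 * H\<close> by
    \<open>u1\<close>. The total stays below \<open>4 * H\<close>, the factor removed in the
    definition of \<open>y\<close>.\<close>
  have upper: "norm (\<Sum>k<N. c k *\<^sub>R u k) \<le> 4 * H" if c: "L2_set c {..<N} = 1" for c
  proof -
    have c1: "\<bar>c k\<bar> \<le> 1" if "k < N" for k
      using member_le_L2_set[of "{..<N}" k "\<lambda>k. \<bar>c k\<bar>"] that c by (simp add: L2_set_def)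
    define g where "g = (\<lambda>k. real_of_int ((\<lambda>k\<in>{..<N}. \<lfloor>N * c k\<rfloor>) k) / N)"
    have "g \<in> \<Gamma>" unfolding \<Gamma>_def grid_def g_def
    proof (intro UnI1 imageI PiE_I)
      fix k assume "k \<in> {..<N}"
      then have "\<bar>N * c k\<bar> \<le> N" using c1[of k] by (simp add: abs_mult mult_left_le)
      then have "N * c k \<le> N" "- real N \<le> N * c k" by linarith+
      then have "\<lfloor>N * c k\<rfloor> \<le> int N" "- int N \<le> \<lfloor>N * c k\<rfloor>" by linarith+
      then show "(\<lambda>k\<in>{..<N}. \<lfloor>N * c k\<rfloor>) k \<in> {- int N..int N}"
        using \<open>k \<in> {..<N}\<close> by simp
    qed simp
    have cg: "\<bar>c k - g k\<bar> \<le> 1 / N" if k: "k < N" for k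
    proof -
      have "c k - g k = (N * c k - of_int \<lfloor>N * c k\<rfloor>) / N" using k False by (simp add: g_def field_simps)
      moreover have "0 \<le> N * c k - of_int \<lfloor>N * c k\<rfloor>" "N * c k - of_int \<lfloor>N * c k\<rfloor> \<le> 1" by linarith+
      ultimately show ?thesis by (simp add: divide_right_mono)
    qed
    have "L2_set g {..<N} \<le> L2_set c {..<N} + L2_set (\<lambda>k. g k - c k) {..<N}"
      using L2_set_triangle_ineq[of c "\<lambda>k. g k - c k" "{..<N}"] by simp
    also have "L2_set (\<lambda>k. g k - c k) {..<N} \<le> (\<Sum>k<N. \<bar>g k - c k\<bar>)" by (rule L2_set_le_sum_abs)
    also have "\<dots> \<le> (\<Sum>k<N. 1 / N)" by (rule sum_mono) (use cg in \<open>auto simp: abs_minus_commute\<close>)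
    finally have g2: "L2_set g {..<N} \<le> 2" using c False by simp
    have "(\<Sum>k<N. c k *\<^sub>R u k) = (\<Sum>k<N. g k *\<^sub>R u k) + (\<Sum>k<N. (c k - g k) *\<^sub>R u k)"
      by (simp add: sum.distrib[symmetric] scaleR_diff_left)
    then have "norm (\<Sum>k<N. c k *\<^sub>R u k) \<le> norm (\<Sum>k<N. g k *\<^sub>R u k) + norm (\<Sum>k<N. (c k - g k) *\<^sub>R u k)"
      by (metis norm_triangle_ineq)
    also have "norm (\<Sum>k<N. g k *\<^sub>R u k) \<le> H * 2 + H / 8"
      using dev1[OF \<open>g \<in> \<Gamma>\<close>] m_le[of g] mult_left_mono[OF g2, of H] H unfolding Wu by linarith
    also have "norm (\<Sum>k<N. (c k - g k) *\<^sub>R u k) \<le> (\<Sum>k<N. (1 / N) * (9/8 * H))"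
    proof (rule order_trans[OF norm_sum], rule sum_mono)
      fix k assume "k \<in> {..<N}"
      then show "norm ((c k - g k) *\<^sub>R u k) \<le> (1 / N) * (9/8 * H)"
        unfolding norm_scaleR using cg[of k] u1[of k] by (intro mult_mono) auto
    qed
    finally show ?thesis using False H by simp
  qed
  define y where "y = (\<lambda>k. (1 / (4 * H)) *\<^sub>R u k)"
  show ?thesis
  proof (intro exI[of _ y] conjI allI impI)
    show "y k \<in> E" for k unfolding y_def using uE E by (simp add: subspace_scale)
    have yu: "norm (\<Sum>k<N. c k *\<^sub>R y k) = norm (\<Sum>k<N. c k *\<^sub>R u k) / (4 * H)" for c
    proof -
      have "(\<Sum>k<N. c k *\<^sub>R y k) = (1 / (4 * H)) *\<^sub>R (\<Sum>k<N. c k *\<^sub>R u k)"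
        by (simp add: y_def scaleR_sum_right)
      then show ?thesis using H by simp
    qed
    show "upper2 1 {..<N} y" unfolding upper2_def
    proof
      fix c :: "nat \<Rightarrow> real"
      define L where "L = L2_set c {..<N}"
      show "norm (\<Sum>k<N. c k *\<^sub>R y k) \<le> 1 * L2_set c {..<N}"
      proof (cases "L = 0")
        case True
        then show ?thesis by (simp add: L_def L2_set_eq_0_iff)
      next
        case False
        then have L: "L > 0" unfolding L_def using L2_set_nonneg[of c "{..<N}"] by linarith
        have "L2_set (\<lambda>k. c k * (1 / L)) {..<N} = 1"
          using L L2_set_left_distrib[of "1 / L" c "{..<N}"] by (simp add: L_def)
        then have "norm (\<Sum>k<N. (c k * (1 / L)) *\<^sub>R u k) \<le> 4 * H" by (rule upper)
        moreover have "(\<Sum>k<N. (c k * (1 / L)) *\<^sub>R u k) = (1 / L) *\<^sub>R (\<Sum>k<N. c k *\<^sub>R u k)"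
          by (simp add: scaleR_sum_right mult.commute)
        ultimately show ?thesis using L H by (simp add: yu L_def[symmetric] field_simps)
      qed
    qed
    show "sqrt (real N) / 32 \<le> norm (\<Sum>k<N. sg D k *\<^sub>R y k)" for D
    proof -
      define D' where "D' = D \<inter> {..<N}"
      have "sg D' \<in> \<Gamma>" by (auto simp: \<Gamma>_def D'_def)
      have eq: "(\<Sum>k<N. sg D k *\<^sub>R u k) = (\<Sum>k<N. sg D' k *\<^sub>R u k)"
        by (rule sum.cong) (auto simp: sg_def D'_def)
      have "1 \<le> sqrt N" using False by simp
      then have "H / 8 \<le> 1/8 * sqrt N * H" using H by simp
      then have "5/32 * sqrt N * H \<le> norm (\<Sum>k<N. sg D' k *\<^sub>R u k)"
        using dev2[OF \<open>sg D' \<in> \<Gamma>\<close>] m_sg[of D'] unfolding Wu by linarith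
      moreover have "0 \<le> sqrt N * H" using H by simp
      ultimately have "sqrt N * H \<le> 8 * norm (\<Sum>k<N. sg D' k *\<^sub>R u k)" by linarith
      then show ?thesis using H by (simp add: yu eq field_simps)
    qed
  qed
qed

section \<open>Systems correlated with all signs\<close>

text \<open>Zorn's lemma on the graphs of dominated functionals.\<close>

lemma hahn_banach_norming:
  fixes x0 :: "'v::real_normed_vector"
  shows "\<exists>f :: 'v \<Rightarrow> real. linear f \<and> (\<forall>x. \<bar>f x\<bar> \<le> norm x) \<and> f x0 = norm x0"
proof -
  define good where "good = (\<lambda>G :: ('v \<times> real) set. subspace G \<and> (\<forall>(x, a)\<in>G. a \<le> norm x))"
  define \<G> where "\<G> = {G. good G \<and> (x0, norm x0) \<in> G}"
  define G0 where "G0 = span {(x0, norm x0)}"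
  have "good G0"
    unfolding good_def
  proof (intro conjI ballI)
    fix p assume "p \<in> G0"
    then obtain t where "p = t *\<^sub>R (x0, norm x0)" by (auto simp: G0_def span_singleton)
    then show "case p of (x, a) \<Rightarrow> a \<le> norm x" by (simp add: mult_right_mono)
  qed (simp add: G0_def)
  then have G0: "G0 \<in> \<G>" by (simp add: \<G>_def G0_def span_base)
  have "\<exists>M\<in>\<G>. \<forall>G\<in>\<G>. M \<subseteq> G \<longrightarrow> G = M"
  proof (rule subset_Zorn_nonempty)
    show "\<G> \<noteq> {}" using G0 by auto
    fix C assume C: "C \<noteq> {}" "subset.chain \<G> C"
    have sub: "subspace G" if "G \<in> C" for G using that C(2) by (auto simp: subset.chain_def \<G>_def good_def)
    have "subspace (\<Union>C)"
      unfolding subspace_def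
    proof (intro conjI ballI allI)
      show "0 \<in> \<Union>C" using C(1) sub subspace_0 by blast
      show "c *\<^sub>R p \<in> \<Union>C" if "p \<in> \<Union>C" for c p using that sub subspace_scale by blast
      fix p q assume "p \<in> \<Union>C" "q \<in> \<Union>C"
      then obtain G H where GH: "G \<in> C" "H \<in> C" "p \<in> G" "q \<in> H" by auto
      then have "G \<subseteq> H \<or> H \<subseteq> G" using C(2) by (auto simp: subset.chain_def)
      then obtain K where "K \<in> C" "p \<in> K" "q \<in> K" using GH by auto
      then show "p + q \<in> \<Union>C" using sub subspace_add by blast
    qed
    moreover have "\<forall>(x, a)\<in>\<Union>C. a \<le> norm x" using C(2) by (auto simp: subset.chain_def \<G>_def good_def)
    moreover have "(x0, norm x0) \<in> \<Union>C" using C by (auto simp: subset.chain_def \<G>_def)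
    ultimately show "\<Union>C \<in> \<G>" by (simp add: \<G>_def good_def)
  qed
  then obtain M where M: "M \<in> \<G>" "\<And>G. G \<in> \<G> \<Longrightarrow> M \<subseteq> G \<Longrightarrow> G = M" by auto
  have subM: "subspace M" and dom: "\<And>x a. (x, a) \<in> M \<Longrightarrow> a \<le> norm x" and x0: "(x0, norm x0) \<in> M"
    using M(1) by (auto simp: \<G>_def good_def)
  have fst_total: "\<exists>a. (y, a) \<in> M" for y
  proof (rule ccontr)
    assume no: "\<nexists>a. (y, a) \<in> M"
    define lo where "lo = {a - norm (x - y) | x a. (x, a) \<in> M}"
    \<comment> \<open>Every lower bound for the value at \<open>y\<close> lies below every upper
      bound, so a value \<open>c\<close> compatible with domination exists.\<close>
    have cross: "a - norm (x - y) \<le> norm (x' + y) - a'" if "(x, a) \<in> M" "(x', a') \<in> M" for x a x' a'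
    proof -
      have "(x + x', a + a') \<in> M" using subspace_add[OF subM that] by simp
      then have "a + a' \<le> norm ((x - y) + (x' + y))" using dom by (simp add: algebra_simps)
      also have "\<dots> \<le> norm (x - y) + norm (x' + y)" by (rule norm_triangle_ineq)
      finally show ?thesis by simp
    qed
    have "lo \<noteq> {}" using x0 by (auto simp: lo_def)
    have bdd: "bdd_above lo" by (rule bdd_aboveI[of _ "norm (x0 + y) - norm x0"]) (use cross x0 in \<open>auto simp: lo_def\<close>)
    define c where "c = Sup lo"
    have c1: "a - norm (x - y) \<le> c" if "(x, a) \<in> M" for x a
      unfolding c_def by (rule cSup_upper[OF _ bdd]) (use that in \<open>auto simp: lo_def\<close>)
    have c2: "c \<le> norm (x' + y) - a'" if "(x', a') \<in> M" for x' a'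
      unfolding c_def by (rule cSup_least[OF \<open>lo \<noteq> {}\<close>]) (use that cross in \<open>auto simp: lo_def\<close>)
    define M' where "M' = {(x + t *\<^sub>R y, a + t * c) | x a t. (x, a) \<in> M}"
    have M'I: "(x + t *\<^sub>R y, a + t * c) \<in> M'" if "(x, a) \<in> M" for x a t
      using that by (auto simp: M'_def)
    have "subspace M'"
      unfolding subspace_def
    proof (intro conjI ballI allI)
      show "0 \<in> M'" using M'I[of 0 0 0] subspace_0[OF subM] by (simp add: zero_prod_def)
      show "r *\<^sub>R p \<in> M'" if "p \<in> M'" for r p
      proof -
        obtain x a t where p: "p = (x + t *\<^sub>R y, a + t * c)" "(x, a) \<in> M" using \<open>p \<in> M'\<close> unfolding M'_def by blast
        have "(r *\<^sub>R x, r * a) \<in> M" using subspace_scale[OF subM p(2), of r] by simp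
        from M'I[OF this, of "r * t"] show ?thesis by (simp add: p(1) algebra_simps)
      qed
      fix p q assume "p \<in> M'" "q \<in> M'"
      then obtain x a t x' a' t' where p: "p = (x + t *\<^sub>R y, a + t * c)" "(x, a) \<in> M"
        and q: "q = (x' + t' *\<^sub>R y, a' + t' * c)" "(x', a') \<in> M"
        unfolding M'_def by blast
      have "(x + x', a + a') \<in> M" using subspace_add[OF subM p(2) q(2)] by simp
      from M'I[OF this, of "t + t'"] show "p + q \<in> M'" by (simp add: p(1) q(1) algebra_simps)
    qed
    moreover have "a + t * c \<le> norm (x + t *\<^sub>R y)" if xa: "(x, a) \<in> M" for x a t
    proof -
      consider "t = 0" | "t > 0" | "t < 0" by linarith
      then show ?thesis
      proof cases
        case 1
        then show ?thesis using dom xa by simp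
      next
        case 2
        have "((1/t) *\<^sub>R x, (1/t) * a) \<in> M" using subspace_scale[OF subM xa, of "1/t"] by simp
        from c2[OF this] have "t * c \<le> t * norm ((1/t) *\<^sub>R x + y) - a" using 2 by (simp add: field_simps)
        also have "t * norm ((1/t) *\<^sub>R x + y) = norm (t *\<^sub>R ((1/t) *\<^sub>R x + y))" using 2 by simp
        also have "t *\<^sub>R ((1/t) *\<^sub>R x + y) = x + t *\<^sub>R y" using 2 by (simp add: scaleR_add_right)
        finally show ?thesis by simp
      next
        case 3
        define s where "s = - t"
        have s: "s > 0" using 3 by (simp add: s_def)
        have "((1/s) *\<^sub>R x, (1/s) * a) \<in> M" using subspace_scale[OF subM xa, of "1/s"] by simp
        from c1[OF this] have "a - s * norm ((1/s) *\<^sub>R x - y) \<le> s * c" using s by (simp add: field_simps)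
        moreover have "s * norm ((1/s) *\<^sub>R x - y) = norm (s *\<^sub>R ((1/s) *\<^sub>R x - y))" using s by simp
        moreover have "s *\<^sub>R ((1/s) *\<^sub>R x - y) = x - s *\<^sub>R y" using s by (simp add: scaleR_diff_right)
        ultimately have "a - s * c \<le> norm (x - s *\<^sub>R y)" by simp
        then show ?thesis by (simp add: s_def)
      qed
    qed
    ultimately have "good M'" by (auto simp: good_def M'_def)
    moreover have sub: "M \<subseteq> M'"
    proof
      fix p assume "p \<in> M"
      then show "p \<in> M'" using M'I[of "fst p" "snd p" 0] by simp
    qed
    ultimately have "M' = M" using x0 by (intro M(2)) (auto simp: \<G>_def)
    moreover have "(y, c) \<in> M'"
      using M'I[of 0 0 1] subspace_0[OF subM] by (simp add: zero_prod_def)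
    ultimately show False using no by auto
  qed
  \<comment> \<open>Domination forces single values: \<open>(0, a - b)\<close> and its negative both
    lie in the graph, and both second components are at most \<open>norm 0\<close>.\<close>
  have uniq: "a = b" if "(x, a) \<in> M" "(x, b) \<in> M" for x a b
  proof -
    have "(0, a - b) \<in> M" "(0, b - a) \<in> M"
      using subspace_diff[OF subM that] subspace_diff[OF subM that(2,1)] by auto
    from dom[OF this(1)] dom[OF this(2)] show ?thesis by simp
  qed
  define f where "f x = (THE a. (x, a) \<in> M)" for x
  have f: "(x, f x) \<in> M" for x
  proof -
    obtain a where a: "(x, a) \<in> M" using fst_total by blast
    show ?thesis unfolding f_def by (rule theI[of _ a]) (use a uniq in blast)+
  qed
  have fe: "f x = a" if "(x, a) \<in> M" for x a using uniq[OF f that] .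
  have lin: "linear f"
  proof
    show "f (x + y) = f x + f y" for x y using subspace_add[OF subM f[of x] f[of y]] by (simp add: fe)
    show "f (r *\<^sub>R x) = r *\<^sub>R f x" for r x using subspace_scale[OF subM f[of x], of r] by (simp add: fe)
  qed
  moreover have "\<bar>f x\<bar> \<le> norm x" for x
    using dom[OF f[of x]] dom[OF f[of "- x"]] linear_neg[OF lin, of x] by simp
  moreover have "f x0 = norm x0" using fe[OF x0] .
  ultimately show ?thesis by blast
qed

section \<open>Norming functionals over real and complex scalars\<close>

context banach_space_over begin

lemma smul_scaleR: "smul c (r *\<^sub>R x) = r *\<^sub>R smul c x"
proof -
  have "smul c (smul (of_real r) x) = smul (of_real r) (smul c x)"
    by (simp only: scale_scale mult.commute)
  then show ?thesis unfolding scale_of_real .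
qed

text \<open>
  For complex scalars the real functional \<open>r\<close> gives \<open>\<phi> x = r x - i r (i x)\<close>; crude bounds suffice.
\<close>

lemma norming_functional:
  "\<exists>\<phi>\<in>dual_space smul. norm \<phi> \<le> 1 \<and> norm x0 / 4 \<le> norm (blinfun_apply \<phi> x0)"
proof -
  obtain r :: "'a \<Rightarrow> real" where r: "linear r" "\<And>x. \<bar>r x\<bar> \<le> norm x" "r x0 = norm x0"
    using hahn_banach_norming[of x0] by blast
  have radd: "r (x + y) = r x + r y" and rsc: "r (t *\<^sub>R x) = t * r x" for x y t
    using linear_add[OF r(1)] linear_cmul[OF r(1)] by auto
  show ?thesis
  proof (cases "\<forall>z::'k. \<exists>a. z = of_real a")
    case True
    define \<phi> where "\<phi> = (\<lambda>x. of_real (r x) :: 'k)"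
    have bl: "bounded_linear \<phi>"
      by (rule bounded_linear_intro[where K=1]) (simp_all add: \<phi>_def radd rsc r(2) scaleR_conv_of_real)
    have "Blinfun \<phi> \<in> dual_space smul"
    proof (unfold dual_space_def, intro CollectI allI)
      fix c :: 'k and x
      obtain a where "c = of_real a" using True by blast
      then show "blinfun_apply (Blinfun \<phi>) (smul c x) = c * blinfun_apply (Blinfun \<phi>) x"
        unfolding bounded_linear_Blinfun_apply[OF bl] by (simp add: scale_of_real \<phi>_def rsc)
    qed
    moreover have "norm (Blinfun \<phi>) \<le> 1"
    proof (rule norm_blinfun_bound)
      show "norm (blinfun_apply (Blinfun \<phi>) x) \<le> 1 * norm x" for x
        unfolding bounded_linear_Blinfun_apply[OF bl] by (simp add: \<phi>_def r(2))
    qed simp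
    moreover have "norm x0 / 4 \<le> norm (blinfun_apply (Blinfun \<phi>) x0)"
      unfolding bounded_linear_Blinfun_apply[OF bl] by (simp add: \<phi>_def r(3))
    ultimately show ?thesis by blast
  next
    case False
    then obtain i :: 'k where i: "i * i = -1" and dec: "\<And>z::'k. \<exists>a b. z = of_real a + of_real b * i"
      using scalar_field_real_or_complex[where 'k='k] by auto
    have "norm i * norm i = 1" using arg_cong[OF i, of norm] by (simp add: norm_mult)
    then have ni: "norm i = 1" by (intro power2_eq_imp_eq[of _ 1]) (simp_all add: power2_eq_square)
    \<comment> \<open>Halved, because the bounds on \<open>r x\<close> and
      \<open>r (smul i x)\<close> add up to \<open>2 * norm x\<close>.\<close>
    define \<phi> where "\<phi> = (\<lambda>x. (of_real (r x) - i * of_real (r (smul i x))) /\<^sub>R 2)"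
    have nle: "norm (\<phi> x) \<le> norm x" for x
    proof -
      have "norm (of_real (r x) - i * of_real (r (smul i x))) \<le> \<bar>r x\<bar> + \<bar>r (smul i x)\<bar>"
        using norm_triangle_ineq4[of "of_real (r x)" "i * of_real (r (smul i x))"] by (simp add: norm_mult ni)
      also have "\<dots> \<le> norm x + norm x" using r(2)[of x] r(2)[of "smul i x"] by (simp add: norm_scale ni)
      finally show ?thesis by (simp add: \<phi>_def)
    qed
    have add: "\<phi> (x + y) = \<phi> x + \<phi> y" for x y
    proof -
      have "of_real (r x + r y) - i * of_real (r (smul i x) + r (smul i y)) =
        (of_real (r x) - i * of_real (r (smul i x))) + (of_real (r y) - i * of_real (r (smul i y)))"
        by (simp add: algebra_simps)
      then show ?thesis unfolding \<phi>_def scale_right_distrib radd by (simp only: scaleR_add_right)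
    qed
    have sc: "\<phi> (t *\<^sub>R x) = t *\<^sub>R \<phi> x" for t x
    proof -
      have "of_real (t * r x) - i * of_real (t * r (smul i x)) = t *\<^sub>R (of_real (r x) - i * of_real (r (smul i x)))"
        by (simp add: scaleR_conv_of_real algebra_simps)
      then show ?thesis unfolding \<phi>_def smul_scaleR rsc by (simp only: scaleR_left_commute)
    qed
    have bl: "bounded_linear \<phi>"
      by (rule bounded_linear_intro[where K=1]) (simp_all add: add sc nle)
    have ii: "smul i (smul i x) = (-1) *\<^sub>R x" for x
      unfolding scale_scale i using scale_of_real[of "-1" x] by simp
    have \<phi>i: "\<phi> (smul i x) = i * \<phi> x" for x
    proof -
      have "i * (of_real (r x) - i * of_real (r (smul i x))) = of_real (r (smul i x)) + i * of_real (r x)"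
        by (simp add: right_diff_distrib mult.assoc[symmetric] i)
      then have "i * (of_real (r x) - i * of_real (r (smul i x))) = of_real (r (smul i x)) - i * of_real (r (smul i (smul i x)))"
        unfolding ii rsc by simp
      then show ?thesis unfolding \<phi>_def by (simp only: mult_scaleR_right)
    qed
    have "Blinfun \<phi> \<in> dual_space smul"
    proof (unfold dual_space_def, intro CollectI allI)
      fix c :: 'k and x
      obtain a b where c: "c = of_real a + of_real b * i" using dec by blast
      have "smul c x = a *\<^sub>R x + b *\<^sub>R smul i x"
        unfolding c scale_left_distrib scale_scale[symmetric] scale_of_real ..
      then show "blinfun_apply (Blinfun \<phi>) (smul c x) = c * blinfun_apply (Blinfun \<phi>) x"
        unfolding bounded_linear_Blinfun_apply[OF bl] by (simp only: add sc \<phi>i c scaleR_conv_of_real distrib_right mult.assoc)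
    qed
    moreover have "norm (Blinfun \<phi>) \<le> 1"
      by (rule norm_blinfun_bound) (simp_all add: bounded_linear_Blinfun_apply[OF bl] nle)
    moreover have "norm x0 / 4 \<le> norm (\<phi> x0)"
    proof -
      define a b where "a = r x0" and "b = r (smul i x0)"
      \<comment> \<open>Multiplying by the conjugate bounds \<open>a - i b\<close> from below using
        only multiplicativity of the norm and the triangle inequality. The factor 1/2 lost here and
        the halving of \<open>\<phi>\<close> make up the 1/4 of the statement.\<close>
      have "(of_real a - i * of_real b) * (of_real a + i * of_real b) = of_real (a * a + b * b)"
      proof -
        have "(u - i * v) * (u + i * v) = u * u - (i * i) * (v * v)" for u v :: 'k by (simp add: algebra_simps)
        then show ?thesis by (simp add: i)
      qed
      from arg_cong[OF this, of norm]
      have "a * a + b * b = norm (of_real a - i * of_real b) * norm (of_real a + i * of_real b)"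
        by (simp only: norm_mult norm_of_real abs_of_nonneg[OF sum_squares_ge_zero])
      also have "\<dots> \<le> norm (of_real a - i * of_real b) * (\<bar>a\<bar> + \<bar>b\<bar>)"
        using norm_triangle_ineq[of "of_real a" "i * of_real b"] by (intro mult_left_mono) (simp_all add: norm_mult ni)
      finally have le: "a * a + b * b \<le> norm (of_real a - i * of_real b) * (\<bar>a\<bar> + \<bar>b\<bar>)" .
      have "\<bar>a\<bar> / 2 \<le> norm (of_real a - i * of_real b)"
      proof (rule ccontr)
        assume neg: "\<not> ?thesis"
        then have p: "\<bar>a\<bar> > 0" using norm_ge_zero[of "of_real a - i * of_real b"] by linarith
        have contra: False if "A > 0" "A * A + B * B \<le> A / 2 * (A + B)" for A B :: real
        proof -
          have lin: "x > 0 \<Longrightarrow> z \<ge> 0 \<Longrightarrow> w \<le> (x + z) / 2 \<Longrightarrow> x + z \<le> (x + w) / 2 \<Longrightarrow> False" for x z w :: real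
            by (simp add: field_simps)
          have "A * B \<le> (A * A + B * B) / 2" using zero_le_square[of "A - B"] by (simp add: algebra_simps)
          moreover have "A * A + B * B \<le> (A * A + A * B) / 2" using that(2) by (simp add: field_simps)
          ultimately show False using lin[of "A * A" "B * B" "A * B"] that(1) by simp
        qed
        have "a * a + b * b \<le> \<bar>a\<bar> / 2 * (\<bar>a\<bar> + \<bar>b\<bar>)"
          by (rule order_trans[OF le mult_right_mono]) (use neg in auto)
        then show False using contra[OF p, of "\<bar>b\<bar>"] by simp
      qed
      then show ?thesis using r(3) by (simp add: \<phi>_def a_def b_def)
    qed
    ultimately show ?thesis
      by (intro bexI[of _ "Blinfun \<phi>"]) (simp_all add: bounded_linear_Blinfun_apply[OF bl])
  qed
qed

end

context banach_space_over begin

lemma smul_scaleR_left: "smul (r *\<^sub>R c) x = r *\<^sub>R smul c x"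
  unfolding scaleR_conv_of_real scale_scale[symmetric] scale_of_real ..

text \<open>Expanding the scalars in \<open>Basis\<close> leaves real coefficients, one sum per
  basis element; hence the factor \<open>DIM('k)\<close>.\<close>

lemma upper2_scalars:
  assumes "upper2 C I y"
  shows "norm (\<Sum>i\<in>I. smul (t i) (y i)) \<le> real DIM('k) * C * L2_set (\<lambda>i. norm (t i)) I"
proof -
  have nb: "norm (smul b v) = norm v" if "b \<in> Basis" for b v using that by (simp add: norm_scale)
  have C0: "C * L2_set (\<lambda>i. norm (t i)) I \<ge> 0"
    using upper2D[OF assms, of "\<lambda>i. norm (t i)"] norm_ge_zero order_trans by blast
  have "smul (t i) (y i) = (\<Sum>b\<in>Basis. smul b (inner (t i) b *\<^sub>R y i))" for i
  proof -
    have "smul (t i) (y i) = smul (\<Sum>b\<in>Basis. inner (t i) b *\<^sub>R b) (y i)"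
      by (simp only: euclidean_representation)
    then show ?thesis by (simp add: scale_sum_left smul_scaleR_left smul_scaleR)
  qed
  then have "(\<Sum>i\<in>I. smul (t i) (y i)) = (\<Sum>b\<in>Basis. smul b (\<Sum>i\<in>I. inner (t i) b *\<^sub>R y i))"
    by (simp add: scale_sum_right) (rule sum.swap)
  then have "norm (\<Sum>i\<in>I. smul (t i) (y i)) \<le> (\<Sum>b\<in>Basis. norm (smul b (\<Sum>i\<in>I. inner (t i) b *\<^sub>R y i)))"
    by (simp add: norm_sum)
  also have "\<dots> \<le> (\<Sum>b\<in>(Basis::'k set). C * L2_set (\<lambda>i. norm (t i)) I)"
  proof (rule sum_mono)
    fix b :: 'k assume b: "b \<in> Basis"
    have C: "C * L2_set (\<lambda>i. inner (t i) b) I \<le> C * L2_set (\<lambda>i. norm (t i)) I"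
    proof (cases "C \<ge> 0")
      case True
      have "L2_set (\<lambda>i. inner (t i) b) I = L2_set (\<lambda>i. \<bar>inner (t i) b\<bar>) I" by (simp add: L2_set_def)
      also have "\<dots> \<le> L2_set (\<lambda>i. norm (t i)) I" by (rule L2_set_mono) (use b in \<open>auto simp: Basis_le_norm\<close>)
      finally show ?thesis using True by (rule mult_left_mono)
    next
      case False
      then have "C * L2_set (\<lambda>i. inner (t i) b) I \<le> 0"
        using L2_set_nonneg[of "\<lambda>i. inner (t i) b" I] by (auto simp: mult_le_0_iff)
      then show ?thesis using C0 by linarith
    qed
    then show "norm (smul b (\<Sum>i\<in>I. inner (t i) b *\<^sub>R y i)) \<le> C * L2_set (\<lambda>i. norm (t i)) I"
      unfolding nb[OF b] using upper2D[OF assms, of "\<lambda>i. inner (t i) b"] by linarith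
  qed
  finally show ?thesis by (simp add: mult.assoc)
qed

end

lemma obtain_relabelling:
  assumes "finite S" "n \<le> card S"
  shows "\<exists>s. inj_on s {..<n::nat} \<and> s ` {..<n} \<subseteq> S"
proof -
  obtain S' where S': "S' \<subseteq> S" "card S' = n" "finite S'" using obtain_subset_with_card_n[OF assms(2)] by metis
  obtain h where "bij_betw h {0..<card S'} S'" using ex_bij_betw_nat_finite[OF S'(3)] by blast
  then show ?thesis using S' by (intro exI[of _ h]) (auto simp: bij_betw_def lessThan_atLeast0)
qed

text \<open>
  The norming functionals \<open>g A\<close> of the signed sums need not be biorthogonal to \<open>y\<close>, but on average
  they are correlated with a positive proportion of the \<open>y k\<close>; discard the others and rescale.
\<close>

theorem correlated_signs:
  fixes pair :: "'v::banach \<Rightarrow> 'w::banach \<Rightarrow> 'k::{real_normed_field,euclidean_space}"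
  assumes sv: "banach_space_over sv" and sw: "banach_space_over sw"
    and bil: "bounded_bilinear pair" and le: "\<And>v w. norm (pair v w) \<le> norm v * norm w"
    and pv: "\<And>c v w. v \<in> E \<Longrightarrow> w \<in> F \<Longrightarrow> pair (sv c v) w = c * pair v w"
    and pw: "\<And>c v w. v \<in> E \<Longrightarrow> w \<in> F \<Longrightarrow> pair v (sw c w) = c * pair v w"
    and E: "subspace E" "\<And>c v. v \<in> E \<Longrightarrow> sv c v \<in> E"
    and F: "subspace F" "\<And>c w. w \<in> F \<Longrightarrow> sw c w \<in> F"
    and norming: "\<And>v. v \<in> E \<Longrightarrow> \<exists>w\<in>F. norm w \<le> 1 \<and> norm v / 4 \<le> norm (pair v w)"
    and emb: "\<And>N. \<exists>y. (\<forall>k<N. y k \<in> E) \<and> upper2 1 {..<N::nat} y \<and>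
       (\<forall>D. sqrt (real N) / 32 \<le> norm (\<Sum>k<N. sg D k *\<^sub>R y k))"
  shows "\<exists>C\<ge>0. \<forall>n. \<exists>y g. (\<forall>k<n. y k \<in> E) \<and>
     (\<forall>t. norm (\<Sum>k<n. sv (t k) (y k)) \<le> C * L2_set (\<lambda>k. norm (t k)) {..<n}) \<and>
     (\<forall>A. g A \<in> F \<and> norm (g A) \<le> sqrt (real n)) \<and>
     (\<forall>k<n. cavg {..<n} (\<lambda>A. sg A k *\<^sub>R pair (y k) (g A)) = 1)"
proof (intro exI[of _ "real DIM('k) * 65536"] conjI allI)
  interpret v: banach_space_over sv by fact
  interpret w: banach_space_over sw by fact
  interpret p: bounded_bilinear pair by fact
  fix n :: nat
  \<comment> \<open>\<open>65536 = 256\<^sup>2\<close>: correlations with sum at least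
    \<open>sqrt N / 128\<close> and l2 norm at most 1 leave at least \<open>N / 65536\<close>
    indices above the threshold.\<close>
  define N where "N = 65536 * n"
  obtain y where yE: "\<forall>k<N. y k \<in> E" and yu: "upper2 1 {..<N} y"
    and ys: "\<And>D. sqrt (real N) / 32 \<le> norm (\<Sum>k<N. sg D k *\<^sub>R y k)" using emb[of N] by blast
  define V where "V = (\<lambda>D. \<Sum>k<N. sg D k *\<^sub>R y k)"
  have VE: "V D \<in> E" for D unfolding V_def using E yE by (auto intro!: subspace_sum subspace_scale)
  \<comment> \<open>The 128 is 32 from the embedding times 4 from the norming functional; a
    unimodular scalar rotates the pairing onto the positive axis.\<close>
  have "\<exists>u\<in>F. norm u \<le> 1 \<and> sqrt N / 128 \<le> inner (pair (V D) u) 1" for D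
  proof -
    obtain w where w: "w \<in> F" "norm w \<le> 1" "norm (V D) / 4 \<le> norm (pair (V D) w)" using norming[OF VE] by blast
    define q where "q = pair (V D) w"
    have q: "sqrt N / 128 \<le> norm q" using ys[of D] w(3) by (simp add: V_def q_def)
    show ?thesis
    proof (cases "q = 0")
      case True
      then show ?thesis using q w by (intro bexI[of _ w]) (simp_all add: q_def[symmetric] p.zero_left)
    next
      case False
      have "pair (V D) (sw (of_real (norm q) / q) w) = of_real (norm q)"
        using False by (simp add: pw[OF VE w(1)] q_def[symmetric])
      moreover have "inner (of_real (norm q) :: 'k) 1 = norm q"
        by (simp add: of_real_def power2_norm_eq_inner[symmetric])
      moreover have "norm (sw (of_real (norm q) / q) w) \<le> 1"
        using w(2) False by (simp add: w.norm_scale norm_divide)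
      ultimately show ?thesis using q F(2)[OF w(1)] by (intro bexI[of _ "sw (of_real (norm q) / q) w"]) auto
    qed
  qed
  then obtain g where gF: "\<And>D. g D \<in> F" and g1: "\<And>D. norm (g D) \<le> 1"
    and gV: "\<And>D. sqrt N / 128 \<le> inner (pair (V D) (g D)) 1" by metis
  define c where "c = (\<lambda>k. cavg {..<N} (\<lambda>D. sg D k *\<^sub>R pair (y k) (g D)))"
  define \<rho> where "\<rho> = (\<lambda>k. inner (c k) 1)"
  have test: "(\<Sum>k<N. a k * \<rho> k) = cavg {..<N} (\<lambda>D. inner (pair (\<Sum>k<N. (a k * sg D k) *\<^sub>R y k) (g D)) 1)" for a
  proof -
    have "a k * \<rho> k = cavg {..<N} (\<lambda>D. inner (pair ((a k * sg D k) *\<^sub>R y k) (g D)) 1)" for k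
      unfolding \<rho>_def c_def cavg_bounded_linear[OF bounded_linear_inner_left]
      by (simp add: p.scaleR_left mult.assoc flip: cavg_mult_left)
    then show ?thesis by (simp add: cavg_sum[symmetric] p.sum_left inner_sum_left)
  qed
  have sum\<rho>: "sqrt N / 128 \<le> (\<Sum>k<N. \<rho> k)"
  proof -
    have "cavg {..<N} (\<lambda>_. sqrt N / 128) \<le> cavg {..<N} (\<lambda>D. inner (pair (V D) (g D)) 1)"
      by (rule cavg_mono) (rule gV)
    then show ?thesis using test[of "\<lambda>_. 1"] by (simp add: V_def)
  qed
  \<comment> \<open>The sequence \<open>\<rho>\<close> is tested against itself: the square of its
    l2 norm is an average of pairings of combinations with coefficients
    \<open>\<rho> k * sg D k\<close> with functionals of norm at most 1.\<close>
  have L2\<rho>: "L2_set \<rho> {..<N} \<le> 1"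
  proof -
    have "(L2_set \<rho> {..<N})\<^sup>2 = (\<Sum>k<N. \<rho> k * \<rho> k)" by (simp add: L2_set_def sum_nonneg power2_eq_square)
    also have "\<dots> \<le> cavg {..<N} (\<lambda>D. L2_set \<rho> {..<N})"
      unfolding test
    proof (rule cavg_mono)
      fix D
      define x where "x = (\<Sum>k<N. (\<rho> k * sg D k) *\<^sub>R y k)"
      have "inner (pair x (g D)) 1 \<le> norm (pair x (g D))" using Cauchy_Schwarz_ineq2[of "pair x (g D)" 1] by simp
      also have "\<dots> \<le> norm x * norm (g D)" by (rule le)
      also have "\<dots> \<le> norm x" using g1[of D] by (simp add: mult_left_le)
      also have "\<dots> \<le> L2_set \<rho> {..<N}"
        using upper2D[OF yu, of "\<lambda>k. \<rho> k * sg D k"] by (simp add: x_def L2_set_def power_mult_distrib)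
      finally show "inner (pair (\<Sum>k<N. (\<rho> k * sg D k) *\<^sub>R y k) (g D)) 1 \<le> L2_set \<rho> {..<N}" by (simp add: x_def)
    qed
    also have "\<dots> = L2_set \<rho> {..<N}" by simp
    finally show ?thesis
      using L2_set_nonneg[of \<rho> "{..<N}"] by (cases "L2_set \<rho> {..<N} = 0") (auto simp: power2_eq_square)
  qed
  \<comment> \<open>The threshold is half of the mean correlation \<open>1 / (128 * sqrt N)\<close>,
    so the discarded indices carry at most half of the required sum.\<close>
  define S where "S = {k\<in>{..<N}. 1 / (256 * sqrt N) \<le> \<rho> k}"
  have finS: "finite S" by (simp add: S_def)
  have "n \<le> card S"
  proof (cases "n = 0")
    case False
    then have N: "N > 0" "sqrt N > 0" by (auto simp: N_def)
    have split: "(\<Sum>k<N. \<rho> k) = (\<Sum>k\<in>S. \<rho> k) + (\<Sum>k\<in>{..<N} - S. \<rho> k)"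
      by (subst add.commute, rule sum.subset_diff) (auto simp: S_def)
    have "(\<Sum>k\<in>{..<N} - S. \<rho> k) \<le> (\<Sum>k\<in>{..<N} - S. 1 / (256 * sqrt N))"
      by (rule sum_mono) (auto simp: S_def)
    also have "\<dots> \<le> N * (1 / (256 * sqrt N))"
      using card_mono[of "{..<N}" "{..<N} - S"] by (simp add: divide_right_mono)
    also have "\<dots> = sqrt N / 256" using N by (simp add: real_div_sqrt)
    finally have small: "(\<Sum>k\<in>{..<N} - S. \<rho> k) \<le> sqrt N / 256" .
    have "L2_set \<rho> S \<le> L2_set \<rho> {..<N}" unfolding L2_set_def
      by (rule real_sqrt_le_mono, rule sum_mono2) (auto simp: S_def)
    then have "L2_set \<rho> S \<le> 1" using L2\<rho> by simp
    then have "L2_set (\<lambda>_. 1) S * L2_set \<rho> S \<le> sqrt (card S)"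
      by (simp add: L2_set_def mult_left_le)
    moreover have "(\<Sum>k\<in>S. \<rho> k) \<le> (\<Sum>k\<in>S. \<bar>1\<bar> * \<bar>\<rho> k\<bar>)" by (rule sum_mono) simp
    moreover have "(\<Sum>k\<in>S. \<bar>1\<bar> * \<bar>\<rho> k\<bar>) \<le> L2_set (\<lambda>_. 1) S * L2_set \<rho> S" by (rule L2_set_mult_ineq)
    ultimately have "sqrt N / 256 \<le> sqrt (card S)" using sum\<rho> split small by linarith
    then have "(sqrt N / 256)\<^sup>2 \<le> (sqrt (card S))\<^sup>2" by (rule power_mono) simp
    then have "real n \<le> real (card S)" by (simp add: power_divide N_def)
    then show ?thesis by simp
  qed simp
  then obtain s where s: "inj_on s {..<n}" "s ` {..<n} \<subseteq> S" using obtain_relabelling[OF finS] by blast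
  have sN: "s k < N" and sS: "1 / (256 * sqrt N) \<le> \<rho> (s k)" if "k < n" for k
    using s(2) that by (auto simp: S_def image_subset_iff)
  have sqN: "sqrt N = 256 * sqrt n" by (simp add: N_def real_sqrt_mult)
  \<comment> \<open>Normalises the correlations to 1. The surviving \<open>c (s k)\<close> have norm
    at least \<open>1 / (65536 * sqrt n)\<close>, and the factor \<open>sqrt n\<close> is
    compensated by letting the functionals have norm \<open>sqrt n\<close>.\<close>
  define e where "e = (\<lambda>k. 1 / (of_real (sqrt n) * c (s k)))"
  have cne: "c (s k) \<noteq> 0" and ne: "norm (e k) \<le> 65536" if k: "k < n" for k
  proof -
    have n: "sqrt n > 0" using k by simp
    have "\<rho> (s k) \<le> norm (c (s k))" using Cauchy_Schwarz_ineq2[of "c (s k)" 1] by (simp add: \<rho>_def)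
    then have le: "1 / (65536 * sqrt n) \<le> norm (c (s k))" using sS[OF k] by (simp add: sqN)
    have "0 < 1 / (65536 * sqrt n)" using n by simp
    with le have pos: "norm (c (s k)) > 0" by (rule less_le_trans[rotated])
    then show "c (s k) \<noteq> 0" by simp
    have "1 \<le> norm (c (s k)) * (65536 * sqrt n)"
      using le n by (subst (asm) pos_divide_le_eq) simp_all
    then have "1 \<le> 65536 * (sqrt n * norm (c (s k)))" by (simp only: mult_ac)
    then show "norm (e k) \<le> 65536" using n pos by (simp add: e_def norm_divide norm_mult divide_le_eq)
  qed
  define y' where "y' = (\<lambda>k. sv (e k) (y (s k)))"
  define R where "R = {..<N} - s ` {..<n}"
  \<comment> \<open>The signs at discarded indices are averaged out, which keeps the norm bound and
    turns correlations over \<open>N\<close> signs into correlations over \<open>n\<close>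
    signs.\<close>
  define g' where "g' = (\<lambda>A. sqrt n *\<^sub>R cavg R (\<lambda>D. g (s ` (A \<inter> {..<n}) \<union> D)))"
  have fR: "finite R" by (simp add: R_def)
  show "\<exists>y g. (\<forall>k<n. y k \<in> E) \<and>
     (\<forall>t. norm (\<Sum>k<n. sv (t k) (y k)) \<le> real DIM('k) * 65536 * L2_set (\<lambda>k. norm (t k)) {..<n}) \<and>
     (\<forall>A. g A \<in> F \<and> norm (g A) \<le> sqrt (real n)) \<and>
     (\<forall>k<n. cavg {..<n} (\<lambda>A. sg A k *\<^sub>R pair (y k) (g A)) = 1)"
  proof (intro exI[of _ y'] exI[of _ g'] conjI allI impI)
    show "y' k \<in> E" if "k < n" for k using E(2) yE sN[OF that] by (simp add: y'_def)
    show "g' A \<in> F" for A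
      unfolding g'_def cavg_def using F(1) gF by (auto intro!: subspace_scale subspace_sum)
    show "norm (g' A) \<le> sqrt (real n)" for A
    proof -
      have "norm (cavg R (\<lambda>D. g (s ` (A \<inter> {..<n}) \<union> D))) \<le> cavg R (\<lambda>D. 1)"
        by (rule order_trans[OF norm_cavg_le cavg_mono]) (rule g1)
      then show ?thesis using fR by (simp add: g'_def mult_left_le)
    qed
    show "norm (\<Sum>k<n. sv (t k) (y' k)) \<le> real DIM('k) * 65536 * L2_set (\<lambda>k. norm (t k)) {..<n}" for t
    proof -
      define \<tau> where "\<tau> = (\<lambda>j. if j \<in> s ` {..<n} then t (the_inv_into {..<n} s j) * e (the_inv_into {..<n} s j) else 0)"
      have \<tau>s: "\<tau> (s k) = t k * e k" if "k < n" for k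
        using that by (simp add: \<tau>_def the_inv_into_f_f[OF s(1)])
      have ext: "(\<Sum>j<N. h j) = (\<Sum>k<n. h (s k))" if "\<And>j. j \<notin> s ` {..<n} \<Longrightarrow> h j = 0" for h :: "nat \<Rightarrow> 'x::comm_monoid_add"
      proof -
        have "(\<Sum>j<N. h j) = (\<Sum>j\<in>s ` {..<n}. h j)"
          by (rule sum.mono_neutral_right) (use sN that in auto)
        then show ?thesis by (simp add: sum.reindex[OF s(1)])
      qed
      have "(\<Sum>k<n. sv (t k) (y' k)) = (\<Sum>k<n. sv (\<tau> (s k)) (y (s k)))"
        by (rule sum.cong) (simp_all add: y'_def \<tau>s)
      also have "\<dots> = (\<Sum>j<N. sv (\<tau> j) (y j))"
        by (rule ext[symmetric]) (simp add: \<tau>_def)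
      finally have eq: "(\<Sum>k<n. sv (t k) (y' k)) = (\<Sum>j<N. sv (\<tau> j) (y j))" .
      have "L2_set (\<lambda>j. norm (\<tau> j)) {..<N} = L2_set (\<lambda>k. norm (t k * e k)) {..<n}"
      proof -
        have "(\<Sum>j<N. (norm (\<tau> j))\<^sup>2) = (\<Sum>k<n. (norm (\<tau> (s k)))\<^sup>2)"
          by (rule ext) (simp add: \<tau>_def)
        then show ?thesis by (simp add: L2_set_def \<tau>s)
      qed
      also have "\<dots> \<le> L2_set (\<lambda>k. norm (t k) * 65536) {..<n}"
        by (rule L2_set_mono) (use ne in \<open>auto simp: norm_mult intro!: mult_left_mono\<close>)
      also have "\<dots> = 65536 * L2_set (\<lambda>k. norm (t k)) {..<n}"
        by (simp add: L2_set_left_distrib mult.commute)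
      finally have fin: "real DIM('k) * 1 * L2_set (\<lambda>j. norm (\<tau> j)) {..<N} \<le>
          real DIM('k) * 1 * (65536 * L2_set (\<lambda>k. norm (t k)) {..<n})"
        by (rule mult_left_mono) simp
      show ?thesis
        using order_trans[OF v.upper2_scalars[OF yu, of \<tau>] fin] unfolding eq by (simp only: mult_1_right mult.assoc)
    qed
    show "cavg {..<n} (\<lambda>A. sg A k *\<^sub>R pair (y' k) (g' A)) = 1" if k: "k < n" for k
    proof -
      have yk: "y (s k) \<in> E" using yE sN[OF k] by simp
      have n: "sqrt n > 0" using k by simp
      have avgF: "cavg R (\<lambda>D. g (s ` A \<union> D)) \<in> F" for A
        unfolding cavg_def using F(1) gF by (auto intro!: subspace_scale subspace_sum)
      have "cavg {..<n} (\<lambda>A. sg A k *\<^sub>R pair (y' k) (g' A)) =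
          cavg {..<n} (\<lambda>A. (e k * of_real (sqrt n)) * cavg R (\<lambda>D. sg A k *\<^sub>R pair (y (s k)) (g (s ` A \<union> D))))"
      proof (rule cavg_cong)
        fix A assume "A \<subseteq> {..<n}"
        then have A: "A \<inter> {..<n} = A" by auto
        have "pair (y' k) (g' A) = (e k * of_real (sqrt n)) * pair (y (s k)) (cavg R (\<lambda>D. g (s ` A \<union> D)))"
          unfolding g'_def A y'_def p.scaleR_right pv[OF yk avgF]
          by (simp add: scaleR_conv_of_real mult_ac)
        then show "sg A k *\<^sub>R pair (y' k) (g' A) =
            (e k * of_real (sqrt n)) * cavg R (\<lambda>D. sg A k *\<^sub>R pair (y (s k)) (g (s ` A \<union> D)))"
          by (simp add: cavg_scaleR cavg_bounded_linear[OF p.bounded_linear_right] mult_scaleR_right)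
      qed
      also have "\<dots> = (e k * of_real (sqrt n)) * cavg {..<n} (\<lambda>A. cavg R (\<lambda>D. sg A k *\<^sub>R pair (y (s k)) (g (s ` A \<union> D))))"
        by (rule cavg_bounded_linear[symmetric]) (rule bounded_linear_mult_right)
      also have "cavg {..<n} (\<lambda>A. cavg R (\<lambda>D. sg A k *\<^sub>R pair (y (s k)) (g (s ` A \<union> D)))) =
          cavg {..<n} (\<lambda>A. cavg R (\<lambda>D. sg (s ` A \<union> D) (s k) *\<^sub>R pair (y (s k)) (g (s ` A \<union> D))))"
      proof (intro cavg_cong)
        fix A D assume AD: "A \<subseteq> {..<n}" "D \<subseteq> R"
        have "s k \<in> s ` A \<union> D \<longleftrightarrow> k \<in> A"
          using AD k s(1) by (auto simp: R_def inj_on_def)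
        then show "sg A k *\<^sub>R pair (y (s k)) (g (s ` A \<union> D)) = sg (s ` A \<union> D) (s k) *\<^sub>R pair (y (s k)) (g (s ` A \<union> D))"
          by (simp add: sg_def)
      qed
      also have "\<dots> = cavg (s ` {..<n}) (\<lambda>A. cavg R (\<lambda>D. sg (A \<union> D) (s k) *\<^sub>R pair (y (s k)) (g (A \<union> D))))"
        by (rule cavg_reindex[OF s(1), symmetric])
      also have "\<dots> = cavg (s ` {..<n} \<union> R) (\<lambda>D. sg D (s k) *\<^sub>R pair (y (s k)) (g D))"
        by (rule cavg_Un[symmetric]) (auto simp: R_def)
      also have "s ` {..<n} \<union> R = {..<N}" using sN by (auto simp: R_def)
      also have "cavg {..<N} (\<lambda>D. sg D (s k) *\<^sub>R pair (y (s k)) (g D)) = c (s k)" by (simp add: c_def)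
      also have "(e k * of_real (sqrt n)) * c (s k) = 1" using cne[OF k] n by (simp add: e_def)
      finally show ?thesis .
    qed
  qed
qed simp

section \<open>The dual space and triangular systems\<close>

lemma blinfun_apply_dual_scale: "blinfun_apply (dual_scale c \<phi>) x = c * blinfun_apply \<phi> x"
  unfolding dual_scale_def
  by (subst bounded_linear_Blinfun_apply)
     (auto intro: bounded_linear_compose[OF bounded_linear_mult_right] blinfun.bounded_linear_right)

text \<open>Valid on all real-linear bounded maps, so that results on Banach spaces over
  \<open>'k\<close> apply to the dual, with \<open>dual_space smul\<close> as carrier. The lower
  norm estimate comes from scaling back by \<open>inverse c\<close>.\<close>

lemma banach_space_over_dual_scale:
  "banach_space_over (dual_scale :: 'k \<Rightarrow> ('a::banach \<Rightarrow>\<^sub>L 'k) \<Rightarrow> ('a \<Rightarrow>\<^sub>L 'k::{real_normed_field,euclidean_space}))"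
proof
  show "norm (dual_scale c \<phi>) = norm c * norm \<phi>" for c :: 'k and \<phi> :: "'a \<Rightarrow>\<^sub>L 'k"
  proof (rule antisym)
    have le: "norm (dual_scale c \<phi>) \<le> norm c * norm \<phi>" for c :: 'k and \<phi> :: "'a \<Rightarrow>\<^sub>L 'k"
      by (rule norm_blinfun_bound)
         (auto simp: blinfun_apply_dual_scale norm_mult mult.assoc intro!: mult_left_mono norm_blinfun)
    show "norm (dual_scale c \<phi>) \<le> norm c * norm \<phi>" by (rule le)
    show "norm c * norm \<phi> \<le> norm (dual_scale c \<phi>)"
    proof (cases "c = 0")
      case False
      have "\<phi> = dual_scale (inverse c) (dual_scale c \<phi>)"
        using False by (intro blinfun_eqI) (simp add: blinfun_apply_dual_scale mult.assoc[symmetric])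
      then have "norm \<phi> \<le> norm (inverse c) * norm (dual_scale c \<phi>)" using le[of "inverse c" "dual_scale c \<phi>"] by simp
      then have "norm c * norm \<phi> \<le> norm c * (norm (inverse c) * norm (dual_scale c \<phi>))"
        by (rule mult_left_mono) simp
      also have "\<dots> = norm (dual_scale c \<phi>)" using False by (simp add: norm_inverse)
      finally show ?thesis .
    qed simp
  qed
qed (auto intro!: blinfun_eqI simp: blinfun_apply_dual_scale blinfun.add_right blinfun.add_left
     blinfun.scaleR_left algebra_simps scaleR_conv_of_real)

lemma prod_list_eq_1: "(\<And>x. x \<in> set xs \<Longrightarrow> x = 1) \<Longrightarrow> prod_list xs = 1"
  by (induction xs) auto

lemma inner_one_one [simp]: "inner (1::'k::{real_normed_field,euclidean_space}) 1 = 1"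
  by (simp add: power2_norm_eq_inner[symmetric])

context banach_space_over begin

lemma dual_space_subspace: "real_vector.subspace (dual_space smul)"
  by (auto simp: dual_space_def real_vector.subspace_def blinfun.add_left blinfun.scaleR_left algebra_simps)

lemma dual_scale_in_dual_space: "\<phi> \<in> dual_space smul \<Longrightarrow> dual_scale c \<phi> \<in> dual_space smul"
  by (simp add: dual_space_def blinfun_apply_dual_scale mult.left_commute)

lemma dual_space_smul: "\<phi> \<in> dual_space smul \<Longrightarrow> blinfun_apply \<phi> (smul c x) = c * blinfun_apply \<phi> x"
  by (simp add: dual_space_def)

text \<open>Each new functional enlarges \<open>S\<close> by at most one vector of the previous
  common kernel, which corrects the representative. In infinite dimension the common kernel is
  therefore nonzero.\<close>

lemma kernel_finite_codimension:
  assumes "\<forall>i<m. \<phi> i \<in> dual_space smul"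
  shows "\<exists>S. finite S \<and> (\<forall>x. \<exists>s\<in>module.span smul S. \<forall>i<m::nat. blinfun_apply (\<phi> i) (x - s) = 0)"
  using assms
proof (induction m)
  case (Suc m)
  then obtain S where S: "finite S" "\<And>x. \<exists>s\<in>span S. \<forall>i<m. blinfun_apply (\<phi> i) (x - s) = 0" by force
  show ?case
  proof (cases "\<exists>v. (\<forall>i<m. blinfun_apply (\<phi> i) v = 0) \<and> blinfun_apply (\<phi> m) v \<noteq> 0")
    case False
    show ?thesis
    proof (intro exI[of _ S] conjI allI S(1))
      fix x
      obtain s where s: "s \<in> span S" "\<forall>i<m. blinfun_apply (\<phi> i) (x - s) = 0" using S(2) by blast
      moreover have "blinfun_apply (\<phi> m) (x - s) = 0" using False s(2) by blast
      ultimately show "\<exists>s\<in>span S. \<forall>i<Suc m. blinfun_apply (\<phi> i) (x - s) = 0"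
        by (intro bexI[of _ s]) (auto simp: less_Suc_eq)
    qed
  next
    case True
    then obtain v where v: "\<forall>i<m. blinfun_apply (\<phi> i) v = 0" "blinfun_apply (\<phi> m) v \<noteq> 0" by blast
    have "\<exists>s'\<in>span (insert v S). \<forall>i<Suc m. blinfun_apply (\<phi> i) (x - s') = 0" for x
    proof -
      obtain s where s: "s \<in> span S" "\<forall>i<m. blinfun_apply (\<phi> i) (x - s) = 0" using S(2) by blast
      define t where "t = blinfun_apply (\<phi> m) (x - s) / blinfun_apply (\<phi> m) v"
      have "s + smul t v \<in> span (insert v S)"
        using s(1) subsetD[OF span_mono[of S "insert v S"]] by (intro span_add span_scale[OF span_base]) auto
      moreover have "blinfun_apply (\<phi> i) (x - (s + smul t v)) = blinfun_apply (\<phi> i) (x - s) - t * blinfun_apply (\<phi> i) v"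
        if "i < Suc m" for i
        using Suc.prems that by (simp add: blinfun.diff_right blinfun.add_right dual_space_smul)
      then have "\<forall>i<Suc m. blinfun_apply (\<phi> i) (x - (s + smul t v)) = 0"
        using s(2) v by (auto simp: less_Suc_eq t_def)
      ultimately show ?thesis by blast
    qed
    then show ?thesis using S(1) by (intro exI[of _ "insert v S"]) auto
  qed
qed (auto intro: exI[of _ "{}"])

text \<open>A nonzero common zero of the functionals found so far, together with a functional
  norming it, continues the system. Triangularity already gives Gram determinant 1, and one system
  serves both the space and its dual.\<close>

lemma triangular_system:
  fixes m :: nat
  assumes inf: "\<nexists>S. finite S \<and> module.span smul S = UNIV"
  shows "\<exists>x \<phi>. (\<forall>i<m. \<phi> i \<in> dual_space smul \<and> blinfun_apply (\<phi> i) (x i) = 1) \<and>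
     (\<forall>i<m. \<forall>j<m. i < j \<longrightarrow> blinfun_apply (\<phi> i) (x j) = 0)"
proof (induction m)
  case (Suc m)
  then obtain x \<phi> where IH: "\<forall>i<m. \<phi> i \<in> dual_space smul \<and> blinfun_apply (\<phi> i) (x i) = 1"
     "\<forall>i<m. \<forall>j<m. i < j \<longrightarrow> blinfun_apply (\<phi> i) (x j) = 0" by blast
  obtain v where v: "v \<noteq> 0" "\<forall>i<m. blinfun_apply (\<phi> i) v = 0"
  proof (rule ccontr)
    assume no: "\<not> thesis"
    obtain S where S: "finite S" "\<And>x. \<exists>s\<in>span S. \<forall>i<m. blinfun_apply (\<phi> i) (x - s) = 0"
      using kernel_finite_codimension[of m \<phi>] IH(1) by auto
    have "x \<in> span S" for x
    proof -
      obtain s where "s \<in> span S" "\<forall>i<m. blinfun_apply (\<phi> i) (x - s) = 0" using S(2) by blast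
      moreover have "x - s = 0" using that no calculation(2) by blast
      ultimately show ?thesis by simp
    qed
    then show False using inf S(1) by blast
  qed
  obtain \<psi> where \<psi>: "\<psi> \<in> dual_space smul" "norm v / 4 \<le> norm (blinfun_apply \<psi> v)"
    using norming_functional[of v] by blast
  have nz: "blinfun_apply \<psi> v \<noteq> 0" using \<psi>(2) v(1) by auto
  define w where "w = smul (1 / blinfun_apply \<psi> v) v"
  have w: "blinfun_apply \<psi> w = 1" using nz by (simp add: w_def dual_space_smul[OF \<psi>(1)])
  have w0: "\<forall>i<m. blinfun_apply (\<phi> i) w = 0" using IH(1) v(2) by (simp add: w_def dual_space_smul)
  show ?case
    by (intro exI[of _ "x(m := w)"] exI[of _ "\<phi>(m := \<psi>)"]) (use IH w w0 \<psi>(1) in \<open>auto simp: less_Suc_eq\<close>)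
qed simp

text \<open>The component along 1 turns scalar-valued pairings into the real functionals that the
  determinant argument requires; on a triangular system the diagonal stays 1.\<close>

lemma bounded_linear_inner_blinfun:
  "bounded_linear (\<lambda>x. inner (blinfun_apply \<phi> x) 1)" "bounded_linear (\<lambda>\<phi>. inner (blinfun_apply \<phi> x) 1)"
  by (rule bounded_linear_inner_left_comp[OF blinfun.bounded_linear_right],
      rule bounded_linear_inner_left_comp[OF blinfun.bounded_linear_left])

lemma sign_embedding_primal:
  assumes inf: "\<nexists>S. finite S \<and> module.span smul S = UNIV"
  shows "\<exists>y :: nat \<Rightarrow> 'a. (\<forall>k<N. y k \<in> UNIV) \<and> upper2 1 {..<N} y \<and>
     (\<forall>D. sqrt (real N) / 32 \<le> norm (\<Sum>k<N. sg D k *\<^sub>R y k))"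
proof (rule sign_embedding[OF real_vector.subspace_UNIV])
  fix n :: nat
  obtain x \<phi> where 1: "\<forall>i<2*n. \<phi> i \<in> dual_space smul \<and> blinfun_apply (\<phi> i) (x i) = 1"
     "\<forall>i<2*n. \<forall>j<2*n. i < j \<longrightarrow> blinfun_apply (\<phi> i) (x j) = 0"
    using triangular_system[OF inf, of "2*n"] by blast
  have "det (gram_mat (2*n) (\<lambda>i x. inner (blinfun_apply (\<phi> i) x) 1) x) = 1"
    by (subst det_lower_triangular[where n="2*n"]) (use 1 in \<open>auto simp: gram_mat_def diag_mat_def intro!: prod_list_eq_1\<close>)
  then show "\<exists>x :: nat \<Rightarrow> 'a. (\<forall>i<n. x i \<in> UNIV \<and> 1/4 \<le> norm (x i)) \<and> upper2 1 {..<n} x"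
    by (intro weak_dvoretzky_rogers[where l = "\<lambda>i x. inner (blinfun_apply (\<phi> i) x) 1" and b = x])
       (simp_all add: bounded_linear_inner_blinfun)
qed

lemma sign_embedding_dual:
  assumes inf: "\<nexists>S. finite S \<and> module.span smul S = UNIV"
  shows "\<exists>y. (\<forall>k<N. y k \<in> dual_space smul) \<and> upper2 1 {..<N} y \<and>
     (\<forall>D. sqrt (real N) / 32 \<le> norm (\<Sum>k<N. sg D k *\<^sub>R y k))"
proof (rule sign_embedding[OF dual_space_subspace])
  fix n :: nat
  obtain x \<phi> where 1: "\<forall>i<2*n. \<phi> i \<in> dual_space smul \<and> blinfun_apply (\<phi> i) (x i) = 1"
     "\<forall>i<2*n. \<forall>j<2*n. i < j \<longrightarrow> blinfun_apply (\<phi> i) (x j) = 0"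
    using triangular_system[OF inf, of "2*n"] by blast
  have "det (gram_mat (2*n) (\<lambda>i \<phi>. inner (blinfun_apply \<phi> (x i)) 1) \<phi>) = 1"
    by (subst det_upper_triangular[where n="2*n"])
       (use 1 in \<open>auto simp: gram_mat_def diag_mat_def intro!: prod_list_eq_1\<close>)
  then show "\<exists>x. (\<forall>i<n. x i \<in> dual_space smul \<and> 1/4 \<le> norm (x i)) \<and> upper2 1 {..<n} x"
    using 1
    by (intro weak_dvoretzky_rogers[where l = "\<lambda>i \<phi>. inner (blinfun_apply \<phi> (x i)) 1" and b = \<phi>])
       (simp_all add: bounded_linear_inner_blinfun dual_space_subspace)
qed

lemma correlated_signs_primal:
  assumes inf: "\<nexists>S. finite S \<and> module.span smul S = UNIV"
  shows "\<exists>C\<ge>0. \<forall>n. \<exists>y g.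
     (\<forall>t. norm (\<Sum>k<n. smul (t k) (y k)) \<le> C * L2_set (\<lambda>k. norm (t k)) {..<n}) \<and>
     (\<forall>A. g A \<in> dual_space smul \<and> norm (g A) \<le> sqrt (real n)) \<and>
     (\<forall>k<n. cavg {..<n} (\<lambda>A. sg A k *\<^sub>R blinfun_apply (g A) (y k)) = 1)"
proof -
  have bil: "bounded_bilinear (\<lambda>(x::'a) (\<phi>::'a \<Rightarrow>\<^sub>L 'k). blinfun_apply \<phi> x)"
    by (rule bounded_bilinear.flip) (rule bounded_bilinear_blinfun_apply)
  have "\<exists>C\<ge>0. \<forall>n. \<exists>y g. (\<forall>k<n. y k \<in> UNIV) \<and>
     (\<forall>t. norm (\<Sum>k<n. smul (t k) (y k)) \<le> C * L2_set (\<lambda>k. norm (t k)) {..<n}) \<and>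
     (\<forall>A. g A \<in> dual_space smul \<and> norm (g A) \<le> sqrt (real n)) \<and>
     (\<forall>k<n. cavg {..<n} (\<lambda>A. sg A k *\<^sub>R blinfun_apply (g A) (y k)) = 1)"
  proof (rule correlated_signs[where pair = "\<lambda>x \<phi>. blinfun_apply \<phi> x" and sv = smul and sw = dual_scale
        and E = UNIV and F = "dual_space smul"])
    show "norm (blinfun_apply \<phi> x) \<le> norm x * norm \<phi>" for x :: 'a and \<phi> :: "'a \<Rightarrow>\<^sub>L 'k"
      using norm_blinfun[of \<phi> x] by (simp add: mult.commute)
    show "\<exists>\<phi>\<in>dual_space smul. norm \<phi> \<le> 1 \<and> norm x / 4 \<le> norm (blinfun_apply \<phi> x)" for x
      by (rule norming_functional)
    show "\<exists>y :: nat \<Rightarrow> 'a. (\<forall>k<N. y k \<in> UNIV) \<and> upper2 1 {..<N} y \<and>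
       (\<forall>D. sqrt (real N) / 32 \<le> norm (\<Sum>k<N. sg D k *\<^sub>R y k))" for N
      by (rule sign_embedding_primal[OF inf])
  qed (use bil in \<open>simp_all add: banach_space_over_axioms banach_space_over_dual_scale dual_space_smul
     blinfun_apply_dual_scale dual_scale_in_dual_space dual_space_subspace\<close>)
  then show ?thesis by simp
qed

lemma correlated_signs_dual:
  assumes inf: "\<nexists>S. finite S \<and> module.span smul S = UNIV"
  shows "\<exists>C\<ge>0. \<forall>n. \<exists>\<phi> f. (\<forall>k<n. \<phi> k \<in> dual_space smul) \<and>
     (\<forall>t. norm (\<Sum>k<n. dual_scale (t k) (\<phi> k)) \<le> C * L2_set (\<lambda>k. norm (t k)) {..<n}) \<and>
     (\<forall>A. norm (f A :: 'a) \<le> sqrt (real n)) \<and>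
     (\<forall>k<n. cavg {..<n} (\<lambda>A. sg A k *\<^sub>R blinfun_apply (\<phi> k) (f A)) = 1)"
proof -
  \<comment> \<open>Here the definition of the operator norm replaces Hahn--Banach: if no
    \<open>w\<close> worked, the norm would be at most a quarter of itself.\<close>
  have norming: "\<exists>w\<in>UNIV. norm w \<le> 1 \<and> norm \<phi> / 4 \<le> norm (blinfun_apply \<phi> w)" for \<phi> :: "'a \<Rightarrow>\<^sub>L 'k"
  proof (rule ccontr)
    assume neg: "\<not> ?thesis"
    have "norm \<phi> \<le> norm \<phi> / 4"
    proof (rule norm_blinfun_bound)
      fix x
      show "norm (blinfun_apply \<phi> x) \<le> norm \<phi> / 4 * norm x"
      proof (cases "x = 0")
        case False
        have "\<not> norm \<phi> / 4 \<le> norm (blinfun_apply \<phi> ((1 / norm x) *\<^sub>R x))"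
          using neg False by (auto dest!: spec[of _ "(1 / norm x) *\<^sub>R x"])
        then show ?thesis using False by (simp add: blinfun.scaleR_right field_simps)
      qed simp
    qed simp
    then have "norm \<phi> = 0" using norm_ge_zero[of \<phi>] by linarith
    then show False using neg by (auto dest!: spec[of _ 0])
  qed
  have "\<exists>C\<ge>0. \<forall>n. \<exists>\<phi> f. (\<forall>k<n. \<phi> k \<in> dual_space smul) \<and>
     (\<forall>t. norm (\<Sum>k<n. dual_scale (t k) (\<phi> k)) \<le> C * L2_set (\<lambda>k. norm (t k)) {..<n}) \<and>
     (\<forall>A. f A \<in> UNIV \<and> norm (f A :: 'a) \<le> sqrt (real n)) \<and>
     (\<forall>k<n. cavg {..<n} (\<lambda>A. sg A k *\<^sub>R blinfun_apply (\<phi> k) (f A)) = 1)"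
  proof (rule correlated_signs[where pair = blinfun_apply and sv = dual_scale and sw = smul
        and E = "dual_space smul" and F = UNIV])
    show "norm (blinfun_apply \<phi> x) \<le> norm \<phi> * norm x" for x :: 'a and \<phi> :: "'a \<Rightarrow>\<^sub>L 'k"
      by (rule norm_blinfun)
    show "\<exists>w\<in>UNIV. norm w \<le> 1 \<and> norm \<phi> / 4 \<le> norm (blinfun_apply \<phi> w)" for \<phi> :: "'a \<Rightarrow>\<^sub>L 'k"
      by (rule norming)
    show "\<exists>y. (\<forall>k<N. y k \<in> dual_space smul) \<and> upper2 1 {..<N} y \<and>
       (\<forall>D. sqrt (real N) / 32 \<le> norm (\<Sum>k<N. sg D k *\<^sub>R y k))" for N
      by (rule sign_embedding_dual[OF inf])
  qed (simp_all add: banach_space_over_axioms banach_space_over_dual_scale dual_space_smul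
     blinfun_apply_dual_scale dual_scale_in_dual_space dual_space_subspace bounded_bilinear_blinfun_apply)
  then show ?thesis by simp
qed

end

section \<open>Smooth bumps\<close>

definition smooth :: "(real \<Rightarrow> real) \<Rightarrow> bool" where
  "smooth f \<longleftrightarrow> (\<exists>D. D 0 = f \<and> (\<forall>n x. (D n has_real_derivative D (Suc n) x) (at x)))"

text \<open>Iterating a choice of derivatives inside \<open>S\<close> builds the whole sequence, so
  smoothness reduces to exhibiting a family closed under differentiation.\<close>

lemma smooth_coinduct:
  assumes "f \<in> S" and step: "\<And>h. h \<in> S \<Longrightarrow> \<exists>h'\<in>S. \<forall>x. (h has_real_derivative h' x) (at x)"
  shows "smooth f"
proof -
  obtain nxt where nxt: "\<And>h. h \<in> S \<Longrightarrow> nxt h \<in> S \<and> (\<forall>x. (h has_real_derivative nxt h x) (at x))"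
    using step by metis
  have "(nxt ^^ n) f \<in> S" for n by (induction n) (use assms(1) nxt in auto)
  then show ?thesis
    unfolding smooth_def by (intro exI[of _ "\<lambda>n. (nxt ^^ n) f"]) (use nxt in auto)
qed

lemma smooth_deriv:
  assumes "smooth f"
  obtains f' where "smooth f'" "\<And>x. (f has_real_derivative f' x) (at x)"
proof -
  obtain D where D: "D 0 = f" "\<And>n x. (D n has_real_derivative D (Suc n) x) (at x)"
    using assms by (auto simp: smooth_def)
  have "smooth (D 1)" unfolding smooth_def
    by (intro exI[of _ "\<lambda>n. D (Suc n)"]) (use D in auto)
  then show ?thesis using that[of "D 1"] D(2)[of 0] by (simp add: D(1))
qed

lemma smooth_mult:
  assumes "smooth f" "smooth g"
  shows "smooth (\<lambda>x. f x * g x)"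
proof -
  obtain D where D: "D 0 = f" "\<And>n x. (D n has_real_derivative D (Suc n) x) (at x)"
    using assms(1) by (auto simp: smooth_def)
  obtain E where E: "E 0 = g" "\<And>n x. (E n has_real_derivative E (Suc n) x) (at x)"
    using assms(2) by (auto simp: smooth_def)
  \<comment> \<open>The family for products: finite sums of products of derivatives, encoded by
    lists of pairs of orders and closed by the product rule.\<close>
  define h where "h = (\<lambda>L x. \<Sum>(a, b)\<leftarrow>L. D a x * E b x)"
  have step: "\<exists>L'. \<forall>x. (h L has_real_derivative h L' x) (at x)" for L
  proof (induction L)
    case Nil
    then show ?case by (intro exI[of _ "[]"]) (simp add: h_def)
  next
    case (Cons p L)
    then obtain L' where L': "\<And>x. (h L has_real_derivative h L' x) (at x)" by blast
    obtain a b where p: "p = (a, b)" by fastforce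
    have eq: "h (p # L) = (\<lambda>x. D a x * E b x + h L x)" by (simp add: h_def p)
    have "(h (p # L) has_real_derivative h ((Suc a, b) # (a, Suc b) # L') x) (at x)" for x
      unfolding eq using DERIV_add[OF DERIV_mult[OF D(2)[of a x] E(2)[of b x]] L'[of x]]
      by (simp add: h_def algebra_simps)
    then show ?case by blast
  qed
  show ?thesis
  proof (rule smooth_coinduct[where S = "range h"])
    have "(\<lambda>x. f x * g x) = h [(0, 0)]" by (simp add: h_def D E)
    then show "(\<lambda>x. f x * g x) \<in> range h" by simp
  qed (use step in auto)
qed

lemma smooth_const: "smooth (\<lambda>_. c)"
  by (rule smooth_coinduct[where S = "{\<lambda>_. c, \<lambda>_. 0}"]) (auto intro!: derivative_eq_intros)

lemma smooth_prod: "finite A \<Longrightarrow> (\<And>i. i \<in> A \<Longrightarrow> smooth (f i)) \<Longrightarrow> smooth (\<lambda>x. \<Prod>i\<in>A. f i x)"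
  by (induction A rule: finite_induct) (auto intro: smooth_mult smooth_const)

lemma smooth_sin: "smooth (\<lambda>x. sin (\<omega> * x + \<theta>))"
  unfolding smooth_def
proof (intro exI[of _ "\<lambda>n x. \<omega> ^ n * sin (\<omega> * x + \<theta> + n * (pi / 2))"] conjI allI)
  fix n :: nat and x
  have e: "\<omega> * x + \<theta> + Suc n * (pi / 2) = (\<omega> * x + \<theta> + n * (pi / 2)) + pi / 2"
    by (simp add: algebra_simps add_divide_distrib)
  have "cos (\<omega> * x + \<theta> + n * (pi / 2)) = sin (\<omega> * x + \<theta> + Suc n * (pi / 2))"
    unfolding e sin_add by simp
  moreover have "((\<lambda>x. \<omega> ^ n * sin (\<omega> * x + \<theta> + n * (pi / 2))) has_real_derivative
     \<omega> ^ n * (cos (\<omega> * x + \<theta> + n * (pi / 2)) * \<omega>)) (at x)"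
    by (auto intro!: derivative_eq_intros)
  ultimately show "((\<lambda>x. \<omega> ^ n * sin (\<omega> * x + \<theta> + n * (pi / 2))) has_real_derivative
     \<omega> ^ Suc n * sin (\<omega> * x + \<theta> + Suc n * (pi / 2))) (at x)"
    by (simp add: mult_ac)
qed simp

lemma smooth_affine:
  assumes "smooth f"
  shows "smooth (\<lambda>x. f (c * x + d))"
proof -
  obtain D where D: "D 0 = f" "\<And>n x. (D n has_real_derivative D (Suc n) x) (at x)"
    using assms by (auto simp: smooth_def)
  have "((\<lambda>x. c ^ n * D n (c * x + d)) has_real_derivative c ^ n * (D (Suc n) (c * x + d) * c)) (at x)" for n x
    by (intro DERIV_cmult DERIV_chain2[OF D(2)]) (auto intro!: derivative_eq_intros)
  then show ?thesis unfolding smooth_def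
    by (intro exI[of _ "\<lambda>n x. c ^ n * D n (c * x + d)"]) (simp add: D(1) mult_ac)
qed

text \<open>The polynomial in \<open>1 / x\<close> makes the family closed under differentiation,
  also at the origin, where the exponential beats every power.\<close>

definition half_bump :: "real poly \<Rightarrow> real \<Rightarrow> real" where
  "half_bump p x = (if x > 0 then poly p (1 / x) * exp (- (1 / x)) else 0)"

lemma poly_times_exp_minus_tendsto_0: "((\<lambda>y. poly p y * exp (- y)) \<longlongrightarrow> (0::real)) at_top"
proof -
  have "((\<lambda>y. \<Sum>i\<le>degree p. coeff p i * (y ^ i / exp y)) \<longlongrightarrow> (\<Sum>i\<le>degree p. coeff p i * 0)) at_top"
    by (intro tendsto_sum tendsto_mult tendsto_const tendsto_power_div_exp_0)
  then show ?thesis by (simp add: poly_altdef sum_distrib_right exp_minus sum_divide_distrib field_simps)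
qed

lemma half_bump_deriv: "(half_bump p has_real_derivative half_bump ([:0, 0, 1:] * (p - pderiv p)) x) (at x)"
proof -
  define q where "q = [:0, 0, 1:] * (p - pderiv p)"
  consider "x > 0" | "x < 0" | "x = 0" by linarith
  then have "(half_bump p has_real_derivative half_bump q x) (at x)"
  proof cases
    case 1
    have "((\<lambda>x. poly p (1 / x) * exp (- (1 / x))) has_real_derivative half_bump q x) (at x)"
      using 1 by (auto intro!: derivative_eq_intros simp: half_bump_def q_def power2_eq_square field_simps)
    then show "(half_bump p has_real_derivative half_bump q x) (at x)"
      by (rule has_field_derivative_transform_within_open[where S = "{0<..}"]) (use 1 in \<open>auto simp: half_bump_def\<close>)
  next
    case 2
    have "((\<lambda>_. 0) has_real_derivative half_bump q x) (at x)" using 2 by (simp add: half_bump_def)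
    then show "(half_bump p has_real_derivative half_bump q x) (at x)"
      by (rule has_field_derivative_transform_within_open[where S = "{..<0}"]) (use 2 in \<open>auto simp: half_bump_def\<close>)
  next
    case 3
    \<comment> \<open>The extra factor \<open>[:0, 1:]\<close> accounts for the division by
      \<open>h\<close> in the difference quotient at 0.\<close>
    have "((\<lambda>y. poly ([:0, 1:] * p) y * exp (- y)) \<longlongrightarrow> 0) at_top" by (rule poly_times_exp_minus_tendsto_0)
    then have "((\<lambda>h. poly ([:0, 1:] * p) (1 / h) * exp (- (1 / h))) \<longlongrightarrow> 0) (at_right 0)"
      by (rule filterlim_compose) (simp add: filterlim_inverse_at_top_right flip: inverse_eq_divide)
    then have R: "((\<lambda>h. half_bump p h / h) \<longlongrightarrow> 0) (at_right 0)"
      by (rule Lim_transform_eventually) (auto simp: half_bump_def eventually_at_right_less intro!: eventually_at_rightI[of 0 1])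
    have L: "((\<lambda>h. half_bump p h / h) \<longlongrightarrow> 0) (at_left 0)"
      by (rule Lim_transform_eventually[OF tendsto_const]) (auto simp: half_bump_def intro!: eventually_at_leftI[of "-1" 0])
    have "((\<lambda>h. half_bump p h / h) \<longlongrightarrow> 0) (at 0)" using L R by (rule filterlim_split_at)
    then show "(half_bump p has_real_derivative half_bump q x) (at x)" by (simp add: 3 DERIV_def half_bump_def)
  qed
  then show ?thesis by (simp only: q_def)
qed

lemma smooth_half_bump: "smooth (half_bump p)"
  by (rule smooth_coinduct[where S = "range half_bump"]) (use half_bump_deriv in blast)+

definition bump :: "real \<Rightarrow> real" where
  "bump x = half_bump 1 x * half_bump 1 (1 - x)"

lemma smooth_bump: "smooth (\<lambda>x. bump (x - c))"
proof -
  have "smooth (\<lambda>x. half_bump 1 (1 * x + (- c)) * half_bump 1 ((-1) * x + (1 + c)))"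
    by (intro smooth_mult smooth_affine smooth_half_bump)
  then show ?thesis by (simp add: bump_def algebra_simps)
qed

lemma bump_bounds: "0 \<le> bump x" "bump x \<le> 1"
proof -
  have "0 \<le> half_bump 1 y \<and> half_bump 1 y \<le> 1" for y by (simp add: half_bump_def)
  then show "0 \<le> bump x" "bump x \<le> 1" unfolding bump_def by (auto intro: mult_le_one)
qed

lemma bump_eq_0: "x \<notin> {0<..<1} \<Longrightarrow> bump x = 0"
  by (auto simp: bump_def half_bump_def)

lemma bump_pos: "0 < x \<Longrightarrow> x < 1 \<Longrightarrow> 0 < bump x"
  by (simp add: bump_def half_bump_def)

lemma test_function_of_real:
  assumes u: "smooth u" and supp: "\<And>x. x \<notin> {a..b} \<Longrightarrow> u x = 0"
  shows "test_function (\<lambda>x. of_real (u x) :: 'k::real_normed_field)"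
proof -
  obtain D where D: "D 0 = u" "\<And>n x. (D n has_real_derivative D (Suc n) x) (at x)"
    using u by (auto simp: smooth_def)
  have "((\<lambda>x. of_real (D n x) :: 'k) has_vector_derivative of_real (D (Suc n) x)) (at x)" for n x
    by (rule bounded_linear.has_vector_derivative[OF bounded_linear_of_real])
       (use D(2) in \<open>simp add: has_real_derivative_iff_has_vector_derivative\<close>)
  moreover have "compact (closure {x. of_real (u x) \<noteq> (0::'k)})"
  proof -
    have "x \<in> {a..b}" if "u x \<noteq> 0" for x using supp[of x] that by blast
    then have "{x. of_real (u x) \<noteq> (0::'k)} \<subseteq> {a..b}" by auto
    then have "bounded {x. of_real (u x) \<noteq> (0::'k)}" by (rule bounded_subset[OF bounded_closed_interval])
    then show ?thesis by (simp add: compact_closure)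
  qed
  ultimately show ?thesis
    unfolding test_function_def by (intro conjI exI[of _ "\<lambda>n x. of_real (D n x)"]) (simp_all add: D(1))
qed

section \<open>Hilbert transforms of modulated bumps\<close>

text \<open>The interval splits into \<open>\<Lambda>\<close> periods of
  \<open>W (\<Lambda> * x)\<close>; on each one \<open>h\<close> is nearly constant and
  \<open>W\<close> integrates to 0.\<close>

lemma fejer_mean_zero:
  fixes h W :: "real \<Rightarrow> real"
  assumes h: "continuous_on {0..1} h" and W: "continuous_on UNIV W"
    and per: "\<And>x. W (x + 1) = W x" and mean: "integral {0..1} W = 0"
  shows "(\<lambda>\<Lambda>. integral {0..1} (\<lambda>x. h x * W (real \<Lambda> * x))) \<longlonglongrightarrow> 0"
proof (rule LIMSEQ_I)
  fix e :: real assume "e > 0"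
  have pern: "W (x + real n) = W x" for x n
  proof (induction n)
    case (Suc n)
    have "x + real (Suc n) = (x + real n) + 1" by simp
    then show ?case using per[of "x + real n"] Suc by (simp only:)
  qed simp
  have contW: "continuous_on S (\<lambda>x. W (f x))" if "continuous_on S f" for S and f :: "real \<Rightarrow> real"
    using continuous_on_compose2[OF W that] by auto
  obtain K where K: "K > 0" "\<And>x. x \<in> {0..1} \<Longrightarrow> \<bar>W x\<bar> \<le> K"
    using compact_imp_bounded[OF compact_continuous_image[OF continuous_on_subset[OF W] compact_Icc[of 0 1]]]
    by (auto simp: bounded_pos)
  have WK: "\<bar>W x\<bar> \<le> K" if "x \<ge> 0" for x
  proof -
    have fx: "x = frac x + real (nat \<lfloor>x\<rfloor>)" using that by (simp add: frac_def)
    have "W x = W (frac x)" by (subst fx) (rule pern)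
    moreover have "frac x \<in> {0..1}" using frac_lt_1[of x] by (simp add: less_imp_le)
    ultimately show ?thesis using K(2) by simp
  qed
  define e' where "e' = e / (2 * K)"
  have e': "e' > 0" using \<open>e > 0\<close> K by (simp add: e'_def)
  obtain d where d0: "d > 0" and d': "\<forall>x\<in>{0..1}. \<forall>y\<in>{0..1}. dist y x < d \<longrightarrow> dist (h y) (h x) < e'"
    using compact_uniformly_continuous[OF h compact_Icc] e' unfolding uniformly_continuous_on_def by blast
  have d: "d > 0" "\<And>x y. x \<in> {0..1} \<Longrightarrow> y \<in> {0..1} \<Longrightarrow> dist y x < d \<Longrightarrow> dist (h y) (h x) < e'"
    using d0 d' by blast+
  obtain N0 :: nat where N0: "1 / d < N0" using reals_Archimedean2 by blast
  show "\<exists>no. \<forall>\<Lambda>\<ge>no. norm (integral {0..1} (\<lambda>x. h x * W (real \<Lambda> * x)) - 0) < e"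
  proof (intro exI[of _ "Suc N0"] allI impI)
    fix \<Lambda> assume \<Lambda>: "Suc N0 \<le> \<Lambda>"
    then have pos: "real \<Lambda> > 0" by simp
    have small: "1 / real \<Lambda> < d"
    proof -
      have "1 / d < real \<Lambda>" using N0 \<Lambda> by linarith
      then show ?thesis using d(1) pos by (simp add: field_simps)
    qed
    define F where "F = (\<lambda>x. h x * W (real \<Lambda> * x))"
    have contF: "continuous_on {0..1} F" unfolding F_def by (intro continuous_intros h contW)
    define p where "p = (\<lambda>i. real i / real \<Lambda>)"
    have p: "p i \<le> p (Suc i)" "0 \<le> p i" for i using pos by (auto simp: p_def divide_right_mono)
    have p1: "p i \<le> 1" if "i \<le> \<Lambda>" for i using that pos by (simp add: p_def)
    have pS: "p (Suc i) = p i + 1 / real \<Lambda>" for i by (simp add: p_def add_divide_distrib)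
    have sumF: "integral {0..p n} F = (\<Sum>i<n. integral {p i..p (Suc i)} F)" if "n \<le> \<Lambda>" for n
      using that
    proof (induction n)
      case 0
      then show ?case by (simp add: p_def)
    next
      case (Suc n)
      have "F integrable_on {0..p (Suc n)}"
        by (rule integrable_continuous_real[OF continuous_on_subset[OF contF]]) (use p1[OF Suc.prems] in auto)
      then have "integral {0..p n} F + integral {p n..p (Suc n)} F = integral {0..p (Suc n)} F"
        using p by (intro Henstock_Kurzweil_Integration.integral_combine) auto
      then show ?case using Suc by simp
    qed
    have cell: "\<bar>integral {p i..p (Suc i)} F\<bar> \<le> e' * K / real \<Lambda>" if i: "i < \<Lambda>" for i
    proof -
      define I where "I = {p i..p (Suc i)}"
      have I01: "I \<subseteq> {0..1}" using p(2)[of i] p1[of "Suc i"] i by (auto simp: I_def)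
      have "(W has_integral 0) {0..1}"
        using mean integrable_integral[OF integrable_continuous_real[OF continuous_on_subset[OF W]], of 0 1] by simp
      from has_integral_affinity[OF this[unfolded cbox_interval[symmetric]], of "real \<Lambda>" "- real i"]
      have "((\<lambda>x. W (real \<Lambda> * x - real i)) has_integral 0) ((\<lambda>x. (1 / real \<Lambda>) * x + real i / real \<Lambda>) ` {0..1})"
        using pos by (simp add: mult.commute)
      also have "(\<lambda>x. (1 / real \<Lambda>) * x + real i / real \<Lambda>) ` {0..1} = I"
        using pos image_affinity_atLeastAtMost[of "1 / real \<Lambda>" "real i / real \<Lambda>" 0 1]
        by (simp add: I_def p_def add_divide_distrib)
      finally have 0: "((\<lambda>x. W (real \<Lambda> * x - real i)) has_integral 0) I" .
      have Wi: "W (real \<Lambda> * x - real i) = W (real \<Lambda> * x)" for x using pern[of "real \<Lambda> * x - real i" i] by simp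
      have 1: "((\<lambda>x. h (p i) * W (real \<Lambda> * x)) has_integral 0) I"
        using has_integral_mult_right[OF 0, of "h (p i)"] by (simp add: Wi)
      have FI: "F integrable_on I"
        unfolding I_def by (rule integrable_continuous_real[OF continuous_on_subset[OF contF]]) (use I01 in \<open>auto simp: I_def\<close>)
      have "((\<lambda>x. F x - h (p i) * W (real \<Lambda> * x)) has_integral (integral I F - 0)) I"
        by (intro has_integral_diff integrable_integral FI 1)
      then have "norm (integral I F) \<le> e' * K * measure lborel (cbox (p i) (p (Suc i)))"
      proof (intro has_integral_bound[where f = "\<lambda>x. F x - h (p i) * W (real \<Lambda> * x)"])
        fix x assume "x \<in> cbox (p i) (p (Suc i))"
        then have x: "p i \<le> x" "x \<le> p i + 1 / real \<Lambda>" by (auto simp: pS)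
        have x01: "x \<in> {0..1}" "p i \<in> {0..1}" using x I01 p(2)[of i] p1[of i] i by (auto simp: I_def pS subset_iff)
        have "\<bar>h x - h (p i)\<bar> \<le> e'"
          using d(2)[OF x01(2,1)] x small by (simp add: dist_real_def abs_le_iff less_imp_le)
        moreover have "\<bar>W (real \<Lambda> * x)\<bar> \<le> K" by (rule WK) (use x01 pos in auto)
        ultimately have "\<bar>h x - h (p i)\<bar> * \<bar>W (real \<Lambda> * x)\<bar> \<le> e' * K" using e' by (intro mult_mono) auto
        then show "norm (F x - h (p i) * W (real \<Lambda> * x)) \<le> e' * K"
          by (simp add: F_def abs_mult[symmetric] left_diff_distrib)
      qed (use e' K in \<open>simp_all add: I_def\<close>)
      then show ?thesis using p(1)[of i] by (simp add: I_def pS)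
    qed
    have "integral {0..1} F = (\<Sum>i<\<Lambda>. integral {p i..p (Suc i)} F)"
      using sumF[of \<Lambda>] pos by (simp add: p_def)
    then have "\<bar>integral {0..1} F\<bar> \<le> (\<Sum>i<\<Lambda>. e' * K / real \<Lambda>)"
      by (simp only:) (rule order_trans[OF sum_abs sum_mono], use cell in auto)
    also have "\<dots> = e' * K" using pos by simp
    also have "\<dots> < e" using K \<open>e > 0\<close> by (simp add: e'_def)
    finally show "norm (integral {0..1} (\<lambda>x. h x * W (real \<Lambda> * x)) - 0) < e" by (simp add: F_def)
  qed
qed

text \<open>Fejer's lemma; subtracting the mean of \<open>W\<close> reduces it to the preceding
  case.\<close>

lemma fejer:
  fixes h W :: "real \<Rightarrow> real"
  assumes h: "continuous_on {0..1} h" and W: "continuous_on UNIV W" and per: "\<And>x. W (x + 1) = W x"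
  shows "(\<lambda>\<Lambda>. integral {0..1} (\<lambda>x. h x * W (real \<Lambda> * x))) \<longlonglongrightarrow> integral {0..1} h * integral {0..1} W"
proof -
  define w where "w = integral {0..1} W"
  have Wi: "W integrable_on {0..1}" by (rule integrable_continuous_real) (rule continuous_on_subset[OF W], simp)
  have hi: "h integrable_on {0..1}" using h by (rule integrable_continuous_real)
  have "(\<lambda>\<Lambda>. integral {0..1} (\<lambda>x. h x * (W (real \<Lambda> * x) - w))) \<longlonglongrightarrow> 0"
  proof (rule fejer_mean_zero[OF h, where W = "\<lambda>x. W x - w"])
    show "integral {0..1} (\<lambda>x. W x - w) = 0"
      using Henstock_Kurzweil_Integration.integral_diff[OF Wi integrable_const_ivl[of w]] by (simp add: w_def)
  qed (use W per in \<open>auto intro!: continuous_intros\<close>)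
  moreover have "integral {0..1} (\<lambda>x. h x * (W (real \<Lambda> * x) - w)) = integral {0..1} (\<lambda>x. h x * W (real \<Lambda> * x)) - integral {0..1} h * w" for \<Lambda> :: nat
  proof -
    have i1: "(\<lambda>x. h x * W (real \<Lambda> * x)) integrable_on {0..1}"
      by (intro integrable_continuous_real continuous_intros h continuous_on_compose2[OF W]) auto
    have i2: "(\<lambda>x. h x * w) integrable_on {0..1}" using hi by (rule integrable_on_mult_left)
    show ?thesis
      unfolding right_diff_distrib using Henstock_Kurzweil_Integration.integral_diff[OF i1 i2] by simp
  qed
  ultimately show ?thesis by (simp add: w_def LIM_zero_iff)
qed

section \<open>Principal values as proper integrals\<close>

definition C1_on :: "real \<Rightarrow> (real \<Rightarrow> real) \<Rightarrow> (real \<Rightarrow> real) \<Rightarrow> bool" where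
  "C1_on c u u' \<longleftrightarrow> (\<forall>x. (u has_real_derivative u' x) (at x)) \<and> continuous_on UNIV u' \<and>
     (\<forall>x. x \<notin> {c..c+1} \<longrightarrow> u x = 0)"

text \<open>Equals \<open>(u (x - t) - u (x + t)) / t\<close> for \<open>t \<noteq> 0\<close>.
  Writing it as an integral of the derivative extends it continuously to \<open>t = 0\<close>, which
  removes the singularity of the principal value.\<close>

definition dquot :: "(real \<Rightarrow> real) \<Rightarrow> real \<Rightarrow> real \<Rightarrow> real" where
  "dquot u' x t = - integral {-1..1} (\<lambda>s. u' (x + s * t))"

text \<open>Restricting \<open>t\<close> to \<open>{0..1}\<close> is correct for \<open>x\<close> in
  the unit interval that supports \<open>u\<close>, and only there is this the Hilbert transform.
  The pairing asks for no other points, since in each of its terms the untransformed test function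
  vanishes outside.\<close>

definition hilb :: "(real \<Rightarrow> real) \<Rightarrow> real \<Rightarrow> real" where
  "hilb u' x = (1 / pi) * integral {0..1} (dquot u' x)"

lemma C1_onD:
  assumes "C1_on c u u'"
  shows "(u has_real_derivative u' x) (at x)" "continuous_on UNIV u'" "x \<notin> {c..c+1} \<Longrightarrow> u x = 0"
    "continuous_on S u"
proof -
  show "(u has_real_derivative u' x) (at x)" "continuous_on UNIV u'" "x \<notin> {c..c+1} \<Longrightarrow> u x = 0"
    using assms by (auto simp: C1_on_def)
  show "continuous_on S u" using assms unfolding C1_on_def
    by (meson DERIV_isCont continuous_at_imp_continuous_on)
qed

lemma integral_affine_derivative:
  assumes u: "\<And>x. (u has_real_derivative u' x) (at x)" and "t \<noteq> 0" "a \<le> b"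
  shows "((\<lambda>s. u' (x + s * t)) has_integral (u (x + b * t) - u (x + a * t)) / t) {a..b}"
proof -
  have "((\<lambda>s. u (x + s * t) / t) has_vector_derivative u' (x + s * t)) (at s within {a..b})" for s
  proof -
    have "((\<lambda>s. u (x + s * t)) has_real_derivative u' (x + s * t) * t) (at s)"
      by (rule DERIV_chain2[OF u]) (auto intro!: derivative_eq_intros)
    from DERIV_cdivide[OF this, of t] show ?thesis using \<open>t \<noteq> 0\<close>
      by (simp add: has_real_derivative_iff_has_vector_derivative has_vector_derivative_at_within)
  qed
  from fundamental_theorem_of_calculus[OF \<open>a \<le> b\<close> this] show ?thesis by (simp add: diff_divide_distrib)
qed

lemma dquot_eq:
  assumes "\<And>x. (u has_real_derivative u' x) (at x)" "t \<noteq> 0"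
  shows "dquot u' x t = (u (x - t) - u (x + t)) / t"
  unfolding dquot_def
  using integral_unique[OF integral_affine_derivative[OF assms, where a = "-1" and b = 1 and x = x]]
  by (simp add: minus_divide_left)

lemma continuous_on_dquot:
  assumes "continuous_on UNIV u'"
  shows "continuous_on UNIV (\<lambda>(x, t). dquot u' x t)"
proof -
  have "continuous_on UNIV (\<lambda>p. integral (cbox (-1) 1) (\<lambda>s. u' (fst p + s * snd p)))"
    by (rule integral_continuous_on_param)
       (auto simp: case_prod_unfold intro!: continuous_intros continuous_on_compose2[OF assms])
  then show ?thesis by (auto simp: dquot_def case_prod_unfold intro!: continuous_intros)
qed

lemma continuous_on_dquot_snd:
  assumes "continuous_on UNIV u'"
  shows "continuous_on S (dquot u' x)"
proof -
  have "continuous_on S (\<lambda>t. (x, t))" by (intro continuous_on_Pair continuous_on_const continuous_on_id)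
  from continuous_on_compose2[OF continuous_on_dquot[OF assms] this] show ?thesis by simp
qed

lemma continuous_on_hilb:
  assumes "continuous_on UNIV u'"
  shows "continuous_on S (hilb u')"
proof -
  have "continuous_on UNIV (\<lambda>x. integral (cbox 0 1) (dquot u' x))"
    by (rule integral_continuous_on_param)
       (rule continuous_on_subset[OF continuous_on_dquot[OF assms]], simp)
  then show ?thesis unfolding hilb_def by (auto intro!: continuous_intros intro: continuous_on_subset)
qed

text \<open>Reflection of one half-line and translation of the other bring both truncated integrals
  to \<open>{\<epsilon>..1}\<close>, where they combine into the difference quotient; its continuity
  at 0 gives the limit.\<close>

lemma hilbert_transform_sum:
  fixes e :: "'i \<Rightarrow> 'e::banach"
  assumes u: "\<And>i. i \<in> I \<Longrightarrow> C1_on c (u i) (u' i)" and I: "finite I" and x: "x \<in> {c..c+1}"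
  shows "hilbert_transform (\<lambda>y. \<Sum>i\<in>I. u i y *\<^sub>R e i) x = (\<Sum>i\<in>I. hilb (u' i) x *\<^sub>R e i)"
proof -
  define F where "F = (\<lambda>y. \<Sum>i\<in>I. u i y *\<^sub>R e i)"
  have F0: "F y = 0" if "y \<notin> {c..c+1}" for y
    unfolding F_def using C1_onD(3)[OF u that] by (intro sum.neutral) auto
  have contF: "continuous_on S F" for S
    unfolding F_def by (intro continuous_intros C1_onD(4)[OF u])
  have contF': "continuous_on S (\<lambda>t. F (g t))" if "continuous_on S g" for S g
    using continuous_on_compose2[OF contF[of UNIV] that] by auto
  define Q where "Q = (\<lambda>\<epsilon>. integral {\<epsilon>..1} (\<lambda>t. \<Sum>i\<in>I. dquot (u' i) x t *\<^sub>R e i))"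
  have trunc: "integral {..x - \<epsilon>} (\<lambda>y. F y /\<^sub>R (x - y)) + integral {x + \<epsilon>..} (\<lambda>y. F y /\<^sub>R (x - y)) = Q \<epsilon>"
    if \<epsilon>: "\<epsilon> \<in> {0<..<1}" for \<epsilon>
  proof -
    define f1 where "f1 = (\<lambda>t. F (x - t) /\<^sub>R t)"
    define f2 where "f2 = (\<lambda>t. - (F (x + t) /\<^sub>R t))"
    have i1: "f1 integrable_on {\<epsilon>..1}" and i2: "f2 integrable_on {\<epsilon>..1}"
      unfolding f1_def f2_def by (intro integrable_continuous_real continuous_intros contF'; use \<epsilon> in auto)+
    have "((\<lambda>y. f1 ((-1) *\<^sub>R y + x)) has_integral integral {\<epsilon>..1} f1) ((\<lambda>y. (-1) * y + x) ` {\<epsilon>..1})"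
      using has_integral_affinity[OF integrable_integral[OF i1, unfolded cbox_interval[symmetric]], of "-1" x] by simp
    also have "(\<lambda>y. (-1) * y + x) ` {\<epsilon>..1} = {x - 1..x - \<epsilon>}"
      using image_affinity_atLeastAtMost[of "-1" x \<epsilon> 1] \<epsilon> by (auto simp: algebra_simps)
    finally have a1: "((\<lambda>y. F y /\<^sub>R (x - y)) has_integral integral {\<epsilon>..1} f1) {x - 1..x - \<epsilon>}"
      by (simp add: f1_def)
    have "((\<lambda>y. F y /\<^sub>R (x - y)) has_integral integral {\<epsilon>..1} f1) {..x - \<epsilon>}"
      unfolding has_integral_restrict_UNIV[symmetric, of _ _ "{..x - \<epsilon>}"]
      using a1[unfolded has_integral_restrict_UNIV[symmetric, of _ _ "{x - 1..x - \<epsilon>}"]]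
    proof (rule has_integral_eq[rotated])
      fix y :: real
      have "F y = 0" if "y < x - 1" using F0[of y] x that by auto
      then show "(if y \<in> {x - 1..x - \<epsilon>} then F y /\<^sub>R (x - y) else 0) = (if y \<in> {..x - \<epsilon>} then F y /\<^sub>R (x - y) else 0)"
        by auto
    qed
    then have e1: "integral {..x - \<epsilon>} (\<lambda>y. F y /\<^sub>R (x - y)) = integral {\<epsilon>..1} f1" by (rule integral_unique)
    have "((\<lambda>y. f2 (1 *\<^sub>R y + (- x))) has_integral integral {\<epsilon>..1} f2) ((\<lambda>y. y + x) ` {\<epsilon>..1})"
      using has_integral_affinity[OF integrable_integral[OF i2, unfolded cbox_interval[symmetric]], of 1 "- x"] by simp
    also have "(\<lambda>y. y + x) ` {\<epsilon>..1} = {x + \<epsilon>..x + 1}"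
      by (simp add: add.commute)
    also have "(\<lambda>y. f2 (1 *\<^sub>R y + (- x))) = (\<lambda>y. F y /\<^sub>R (x - y))"
    proof
      fix y
      have "inverse (x - y) = - inverse (y - x)" by (metis inverse_minus_eq minus_diff_eq)
      then show "f2 (1 *\<^sub>R y + (- x)) = F y /\<^sub>R (x - y)" by (simp add: f2_def)
    qed
    finally have a2: "((\<lambda>y. F y /\<^sub>R (x - y)) has_integral integral {\<epsilon>..1} f2) {x + \<epsilon>..x + 1}" .
    have "((\<lambda>y. F y /\<^sub>R (x - y)) has_integral integral {\<epsilon>..1} f2) {x + \<epsilon>..}"
      unfolding has_integral_restrict_UNIV[symmetric, of _ _ "{x + \<epsilon>..}"]
      using a2[unfolded has_integral_restrict_UNIV[symmetric, of _ _ "{x + \<epsilon>..x + 1}"]]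
    proof (rule has_integral_eq[rotated])
      fix y :: real
      have "F y = 0" if "y > x + 1" using F0[of y] x that by auto
      then show "(if y \<in> {x + \<epsilon>..x + 1} then F y /\<^sub>R (x - y) else 0) = (if y \<in> {x + \<epsilon>..} then F y /\<^sub>R (x - y) else 0)"
        by auto
    qed
    then have e2: "integral {x + \<epsilon>..} (\<lambda>y. F y /\<^sub>R (x - y)) = integral {\<epsilon>..1} f2" by (rule integral_unique)
    have "integral {\<epsilon>..1} f1 + integral {\<epsilon>..1} f2 = integral {\<epsilon>..1} (\<lambda>t. f1 t + f2 t)"
      by (rule Henstock_Kurzweil_Integration.integral_add[OF i1 i2, symmetric])
    also have "\<dots> = Q \<epsilon>"
      unfolding Q_def
    proof (rule integral_cong)
      fix t assume "t \<in> {\<epsilon>..1}"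
      then have t: "t \<noteq> 0" using \<epsilon> by auto
      have "dquot (u' i) x t *\<^sub>R e i = (u i (x - t) *\<^sub>R e i) /\<^sub>R t - (u i (x + t) *\<^sub>R e i) /\<^sub>R t" if "i \<in> I" for i
        using dquot_eq[OF C1_onD(1)[OF u[OF that]] t, of x]
        by (simp add: scaleR_diff_left divide_inverse right_diff_distrib mult.commute)
      then show "f1 t + f2 t = (\<Sum>i\<in>I. dquot (u' i) x t *\<^sub>R e i)"
        by (simp add: f1_def f2_def F_def scaleR_sum_right sum_subtractf)
    qed
    finally show ?thesis unfolding e1 e2 .
  qed
  have di: "dquot (u' i) x integrable_on {a..b}" if "i \<in> I" for i a b
    by (intro integrable_continuous_real continuous_on_dquot_snd C1_onD(2)[OF u[OF that]])
  have Qs: "Q \<epsilon> = (\<Sum>i\<in>I. integral {\<epsilon>..1} (dquot (u' i) x) *\<^sub>R e i)" for \<epsilon>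
    unfolding Q_def
    by (rule integral_unique, intro has_integral_sum I has_integral_scaleR_left integrable_integral di)
  have lim1: "((\<lambda>\<epsilon>. integral {\<epsilon>..1} (dquot (u' i) x)) \<longlongrightarrow> integral {0..1} (dquot (u' i) x)) (at_right 0)" if "i \<in> I" for i
  proof -
    have "continuous_on {0..1} (\<lambda>\<epsilon>. integral {\<epsilon>..1} (dquot (u' i) x))"
      by (rule indefinite_integral_continuous_1') (rule di[OF that])
    then have "((\<lambda>\<epsilon>. integral {\<epsilon>..1} (dquot (u' i) x)) \<longlongrightarrow> integral {0..1} (dquot (u' i) x)) (at 0 within {0..1})"
      by (simp add: continuous_on_def)
    then show ?thesis by (simp add: at_within_Icc_at_right)
  qed
  have "((\<lambda>\<epsilon>. (1 / pi) *\<^sub>R Q \<epsilon>) \<longlongrightarrow> (1 / pi) *\<^sub>R (\<Sum>i\<in>I. integral {0..1} (dquot (u' i) x) *\<^sub>R e i)) (at_right 0)"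
    unfolding Qs by (intro tendsto_intros lim1)
  moreover have "(1 / pi) *\<^sub>R (\<Sum>i\<in>I. integral {0..1} (dquot (u' i) x) *\<^sub>R e i) = (\<Sum>i\<in>I. hilb (u' i) x *\<^sub>R e i)"
    by (simp add: hilb_def scaleR_sum_right)
  ultimately have "((\<lambda>\<epsilon>. (1 / pi) *\<^sub>R Q \<epsilon>) \<longlongrightarrow> (\<Sum>i\<in>I. hilb (u' i) x *\<^sub>R e i)) (at_right 0)" by simp
  then have "((\<lambda>\<epsilon>. (1 / pi) *\<^sub>R (integral {..x - \<epsilon>} (\<lambda>y. F y /\<^sub>R (x - y)) + integral {x + \<epsilon>..} (\<lambda>y. F y /\<^sub>R (x - y))))
      \<longlongrightarrow> (\<Sum>i\<in>I. hilb (u' i) x *\<^sub>R e i)) (at_right 0)"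
    by (rule Lim_transform_eventually) (auto intro!: eventually_at_rightI[of 0 1] simp: trunc)
  then show ?thesis
    unfolding hilbert_transform_def F_def[symmetric] by (intro tendsto_Lim) simp_all
qed

lemma C1_on_mult:
  assumes "C1_on c h h'" "\<And>x. (w has_real_derivative w' x) (at x)" "continuous_on UNIV w'"
  shows "C1_on c (\<lambda>x. h x * w x) (\<lambda>x. h' x * w x + h x * w' x)"
proof -
  have "continuous_on UNIV w" using assms(2) by (meson DERIV_isCont continuous_at_imp_continuous_on)
  moreover have "((\<lambda>x. h x * w x) has_real_derivative h' x * w x + h x * w' x) (at x)" for x
    using DERIV_mult[OF C1_onD(1)[OF assms(1)] assms(2), of x] by (simp add: add.commute mult.commute)
  ultimately show ?thesis
    unfolding C1_on_def using assms C1_onD[OF assms(1)] by (auto intro!: continuous_intros)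
qed

lemma integral_sinc_scaled:
  assumes "\<omega> > 0"
  shows "((\<lambda>t. \<omega> * sinc (\<omega> * t)) has_integral Si \<omega>) {0..1}"
proof -
  have "((\<lambda>t. Si (\<omega> * t)) has_vector_derivative \<omega> * sinc (\<omega> * t)) (at t within {0..1})" for t
  proof -
    have "((\<lambda>t. Si (\<omega> * t)) has_real_derivative sinc (\<omega> * t) * \<omega>) (at t)"
      by (rule DERIV_chain2[OF DERIV_Si]) (auto intro!: derivative_eq_intros)
    then show ?thesis
      by (simp only: has_real_derivative_iff_has_vector_derivative mult.commute has_vector_derivative_at_within)
  qed
  then have "((\<lambda>t. \<omega> * sinc (\<omega> * t)) has_integral (Si (\<omega> * 1) - Si (\<omega> * 0))) {0..1}"
    by (rule fundamental_theorem_of_calculus[rotated]) simp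
  moreover have "Si 0 = 0" by (simp add: Si_def zero_ereal_def[symmetric])
  ultimately show ?thesis by simp
qed

text \<open>The continuous extension of \<open>(u (x - t) + u (x + t) - 2 * u x) / t\<close>;
  subtracting \<open>2 * u x\<close> isolates the singular part that the sine integral takes care
  of.\<close>

definition dquot2 :: "(real \<Rightarrow> real) \<Rightarrow> real \<Rightarrow> real \<Rightarrow> real" where
  "dquot2 u' x t = integral {0..1} (\<lambda>s. u' (x + s * t)) - integral {-1..0} (\<lambda>s. u' (x + s * t))"

lemma dquot2_eq:
  assumes "\<And>x. (u has_real_derivative u' x) (at x)" "t \<noteq> 0"
  shows "dquot2 u' x t = (u (x - t) + u (x + t) - 2 * u x) / t"
  unfolding dquot2_def
  using integral_unique[OF integral_affine_derivative[OF assms, where a = 0 and b = 1 and x = x]]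
    integral_unique[OF integral_affine_derivative[OF assms, where a = "-1" and b = 0 and x = x]]
  by (simp add: diff_divide_distrib add_divide_distrib)

lemma continuous_on_dquot2:
  assumes "continuous_on UNIV u'"
  shows "continuous_on UNIV (\<lambda>(x, t). dquot2 u' x t)"
proof -
  have "continuous_on UNIV (\<lambda>p. integral (cbox a b) (\<lambda>s. u' (fst p + s * snd p)))" for a b :: real
    by (rule integral_continuous_on_param)
       (auto simp: case_prod_unfold intro!: continuous_intros continuous_on_compose2[OF assms])
  from this[of 0 1] this[of "-1" 0] show ?thesis
    by (auto simp: dquot2_def case_prod_unfold intro!: continuous_intros)
qed

lemma continuous_on_dquot2_snd:
  assumes "continuous_on UNIV u'"
  shows "continuous_on S (dquot2 u' x)"
proof -
  have "continuous_on S (\<lambda>t. (x, t))" by (intro continuous_on_Pair continuous_on_const continuous_on_id)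
  from continuous_on_compose2[OF continuous_on_dquot2[OF assms] this] show ?thesis by simp
qed

text \<open>By the addition formulas \<open>cos (\<omega> * t)\<close> meets the regular quotient
  \<open>dquot\<close>, while \<open>sin (\<omega> * t) / t\<close> meets
  \<open>h (x - t) + h (x + t)\<close>, whose part \<open>2 * h x\<close> integrates to
  \<open>Si \<omega>\<close>. For large \<open>\<omega>\<close> only this last term survives and
  tends to \<open>pi / 2\<close>, so a modulating cosine becomes a sine.\<close>

lemma hilb_modulated:
  assumes h: "C1_on c h h'" and \<omega>: "\<omega> > 0"
    and u: "C1_on c (\<lambda>y. h y * cos (\<omega> * y + \<theta>)) u'"
  shows "hilb u' x = (1 / pi) * (cos (\<omega> * x + \<theta>) * integral {0..1} (\<lambda>t. dquot h' x t * cos (\<omega> * t))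
    + sin (\<omega> * x + \<theta>) * (integral {0..1} (\<lambda>t. dquot2 h' x t * sin (\<omega> * t)) + 2 * h x * Si \<omega>))"
proof -
  define \<alpha> where "\<alpha> = \<omega> * x + \<theta>"
  have i1: "(\<lambda>t. dquot h' x t * cos (\<omega> * t)) integrable_on {0..1}"
    by (intro integrable_continuous_real continuous_intros continuous_on_dquot_snd C1_onD(2)[OF h])
  have i2: "(\<lambda>t. dquot2 h' x t * sin (\<omega> * t)) integrable_on {0..1}"
    by (intro integrable_continuous_real continuous_intros continuous_on_dquot2_snd C1_onD(2)[OF h])
  have "((\<lambda>t. cos \<alpha> * (dquot h' x t * cos (\<omega> * t)) + sin \<alpha> * (dquot2 h' x t * sin (\<omega> * t) + 2 * h x * (\<omega> * sinc (\<omega> * t))))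
     has_integral (cos \<alpha> * integral {0..1} (\<lambda>t. dquot h' x t * cos (\<omega> * t))
       + sin \<alpha> * (integral {0..1} (\<lambda>t. dquot2 h' x t * sin (\<omega> * t)) + 2 * h x * Si \<omega>))) {0..1}"
    by (intro has_integral_add has_integral_mult_right integrable_integral i1 i2 integral_sinc_scaled \<omega>)
  then have "(dquot u' x has_integral (cos \<alpha> * integral {0..1} (\<lambda>t. dquot h' x t * cos (\<omega> * t))
       + sin \<alpha> * (integral {0..1} (\<lambda>t. dquot2 h' x t * sin (\<omega> * t)) + 2 * h x * Si \<omega>))) {0..1}"
  proof (rule has_integral_spike[OF negligible_sing[of 0], rotated])
    fix t :: real assume "t \<in> {0..1} - {0}"
    then have t: "t \<noteq> 0" by auto
    have c: "cos (\<omega> * (x - t) + \<theta>) = cos \<alpha> * cos (\<omega> * t) + sin \<alpha> * sin (\<omega> * t)"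
      "cos (\<omega> * (x + t) + \<theta>) = cos \<alpha> * cos (\<omega> * t) - sin \<alpha> * sin (\<omega> * t)"
      using cos_diff[of \<alpha> "\<omega> * t"] cos_add[of \<alpha> "\<omega> * t"] by (simp_all add: \<alpha>_def algebra_simps)
    show "dquot u' x t = cos \<alpha> * (dquot h' x t * cos (\<omega> * t)) + sin \<alpha> * (dquot2 h' x t * sin (\<omega> * t) + 2 * h x * (\<omega> * sinc (\<omega> * t)))"
      unfolding dquot_eq[OF C1_onD(1)[OF u] t] dquot_eq[OF C1_onD(1)[OF h] t] dquot2_eq[OF C1_onD(1)[OF h] t] c
      using t \<omega> by (simp add: field_simps)
  qed
  then show ?thesis unfolding hilb_def \<alpha>_def by (simp add: integral_unique)
qed

lemma sin_cos_2pi_nat: "sin (2 * pi * real m) = 0" "cos (2 * pi * real m) = 1"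
  using sin_2npi[of m] cos_2npi[of m] by (simp_all only: mult_ac)

lemma integral_trig_period:
  assumes "m > 0"
  shows "integral {0..1} (\<lambda>x. cos (2 * pi * real m * x + \<theta>)) = 0"
proof -
  have "((\<lambda>x. sin (2 * pi * real m * x + \<theta>) / (2 * pi * real m)) has_vector_derivative cos (2 * pi * real m * x + \<theta>)) (at x within {0..1})" for x
    using assms by (auto intro!: derivative_eq_intros simp: has_real_derivative_iff_has_vector_derivative[symmetric])
  note F = fundamental_theorem_of_calculus[rotated, OF this]
  have "integral {0..1} (\<lambda>x. cos (2 * pi * real m * x + \<theta>)) =
      sin (2 * pi * real m * 1 + \<theta>) / (2 * pi * real m) - sin (2 * pi * real m * 0 + \<theta>) / (2 * pi * real m)"
    by (rule integral_unique, rule F) simp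
  also have "sin (2 * pi * real m * 1 + \<theta>) = sin \<theta>"
    using sin_add[of "2 * pi * real m" \<theta>] by (simp add: sin_cos_2pi_nat)
  finally show ?thesis by simp
qed

lemma riemann_lebesgue_cos:
  assumes "continuous_on {0..1} q" "m > 0"
  shows "(\<lambda>\<Lambda>. integral {0..1} (\<lambda>t. q t * cos (2 * pi * real m * real \<Lambda> * t + \<theta>))) \<longlonglongrightarrow> 0"
proof -
  have per: "cos (2 * pi * real m * (x + 1) + \<theta>) = cos (2 * pi * real m * x + \<theta>)" for x
  proof -
    have e: "2 * pi * real m * (x + 1) + \<theta> = (2 * pi * real m * x + \<theta>) + 2 * pi * real m" by (simp add: algebra_simps)
    show ?thesis unfolding e cos_add[of _ "2 * pi * real m"] sin_cos_2pi_nat by simp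
  qed
  have "(\<lambda>\<Lambda>. integral {0..1} (\<lambda>t. q t * (\<lambda>t. cos (2 * pi * real m * t + \<theta>)) (real \<Lambda> * t))) \<longlonglongrightarrow> 0"
    by (rule fejer_mean_zero) (use assms per in \<open>auto intro!: continuous_intros simp: integral_trig_period\<close>)
  then show ?thesis by (simp add: mult.assoc)
qed

lemma riemann_lebesgue_sin:
  assumes "continuous_on {0..1} q" "m > 0"
  shows "(\<lambda>\<Lambda>. integral {0..1} (\<lambda>t. q t * sin (2 * pi * real m * real \<Lambda> * t))) \<longlonglongrightarrow> 0"
proof -
  have "sin y = cos (y + (- (pi / 2)))" for y :: real by (simp add: cos_diff flip: diff_conv_add_uminus)
  then show ?thesis using riemann_lebesgue_cos[OF assms, of "- (pi / 2)"] by simp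
qed

text \<open>Under dilation of \<open>w\<close>, the Hilbert transform of the modulated bump behaves
  like \<open>h x * v (\<Lambda> * x)\<close>. Convergence is merely pointwise; the uniform bound is
  included for dominated convergence.\<close>

definition hasym :: "real \<Rightarrow> (real \<Rightarrow> real) \<Rightarrow> (real \<Rightarrow> real) \<Rightarrow> (real \<Rightarrow> real) \<Rightarrow> (real \<Rightarrow> real) \<Rightarrow> bool" where
  "hasym c h h' w v \<longleftrightarrow> (\<exists>w'. (\<forall>x. (w has_real_derivative w' x) (at x)) \<and> continuous_on UNIV w' \<and>
     (\<forall>x\<in>{c..c+1}. (\<lambda>\<Lambda>::nat. hilb (\<lambda>y. h' y * w (\<Lambda> * y) + h y * (\<Lambda> * w' (\<Lambda> * y))) x - h x * v (\<Lambda> * x)) \<longlonglongrightarrow> 0) \<and>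
     (\<exists>K. \<forall>\<Lambda>::nat. \<forall>x\<in>{c..c+1}. \<bar>hilb (\<lambda>y. h' y * w (\<Lambda> * y) + h y * (\<Lambda> * w' (\<Lambda> * y))) x\<bar> \<le> K))"

lemma C1_on_dilated:
  assumes "C1_on c h h'" "\<And>x. (w has_real_derivative w' x) (at x)" "continuous_on UNIV w'"
  shows "C1_on c (\<lambda>y. h y * w (\<Lambda> * y)) (\<lambda>y. h' y * w (\<Lambda> * y) + h y * (\<Lambda> * w' (\<Lambda> * y)))"
proof (rule C1_on_mult[OF assms(1)])
  show "((\<lambda>y. w (\<Lambda> * y)) has_real_derivative \<Lambda> * w' (\<Lambda> * x)) (at x)" for x
    unfolding mult.commute[of \<Lambda> "w' (\<Lambda> * x)"] by (rule DERIV_chain2[OF assms(2)]) (auto intro!: derivative_eq_intros)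
  show "continuous_on UNIV (\<lambda>y. \<Lambda> * w' (\<Lambda> * y))"
    by (intro continuous_intros continuous_on_compose2[OF assms(3)]) auto
qed

lemma compact_box_bound:
  fixes f :: "real \<Rightarrow> real \<Rightarrow> real"
  assumes "continuous_on UNIV (\<lambda>(x, t). f x t)"
  shows "\<exists>K\<ge>0. \<forall>x\<in>{a..b}. \<forall>t\<in>{a'..b'}. \<bar>f x t\<bar> \<le> K"
proof -
  have "compact ((\<lambda>(x, t). f x t) ` ({a..b} \<times> {a'..b'}))"
    by (intro compact_continuous_image continuous_on_subset[OF assms] compact_Times compact_Icc) auto
  then have "bounded ((\<lambda>(x, t). f x t) ` ({a..b} \<times> {a'..b'}))" by (rule compact_imp_bounded)
  then obtain K where K: "K > 0" "\<forall>y\<in>(\<lambda>(x, t). f x t) ` ({a..b} \<times> {a'..b'}). norm y \<le> K"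
    unfolding bounded_pos by (elim exE conjE)
  show ?thesis
  proof (intro exI[of _ K] conjI ballI)
    show "\<bar>f x t\<bar> \<le> K" if "x \<in> {a..b}" "t \<in> {a'..b'}" for x t
    proof -
      have "f x t \<in> (\<lambda>(x, t). f x t) ` ({a..b} \<times> {a'..b'})"
        by (rule image_eqI[where x = "(x, t)"]) (use that in auto)
      then show ?thesis using K(2) by auto
    qed
  qed (use K in simp)
qed

lemma abs_integral_01_le:
  assumes "continuous_on {0..1} (f :: real \<Rightarrow> real)" "\<And>t. t \<in> {0..1} \<Longrightarrow> \<bar>f t\<bar> \<le> K"
  shows "\<bar>integral {0..1} f\<bar> \<le> K"
  using integral_bound[of 0 1 f K] assms by simp

lemma hasym_cos:
  assumes h: "C1_on c h h'" and m: "m > 0"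
  shows "hasym c h h' (\<lambda>y. cos (2 * pi * real m * y + \<theta>)) (\<lambda>y. sin (2 * pi * real m * y + \<theta>))"
proof -
  define w' where "w' = (\<lambda>y. - sin (2 * pi * real m * y + \<theta>) * (2 * pi * real m))"
  have w: "((\<lambda>y. cos (2 * pi * real m * y + \<theta>)) has_real_derivative w' x) (at x)" for x
    unfolding w'_def by (auto intro!: derivative_eq_intros)
  have w'c: "continuous_on UNIV w'" unfolding w'_def by (intro continuous_intros)
  define U where "U = (\<lambda>(\<Lambda>::nat) y. h' y * cos (2 * pi * real m * (\<Lambda> * y) + \<theta>) + h y * (\<Lambda> * w' (\<Lambda> * y)))"
  define I1 where "I1 = (\<lambda>(\<Lambda>::nat) x. integral {0..1} (\<lambda>t. dquot h' x t * cos (2 * pi * real m * \<Lambda> * t)))"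
  define I2 where "I2 = (\<lambda>(\<Lambda>::nat) x. integral {0..1} (\<lambda>t. dquot2 h' x t * sin (2 * pi * real m * \<Lambda> * t)))"
  have form: "hilb (U \<Lambda>) x = (1 / pi) * (cos (2 * pi * real m * \<Lambda> * x + \<theta>) * I1 \<Lambda> x
     + sin (2 * pi * real m * \<Lambda> * x + \<theta>) * (I2 \<Lambda> x + 2 * h x * Si (2 * pi * real m * \<Lambda>)))" if "\<Lambda> > 0" for \<Lambda> x
    unfolding I1_def I2_def
  proof (rule hilb_modulated[OF h])
    show "C1_on c (\<lambda>y. h y * cos (2 * pi * real m * \<Lambda> * y + \<theta>)) (U \<Lambda>)"
      using C1_on_dilated[OF h w w'c, of "real \<Lambda>"] by (simp add: U_def mult.assoc)
  qed (use m that in simp)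
  have h'c: "continuous_on UNIV h'" by (rule C1_onD(2)[OF h])
  have "(\<lambda>\<Lambda>. hilb (U \<Lambda>) x - h x * sin (2 * pi * real m * (\<Lambda> * x) + \<theta>)) \<longlonglongrightarrow> 0" for x :: real
  proof -
    have l1: "(\<lambda>\<Lambda>. I1 \<Lambda> x) \<longlonglongrightarrow> 0"
      unfolding I1_def using riemann_lebesgue_cos[OF continuous_on_dquot_snd[OF h'c] m, of x 0] by simp
    have l2: "(\<lambda>\<Lambda>. I2 \<Lambda> x) \<longlonglongrightarrow> 0"
      unfolding I2_def by (rule riemann_lebesgue_sin[OF continuous_on_dquot2_snd[OF h'c] m])
    have l3: "(\<lambda>\<Lambda>. Si (2 * pi * real m * real \<Lambda>) - pi / 2) \<longlonglongrightarrow> 0"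
    proof -
      have "filterlim (\<lambda>\<Lambda>. 2 * pi * real m * real \<Lambda>) at_top sequentially"
        by (rule filterlim_tendsto_pos_mult_at_top[OF tendsto_const _ filterlim_real_sequentially]) (use m in simp)
      from filterlim_compose[OF Si_at_top this] show ?thesis by (simp add: LIM_zero_iff)
    qed
    have "(\<lambda>\<Lambda>. \<bar>I1 \<Lambda> x\<bar> + \<bar>I2 \<Lambda> x\<bar> + 2 * \<bar>h x\<bar> * \<bar>Si (2 * pi * real m * real \<Lambda>) - pi / 2\<bar>) \<longlonglongrightarrow> \<bar>0\<bar> + \<bar>0\<bar> + 2 * \<bar>h x\<bar> * \<bar>0\<bar>"
      by (intro tendsto_intros l1 l2 l3)
    then have lim: "(\<lambda>\<Lambda>. \<bar>I1 \<Lambda> x\<bar> + \<bar>I2 \<Lambda> x\<bar> + 2 * \<bar>h x\<bar> * \<bar>Si (2 * pi * real m * real \<Lambda>) - pi / 2\<bar>) \<longlonglongrightarrow> 0" by simp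
    show ?thesis
    proof (rule Lim_null_comparison[OF _ lim], rule eventually_sequentiallyI[of 1])
      fix \<Lambda> :: nat assume "1 \<le> \<Lambda>"
      define \<alpha> where "\<alpha> = 2 * pi * real m * \<Lambda> * x + \<theta>"
      define s where "s = Si (2 * pi * real m * real \<Lambda>) - pi / 2"
      have "hilb (U \<Lambda>) x - h x * sin \<alpha> = (1 / pi) * (cos \<alpha> * I1 \<Lambda> x + sin \<alpha> * (I2 \<Lambda> x + 2 * h x * s))"
      proof -
        have alg: "1 / pi * (a + q * (b + 2 * h x * (s + pi / 2))) - h x * q = 1 / pi * (a + q * (b + 2 * h x * s))" for a b q
          by (simp add: field_simps)
        have S: "Si (2 * pi * real m * \<Lambda>) = s + pi / 2" by (simp add: s_def)
        have \<Lambda>: "\<Lambda> > 0" using \<open>1 \<le> \<Lambda>\<close> by simp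
        show ?thesis unfolding form[OF \<Lambda>] S \<alpha>_def[symmetric] by (rule alg)
      qed
      also have "\<bar>\<dots>\<bar> \<le> 1 * (1 * \<bar>I1 \<Lambda> x\<bar> + 1 * (\<bar>I2 \<Lambda> x\<bar> + 2 * \<bar>h x\<bar> * \<bar>s\<bar>))"
        unfolding abs_mult
      proof (rule mult_mono)
        show "\<bar>1 / pi\<bar> \<le> 1" using pi_gt3 by simp
        have "\<bar>cos \<alpha> * I1 \<Lambda> x\<bar> \<le> 1 * \<bar>I1 \<Lambda> x\<bar>" unfolding abs_mult by (intro mult_right_mono) auto
        moreover have "\<bar>sin \<alpha> * (I2 \<Lambda> x + 2 * h x * s)\<bar> \<le> 1 * (\<bar>I2 \<Lambda> x\<bar> + 2 * \<bar>h x\<bar> * \<bar>s\<bar>)"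
          unfolding abs_mult
        proof (rule mult_mono)
          show "\<bar>I2 \<Lambda> x + 2 * h x * s\<bar> \<le> \<bar>I2 \<Lambda> x\<bar> + 2 * \<bar>h x\<bar> * \<bar>s\<bar>"
            by (rule order_trans[OF abs_triangle_ineq]) (simp add: abs_mult)
        qed auto
        ultimately show "\<bar>cos \<alpha> * I1 \<Lambda> x + sin \<alpha> * (I2 \<Lambda> x + 2 * h x * s)\<bar> \<le> 1 * \<bar>I1 \<Lambda> x\<bar> + 1 * (\<bar>I2 \<Lambda> x\<bar> + 2 * \<bar>h x\<bar> * \<bar>s\<bar>)"
          by linarith
      qed auto
      finally show "norm (hilb (U \<Lambda>) x - h x * sin (2 * pi * real m * (\<Lambda> * x) + \<theta>))
          \<le> \<bar>I1 \<Lambda> x\<bar> + \<bar>I2 \<Lambda> x\<bar> + 2 * \<bar>h x\<bar> * \<bar>Si (2 * pi * real m * real \<Lambda>) - pi / 2\<bar>"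
        by (simp add: \<alpha>_def s_def mult.assoc)
    qed
  qed
  moreover have "\<exists>K. \<forall>\<Lambda>::nat. \<forall>x\<in>{c..c+1}. \<bar>hilb (U \<Lambda>) x\<bar> \<le> K"
  proof -
    have "\<exists>K\<ge>0. \<forall>x\<in>{c..c+1}. \<forall>t\<in>{0..1}. \<bar>dquot h' x t\<bar> \<le> K"
      by (rule compact_box_bound[where f = "dquot h'"]) (rule continuous_on_dquot[OF h'c])
    then obtain K1 where K1: "K1 \<ge> 0" "\<forall>x\<in>{c..c+1}. \<forall>t\<in>{0..1}. \<bar>dquot h' x t\<bar> \<le> K1"
      by (elim exE conjE)
    have "\<exists>K\<ge>0. \<forall>x\<in>{c..c+1}. \<forall>t\<in>{0..1}. \<bar>dquot2 h' x t\<bar> \<le> K"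
      by (rule compact_box_bound[where f = "dquot2 h'"]) (rule continuous_on_dquot2[OF h'c])
    then obtain K2 where K2: "K2 \<ge> 0" "\<forall>x\<in>{c..c+1}. \<forall>t\<in>{0..1}. \<bar>dquot2 h' x t\<bar> \<le> K2"
      by (elim exE conjE)
    have bd: "\<exists>K\<ge>0. \<forall>x\<in>{c..c+1}. \<bar>k x\<bar> \<le> K" if "continuous_on UNIV k" for k :: "real \<Rightarrow> real"
    proof -
      have "compact (k ` {c..c+1})" by (intro compact_continuous_image continuous_on_subset[OF that]) auto
      then have "bounded (k ` {c..c+1})" by (rule compact_imp_bounded)
      then obtain K where K: "K > 0" "\<forall>y\<in>k ` {c..c+1}. norm y \<le> K"
        unfolding bounded_pos by (elim exE conjE)
      show ?thesis by (intro exI[of _ K]) (use K in auto)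
    qed
    obtain K3 where K3: "K3 \<ge> 0" "\<forall>x\<in>{c..c+1}. \<bar>h x\<bar> \<le> K3"
      using bd[OF C1_onD(4)[OF h]] by (elim exE conjE)
    obtain B where B: "\<And>T. \<bar>Si T\<bar> \<le> B" using bounded_Si by blast
    have B0: "B \<ge> 0" using B[of 0] by linarith
    have cU0: "continuous_on UNIV (U 0)"
      unfolding U_def by (auto intro!: continuous_intros h'c)
    \<comment> \<open>The formula \<open>form\<close> excludes \<open>\<Lambda> = 0\<close>, which
      gets a bound of its own.\<close>
    obtain K0 where K0: "K0 \<ge> 0" "\<forall>x\<in>{c..c+1}. \<bar>hilb (U 0) x\<bar> \<le> K0"
      using bd[OF continuous_on_hilb[OF cU0]] by (elim exE conjE)
    have "\<bar>hilb (U \<Lambda>) x\<bar> \<le> K0 + (K1 + (K2 + 2 * K3 * B))" if x: "x \<in> {c..c+1}" for \<Lambda> :: nat and x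
    proof (cases "\<Lambda> = 0")
      case True
      then show ?thesis using K0(2) x K1 K2 K3 B0 by (auto intro!: add_increasing2)
    next
      case False
      have b1: "\<bar>I1 \<Lambda> x\<bar> \<le> K1"
        unfolding I1_def
      proof (rule abs_integral_01_le)
        show "continuous_on {0..1} (\<lambda>t. dquot h' x t * cos (2 * pi * real m * \<Lambda> * t))"
          by (intro continuous_intros continuous_on_dquot_snd h'c)
        fix t :: real assume t: "t \<in> {0..1}"
        have "\<bar>dquot h' x t * cos (2 * pi * real m * \<Lambda> * t)\<bar> \<le> K1 * 1"
          unfolding abs_mult using K1 x t by (intro mult_mono) auto
        then show "\<bar>dquot h' x t * cos (2 * pi * real m * \<Lambda> * t)\<bar> \<le> K1" by simp
      qed
      have b2: "\<bar>I2 \<Lambda> x\<bar> \<le> K2"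
        unfolding I2_def
      proof (rule abs_integral_01_le)
        show "continuous_on {0..1} (\<lambda>t. dquot2 h' x t * sin (2 * pi * real m * \<Lambda> * t))"
          by (intro continuous_intros continuous_on_dquot2_snd h'c)
        fix t :: real assume t: "t \<in> {0..1}"
        have "\<bar>dquot2 h' x t * sin (2 * pi * real m * \<Lambda> * t)\<bar> \<le> K2 * 1"
          unfolding abs_mult using K2 x t by (intro mult_mono) auto
        then show "\<bar>dquot2 h' x t * sin (2 * pi * real m * \<Lambda> * t)\<bar> \<le> K2" by simp
      qed
      have b3: "\<bar>2 * h x * Si (2 * pi * real m * \<Lambda>)\<bar> \<le> 2 * K3 * B"
        unfolding abs_mult using K3 x B by (intro mult_mono) auto
      have "\<bar>hilb (U \<Lambda>) x\<bar> \<le> 1 * (1 * K1 + 1 * (K2 + 2 * K3 * B))"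
        unfolding form[OF \<open>\<Lambda> \<noteq> 0\<close>[unfolded neq0_conv]] abs_mult[of "1 / pi"]
      proof (rule mult_mono)
        show "\<bar>1 / pi\<bar> \<le> 1" using pi_gt3 by simp
        show "\<bar>cos (2 * pi * real m * \<Lambda> * x + \<theta>) * I1 \<Lambda> x +
            sin (2 * pi * real m * \<Lambda> * x + \<theta>) * (I2 \<Lambda> x + 2 * h x * Si (2 * pi * real m * \<Lambda>))\<bar>
            \<le> 1 * K1 + 1 * (K2 + 2 * K3 * B)"
        proof (rule order_trans[OF abs_triangle_ineq], rule add_mono)
          show "\<bar>cos (2 * pi * real m * \<Lambda> * x + \<theta>) * I1 \<Lambda> x\<bar> \<le> 1 * K1"
            unfolding abs_mult using b1 by (intro mult_mono) auto
          have "\<bar>I2 \<Lambda> x + 2 * h x * Si (2 * pi * real m * \<Lambda>)\<bar> \<le> K2 + 2 * K3 * B"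
            using b2 b3 by linarith
          then show "\<bar>sin (2 * pi * real m * \<Lambda> * x + \<theta>) * (I2 \<Lambda> x + 2 * h x * Si (2 * pi * real m * \<Lambda>))\<bar>
              \<le> 1 * (K2 + 2 * K3 * B)"
            unfolding abs_mult[of "sin _"] by (intro mult_mono) auto
        qed
      qed (use K1 K2 K3 B0 in auto)
      then show ?thesis using K0 by simp
    qed
    then show ?thesis by blast
  qed
  ultimately show ?thesis unfolding hasym_def U_def
    using w w'c by (intro exI[of _ w']) blast
qed

lemma hilb_add:
  assumes "continuous_on UNIV u" "continuous_on UNIV v"
  shows "hilb (\<lambda>y. a * u y + b * v y) x = a * hilb u x + b * hilb v x"
proof -
  have c: "(\<lambda>s. w (x + s * t)) integrable_on {-1..1}" if "continuous_on UNIV w" for w :: "real \<Rightarrow> real" and t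
    by (intro integrable_continuous_real continuous_on_compose2[OF that] continuous_intros) auto
  have d: "dquot (\<lambda>y. a * u y + b * v y) x t = a * dquot u x t + b * dquot v x t" for t
  proof -
    have "((\<lambda>s. a * u (x + s * t) + b * v (x + s * t)) has_integral
        (a * integral {-1..1} (\<lambda>s. u (x + s * t)) + b * integral {-1..1} (\<lambda>s. v (x + s * t)))) {-1..1}"
      by (intro has_integral_add has_integral_mult_right integrable_integral c assms)
    then show ?thesis unfolding dquot_def by (simp add: integral_unique)
  qed
  have "((\<lambda>t. a * dquot u x t + b * dquot v x t) has_integral
      (a * integral {0..1} (dquot u x) + b * integral {0..1} (dquot v x))) {0..1}"
    by (intro has_integral_add has_integral_mult_right integrable_integral integrable_continuous_real
        continuous_on_dquot_snd assms)
  then have "integral {0..1} (dquot (\<lambda>y. a * u y + b * v y) x) = a * integral {0..1} (dquot u x) + b * integral {0..1} (dquot v x)"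
    unfolding d[abs_def] by (rule integral_unique)
  then show ?thesis by (simp add: hilb_def algebra_simps)
qed

lemma hasym_linear:
  assumes h: "C1_on c h h'" and w: "hasym c h h' w1 v1" "hasym c h h' w2 v2"
  shows "hasym c h h' (\<lambda>y. a * w1 y + b * w2 y) (\<lambda>y. a * v1 y + b * v2 y)"
proof -
  define U where "U = (\<lambda>w w' (\<Lambda>::nat) y. h' y * w (\<Lambda> * y) + h y * (\<Lambda> * w' (\<Lambda> * y)) :: real)"
  obtain w1' where 1: "\<forall>x. (w1 has_real_derivative w1' x) (at x)" "continuous_on UNIV w1'"
     "\<forall>x\<in>{c..c+1}. (\<lambda>\<Lambda>. hilb (U w1 w1' \<Lambda>) x - h x * v1 (\<Lambda> * x)) \<longlonglongrightarrow> 0"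
     "\<exists>K. \<forall>\<Lambda>. \<forall>x\<in>{c..c+1}. \<bar>hilb (U w1 w1' \<Lambda>) x\<bar> \<le> K"
    using w(1) unfolding hasym_def U_def by blast
  obtain w2' where 2: "\<forall>x. (w2 has_real_derivative w2' x) (at x)" "continuous_on UNIV w2'"
     "\<forall>x\<in>{c..c+1}. (\<lambda>\<Lambda>. hilb (U w2 w2' \<Lambda>) x - h x * v2 (\<Lambda> * x)) \<longlonglongrightarrow> 0"
     "\<exists>K. \<forall>\<Lambda>. \<forall>x\<in>{c..c+1}. \<bar>hilb (U w2 w2' \<Lambda>) x\<bar> \<le> K"
    using w(2) unfolding hasym_def U_def by blast
  define w where "w = (\<lambda>y. a * w1 y + b * w2 y)"
  define w' where "w' = (\<lambda>y. a * w1' y + b * w2' y)"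
  have cU: "continuous_on UNIV (U w1 w1' \<Lambda>)" "continuous_on UNIV (U w2 w2' \<Lambda>)" for \<Lambda>
    unfolding U_def using C1_onD(2)[OF C1_on_dilated[OF h, of w1 w1' "real \<Lambda>"]]
      C1_onD(2)[OF C1_on_dilated[OF h, of w2 w2' "real \<Lambda>"]] 1 2 by auto
  have UU: "U w w' \<Lambda> = (\<lambda>y. a * U w1 w1' \<Lambda> y + b * U w2 w2' \<Lambda> y)" for \<Lambda>
    by (rule ext) (simp add: U_def w_def w'_def algebra_simps)
  have H: "hilb (U w w' \<Lambda>) x = a * hilb (U w1 w1' \<Lambda>) x + b * hilb (U w2 w2' \<Lambda>) x" for \<Lambda> x
    unfolding UU by (rule hilb_add[OF cU])
  have "(w has_real_derivative w' x) (at x)" for x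
    unfolding w_def w'_def using 1(1) 2(1) by (intro DERIV_add DERIV_cmult) auto
  moreover have "continuous_on UNIV w'" unfolding w'_def by (intro continuous_intros 1 2)
  moreover have "(\<lambda>\<Lambda>. hilb (U w w' \<Lambda>) x - h x * (a * v1 (\<Lambda> * x) + b * v2 (\<Lambda> * x))) \<longlonglongrightarrow> 0" if x: "x \<in> {c..c+1}" for x :: real
  proof -
    have "(\<lambda>\<Lambda>. a * (hilb (U w1 w1' \<Lambda>) x - h x * v1 (\<Lambda> * x)) + b * (hilb (U w2 w2' \<Lambda>) x - h x * v2 (\<Lambda> * x))) \<longlonglongrightarrow> a * 0 + b * 0"
      using 1(3) 2(3) x by (intro tendsto_intros) auto
    then show ?thesis by (simp add: H algebra_simps)
  qed
  moreover have "\<exists>K. \<forall>\<Lambda>. \<forall>x\<in>{c..c+1}. \<bar>hilb (U w w' \<Lambda>) x\<bar> \<le> K"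
  proof -
    obtain K1 K2 where K: "\<forall>\<Lambda>. \<forall>x\<in>{c..c+1}. \<bar>hilb (U w1 w1' \<Lambda>) x\<bar> \<le> K1" "\<forall>\<Lambda>. \<forall>x\<in>{c..c+1}. \<bar>hilb (U w2 w2' \<Lambda>) x\<bar> \<le> K2"
      using 1(4) 2(4) by blast
    have "\<bar>hilb (U w w' \<Lambda>) x\<bar> \<le> \<bar>a\<bar> * K1 + \<bar>b\<bar> * K2" if x: "x \<in> {c..c+1}" for \<Lambda> x
    proof -
      have "\<bar>hilb (U w w' \<Lambda>) x\<bar> \<le> \<bar>a\<bar> * \<bar>hilb (U w1 w1' \<Lambda>) x\<bar> + \<bar>b\<bar> * \<bar>hilb (U w2 w2' \<Lambda>) x\<bar>"
        unfolding H abs_mult[symmetric] by (rule abs_triangle_ineq)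
      also have "\<dots> \<le> \<bar>a\<bar> * K1 + \<bar>b\<bar> * K2" using K x by (intro add_mono mult_left_mono) auto
      finally show ?thesis .
    qed
    then show ?thesis by (intro exI[of _ "\<bar>a\<bar> * K1 + \<bar>b\<bar> * K2"]) auto
  qed
  ultimately show ?thesis unfolding hasym_def w_def[symmetric]
    by (intro exI[of _ w']) (simp add: U_def)
qed

text \<open>
  Bedrosian's principle: a factor whose frequencies stay below \<open>m\<close> passes through the Hilbert
  transform.
\<close>

lemma hasym_product:
  fixes \<nu> :: "'i \<Rightarrow> nat"
  assumes h: "C1_on c h h'" and A: "finite A" and m: "(\<Sum>i\<in>A. \<nu> i) < m"
  shows "hasym c h h' (\<lambda>y. (\<Prod>i\<in>A. sin (2 * pi * real (\<nu> i) * y)) * cos (2 * pi * real m * y + \<theta>))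
    (\<lambda>y. (\<Prod>i\<in>A. sin (2 * pi * real (\<nu> i) * y)) * sin (2 * pi * real m * y + \<theta>))"
  using A m
proof (induction A arbitrary: m \<theta> rule: finite_induct)
  case empty
  then show ?case using hasym_cos[OF h, of m \<theta>] by simp
next
  case (insert i A)
  define S where "S = (\<lambda>y. \<Prod>i\<in>A. sin (2 * pi * real (\<nu> i) * y))"
  \<comment> \<open>The product formula yields sines; the phase shift writes them as cosines again,
    so that the induction hypothesis applies to \<open>m + \<nu> i\<close> and
    \<open>m - \<nu> i\<close>, both still above the remaining frequencies.\<close>
  define \<theta>' where "\<theta>' = \<theta> - pi / 2"
  have less: "(\<Sum>i\<in>A. \<nu> i) < m + \<nu> i" "(\<Sum>i\<in>A. \<nu> i) < m - \<nu> i" and le: "\<nu> i \<le> m" using insert by auto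
  have 1: "hasym c h h' (\<lambda>y. S y * cos (2 * pi * real (m + \<nu> i) * y + \<theta>')) (\<lambda>y. S y * sin (2 * pi * real (m + \<nu> i) * y + \<theta>'))"
    unfolding S_def by (rule insert.IH) (rule less)
  have 2: "hasym c h h' (\<lambda>y. S y * cos (2 * pi * real (m - \<nu> i) * y + \<theta>')) (\<lambda>y. S y * sin (2 * pi * real (m - \<nu> i) * y + \<theta>'))"
    unfolding S_def by (rule insert.IH) (rule less)
  have a: "2 * pi * real (m + \<nu> i) * y + \<theta>' = (2 * pi * real m * y + \<theta>) + 2 * pi * real (\<nu> i) * y - pi / 2"
    "2 * pi * real (m - \<nu> i) * y + \<theta>' = (2 * pi * real m * y + \<theta>) - 2 * pi * real (\<nu> i) * y - pi / 2" for y
    using le by (simp_all add: \<theta>'_def of_nat_diff algebra_simps)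
  have "cos (x + z - pi/2) = sin (x + z)" "sin (x + z - pi/2) = - cos (x + z)"
    "cos (x - z - pi/2) = sin (x - z)" "sin (x - z - pi/2) = - cos (x - z)" for x z :: real
    by (simp_all add: sin_diff[of _ "pi/2"] cos_diff[of _ "pi/2"])
  then have eq: "(1/2) * (S y * cos (2 * pi * real (m + \<nu> i) * y + \<theta>')) + (- (1/2)) * (S y * cos (2 * pi * real (m - \<nu> i) * y + \<theta>'))
       = (\<Prod>j\<in>insert i A. sin (2 * pi * real (\<nu> j) * y)) * cos (2 * pi * real m * y + \<theta>)"
    "(1/2) * (S y * sin (2 * pi * real (m + \<nu> i) * y + \<theta>')) + (- (1/2)) * (S y * sin (2 * pi * real (m - \<nu> i) * y + \<theta>'))
       = (\<Prod>j\<in>insert i A. sin (2 * pi * real (\<nu> j) * y)) * sin (2 * pi * real m * y + \<theta>)" for y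
    unfolding a using insert by (simp_all only: sin_add sin_diff cos_add cos_diff S_def prod.insert[OF insert(1,2)]) (simp_all add: algebra_simps)
  show ?case unfolding eq[symmetric] by (rule hasym_linear[OF h 1 2])
qed

section \<open>Lacunary products\<close>

definition sn :: "real \<Rightarrow> real" where "sn y = sin (2 * pi * y)"
definition cs :: "real \<Rightarrow> real" where "cs y = cos (2 * pi * y)"

text \<open>Quarter shifts fix all factors \<open>w i (4 ^ i * x)\<close> with \<open>i \<ge> 1\<close>, so averaging over them splits off the
  first factor of a lacunary product.\<close>

definition quarter_mean :: "(real \<Rightarrow> real) \<Rightarrow> real \<Rightarrow> bool" where
  "quarter_mean w \<mu> \<longleftrightarrow> continuous_on UNIV w \<and> (\<forall>x. w (x + 1) = w x) \<and>
     (\<forall>x. w x + w (x + 1/4) + w (x + 2/4) + w (x + 3/4) = 4 * \<mu>)"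

lemma sn_cs_shift:
  "sn (x + 1) = sn x" "sn (x + 1/4) = cs x" "sn (x + 2/4) = - sn x" "sn (x + 3/4) = - cs x"
  "cs (x + 1) = cs x" "cs (x + 1/4) = - sn x" "cs (x + 2/4) = - cs x" "cs (x + 3/4) = sn x"
proof -
  have e: "2 * pi * (x + 1) = 2 * pi * x + 2 * pi" "2 * pi * (x + 1/4) = 2 * pi * x + pi / 2"
    "2 * pi * (x + 2/4) = 2 * pi * x + pi" "2 * pi * (x + 3/4) = (2 * pi * x + pi / 2) + pi"
    by (simp_all add: field_simps)
  show "sn (x + 1) = sn x" "sn (x + 1/4) = cs x" "sn (x + 2/4) = - sn x" "sn (x + 3/4) = - cs x"
    "cs (x + 1) = cs x" "cs (x + 1/4) = - sn x" "cs (x + 2/4) = - cs x" "cs (x + 3/4) = sn x"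
    unfolding sn_def cs_def e
    by (simp_all only: sin_add cos_add sin_pi_half cos_pi_half sin_pi cos_pi sin_two_pi cos_two_pi) simp_all
qed

lemma sn_cs_square: "sn x * sn x + cs x * cs x = 1"
  using sin_cos_squared_add[of "2 * pi * x"] by (simp add: sn_def cs_def power2_eq_square)

lemma continuous_on_sn_cs: "continuous_on S sn" "continuous_on S cs"
  unfolding sn_def[abs_def] cs_def[abs_def] by (intro continuous_intros)+

lemma continuous_on_sn_cs_mult: "continuous_on S (\<lambda>x. sn (a * x))" "continuous_on S (\<lambda>x. cs (a * x))"
  unfolding sn_def cs_def by (intro continuous_intros)+

lemma quarter_mean_trig:
  "quarter_mean (\<lambda>_. 1) 1" "quarter_mean sn 0" "quarter_mean cs 0"
  "quarter_mean (\<lambda>x. sn x * sn x) (1/2)" "quarter_mean (\<lambda>x. cs x * cs x) (1/2)"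
  "quarter_mean (\<lambda>x. sn x * cs x) 0" "quarter_mean (\<lambda>x. cs x * sn x) 0"
  unfolding quarter_mean_def sn_cs_shift
  using sn_cs_square by (auto intro!: continuous_intros continuous_on_sn_cs simp: algebra_simps)

lemma integral_shift:
  fixes G :: "real \<Rightarrow> real"
  assumes "continuous_on UNIV G" "a \<le> b"
  shows "integral {a..b} (\<lambda>x. G (x + c)) = integral {a + c..b + c} G"
proof -
  have "(G has_integral integral {a + c..b + c} G) (cbox (a + c) (b + c))"
    unfolding cbox_interval
    by (intro integrable_integral integrable_continuous_real continuous_on_subset[OF assms(1)]) auto
  from has_integral_affinity[OF this, of 1 c] assms(2)
  have "((\<lambda>x. G (x + c)) has_integral integral {a + c..b + c} G) ((\<lambda>x. x - c) ` {a + c..b + c})" by simp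
  also have "(\<lambda>x. x - c) ` {a + c..b + c} = {a..b}"
    using image_affinity_atLeastAtMost[of 1 "- c" "a + c" "b + c"] assms(2) by simp
  finally show ?thesis by (rule integral_unique)
qed

lemma integral_periodic_shift:
  fixes G :: "real \<Rightarrow> real"
  assumes G: "continuous_on UNIV G" and per: "\<And>x. G (x + 1) = G x" and a: "0 \<le> a" "a \<le> 1"
  shows "integral {0..1} (\<lambda>x. G (x + a)) = integral {0..1} G"
proof -
  have int: "G integrable_on {u..v}" for u v
    by (intro integrable_continuous_real continuous_on_subset[OF G]) auto
  have "integral {0..1} (\<lambda>x. G (x + a)) = integral {a..a + 1} G"
    using integral_shift[OF G, of 0 1 a] by (simp add: add.commute)
  also have "\<dots> = integral {a..1} G + integral {1..a + 1} G"
    by (rule Henstock_Kurzweil_Integration.integral_combine[symmetric]) (use a int in auto)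
  also have "integral {1..a + 1} G = integral {0..a} G"
    using integral_shift[OF G, of 0 a 1] a by (simp add: per add.commute)
  also have "integral {a..1} G + integral {0..a} G = integral {0..1} G"
    using Henstock_Kurzweil_Integration.integral_combine[of 0 a 1 G] a int by (simp add: add.commute)
  finally show ?thesis .
qed

lemma integral_periodic_dilate:
  fixes V :: "real \<Rightarrow> real"
  assumes V: "continuous_on UNIV V" and per: "\<And>x. V (x + 1) = V x"
  shows "integral {0..1} (\<lambda>x. V (4 * x)) = integral {0..1} V"
proof -
  have int: "V integrable_on {u..v}" for u v
    by (intro integrable_continuous_real continuous_on_subset[OF V]) auto
  have per': "V (x + 2) = V x" "V (x + 3) = V x" for x
    using per[of x] per[of "x + 1"] per[of "x + 2"] by (simp_all add: add.assoc)
  have unit: "integral {1..2} V = integral {0..1} V" "integral {2..3} V = integral {0..1} V"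
    "integral {3..4} V = integral {0..1} V"
    using integral_shift[OF V, of 0 1 1] integral_shift[OF V, of 0 1 2] integral_shift[OF V, of 0 1 3]
    by (simp_all add: per per')
  have "integral {0..4} V = 4 * integral {0..1} V"
    using Henstock_Kurzweil_Integration.integral_combine[of 0 1 4 V]
      Henstock_Kurzweil_Integration.integral_combine[of 1 2 4 V]
      Henstock_Kurzweil_Integration.integral_combine[of 2 3 4 V] int unit by simp
  then have "(V has_integral 4 * integral {0..1} V) (cbox 0 4)"
    using integrable_integral[OF int[of 0 4]] by simp
  from has_integral_affinity[OF this, of 4 0]
  have "((\<lambda>x. V (4 * x)) has_integral integral {0..1} V) ((\<lambda>x. x / 4) ` {0..4})" by simp
  also have "(\<lambda>x. x / 4) ` {0..4} = {0..1::real}"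
    using image_affinity_atLeastAtMost[of "1/4" 0 0 "4::real"] by simp
  finally show ?thesis by (rule integral_unique)
qed

lemma integral_lacunary_product:
  assumes "\<And>i. i < n \<Longrightarrow> quarter_mean (w i) (\<mu> i)"
  shows "integral {0..1} (\<lambda>x. \<Prod>i<n. w i (4 ^ i * x)) = (\<Prod>i<n. \<mu> i)"
  using assms
proof (induction n arbitrary: w \<mu>)
  case (Suc n)
  have w: "continuous_on UNIV (w i)" "w i (x + 1) = w i x" if "i < Suc n" for i x
    using Suc.prems[OF that] by (auto simp: quarter_mean_def)
  have wn: "w i (x + real k) = w i x" if "i < Suc n" for i x k
  proof (induction k)
    case (Suc k)
    have "x + real (Suc k) = (x + real k) + 1" by simp
    then show ?case using w(2)[OF that, of "x + real k"] Suc by (simp only:)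
  qed simp
  \<comment> \<open>The later factors with all frequencies divided by 4; thus
    \<open>V (4 * x)\<close> has period 1/4.\<close>
  define V where "V = (\<lambda>y. \<Prod>i<n. w (Suc i) (4 ^ i * y))"
  have contw: "continuous_on S (\<lambda>x. w i (f x))" if "i < Suc n" "continuous_on S f" for i S f
    using continuous_on_compose2[OF w(1)[OF that(1)] that(2)] by auto
  have contV: "continuous_on UNIV V" unfolding V_def by (intro continuous_intros contw) auto
  have perV: "V (y + 1) = V y" for y
    unfolding V_def
  proof (rule prod.cong[OF refl])
    fix i assume "i \<in> {..<n}"
    then show "w (Suc i) (4 ^ i * (y + 1)) = w (Suc i) (4 ^ i * y)"
      using wn[of "Suc i" "4 ^ i * y" "4 ^ i"] by (simp add: distrib_left)
  qed
  have perV': "V (y + 2) = V y" "V (y + 3) = V y" for y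
    using perV[of y] perV[of "y + 1"] perV[of "y + 2"] by (simp_all add: add.assoc)
  define G where "G = (\<lambda>x. w 0 x * V (4 * x))"
  have prod: "(\<Prod>i<Suc n. w i (4 ^ i * x)) = G x" for x
    unfolding G_def V_def prod.lessThan_Suc_shift by (simp add: mult_ac)
  have contG: "continuous_on UNIV G"
    unfolding G_def by (intro continuous_intros contw continuous_on_compose2[OF contV]) auto
  have perG: "G (x + 1) = G x" for x
    unfolding G_def using w(2)[of 0] perV[of "4 * x + 3"] perV'(2)[of "4 * x"] by (simp add: distrib_left add.assoc)
  have sh: "integral {0..1} (\<lambda>x. G (x + a)) = integral {0..1} G" if "0 \<le> a" "a \<le> 1" for a
    by (rule integral_periodic_shift[OF contG perG that])
  have int: "(\<lambda>x. G (x + a)) integrable_on {0..1}" for a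
    by (intro integrable_continuous_real continuous_on_compose2[OF contG] continuous_intros) auto
  have "4 * integral {0..1} G = integral {0..1} (\<lambda>x. G (x + 0)) + integral {0..1} (\<lambda>x. G (x + 1/4))
     + integral {0..1} (\<lambda>x. G (x + 2/4)) + integral {0..1} (\<lambda>x. G (x + 3/4))"
    using sh[of 0] sh[of "1/4"] sh[of "2/4"] sh[of "3/4"] by simp
  also have "\<dots> = integral {0..1} (\<lambda>x. G (x + 0) + G (x + 1/4) + G (x + 2/4) + G (x + 3/4))"
    by (rule integral_unique[symmetric]) (intro has_integral_add integrable_integral int)
  also have "(\<lambda>x. G (x + 0) + G (x + 1/4) + G (x + 2/4) + G (x + 3/4)) = (\<lambda>x. 4 * \<mu> 0 * V (4 * x))"
  proof
    fix x
    have "w 0 x + w 0 (x + 1/4) + w 0 (x + 2/4) + w 0 (x + 3/4) = 4 * \<mu> 0"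
      using Suc.prems[of 0] by (simp add: quarter_mean_def)
    moreover have "4 * (x + 1/4) = 4 * x + 1" "4 * (x + 2/4) = 4 * x + 2" "4 * (x + 3/4) = 4 * x + 3" by simp_all
    ultimately show "G (x + 0) + G (x + 1/4) + G (x + 2/4) + G (x + 3/4) = 4 * \<mu> 0 * V (4 * x)"
      unfolding G_def by (simp only: perV perV' add_0_right flip: distrib_right)
  qed
  also have "integral {0..1} (\<lambda>x. 4 * \<mu> 0 * V (4 * x)) = 4 * \<mu> 0 * integral {0..1} V"
    by (simp add: integral_periodic_dilate[OF contV perV])
  also have "integral {0..1} V = (\<Prod>i<n. \<mu> (Suc i))"
    unfolding V_def by (rule Suc.IH) (rule Suc.prems, simp)
  finally have "integral {0..1} G = \<mu> 0 * (\<Prod>i<n. \<mu> (Suc i))" by simp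
  moreover have "(\<Prod>i<Suc n. \<mu> i) = \<mu> 0 * (\<Prod>i<n. \<mu> (Suc i))" by (rule prod.lessThan_Suc_shift)
  ultimately show ?case by (simp only: prod)
qed simp

text \<open>\<open>16 ^ i\<close> and \<open>4 * 16 ^ i\<close> are the even and the odd powers of
  4, so the two families interleave into a single lacunary product.\<close>

lemma integral_lacunary_product2:
  assumes p: "\<And>i. i < n \<Longrightarrow> quarter_mean (p i) (\<mu> i)" and q: "\<And>i. i < n \<Longrightarrow> quarter_mean (q i) (\<nu> i)"
  shows "integral {0..1} (\<lambda>x. (\<Prod>i<n. p i (16 ^ i * x)) * (\<Prod>i<n. q i (4 * 16 ^ i * x))) = (\<Prod>i<n. \<mu> i) * (\<Prod>i<n. \<nu> i)"
proof -
  define w where "w = (\<lambda>i. if even i then p (i div 2) else q (i div 2))"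
  define \<xi> where "\<xi> = (\<lambda>i. if even i then \<mu> (i div 2) else \<nu> (i div 2))"
  have split: "(\<Prod>i<2 * n. f i) = (\<Prod>i<n. f (2 * i)) * (\<Prod>i<n. f (Suc (2 * i)))" for f :: "nat \<Rightarrow> real"
    by (induction n) (simp_all add: mult_ac)
  have pow: "(4::real) ^ (2 * i) = 16 ^ i" for i by (simp add: power_mult)
  have "integral {0..1} (\<lambda>x. \<Prod>i<2 * n. w i (4 ^ i * x)) = (\<Prod>i<2 * n. \<xi> i)"
    by (rule integral_lacunary_product) (use p q in \<open>auto simp: w_def \<xi>_def\<close>)
  then show ?thesis unfolding split by (simp add: w_def \<xi>_def pow)
qed

text \<open>Compared with \<open>hasym\<close> the amplitude \<open>\<phi>\<close> is free: for the
  empty product of sines the limit is the Hilbert transform of the bump itself, not a multiple of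
  the bump.\<close>

definition hconv :: "real \<Rightarrow> (real \<Rightarrow> real) \<Rightarrow> (real \<Rightarrow> real) \<Rightarrow> (real \<Rightarrow> real) \<Rightarrow> (real \<Rightarrow> real) \<Rightarrow> (real \<Rightarrow> real) \<Rightarrow> (real \<Rightarrow> real) \<Rightarrow> bool" where
  "hconv c h h' w w' \<phi> v \<longleftrightarrow> (\<forall>x. (w has_real_derivative w' x) (at x)) \<and> continuous_on UNIV w' \<and>
     (\<forall>x\<in>{c..c+1}. (\<lambda>\<Lambda>::nat. hilb (\<lambda>y. h' y * w (\<Lambda> * y) + h y * (\<Lambda> * w' (\<Lambda> * y))) x - \<phi> x * v (\<Lambda> * x)) \<longlonglongrightarrow> 0) \<and>
     (\<exists>K. \<forall>\<Lambda>::nat. \<forall>x\<in>{c..c+1}. \<bar>hilb (\<lambda>y. h' y * w (\<Lambda> * y) + h y * (\<Lambda> * w' (\<Lambda> * y))) x\<bar> \<le> K)"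

lemma fejer_shifted:
  fixes c :: nat and h W :: "real \<Rightarrow> real"
  assumes h: "continuous_on {real c..real c+1} h" and W: "continuous_on UNIV W" and per: "\<And>x. W (x + 1) = W x"
  shows "(\<lambda>\<Lambda>. integral {real c..real c+1} (\<lambda>x. h x * W (real \<Lambda> * x))) \<longlonglongrightarrow> integral {real c..real c+1} h * integral {0..1} W"
proof -
  have pern: "W (x + real n) = W x" for x n
  proof (induction n)
    case (Suc n)
    have "x + real (Suc n) = (x + real n) + 1" by simp
    then show ?case using per[of "x + real n"] Suc by (simp only:)
  qed simp
  have shift: "integral {0..1} (\<lambda>x. f (x + real c)) = integral {real c..real c+1} f"
    if "continuous_on {real c..real c+1} f" for f :: "real \<Rightarrow> real"
  proof -
    have "(f has_integral integral {real c..real c+1} f) (cbox (real c) (real c + 1))"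
      unfolding cbox_interval by (intro integrable_integral integrable_continuous_real that)
    from has_integral_affinity[OF this, of 1 "real c"]
    have "((\<lambda>x. f (x + real c)) has_integral integral {real c..real c+1} f) ((\<lambda>x. x - real c) ` {real c..real c+1})" by simp
    also have "(\<lambda>x. x - real c) ` {real c..real c+1} = {0..1}"
      using image_affinity_atLeastAtMost[of 1 "- real c" "real c" "real c + 1"] by simp
    finally show ?thesis by (rule integral_unique)
  qed
  have "continuous_on {0..1} (\<lambda>x. h (x + real c))"
    by (rule continuous_on_compose2[OF h]) (auto intro!: continuous_intros)
  from fejer[OF this W per]
  have "(\<lambda>\<Lambda>. integral {0..1} (\<lambda>x. h (x + real c) * W (real \<Lambda> * (x + real c)))) \<longlonglongrightarrow> integral {0..1} (\<lambda>x. h (x + real c)) * integral {0..1} W"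
    by (simp add: distrib_left pern flip: of_nat_mult)
  moreover have "integral {0..1} (\<lambda>x. h (x + real c) * W (real \<Lambda> * (x + real c))) = integral {real c..real c+1} (\<lambda>x. h x * W (real \<Lambda> * x))" for \<Lambda>
    by (rule shift) (intro continuous_intros h continuous_on_compose2[OF W], auto)
  ultimately show ?thesis using shift[OF h] by simp
qed

text \<open>Dominated convergence replaces the transform by its asymptotic form, and Fejer's lemma
  then separates the slow factors from the periodic ones.\<close>

lemma hconv_limit:
  fixes c :: nat
  assumes h: "C1_on (real c) h h'" and w: "hconv (real c) h h' w w' \<phi> v"
    and \<phi>: "continuous_on {real c..real c+1} \<phi>" and v: "continuous_on UNIV v" "\<And>x. v (x + 1) = v x"
    and \<psi>: "continuous_on {real c..real c+1} \<psi>" and G: "continuous_on UNIV G" "\<And>x. G (x + 1) = G x"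
    and G1: "\<And>x. \<bar>G x\<bar> \<le> 1" and v1: "\<And>x. \<bar>v x\<bar> \<le> 1" and \<psi>1: "\<And>x. \<bar>\<psi> x\<bar> \<le> 1"
  shows "(\<lambda>\<Lambda>::nat. integral {real c..real c+1} (\<lambda>x. hilb (\<lambda>y. h' y * w (\<Lambda> * y) + h y * (\<Lambda> * w' (\<Lambda> * y))) x * \<psi> x * G (\<Lambda> * x)))
     \<longlonglongrightarrow> integral {real c..real c+1} (\<lambda>x. \<phi> x * \<psi> x) * integral {0..1} (\<lambda>x. v x * G x)"
proof -
  define I where "I = {real c..real c+1}"
  define U where "U = (\<lambda>(\<Lambda>::nat) y. h' y * w (\<Lambda> * y) + h y * (\<Lambda> * w' (\<Lambda> * y)))"
  obtain K where K: "\<forall>\<Lambda>. \<forall>x\<in>I. \<bar>hilb (U \<Lambda>) x\<bar> \<le> K" using w unfolding hconv_def I_def U_def by blast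
  have lim: "(\<lambda>\<Lambda>. hilb (U \<Lambda>) x - \<phi> x * v (\<Lambda> * x)) \<longlonglongrightarrow> 0" if "x \<in> I" for x :: real
    using w that unfolding hconv_def I_def U_def by blast
  have cU: "continuous_on UNIV (U \<Lambda>)" for \<Lambda>
    unfolding U_def by (rule C1_onD(2)[OF C1_on_dilated[OF h]]) (use w in \<open>auto simp: hconv_def\<close>)
  have "compact (\<phi> ` I)" unfolding I_def by (intro compact_continuous_image \<phi>) auto
  then have "bounded (\<phi> ` I)" by (rule compact_imp_bounded)
  then obtain K' where K': "K' > 0" "\<forall>y\<in>\<phi> ` I. norm y \<le> K'" unfolding bounded_pos by (elim exE conjE)
  have cv: "continuous_on S (\<lambda>x. v (a * x))" and cG: "continuous_on S (\<lambda>x. G (a * x))" for S and a :: real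
    by (intro continuous_on_compose2[OF v(1)] continuous_on_compose2[OF G(1)] continuous_intros; simp)+
  define f where "f = (\<lambda>(\<Lambda>::nat) (x::real). (hilb (U \<Lambda>) x - \<phi> x * v (\<Lambda> * x)) * \<psi> x * G (\<Lambda> * x))"
  have cf: "continuous_on I (f \<Lambda>)" for \<Lambda>
    unfolding f_def using \<phi> \<psi> by (intro continuous_intros continuous_on_hilb cU cv cG) (auto simp: I_def)
  have bound: "\<bar>f \<Lambda> x\<bar> \<le> \<bar>hilb (U \<Lambda>) x - \<phi> x * v (\<Lambda> * x)\<bar>" for \<Lambda> :: nat and x :: real
  proof -
    have "\<bar>f \<Lambda> x\<bar> \<le> \<bar>hilb (U \<Lambda>) x - \<phi> x * v (\<Lambda> * x)\<bar> * 1 * 1"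
      unfolding f_def abs_mult by (intro mult_mono G1 \<psi>1) auto
    then show ?thesis by simp
  qed
  have "(\<lambda>\<Lambda>. integral I (f \<Lambda>)) \<longlonglongrightarrow> integral I (\<lambda>_. 0)"
  proof (rule dominated_convergence(2)[where h = "\<lambda>_. K + K'"])
    show "f \<Lambda> integrable_on I" for \<Lambda> using cf[of \<Lambda>] unfolding I_def by (rule integrable_continuous_real)
    show "(\<lambda>_. K + K') integrable_on I" unfolding I_def by (rule integrable_const_ivl)
    show "norm (f \<Lambda> x) \<le> K + K'" if "x \<in> I" for \<Lambda> :: nat and x :: real
    proof -
      have "\<bar>\<phi> x * v (\<Lambda> * x)\<bar> \<le> K' * 1" unfolding abs_mult using K' v1 that by (intro mult_mono) auto
      moreover have "\<bar>hilb (U \<Lambda>) x\<bar> \<le> K" using K that by blast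
      ultimately show ?thesis using bound[of \<Lambda> x] unfolding real_norm_def by linarith
    qed
    show "(\<lambda>\<Lambda>. f \<Lambda> x) \<longlonglongrightarrow> 0" if "x \<in> I" for x :: real
      by (rule Lim_null_comparison[OF _ tendsto_rabs_zero[OF lim[OF that]]]) (simp add: bound)
  qed
  moreover have "(\<lambda>\<Lambda>. integral I (\<lambda>x. (\<phi> x * \<psi> x) * (\<lambda>x. v x * G x) (real \<Lambda> * x))) \<longlonglongrightarrow> integral I (\<lambda>x. \<phi> x * \<psi> x) * integral {0..1} (\<lambda>x. v x * G x)"
    unfolding I_def using \<phi> \<psi> v G by (intro fejer_shifted) (auto intro!: continuous_intros)
  ultimately have "(\<lambda>\<Lambda>. integral I (f \<Lambda>) + integral I (\<lambda>x. (\<phi> x * \<psi> x) * (v (real \<Lambda> * x) * G (real \<Lambda> * x))))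
      \<longlonglongrightarrow> 0 + integral I (\<lambda>x. \<phi> x * \<psi> x) * integral {0..1} (\<lambda>x. v x * G x)"
    by (intro tendsto_add) simp_all
  moreover have "integral I (f \<Lambda>) + integral I (\<lambda>x. (\<phi> x * \<psi> x) * (v (real \<Lambda> * x) * G (real \<Lambda> * x)))
      = integral I (\<lambda>x. hilb (U \<Lambda>) x * \<psi> x * G (\<Lambda> * x))" for \<Lambda>
  proof -
    have i1: "f \<Lambda> integrable_on I" using cf[of \<Lambda>] unfolding I_def by (rule integrable_continuous_real)
    have i2: "(\<lambda>x. (\<phi> x * \<psi> x) * (v (real \<Lambda> * x) * G (real \<Lambda> * x))) integrable_on I"
      unfolding I_def by (intro integrable_continuous_real continuous_intros \<phi> \<psi> cv cG)
    have "(\<lambda>x::real. f \<Lambda> x + (\<phi> x * \<psi> x) * (v (real \<Lambda> * x) * G (real \<Lambda> * x))) = (\<lambda>x::real. hilb (U \<Lambda>) x * \<psi> x * G (\<Lambda> * x))"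
      by (rule ext) (simp add: f_def algebra_simps)
    then show ?thesis using Henstock_Kurzweil_Integration.integral_add[OF i1 i2] by simp
  qed
  ultimately show ?thesis by (simp add: I_def U_def)
qed

section \<open>Triangular Hilbert matrices on lacunary systems\<close>

lemma sum_inverse_sqrt_le: "(\<Sum>q<n. 1 / sqrt (real q + 1)) \<le> 2 * sqrt (real n)"
proof (induction n)
  case (Suc n)
  define a b where "a = sqrt (real n)" and "b = sqrt (real n + 1)"
  have ab: "a\<^sup>2 = real n" "b\<^sup>2 = real n + 1" "0 \<le> a" "0 < b" "a \<le> b" by (simp_all add: a_def b_def)
  have "1 \<le> (2 * b - 2 * a) * b"
  proof -
    have "(b - a) * (b + a) = 1" using ab by (simp add: power2_eq_square algebra_simps)
    moreover have "(b - a) * (b + a) \<le> (b - a) * (2 * b)" using ab by (intro mult_left_mono) auto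
    ultimately show ?thesis by (simp add: algebra_simps)
  qed
  then have "1 / b \<le> 2 * b - 2 * a" using ab by (simp add: divide_le_eq)
  then show ?case using Suc by (simp add: a_def b_def add.commute)
qed simp

text \<open>The weights of Schur's test for the Hilbert matrix. For \<open>q \<le> p\<close> the
  kernel is at most \<open>1 / (p + 1)\<close>; beyond, it is at most \<open>1 / (q + 1)\<close> and
  the sum telescopes in differences of \<open>2 / sqrt q\<close>. Each range accounts for half of
  the constant 4.\<close>

lemma hilbert_kernel_row_sum:
  "(\<Sum>q<n. 1 / (real p + real q + 1) * (1 / sqrt (real q + 1))) \<le> 4 * (1 / sqrt (real p + 1))"
proof -
  define m where "m = Suc p"
  define s where "s = (\<lambda>n. \<Sum>q<n. 1 / (real p + real q + 1) * (1 / sqrt (real q + 1)))"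
  have m: "real m > 0" "sqrt (real m) > 0" "sqrt (real m) * sqrt (real m) = real m" by (simp_all add: m_def)
  have low: "s n \<le> 2 * sqrt (real n) / real m" for n
  proof -
    have "s n \<le> (\<Sum>q<n. 1 / real m * (1 / sqrt (real q + 1)))"
      unfolding s_def by (intro sum_mono mult_right_mono frac_le) (auto simp: m_def)
    also have "\<dots> = 1 / real m * (\<Sum>q<n. 1 / sqrt (real q + 1))" by (simp only: sum_distrib_left)
    also have "\<dots> \<le> 1 / real m * (2 * sqrt (real n))" by (intro mult_left_mono sum_inverse_sqrt_le) auto
    finally show ?thesis by simp
  qed
  have lowm: "2 * sqrt (real m) / real m = 2 / sqrt (real m)"
    using m by (simp add: field_simps)
  have high: "s (m + d) \<le> 4 / sqrt (real m) - 2 / sqrt (real (m + d))" for d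
  proof (induction d)
    case 0
    then show ?case using low[of m] lowm by simp
  next
    case (Suc d)
    define n where "n = m + d"
    define a b where "a = sqrt (real n)" and "b = sqrt (real n + 1)"
    have ab: "b\<^sup>2 = real n + 1" "a\<^sup>2 = real n" "0 < a" "0 < b" "a \<le> b" by (simp_all add: a_def b_def n_def m_def)
    have "s (Suc n) = s n + 1 / (real p + real n + 1) * (1 / b)" by (simp add: s_def b_def)
    also have "1 / (real p + real n + 1) * (1 / b) \<le> 1 / b\<^sup>2 * (1 / b)"
      using ab by (intro mult_right_mono frac_le) auto
    also have "1 / b\<^sup>2 * (1 / b) \<le> 2 / a - 2 / b"
    proof -
      have e: "(b - a) * (b + a) = 1" using ab by (simp add: power2_eq_square algebra_simps)
      have "a * 1 = (b - a) * (a * (b + a))" using e by (simp add: mult.left_commute)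
      also have "\<dots> \<le> (b - a) * (b * (2 * b))" using ab by (intro mult_left_mono mult_mono) auto
      finally have "a \<le> 2 * (b - a) * b\<^sup>2" by (simp add: power2_eq_square mult_ac)
      then have "a / (a * b\<^sup>2 * b) \<le> 2 * (b - a) * b\<^sup>2 / (a * b\<^sup>2 * b)"
        by (rule divide_right_mono) (use ab(3,4) in simp)
      also have "\<dots> = 2 / a - 2 / b" using ab(3,4) by (simp only: power2_eq_square) (simp add: field_simps)
      also have "a / (a * b\<^sup>2 * b) = 1 / b\<^sup>2 * (1 / b)" using ab(3,4) by (simp only: power2_eq_square) (simp add: field_simps)
      finally show ?thesis .
    qed
    finally have "s (Suc n) \<le> s n + (2 / a - 2 / b)" by simp
    moreover have "s n \<le> 4 / sqrt (real m) - 2 / a" using Suc by (simp add: n_def a_def)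
    moreover have "m + Suc d = Suc n" "sqrt (real (Suc n)) = b" by (simp_all add: n_def b_def add.commute)
    ultimately show ?case by simp
  qed
  have "s n \<le> 4 / sqrt (real m)"
  proof (cases "n \<le> m")
    case True
    have "s n \<le> 2 * sqrt (real n) / real m" by (rule low)
    also have "\<dots> \<le> 2 * sqrt (real m) / real m" using True by (intro divide_right_mono) auto
    also have "\<dots> \<le> 4 / sqrt (real m)" unfolding lowm using m by (intro divide_right_mono) auto
    finally show ?thesis .
  next
    case False
    then have "n = m + (n - m)" by simp
    then have "s n \<le> 4 / sqrt (real m) - 2 / sqrt (real n)" using high[of "n - m"] by simp
    moreover have "0 \<le> 2 / sqrt (real n)" by simp
    ultimately show ?thesis by linarith
  qed
  then show ?thesis by (simp add: s_def m_def add.commute)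
qed

text \<open>Cauchy--Schwarz after splitting every kernel entry symmetrically with the weights
  \<open>w\<close>; the row sums bound one factor, and after exchanging sums the column sums bound
  the other. Nonnegativity of the kernel admits vector-valued sequences.\<close>

lemma schur_test:
  fixes b :: "'i \<Rightarrow> 'k::real_normed_vector"
  assumes k: "\<And>q i. q \<in> Q \<Longrightarrow> i \<in> I \<Longrightarrow> 0 \<le> (\<kappa> q i :: real)"
    and w: "\<And>i. i \<in> I \<Longrightarrow> 0 < w i" and R: "0 \<le> R"
    and row: "\<And>q. q \<in> Q \<Longrightarrow> (\<Sum>i\<in>I. \<kappa> q i * w i) \<le> R * w' q"
    and col: "\<And>i. i \<in> I \<Longrightarrow> (\<Sum>q\<in>Q. \<kappa> q i * w' q) \<le> R * w i"
  shows "(\<Sum>q\<in>Q. (norm (\<Sum>i\<in>I. \<kappa> q i *\<^sub>R b i))\<^sup>2) \<le> R\<^sup>2 * (\<Sum>i\<in>I. (norm (b i))\<^sup>2)"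
proof -
  have "(\<Sum>q\<in>Q. (norm (\<Sum>i\<in>I. \<kappa> q i *\<^sub>R b i))\<^sup>2) \<le> (\<Sum>q\<in>Q. (R * w' q) * (\<Sum>i\<in>I. \<kappa> q i * ((norm (b i))\<^sup>2 / w i)))"
  proof (rule sum_mono)
    fix q' assume q: "q' \<in> Q"
    have "norm (\<Sum>i\<in>I. \<kappa> q' i *\<^sub>R b i) \<le> (\<Sum>i\<in>I. \<kappa> q' i * norm (b i))"
      by (rule order_trans[OF norm_sum]) (use k q in simp)
    also have "\<dots> = (\<Sum>i\<in>I. sqrt (\<kappa> q' i * w i) * sqrt (\<kappa> q' i * ((norm (b i))\<^sup>2 / w i)))"
    proof (rule sum.cong[OF refl])
      fix i assume i: "i \<in> I"
      have "(\<kappa> q' i * w i) * (\<kappa> q' i * ((norm (b i))\<^sup>2 / w i)) = (\<kappa> q' i * norm (b i))\<^sup>2"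
        using w[OF i] by (simp add: power2_eq_square)
      then show "\<kappa> q' i * norm (b i) = sqrt (\<kappa> q' i * w i) * sqrt (\<kappa> q' i * ((norm (b i))\<^sup>2 / w i))"
        using k[OF q i] by (simp add: real_sqrt_mult[symmetric])
    qed
    finally have "(norm (\<Sum>i\<in>I. \<kappa> q' i *\<^sub>R b i))\<^sup>2 \<le> (\<Sum>i\<in>I. sqrt (\<kappa> q' i * w i) * sqrt (\<kappa> q' i * ((norm (b i))\<^sup>2 / w i)))\<^sup>2"
      by (rule power_mono) simp
    also have "\<dots> \<le> (\<Sum>i\<in>I. (sqrt (\<kappa> q' i * w i))\<^sup>2) * (\<Sum>i\<in>I. (sqrt (\<kappa> q' i * ((norm (b i))\<^sup>2 / w i)))\<^sup>2)"
      by (rule Cauchy_Schwarz_ineq_sum)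
    also have "\<dots> = (\<Sum>i\<in>I. \<kappa> q' i * w i) * (\<Sum>i\<in>I. \<kappa> q' i * ((norm (b i))\<^sup>2 / w i))"
      using k[OF q] w by (intro arg_cong2[where f="(*)"] sum.cong) (auto simp: less_imp_le)
    also have "\<dots> \<le> (R * w' q') * (\<Sum>i\<in>I. \<kappa> q' i * ((norm (b i))\<^sup>2 / w i))"
      using k[OF q] w by (intro mult_right_mono row q sum_nonneg) (auto simp: less_imp_le)
    finally show "(norm (\<Sum>i\<in>I. \<kappa> q' i *\<^sub>R b i))\<^sup>2 \<le> (R * w' q') * (\<Sum>i\<in>I. \<kappa> q' i * ((norm (b i))\<^sup>2 / w i))" .
  qed
  also have "\<dots> = (\<Sum>i\<in>I. R * ((norm (b i))\<^sup>2 / w i) * (\<Sum>q\<in>Q. \<kappa> q i * w' q))"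
    unfolding sum_distrib_left by (subst sum.swap) (simp add: mult_ac)
  also have "\<dots> \<le> (\<Sum>i\<in>I. R * ((norm (b i))\<^sup>2 / w i) * (R * w i))"
    using w R by (intro sum_mono mult_left_mono col) (auto simp: less_imp_le)
  also have "\<dots> = R\<^sup>2 * (\<Sum>i\<in>I. (norm (b i))\<^sup>2)"
    unfolding sum_distrib_left
  proof (rule sum.cong[OF refl])
    fix i assume "i \<in> I"
    then show "R * ((norm (b i))\<^sup>2 / w i) * (R * w i) = R\<^sup>2 * (norm (b i))\<^sup>2"
      using w[of i] by (simp add: power2_eq_square)
  qed
  finally show ?thesis .
qed

lemma sum_inverse_squares_le: "(\<Sum>d<n. 1 / (real d + 1)\<^sup>2) \<le> 2"
proof -
  have "(\<Sum>d<Suc n. 1 / (real d + 1)\<^sup>2) \<le> 2 - 1 / (real n + 1)" for n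
  proof (induction n)
    case (Suc n)
    have p: "0 < real n + 1" "0 < real n + 2" by simp_all
    have "1 / (real n + 2)\<^sup>2 \<le> 1 / ((real n + 1) * (real n + 2))"
    proof (rule divide_left_mono)
      show "(real n + 1) * (real n + 2) \<le> (real n + 2)\<^sup>2"
        unfolding power2_eq_square by (rule mult_right_mono) simp_all
    qed (use p in \<open>auto intro!: mult_pos_pos zero_less_power\<close>)
    also have "\<dots> = 1 / (real n + 1) - 1 / (real n + 2)"
      using p by (subst diff_frac_eq) simp_all
    finally have step: "1 / (real n + 2)\<^sup>2 \<le> 1 / (real n + 1) - 1 / (real n + 2)" .
    have e1: "(\<Sum>d<Suc (Suc n). 1 / (real d + 1)\<^sup>2) = (\<Sum>d<Suc n. 1 / (real d + 1)\<^sup>2) + 1 / (real n + 2)\<^sup>2"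
      by (subst sum.lessThan_Suc) (simp add: add.commute)
    have e2: "real (Suc n) + 1 = real n + 2" by simp
    show ?case unfolding e1 e2 using add_mono[OF Suc.IH step] by (simp only: add_diff_eq diff_add_cancel)
  qed simp
  from this[of n] have "(\<Sum>d<n. 1 / (real d + 1)\<^sup>2) + 1 / (real n + 1)\<^sup>2 \<le> 2 - 1 / (real n + 1)" by simp
  moreover have "0 \<le> 1 / (real n + 1)\<^sup>2" "0 \<le> 1 / (real n + 1)" by simp_all
  ultimately show ?thesis by linarith
qed

definition tri :: "nat \<Rightarrow> nat \<Rightarrow> real" where
  "tri k j = (if j < k then 1 / real (k - j) else 0)"

lemma tri_nonneg: "0 \<le> tri k j" by (simp add: tri_def)

lemma sum_tri_squares: "(\<Sum>k<n. (tri k j)\<^sup>2) \<le> 2" "(\<Sum>j<n. (tri k j)\<^sup>2) \<le> 2"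
proof -
  have "(\<Sum>k<n. (tri k j)\<^sup>2) = (\<Sum>k\<in>{j<..<n}. 1 / (real (k - j))\<^sup>2)"
    by (intro sum.mono_neutral_cong_right) (auto simp: tri_def power_divide)
  also have "\<dots> = (\<Sum>d\<in>{..<n - Suc j}. 1 / (real d + 1)\<^sup>2)"
    by (rule sum.reindex_bij_witness[of _ "\<lambda>d. d + Suc j" "\<lambda>k. k - Suc j"]) (auto simp: of_nat_diff)
  also have "\<dots> \<le> 2" by (rule sum_inverse_squares_le)
  finally show "(\<Sum>k<n. (tri k j)\<^sup>2) \<le> 2" .
  have "(\<Sum>j<n. (tri k j)\<^sup>2) \<le> (\<Sum>j<max n k. (tri k j)\<^sup>2)" by (rule sum_mono2) auto
  also have "\<dots> = (\<Sum>j<k. 1 / (real (k - j))\<^sup>2)"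
    by (rule sum.mono_neutral_cong_right) (auto simp: tri_def power_divide)
  also have "\<dots> = (\<Sum>d\<in>{..<k}. 1 / (real d + 1)\<^sup>2)"
    by (rule sum.reindex_bij_witness[of _ "\<lambda>d. k - Suc d" "\<lambda>j. k - Suc j"]) (auto simp: of_nat_diff)
  also have "\<dots> \<le> 2" by (rule sum_inverse_squares_le)
  finally show "(\<Sum>j<n. (tri k j)\<^sup>2) \<le> 2" .
qed

text \<open>Corners of the triangular Hilbert matrix are blocks of the bounded Hilbert matrix.\<close>

lemma tri_corner_sums:
  assumes "t \<le> k"
  shows "(\<Sum>j<t. tri k j * (1 / sqrt (real (t - j)))) \<le> 4 * (1 / sqrt (real (k - t) + 1))"
proof -
  have "(\<Sum>j<t. tri k j * (1 / sqrt (real (t - j)))) = (\<Sum>q<t. 1 / (real (k - t) + real q + 1) * (1 / sqrt (real q + 1)))"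
    by (rule sum.reindex_bij_witness[of _ "\<lambda>q. t - Suc q" "\<lambda>j. t - Suc j"])
       (use assms in \<open>auto simp: tri_def of_nat_diff algebra_simps\<close>)
  then show ?thesis using hilbert_kernel_row_sum[of "k - t" t] by simp
qed

lemma tri_corner_sums':
  assumes "j < t"
  shows "(\<Sum>k\<in>{t..<n}. tri k j * (1 / sqrt (real (k - t) + 1))) \<le> 4 * (1 / sqrt (real (t - j)))"
proof -
  have "(\<Sum>k\<in>{t..<n}. tri k j * (1 / sqrt (real (k - t) + 1))) =
     (\<Sum>q<n - t. 1 / (real (t - Suc j) + real q + 1) * (1 / sqrt (real q + 1)))"
    by (rule sum.reindex_bij_witness[of _ "\<lambda>q. q + t" "\<lambda>k. k - t"])
       (use assms in \<open>auto simp: tri_def of_nat_diff algebra_simps\<close>)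
  also have "\<dots> \<le> 4 * (1 / sqrt (real (t - Suc j) + 1))" by (rule hilbert_kernel_row_sum)
  finally show ?thesis using assms by (simp add: of_nat_diff)
qed

text \<open>Schur's test with inverse square roots of the distance to the threshold \<open>t\<close>
  as weights; 16 is the square of the constant 4 of the row and column sums.\<close>

lemma tri_corner_bound:
  fixes b :: "nat \<Rightarrow> 'k::real_normed_vector"
  shows "(\<Sum>k\<in>{t..<n}. (norm (\<Sum>j<t. tri k j *\<^sub>R b j))\<^sup>2) \<le> 16 * (\<Sum>j<t. (norm (b j))\<^sup>2)"
    and "(\<Sum>j<t. (norm (\<Sum>k\<in>{t..<n}. tri k j *\<^sub>R b k))\<^sup>2) \<le> 16 * (\<Sum>k\<in>{t..<n}. (norm (b k))\<^sup>2)"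
proof -
  show "(\<Sum>k\<in>{t..<n}. (norm (\<Sum>j<t. tri k j *\<^sub>R b j))\<^sup>2) \<le> 16 * (\<Sum>j<t. (norm (b j))\<^sup>2)"
    using schur_test[of "{t..<n}" "{..<t}" tri "\<lambda>j. 1 / sqrt (real (t - j))" 4 "\<lambda>k. 1 / sqrt (real (k - t) + 1)" b]
      tri_corner_sums tri_corner_sums' by (simp add: tri_nonneg)
  show "(\<Sum>j<t. (norm (\<Sum>k\<in>{t..<n}. tri k j *\<^sub>R b k))\<^sup>2) \<le> 16 * (\<Sum>k\<in>{t..<n}. (norm (b k))\<^sup>2)"
    using schur_test[of "{..<t}" "{t..<n}" "\<lambda>j k. tri k j" "\<lambda>k. 1 / sqrt (real (k - t) + 1)" 4 "\<lambda>j. 1 / sqrt (real (t - j))" b]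
      tri_corner_sums tri_corner_sums' by (simp add: tri_nonneg)
qed

section \<open>Almost orthogonality of lacunary systems\<close>

lemma integral_cos_bound:
  assumes m: "0 < m" and lr: "l \<le> r"
  shows "\<bar>integral {l..r} (\<lambda>x::real. cos (2 * pi * m * x + \<theta>))\<bar> \<le> 1 / (pi * m)"
proof -
  have "((\<lambda>x. cos (2 * pi * m * x + \<theta>)) has_integral
      sin (2 * pi * m * r + \<theta>) / (2 * pi * m) - sin (2 * pi * m * l + \<theta>) / (2 * pi * m)) {l..r}"
    using m by (intro fundamental_theorem_of_calculus lr)
      (auto intro!: derivative_eq_intros simp flip: has_real_derivative_iff_has_vector_derivative)
  then have "integral {l..r} (\<lambda>x. cos (2 * pi * m * x + \<theta>)) = (sin (2 * pi * m * r + \<theta>) - sin (2 * pi * m * l + \<theta>)) / (2 * pi * m)"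
    by (simp add: integral_unique diff_divide_distrib)
  also have "\<bar>\<dots>\<bar> = \<bar>sin (2 * pi * m * r + \<theta>) - sin (2 * pi * m * l + \<theta>)\<bar> / (2 * pi * m)"
    using m by (simp add: abs_mult)
  also have "\<dots> \<le> 2 / (2 * pi * m)"
  proof (rule divide_right_mono)
    have "\<bar>sin (2 * pi * m * r + \<theta>)\<bar> \<le> 1" "\<bar>sin (2 * pi * m * l + \<theta>)\<bar> \<le> 1" by simp_all
    then show "\<bar>sin (2 * pi * m * r + \<theta>) - sin (2 * pi * m * l + \<theta>)\<bar> \<le> 2" by linarith
  qed (use m in simp)
  finally show ?thesis using m by (simp add: mult.assoc)
qed

text \<open>The product splits into cosines of frequencies \<open>n - m\<close> and
  \<open>n + m\<close>, both comparable to \<open>n\<close> because of the gap.\<close>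

lemma integral_sin_sin_bound:
  assumes m: "0 < m" and n: "16 * m \<le> n" and lr: "l \<le> r"
  shows "\<bar>integral {l..r} (\<lambda>x::real. sin (2 * pi * m * x + \<theta>) * sin (2 * pi * n * x + \<theta>))\<bar> \<le> 1 / n"
proof -
  define C where "C = (\<lambda>s \<eta>. integral {l..r} (\<lambda>x. cos (2 * pi * s * x + \<eta>)))"
  have hi: "((\<lambda>x. (cos (2 * pi * (n - m) * x + 0) - cos (2 * pi * (n + m) * x + 2 * \<theta>)) / 2) has_integral
      (C (n - m) 0 - C (n + m) (2 * \<theta>)) / 2) {l..r}"
    unfolding C_def
    by (intro has_integral_divide has_integral_diff integrable_integral integrable_continuous_real continuous_intros)
  have fe: "(\<lambda>x. (cos (2 * pi * (n - m) * x + 0) - cos (2 * pi * (n + m) * x + 2 * \<theta>)) / 2) =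
      (\<lambda>x. sin (2 * pi * m * x + \<theta>) * sin (2 * pi * n * x + \<theta>))"
  proof
    fix x :: real
    have e: "2 * pi * (n - m) * x + 0 = (2 * pi * n * x + \<theta>) - (2 * pi * m * x + \<theta>)"
      "2 * pi * (n + m) * x + 2 * \<theta> = (2 * pi * n * x + \<theta>) + (2 * pi * m * x + \<theta>)" by (simp_all add: algebra_simps)
    show "(cos (2 * pi * (n - m) * x + 0) - cos (2 * pi * (n + m) * x + 2 * \<theta>)) / 2 =
      sin (2 * pi * m * x + \<theta>) * sin (2 * pi * n * x + \<theta>)"
      using sin_times_sin[of "2 * pi * n * x + \<theta>" "2 * pi * m * x + \<theta>"]
      unfolding e by (simp only: mult.commute[of "sin (2 * pi * m * x + \<theta>)"])
  qed
  have int: "integral {l..r} (\<lambda>x. sin (2 * pi * m * x + \<theta>) * sin (2 * pi * n * x + \<theta>)) = (C (n - m) 0 - C (n + m) (2 * \<theta>)) / 2"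
    by (rule integral_unique[OF hi[unfolded fe]])
  have "\<bar>C (n - m) 0\<bar> \<le> 1 / (pi * (n - m))" "\<bar>C (n + m) (2 * \<theta>)\<bar> \<le> 1 / (pi * (n + m))"
    unfolding C_def using m n lr by (intro integral_cos_bound; simp)+
  moreover have "1 / (pi * (n - m)) \<le> 1 / n" "1 / (pi * (n + m)) \<le> 1 / n"
  proof -
    have "n \<le> 2 * (n - m)" "n \<le> 1 * (n + m)" using m n by simp_all
    moreover have "2 * (n - m) \<le> pi * (n - m)" "1 * (n + m) \<le> pi * (n + m)"
      using m n pi_gt3 by (intro mult_right_mono; simp)+
    ultimately have "n \<le> pi * (n - m)" "n \<le> pi * (n + m)" by (metis order_trans)+
    then show "1 / (pi * (n - m)) \<le> 1 / n" "1 / (pi * (n + m)) \<le> 1 / n"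
      using m n by (intro divide_left_mono; auto)+
  qed
  ultimately have "\<bar>C (n - m) 0\<bar> \<le> 1 / n" "\<bar>C (n + m) (2 * \<theta>)\<bar> \<le> 1 / n" by (metis order_trans)+
  moreover have "\<bar>(p - q) / 2\<bar> \<le> t" if "\<bar>p\<bar> \<le> t" "\<bar>q\<bar> \<le> t" for p q t :: real
  proof -
    have "\<bar>p - q\<bar> \<le> 2 * t" using that by linarith
    then show ?thesis by simp
  qed
  ultimately show ?thesis unfolding int by blast
qed

lemma sum_power_16_le: "(\<Sum>d<n. (1 / 16) ^ d) \<le> (16 / 15 :: real)"
proof -
  have "(\<Sum>d<n. (1 / 16) ^ d) = (16 / 15) * (1 - (1 / 16 :: real) ^ n)"
    by (subst sum_gp_strict) simp
  then show ?thesis by simp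
qed

lemma sum_power_16_dist_le: "(\<Sum>l<n. (1 / 16) ^ ((i - l) + (l - i))) \<le> (3 :: real)"
proof -
  define q where "q = (\<lambda>l. (1 / 16 :: real) ^ ((i - l) + (l - i)))"
  have "sum q {..<n} \<le> sum q ({..<Suc i} \<union> {Suc i..<Suc i + n})"
    by (rule sum_mono2) (auto simp: q_def)
  also have "\<dots> = sum q {..<Suc i} + sum q {Suc i..<Suc i + n}" by (rule sum.union_disjoint) auto
  also have "sum q {..<Suc i} = (\<Sum>d<Suc i. (1 / 16) ^ d)"
    by (rule sum.reindex_bij_witness[of _ "\<lambda>d. i - d" "\<lambda>l. i - l"]) (auto simp: q_def)
  also have "\<dots> \<le> 16 / 15" by (rule sum_power_16_le)
  also have "sum q {Suc i..<Suc i + n} \<le> (\<Sum>d<n. (1 / 16) ^ d)"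
  proof -
    have "sum q {Suc i..<Suc i + n} = (\<Sum>d<n. (1 / 16) ^ (Suc d))"
      by (rule sum.reindex_bij_witness[of _ "\<lambda>d. Suc i + d" "\<lambda>l. l - Suc i"]) (auto simp: q_def Suc_diff_Suc)
    also have "\<dots> \<le> (\<Sum>d<n. (1 / 16) ^ d)" by (intro sum_mono power_decreasing) auto
    finally show ?thesis .
  qed
  also have "\<dots> \<le> 16 / 15" by (rule sum_power_16_le)
  finally show ?thesis by (simp add: q_def)
qed

text \<open>Every frequency in \<open>I\<close> completes at least one period on the interval, so
  the integral of a product decays like a power of 1/16 in the distance of the indices, relative to
  the length; such a matrix has row sums at most 3. The common phase \<open>\<theta>\<close> covers
  sines and cosines at once.\<close>

lemma lacunary_square_integral:
  fixes b :: "nat \<Rightarrow> 'b::real_inner" and \<mu> :: real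
  assumes lr: "l \<le> r" and I: "I \<subseteq> {..<n}" and \<mu>: "0 < \<mu>" and m: "\<And>i. i \<in> I \<Longrightarrow> 1 \<le> \<mu> * 16 ^ i * (r - l)"
  shows "integral {l..r} (\<lambda>x. (norm (\<Sum>i\<in>I. sin (2 * pi * (\<mu> * 16 ^ i) * x + \<theta>) *\<^sub>R b i))\<^sup>2) \<le> 3 * (r - l) * (\<Sum>i\<in>I. (norm (b i))\<^sup>2)"
proof -
  define v where "v = (\<lambda>i x. sin (2 * pi * (\<mu> * 16 ^ i) * x + \<theta>))"
  define \<delta> where "\<delta> = r - l"
  have \<delta>: "0 \<le> \<delta>" using lr by (simp add: \<delta>_def)
  define q where "q = (\<lambda>i l. (1 / 16 :: real) ^ ((i - l) + (l - i)))"
  have q: "0 \<le> q i j" "q i j = q j i" for i j by (simp_all add: q_def add.commute)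
  have finI: "finite I" using I finite_subset by blast
  have vc: "continuous_on S (v i)" for S i unfolding v_def by (intro continuous_intros)
  have less: "\<bar>integral {l..r} (\<lambda>x. v i x * v j x)\<bar> \<le> \<delta> * q i j" if "i < j" "i \<in> I" for i j
  proof -
    have e: "(16::real) ^ j = 16 ^ i * 16 ^ (j - i)" using that by (simp add: power_add[symmetric])
    have "(16::real) ^ 1 \<le> 16 ^ (j - i)" using that by (intro power_increasing) auto
    then have "16 * (\<mu> * 16 ^ i) \<le> \<mu> * 16 ^ j" unfolding e using \<mu> by (simp add: mult_ac)
    then have "\<bar>integral {l..r} (\<lambda>x. v i x * v j x)\<bar> \<le> 1 / (\<mu> * 16 ^ j)"
      unfolding v_def using \<mu> lr by (intro integral_sin_sin_bound) auto
    also have "\<dots> = 1 / (\<mu> * 16 ^ i) * (1 / 16) ^ (j - i)" by (simp add: e power_divide)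
    also have "\<dots> \<le> \<delta> * (1 / 16) ^ (j - i)"
      using m[OF that(2)] \<mu> by (intro mult_right_mono) (auto simp: \<delta>_def divide_le_eq mult_ac)
    finally show ?thesis using that by (simp add: q_def)
  qed
  have orth: "\<bar>integral {l..r} (\<lambda>x. v i x * v j x)\<bar> \<le> \<delta> * q i j" if ij: "i \<in> I" "j \<in> I" for i j
  proof (cases i j rule: linorder_cases)
    case equal
    have "norm (integral {l..r} (\<lambda>x. v i x * v j x)) \<le> 1 * measure lborel (cbox l r)"
      unfolding cbox_interval[symmetric]
    proof (rule integrable_bound)
      show "(\<lambda>x. v i x * v j x) integrable_on cbox l r"
        unfolding cbox_interval by (intro integrable_continuous_real continuous_intros vc)
      show "norm (v i x * v j x) \<le> 1" for x
        unfolding norm_mult by (intro mult_le_one) (auto simp: v_def)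
    qed simp
    then show ?thesis using equal lr by (simp add: q_def \<delta>_def)
  next
    case greater
    then show ?thesis using less[of j i] ij q(2) by (simp add: mult.commute)
  qed (use less ij in auto)
  have "integral {l..r} (\<lambda>x. (norm (\<Sum>i\<in>I. v i x *\<^sub>R b i))\<^sup>2) = (\<Sum>i\<in>I. \<Sum>j\<in>I. integral {l..r} (\<lambda>x. v i x * v j x) * (b i \<bullet> b j))"
  proof -
    have "((\<lambda>x. \<Sum>i\<in>I. \<Sum>j\<in>I. (v i x * v j x) * (b i \<bullet> b j)) has_integral
        (\<Sum>i\<in>I. \<Sum>j\<in>I. integral {l..r} (\<lambda>x. v i x * v j x) * (b i \<bullet> b j))) {l..r}"
      by (intro has_integral_sum finI has_integral_mult_left integrable_integral integrable_continuous_real continuous_intros vc)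
    moreover have "(norm (\<Sum>i\<in>I. v i x *\<^sub>R b i))\<^sup>2 = (\<Sum>i\<in>I. \<Sum>j\<in>I. (v i x * v j x) * (b i \<bullet> b j))" for x
      by (simp add: power2_norm_eq_inner inner_sum_left inner_sum_right sum_distrib_left mult_ac inner_commute)
    ultimately show ?thesis by (simp add: integral_unique)
  qed
  also have "\<dots> \<le> (\<Sum>i\<in>I. \<Sum>j\<in>I. \<delta> * q i j * (((norm (b i))\<^sup>2 + (norm (b j))\<^sup>2) / 2))"
  proof (intro sum_mono)
    fix i j assume ij: "i \<in> I" "j \<in> I"
    have "\<bar>b i \<bullet> b j\<bar> \<le> norm (b i) * norm (b j)" by (rule Cauchy_Schwarz_ineq2)
    also have "\<dots> \<le> ((norm (b i))\<^sup>2 + (norm (b j))\<^sup>2) / 2"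
      using zero_le_power2[of "norm (b i) - norm (b j)"] by (simp add: power2_diff)
    finally have "\<bar>integral {l..r} (\<lambda>x. v i x * v j x) * (b i \<bullet> b j)\<bar> \<le> \<delta> * q i j * (((norm (b i))\<^sup>2 + (norm (b j))\<^sup>2) / 2)"
      unfolding abs_mult using orth[OF ij] q \<delta> by (intro mult_mono) auto
    then show "integral {l..r} (\<lambda>x. v i x * v j x) * (b i \<bullet> b j) \<le> \<delta> * q i j * (((norm (b i))\<^sup>2 + (norm (b j))\<^sup>2) / 2)"
      by linarith
  qed
  also have "\<dots> = (\<Sum>i\<in>I. \<Sum>j\<in>I. \<delta> * q i j * ((norm (b i))\<^sup>2 / 2)) + (\<Sum>i\<in>I. \<Sum>j\<in>I. \<delta> * q i j * ((norm (b j))\<^sup>2 / 2))"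
    by (simp add: sum.distrib[symmetric] distrib_left add_divide_distrib)
  also have "(\<Sum>i\<in>I. \<Sum>j\<in>I. \<delta> * q i j * ((norm (b j))\<^sup>2 / 2)) = (\<Sum>i\<in>I. \<Sum>j\<in>I. \<delta> * q i j * ((norm (b i))\<^sup>2 / 2))"
    by (subst sum.swap) (simp add: q(2))
  also have "(\<Sum>i\<in>I. \<Sum>j\<in>I. \<delta> * q i j * ((norm (b i))\<^sup>2 / 2)) + (\<Sum>i\<in>I. \<Sum>j\<in>I. \<delta> * q i j * ((norm (b i))\<^sup>2 / 2))
      = (\<Sum>i\<in>I. \<delta> * (norm (b i))\<^sup>2 * (\<Sum>j\<in>I. q i j))"
    by (simp add: sum.distrib[symmetric] sum_distrib_left sum_distrib_right mult_ac)
  also have "\<dots> \<le> (\<Sum>i\<in>I. \<delta> * (norm (b i))\<^sup>2 * 3)"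
  proof (intro sum_mono mult_left_mono)
    fix i
    have "(\<Sum>j\<in>I. q i j) \<le> (\<Sum>j<n. q i j)" using I q by (intro sum_mono2) auto
    also have "\<dots> \<le> 3" unfolding q_def by (rule sum_power_16_dist_le)
    finally show "(\<Sum>j\<in>I. q i j) \<le> 3" .
  qed (use \<delta> in auto)
  also have "\<dots> = 3 * \<delta> * (\<Sum>i\<in>I. (norm (b i))\<^sup>2)" by (simp add: sum_distrib_left mult_ac)
  finally show ?thesis unfolding v_def \<delta>_def .
qed

text \<open>The Hilbert--Schmidt norm bounds a matrix also on vector-valued sequences, by
  Cauchy--Schwarz in each row.\<close>

lemma sum_norm_matrix_square_le:
  fixes a :: "'i \<Rightarrow> 'b::real_normed_vector"
  shows "(\<Sum>q\<in>Q. (norm (\<Sum>i\<in>I. m q i *\<^sub>R a i))\<^sup>2) \<le> (\<Sum>q\<in>Q. \<Sum>i\<in>I. (m q i)\<^sup>2) * (\<Sum>i\<in>I. (norm (a i))\<^sup>2)"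
  unfolding sum_distrib_right[of _ Q]
proof (rule sum_mono)
  fix q
  have "norm (\<Sum>i\<in>I. m q i *\<^sub>R a i) \<le> (\<Sum>i\<in>I. \<bar>m q i\<bar> * norm (a i))"
    by (rule order_trans[OF norm_sum]) simp
  then have "(norm (\<Sum>i\<in>I. m q i *\<^sub>R a i))\<^sup>2 \<le> (\<Sum>i\<in>I. \<bar>m q i\<bar> * norm (a i))\<^sup>2" by (rule power_mono) simp
  also have "\<dots> \<le> (\<Sum>i\<in>I. \<bar>m q i\<bar>\<^sup>2) * (\<Sum>i\<in>I. (norm (a i))\<^sup>2)" by (rule Cauchy_Schwarz_ineq_sum)
  finally show "(norm (\<Sum>i\<in>I. m q i *\<^sub>R a i))\<^sup>2 \<le> (\<Sum>i\<in>I. (m q i)\<^sup>2) * (\<Sum>i\<in>I. (norm (a i))\<^sup>2)" by simp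
qed

lemma norm_sum3_square: "(norm (x + y + z))\<^sup>2 \<le> 3 * ((norm x)\<^sup>2 + (norm y)\<^sup>2 + (norm (z::'b::real_normed_vector))\<^sup>2)"
proof -
  have "(norm (x + y + z))\<^sup>2 \<le> (norm x + norm y + norm z)\<^sup>2"
    by (rule power_mono) (metis norm_triangle_le add_right_mono norm_triangle_ineq order_trans, simp)
  also have "\<dots> \<le> 3 * ((norm x)\<^sup>2 + (norm y)\<^sup>2 + (norm z)\<^sup>2)"
    using zero_le_power2[of "norm x - norm y"] zero_le_power2[of "norm y - norm z"] zero_le_power2[of "norm x - norm z"]
    by (simp add: power2_eq_square algebra_simps)
  finally show ?thesis .
qed

lemma sn_cs_bounds: "\<bar>sn y\<bar> \<le> 1" "\<bar>cs y\<bar> \<le> 1" by (simp_all add: sn_def cs_def)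

lemma sn_cs_lipschitz: "\<bar>sn x - sn y\<bar> \<le> 2 * pi * \<bar>x - y\<bar>" "\<bar>cs x - cs y\<bar> \<le> 2 * pi * \<bar>x - y\<bar>"
proof -
  show *: "\<bar>sn x - sn y\<bar> \<le> 2 * pi * \<bar>x - y\<bar>" for x y
  proof -
    have "\<bar>sn x - sn y\<bar> = 2 * \<bar>sin ((2 * pi * x - 2 * pi * y) / 2)\<bar> * \<bar>cos ((2 * pi * x + 2 * pi * y) / 2)\<bar>"
      unfolding sn_def by (simp add: sin_diff_sin abs_mult)
    also have "\<dots> \<le> 2 * \<bar>(2 * pi * x - 2 * pi * y) / 2\<bar> * 1"
      by (intro mult_mono mult_left_mono abs_sin_x_le_abs_x) auto
    also have "\<dots> = 2 * pi * \<bar>x - y\<bar>" by (simp add: abs_mult flip: right_diff_distrib)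
    finally show ?thesis .
  qed
  show "\<bar>cs x - cs y\<bar> \<le> 2 * pi * \<bar>x - y\<bar>"
    using *[of "x + 1/4" "y + 1/4"] by (simp add: sn_cs_shift)
qed

lemma sn_of_int: "sn (of_int m) = 0"
proof -
  have "2 * pi * of_int m = of_int (2 * m) * pi" by simp
  then show ?thesis unfolding sn_def sin_zero_iff_int2 by blast
qed

text \<open>Frequencies below the inverse length of the interval are frozen at \<open>x0\<close>; the others are
  orthogonal on it. The mixed block is a corner of the kernel.\<close>

lemma block_estimate:
  fixes \<kappa> :: "nat \<Rightarrow> nat \<Rightarrow> real" and a :: "nat \<Rightarrow> 'b::real_inner" and u v :: "nat \<Rightarrow> real \<Rightarrow> real"
  assumes lr: "l \<le> r" and ST: "S \<le> N" "T \<le> N" and H: "0 \<le> H"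
    and uc: "\<And>q. continuous_on {l..r} (u q)" and vc: "\<And>i. continuous_on {l..r} (v i)"
    and u1: "\<And>q x. \<bar>u q x\<bar> \<le> 1" and v1: "\<And>i x. \<bar>v i x\<bar> \<le> 1"
    and frozen: "\<And>x. x \<in> {l..r} \<Longrightarrow> (\<Sum>q<S. \<Sum>i<T. (\<kappa> q i * (u q x * v i x - u q x0 * v i x0))\<^sup>2) \<le> H"
    and corner: "\<And>b :: nat \<Rightarrow> 'b. (\<Sum>q\<in>{S..<N}. (norm (\<Sum>i<T. \<kappa> q i *\<^sub>R b i))\<^sup>2) \<le> 16 * (\<Sum>i<T. (norm (b i))\<^sup>2)"
    and lacunary: "\<And>b :: nat \<Rightarrow> 'b. integral {l..r} (\<lambda>x. (norm (\<Sum>i\<in>{T..<N}. v i x *\<^sub>R b i))\<^sup>2) \<le> 3 * (r - l) * (\<Sum>i\<in>{T..<N}. (norm (b i))\<^sup>2)"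
    and cols: "\<And>i. (\<Sum>q<N. (\<kappa> q i)\<^sup>2) \<le> 2"
  shows "integral {l..r} (\<lambda>x. \<Sum>q<N. (norm (u q x *\<^sub>R (\<Sum>i<N. (\<kappa> q i * v i x) *\<^sub>R a i) -
      (if q < S then \<Sum>i<T. (\<kappa> q i * (u q x0 * v i x0)) *\<^sub>R a i else 0)))\<^sup>2)
     \<le> 3 * (H + 22) * (r - l) * (\<Sum>i<N. (norm (a i))\<^sup>2)"
proof -
  define A where "A = (\<Sum>i<N. (norm (a i))\<^sup>2)"
  have A: "0 \<le> A" unfolding A_def by (intro sum_nonneg) auto
  have AT: "(\<Sum>i<T. (norm (a i))\<^sup>2) \<le> A" unfolding A_def using ST by (intro sum_mono2) auto
  define c where "c = (\<lambda>q. if q < S then \<Sum>i<T. (\<kappa> q i * (u q x0 * v i x0)) *\<^sub>R a i else 0)"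
  define X where "X = (\<lambda>q x. u q x *\<^sub>R (\<Sum>i<N. (\<kappa> q i * v i x) *\<^sub>R a i) - c q)"
  \<comment> \<open>\<open>P1\<close> has both frequencies frozen and is controlled by
    \<open>H\<close>; \<open>P2\<close> has only the inner one frozen and is the corner, with
    constant 16; in \<open>W\<close> the inner frequency oscillates, and lacunarity with the column
    bound gives 3 * 2. Hence \<open>H + 22\<close>, times 3 for squaring a sum of three
    terms.\<close>
  define P1 where "P1 = (\<lambda>q x. if q < S then \<Sum>i<T. (\<kappa> q i * (u q x * v i x - u q x0 * v i x0)) *\<^sub>R a i else 0)"
  define P2 where "P2 = (\<lambda>q x. if q < S then 0 else u q x *\<^sub>R (\<Sum>i<T. \<kappa> q i *\<^sub>R (v i x *\<^sub>R a i)))"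
  define W where "W = (\<lambda>q x. \<Sum>i\<in>{T..<N}. v i x *\<^sub>R (\<kappa> q i *\<^sub>R a i))"
  have split: "X q x = P1 q x + P2 q x + u q x *\<^sub>R W q x" for q x
  proof -
    have "(\<Sum>i<N. (\<kappa> q i * v i x) *\<^sub>R a i) = (\<Sum>i<T. (\<kappa> q i * v i x) *\<^sub>R a i) + W q x"
      unfolding W_def using ST sum.union_disjoint[of "{..<T}" "{T..<N}" "\<lambda>i. (\<kappa> q i * v i x) *\<^sub>R a i"]
      by (simp add: ivl_disj_un ivl_disj_int mult.commute)
    then have "X q x = u q x *\<^sub>R (\<Sum>i<T. (\<kappa> q i * v i x) *\<^sub>R a i) + u q x *\<^sub>R W q x - c q"
      unfolding X_def by (simp only: scaleR_add_right)
    moreover have "u q x *\<^sub>R (\<Sum>i<T. (\<kappa> q i * v i x) *\<^sub>R a i) - c q = P1 q x + P2 q x"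
    proof (cases "q < S")
      case True
      have "u q x *\<^sub>R (\<Sum>i<T. (\<kappa> q i * v i x) *\<^sub>R a i) = (\<Sum>i<T. (\<kappa> q i * (u q x * v i x)) *\<^sub>R a i)"
        by (simp add: scaleR_sum_right mult.left_commute)
      then show ?thesis using True
        by (simp add: P1_def P2_def c_def right_diff_distrib scaleR_diff_left sum_subtractf)
    next
      case False
      then show ?thesis by (simp add: P1_def P2_def c_def)
    qed
    ultimately show ?thesis by (simp add: algebra_simps)
  qed
  have pw: "(\<Sum>q<N. (norm (X q x))\<^sup>2) \<le> 3 * ((H + 16) * A + (\<Sum>q<N. (norm (W q x))\<^sup>2))" if x: "x \<in> {l..r}" for x
  proof -
    have "(\<Sum>q<N. (norm (P1 q x))\<^sup>2) = (\<Sum>q<S. (norm (P1 q x))\<^sup>2)"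
      using ST by (intro sum.mono_neutral_right) (auto simp: P1_def)
    also have "\<dots> = (\<Sum>q<S. (norm (\<Sum>i<T. (\<kappa> q i * (u q x * v i x - u q x0 * v i x0)) *\<^sub>R a i))\<^sup>2)"
      by (simp add: P1_def)
    also have "\<dots> \<le> (\<Sum>q<S. \<Sum>i<T. (\<kappa> q i * (u q x * v i x - u q x0 * v i x0))\<^sup>2) * (\<Sum>i<T. (norm (a i))\<^sup>2)"
      by (rule sum_norm_matrix_square_le)
    also have "\<dots> \<le> H * A" using frozen[OF x] AT H by (intro mult_mono sum_nonneg) auto
    finally have 1: "(\<Sum>q<N. (norm (P1 q x))\<^sup>2) \<le> H * A" .
    have "(\<Sum>q<N. (norm (P2 q x))\<^sup>2) = (\<Sum>q\<in>{S..<N}. (norm (P2 q x))\<^sup>2)"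
      by (intro sum.mono_neutral_right) (auto simp: P2_def)
    also have "\<dots> \<le> (\<Sum>q\<in>{S..<N}. (norm (\<Sum>i<T. \<kappa> q i *\<^sub>R (v i x *\<^sub>R a i)))\<^sup>2)"
    proof (intro sum_mono power_mono)
      fix q assume "q \<in> {S..<N}"
      then show "norm (P2 q x) \<le> norm (\<Sum>i<T. \<kappa> q i *\<^sub>R (v i x *\<^sub>R a i))"
        using u1[of q x] by (auto simp: P2_def intro!: mult_left_le_one_le)
    qed simp
    also have "\<dots> \<le> 16 * (\<Sum>i<T. (norm (v i x *\<^sub>R a i))\<^sup>2)" by (rule corner)
    also have "\<dots> \<le> 16 * (\<Sum>i<T. (norm (a i))\<^sup>2)"
      using v1 by (intro mult_left_mono sum_mono power_mono) (auto intro!: mult_left_le_one_le)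
    also have "\<dots> \<le> 16 * A" using AT by simp
    finally have 2: "(\<Sum>q<N. (norm (P2 q x))\<^sup>2) \<le> 16 * A" .
    have "(\<Sum>q<N. (norm (X q x))\<^sup>2) \<le> (\<Sum>q<N. 3 * ((norm (P1 q x))\<^sup>2 + (norm (P2 q x))\<^sup>2 + (norm (W q x))\<^sup>2))"
    proof (rule sum_mono)
      fix q
      have "(norm (u q x *\<^sub>R W q x))\<^sup>2 \<le> (norm (W q x))\<^sup>2"
        using u1 by (intro power_mono) (auto intro!: mult_left_le_one_le)
      then have "3 * ((norm (P1 q x))\<^sup>2 + (norm (P2 q x))\<^sup>2 + (norm (u q x *\<^sub>R W q x))\<^sup>2)
          \<le> 3 * ((norm (P1 q x))\<^sup>2 + (norm (P2 q x))\<^sup>2 + (norm (W q x))\<^sup>2)" by (simp only: mult_left_mono add_left_mono zero_le_numeral)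
      moreover have "(norm (X q x))\<^sup>2 \<le> 3 * ((norm (P1 q x))\<^sup>2 + (norm (P2 q x))\<^sup>2 + (norm (u q x *\<^sub>R W q x))\<^sup>2)"
        unfolding split by (rule norm_sum3_square)
      ultimately show "(norm (X q x))\<^sup>2 \<le> 3 * ((norm (P1 q x))\<^sup>2 + (norm (P2 q x))\<^sup>2 + (norm (W q x))\<^sup>2)" by (rule order_trans[rotated])
    qed
    also have "\<dots> = 3 * ((\<Sum>q<N. (norm (P1 q x))\<^sup>2) + (\<Sum>q<N. (norm (P2 q x))\<^sup>2) + (\<Sum>q<N. (norm (W q x))\<^sup>2))"
      by (simp only: sum_distrib_left[symmetric] sum.distrib)
    also have "\<dots> \<le> 3 * (H * A + 16 * A + (\<Sum>q<N. (norm (W q x))\<^sup>2))"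
      using 1 2 by (intro mult_left_mono add_mono) auto
    finally show ?thesis by (simp add: algebra_simps)
  qed
  have Wc: "continuous_on {l..r} (\<lambda>x. (norm (W q x))\<^sup>2)" for q
    unfolding W_def by (intro continuous_intros vc)
  have Xc: "continuous_on {l..r} (\<lambda>x. \<Sum>q<N. (norm (X q x))\<^sup>2)"
    unfolding X_def by (intro continuous_intros uc vc)
  have "integral {l..r} (\<lambda>x. \<Sum>q<N. (norm (X q x))\<^sup>2) \<le> integral {l..r} (\<lambda>x. 3 * ((H + 16) * A + (\<Sum>q<N. (norm (W q x))\<^sup>2)))"
    by (intro integral_le integrable_continuous_real Xc pw continuous_intros Wc) auto
  also have "\<dots> = 3 * ((H + 16) * A * (r - l) + (\<Sum>q<N. integral {l..r} (\<lambda>x. (norm (W q x))\<^sup>2)))"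
  proof (rule integral_unique)
    have "((\<lambda>x. (H + 16) * A) has_integral (r - l) *\<^sub>R ((H + 16) * A)) {l..r}"
      using has_integral_const_real[of "(H + 16) * A" l r] lr by simp
    then have "((\<lambda>x. 3 * ((H + 16) * A + (\<Sum>q<N. (norm (W q x))\<^sup>2))) has_integral
       3 * ((r - l) *\<^sub>R ((H + 16) * A) + (\<Sum>q<N. integral {l..r} (\<lambda>x. (norm (W q x))\<^sup>2)))) {l..r}"
      by (intro has_integral_mult_right has_integral_add has_integral_sum integrable_integral integrable_continuous_real Wc) auto
    then show "((\<lambda>x. 3 * ((H + 16) * A + (\<Sum>q<N. (norm (W q x))\<^sup>2))) has_integral
       3 * ((H + 16) * A * (r - l) + (\<Sum>q<N. integral {l..r} (\<lambda>x. (norm (W q x))\<^sup>2)))) {l..r}"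
      by (simp add: mult.commute)
  qed
  also have "(\<Sum>q<N. integral {l..r} (\<lambda>x. (norm (W q x))\<^sup>2)) \<le> 6 * (r - l) * A"
  proof -
    have "(\<Sum>q<N. integral {l..r} (\<lambda>x. (norm (W q x))\<^sup>2)) \<le> (\<Sum>q<N. 3 * (r - l) * (\<Sum>i\<in>{T..<N}. (norm (\<kappa> q i *\<^sub>R a i))\<^sup>2))"
      unfolding W_def by (intro sum_mono lacunary)
    also have "\<dots> = 3 * (r - l) * (\<Sum>i\<in>{T..<N}. (\<Sum>q<N. (\<kappa> q i)\<^sup>2) * (norm (a i))\<^sup>2)"
      unfolding sum_distrib_left[symmetric] by (subst sum.swap) (simp add: power_mult_distrib sum_distrib_right)
    also have "\<dots> \<le> 3 * (r - l) * (\<Sum>i\<in>{T..<N}. 2 * (norm (a i))\<^sup>2)"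
      using lr by (intro mult_left_mono sum_mono mult_right_mono cols) auto
    also have "\<dots> \<le> 3 * (r - l) * (\<Sum>i<N. 2 * (norm (a i))\<^sup>2)"
      using lr by (intro mult_left_mono sum_mono2) auto
    also have "\<dots> = 3 * (r - l) * (2 * A)" unfolding A_def by (simp only: sum_distrib_left)
    also have "\<dots> = 6 * (r - l) * A" by (simp add: algebra_simps)
    finally show ?thesis .
  qed
  finally have "integral {l..r} (\<lambda>x. \<Sum>q<N. (norm (X q x))\<^sup>2) \<le> 3 * ((H + 16) * A * (r - l) + 6 * (r - l) * A)" by simp
  also have "\<dots> = 3 * (H + 22) * (r - l) * A" by (simp add: algebra_simps)
  finally show ?thesis by (simp add: X_def c_def A_def)
qed

section \<open>Frozen frequencies and the two block estimates\<close>

lemma frozen_threshold: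
  assumes "0 < (\<beta>::real)"
  obtains s where "\<And>k. k < s \<longleftrightarrow> \<beta> * 16 ^ k \<le> 1"
proof
  obtain n where "1 / \<beta> < 16 ^ n" using real_arch_pow[of 16 "1 / \<beta>"] by auto
  then have ex: "1 < \<beta> * 16 ^ n" using assms by (simp add: field_simps)
  fix k
  show "k < (LEAST n. 1 < \<beta> * 16 ^ n) \<longleftrightarrow> \<beta> * 16 ^ k \<le> 1"
  proof
    assume "k < (LEAST n. 1 < \<beta> * 16 ^ n)"
    then show "\<beta> * 16 ^ k \<le> 1" using not_less_Least by force
  next
    assume k: "\<beta> * 16 ^ k \<le> 1"
    have L: "1 < \<beta> * 16 ^ (LEAST n. 1 < \<beta> * 16 ^ n)" using ex by (rule LeastI)
    show "k < (LEAST n. 1 < \<beta> * 16 ^ n)"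
    proof (rule ccontr)
      assume "\<not> k < (LEAST n. 1 < \<beta> * 16 ^ n)"
      then have "(16::real) ^ (LEAST n. 1 < \<beta> * 16 ^ n) \<le> 16 ^ k" by (intro power_increasing) auto
      then have "\<beta> * 16 ^ (LEAST n. 1 < \<beta> * 16 ^ n) \<le> \<beta> * 16 ^ k" using assms by (intro mult_left_mono) auto
      then show False using L k by linarith
    qed
  qed
qed

text \<open>The largest term is at most 1 and the others decrease geometrically below it, so the
  number of frozen frequencies does not enter.\<close>

lemma sum_frozen_squares_le:
  assumes "0 < (\<beta>::real)" and s: "\<And>k. k < s \<Longrightarrow> \<beta> * 16 ^ k \<le> 1"
  shows "(\<Sum>k<s. (\<beta> * 16 ^ k)\<^sup>2) \<le> 2"
proof -
  have "(\<Sum>k<s. (\<beta> * 16 ^ k)\<^sup>2) \<le> (\<Sum>k<s. (1 / 16) ^ (s - Suc k))"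
  proof (rule sum_mono)
    fix k assume "k \<in> {..<s}"
    then have k: "k < s" by simp
    have e: "(16::real) ^ (s - 1) = 16 ^ k * 16 ^ (s - Suc k)" using k by (simp add: power_add[symmetric])
    have "\<beta> * 16 ^ k * 16 ^ (s - Suc k) \<le> 1" using s[of "s - 1"] k unfolding e by (simp add: mult_ac)
    then have le: "\<beta> * 16 ^ k \<le> (1 / 16) ^ (s - Suc k)" by (simp add: power_divide field_simps)
    have "(\<beta> * 16 ^ k)\<^sup>2 \<le> (\<beta> * 16 ^ k) * 1"
      unfolding power2_eq_square using s[OF k] assms(1) by (intro mult_left_mono) auto
    then show "(\<beta> * 16 ^ k)\<^sup>2 \<le> (1 / 16) ^ (s - Suc k)" using le by simp
  qed
  also have "\<dots> = (\<Sum>d<s. (1 / 16) ^ d)" by (rule sum.nat_diff_reindex)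
  also have "\<dots> \<le> 16 / 15" by (rule sum_power_16_le)
  finally show ?thesis by simp
qed

text \<open>For \<open>j < k\<close> the cosine is slower than the sine, so \<open>16 ^ k\<close>
  alone governs the variation of the product; the kernel is zero for the other pairs.\<close>

lemma frozen_product_bound:
  fixes \<alpha> :: real
  assumes "0 < \<alpha>" "j < k" "x \<in> {l..r}" "x0 \<in> {l..r}"
  shows "\<bar>sn (\<alpha> * 16 ^ k * x) * cs (4 * \<alpha> * 16 ^ j * x) - sn (\<alpha> * 16 ^ k * x0) * cs (4 * \<alpha> * 16 ^ j * x0)\<bar>
     \<le> 4 * pi * (\<alpha> * (r - l) * 16 ^ k)"
proof -
  define a b a' b' where "a = \<alpha> * 16 ^ k * x" "b = 4 * \<alpha> * 16 ^ j * x" "a' = \<alpha> * 16 ^ k * x0" "b' = 4 * \<alpha> * 16 ^ j * x0"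
  have d: "\<bar>x - x0\<bar> \<le> r - l" using assms by auto
  have "(16::real) ^ Suc j \<le> 16 ^ k" using assms by (intro power_increasing) auto
  then have "4 * (16::real) ^ j \<le> 16 ^ k" using zero_le_power[of "16::real" j] by (simp only: power_Suc) linarith
  then have "\<alpha> * (4 * 16 ^ j) * \<bar>x - x0\<bar> \<le> \<alpha> * 16 ^ k * (r - l)"
    using assms(1) d by (intro mult_mono mult_left_mono) auto
  moreover have "\<alpha> * 16 ^ k * \<bar>x - x0\<bar> \<le> \<alpha> * 16 ^ k * (r - l)"
    using assms(1) d by (intro mult_left_mono) auto
  moreover have "\<bar>a - a'\<bar> = \<alpha> * 16 ^ k * \<bar>x - x0\<bar>" "\<bar>b - b'\<bar> = \<alpha> * (4 * 16 ^ j) * \<bar>x - x0\<bar>"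
    using assms(1) by (simp_all add: a_b_a'_b'_def abs_mult flip: right_diff_distrib)
  ultimately have ab: "\<bar>a - a'\<bar> \<le> \<alpha> * (r - l) * 16 ^ k" "\<bar>b - b'\<bar> \<le> \<alpha> * (r - l) * 16 ^ k" by (simp_all add: mult_ac)
  have "sn a * cs b - sn a' * cs b' = (sn a - sn a') * cs b + sn a' * (cs b - cs b')" by (simp add: algebra_simps)
  also have "\<bar>\<dots>\<bar> \<le> \<bar>sn a - sn a'\<bar> * \<bar>cs b\<bar> + \<bar>sn a'\<bar> * \<bar>cs b - cs b'\<bar>"
    using abs_triangle_ineq[of "(sn a - sn a') * cs b" "sn a' * (cs b - cs b')"] by (simp only: abs_mult)
  also have "\<dots> \<le> (2 * pi * \<bar>a - a'\<bar>) * 1 + 1 * (2 * pi * \<bar>b - b'\<bar>)"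
    by (intro add_mono mult_mono sn_cs_lipschitz sn_cs_bounds) auto
  also have "\<dots> \<le> (2 * pi * (\<alpha> * (r - l) * 16 ^ k)) * 1 + 1 * (2 * pi * (\<alpha> * (r - l) * 16 ^ k))"
    using ab by (intro add_mono mult_mono mult_left_mono) auto
  finally show ?thesis by (simp add: a_b_a'_b'_def)
qed

text \<open>The sum over \<open>j\<close> uses the square-summable rows of the kernel, the sum over
  \<open>k\<close> the geometric decay. With \<open>pi < 4\<close> the constant is
  \<open>32 * 4\<^sup>2 * 2\<close>.\<close>

lemma tri_frozen_sum:
  fixes D :: "nat \<Rightarrow> nat \<Rightarrow> real"
  assumes \<beta>: "0 < \<beta>" and S: "\<And>k. k < S \<Longrightarrow> \<beta> * 16 ^ k \<le> 1" 
    and D: "\<And>k j. j < k \<Longrightarrow> \<bar>D k j\<bar> \<le> 4 * pi * (\<beta> * 16 ^ k)"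
  shows "(\<Sum>k<S. \<Sum>j<T. (tri k j * D k j)\<^sup>2) \<le> 1024"
proof -
  have "(\<Sum>k<S. \<Sum>j<T. (tri k j * D k j)\<^sup>2) \<le> (\<Sum>k<S. \<Sum>j<T. (16 * pi\<^sup>2 * (\<beta> * 16 ^ k)\<^sup>2) * (tri k j)\<^sup>2)"
  proof (intro sum_mono)
    fix k j
    show "(tri k j * D k j)\<^sup>2 \<le> (16 * pi\<^sup>2 * (\<beta> * 16 ^ k)\<^sup>2) * (tri k j)\<^sup>2"
    proof (cases "j < k")
      case True
      have "\<bar>D k j\<bar>\<^sup>2 \<le> (4 * pi * (\<beta> * 16 ^ k))\<^sup>2" by (intro power_mono D True) simp
      then have "(D k j)\<^sup>2 \<le> 16 * pi\<^sup>2 * (\<beta> * 16 ^ k)\<^sup>2" by (simp add: power_mult_distrib)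
      then have "(tri k j)\<^sup>2 * (D k j)\<^sup>2 \<le> (tri k j)\<^sup>2 * (16 * pi\<^sup>2 * (\<beta> * 16 ^ k)\<^sup>2)" by (rule mult_left_mono) simp
      then show ?thesis by (simp only: power_mult_distrib[of "tri k j" "D k j"] mult.commute[of "(tri k j)\<^sup>2" "16 * pi\<^sup>2 * (\<beta> * 16 ^ k)\<^sup>2"])
    qed (simp add: tri_def)
  qed
  also have "\<dots> \<le> (\<Sum>k<S. (16 * pi\<^sup>2 * (\<beta> * 16 ^ k)\<^sup>2) * 2)"
    unfolding sum_distrib_left[symmetric] by (intro sum_mono mult_left_mono sum_tri_squares) auto
  also have "\<dots> = 32 * pi\<^sup>2 * (\<Sum>k<S. (\<beta> * 16 ^ k)\<^sup>2)" by (simp add: sum_distrib_left mult_ac)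
  also have "\<dots> \<le> 32 * 4\<^sup>2 * 2"
    using pi_less_4 by (intro mult_mono mult_left_mono power_mono sum_frozen_squares_le[OF \<beta> S] sum_nonneg) auto
  finally show ?thesis by simp
qed

lemma sn_cs_eq_sin: "sn y = sin (2 * pi * y + 0)" "cs y = sin (2 * pi * y + pi / 2)"
  by (simp_all add: sn_def cs_def sin_add)

lemma triangular_block_estimates:
  fixes a :: "nat \<Rightarrow> 'b::real_inner"
  assumes L: "1 \<le> (L::nat)" and lr: "l < r" and x0: "x0 \<in> {l..r}"
  shows "\<exists>c. (x0 \<in> \<int> \<longrightarrow> c = (\<lambda>_. 0)) \<and>
      integral {l..r} (\<lambda>x. \<Sum>k<N. (norm (sn (real L * 16 ^ k * x) *\<^sub>R (\<Sum>j<N. (tri k j * cs (4 * real L * 16 ^ j * x)) *\<^sub>R a j) - c k))\<^sup>2)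
      \<le> 3138 * (r - l) * (\<Sum>j<N. (norm (a j))\<^sup>2)" (is ?thesis1)
    and "\<exists>c. (x0 \<in> \<int> \<longrightarrow> c = (\<lambda>_. 0)) \<and>
      integral {l..r} (\<lambda>x. \<Sum>j<N. (norm (cs (4 * real L * 16 ^ j * x) *\<^sub>R (\<Sum>k<N. (tri k j * sn (real L * 16 ^ k * x)) *\<^sub>R a k) - c j))\<^sup>2)
      \<le> 3138 * (r - l) * (\<Sum>k<N. (norm (a k))\<^sup>2)" (is ?thesis2)
proof -
  define \<beta> where "\<beta> = real L * (r - l)"
  have \<beta>: "0 < \<beta>" "0 < 4 * \<beta>" "0 < real L" using L lr by (auto simp: \<beta>_def)
  obtain s where s: "\<And>k. k < s \<longleftrightarrow> \<beta> * 16 ^ k \<le> 1" using frozen_threshold[OF \<beta>(1)] by blast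
  obtain t where t: "\<And>k. k < t \<longleftrightarrow> 4 * \<beta> * 16 ^ k \<le> 1" using frozen_threshold[OF \<beta>(2)] by blast
  have ts: "t \<le> s"
  proof (rule ccontr)
    assume "\<not> t \<le> s"
    then have "4 * (\<beta> * 16 ^ s) \<le> 1" using t[of s] by simp
    then have "\<beta> * 16 ^ s \<le> 1" using \<beta>(1) by simp
    then show False using s[of s] by simp
  qed
  \<comment> \<open>The two thresholds differ by at most one. Together with strict triangularity
    this empties the mixed block of the adjoint, as \<open>corner'\<close> shows.\<close>
  have st: "s \<le> Suc t"
  proof (rule ccontr)
    assume "\<not> s \<le> Suc t"
    then have "16 * (\<beta> * 16 ^ t) \<le> 1" using s[of "Suc t"] by (simp add: mult_ac)
    moreover have "0 \<le> \<beta> * 16 ^ t" using \<beta>(1) by simp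
    ultimately have "4 * \<beta> * 16 ^ t \<le> 1" by linarith
    then show False using t[of t] by simp
  qed
  define S T where "S = min s N" and "T = min t N"
  have ST: "S \<le> N" "T \<le> N" by (simp_all add: S_def T_def)
  define u v where "u = (\<lambda>(k::nat) x. sn (real L * 16 ^ k * x))" and "v = (\<lambda>(j::nat) x. cs (4 * real L * 16 ^ j * x))"
  have c: "continuous_on X (u k)" "continuous_on X (v k)" for k X
    unfolding u_def v_def by (intro continuous_on_sn_cs_mult)+
  have b: "\<bar>u k x\<bar> \<le> 1" "\<bar>v k x\<bar> \<le> 1" for k x by (simp_all add: u_def v_def sn_cs_bounds)
  have D: "\<bar>u k x * v j x - u k x0 * v j x0\<bar> \<le> 4 * pi * (\<beta> * 16 ^ k)" if "j < k" "x \<in> {l..r}" for k j x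
    using frozen_product_bound[OF \<beta>(3) that x0] by (simp add: u_def v_def \<beta>_def)
  have fr: "(\<Sum>k<S. \<Sum>j<T. (tri k j * (u k x * v j x - u k x0 * v j x0))\<^sup>2) \<le> 1024" if "x \<in> {l..r}" for x
  proof (rule tri_frozen_sum[OF \<beta>(1)])
    show "\<beta> * 16 ^ k \<le> 1" if "k < S" for k using that s[of k] by (simp add: S_def)
    show "\<bar>u k x * v j x - u k x0 * v j x0\<bar> \<le> 4 * pi * (\<beta> * 16 ^ k)" if "j < k" for k j
      using that \<open>x \<in> {l..r}\<close> by (rule D)
  qed
  have unf: "1 \<le> real L * 16 ^ k * (r - l)" if "k \<in> {S..<N}" for k
    using that s[of k] by (auto simp: S_def \<beta>_def mult_ac)
  have unf': "1 \<le> 4 * real L * 16 ^ k * (r - l)" if "k \<in> {T..<N}" for k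
  proof -
    have "1 \<le> 4 * \<beta> * 16 ^ k" using that t[of k] by (auto simp: T_def)
    then show ?thesis by (simp only: \<beta>_def mult_ac)
  qed
  have lac: "integral {l..r} (\<lambda>x. (norm (\<Sum>i\<in>{S..<N}. u i x *\<^sub>R b i))\<^sup>2) \<le> 3 * (r - l) * (\<Sum>i\<in>{S..<N}. (norm (b i))\<^sup>2)"
    "integral {l..r} (\<lambda>x. (norm (\<Sum>i\<in>{T..<N}. v i x *\<^sub>R b i))\<^sup>2) \<le> 3 * (r - l) * (\<Sum>i\<in>{T..<N}. (norm (b i))\<^sup>2)" for b :: "nat \<Rightarrow> 'b"
  proof -
    have e: "u i x = sin (2 * pi * (real L * 16 ^ i) * x + 0)" "v i x = sin (2 * pi * (4 * real L * 16 ^ i) * x + pi / 2)" for i x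
      unfolding u_def v_def sn_cs_eq_sin by (simp_all only: mult.assoc)
    show "integral {l..r} (\<lambda>x. (norm (\<Sum>i\<in>{S..<N}. u i x *\<^sub>R b i))\<^sup>2) \<le> 3 * (r - l) * (\<Sum>i\<in>{S..<N}. (norm (b i))\<^sup>2)"
      unfolding e using lr \<beta>(3) unf by (intro lacunary_square_integral[where n = N]) auto
    show "integral {l..r} (\<lambda>x. (norm (\<Sum>i\<in>{T..<N}. v i x *\<^sub>R b i))\<^sup>2) \<le> 3 * (r - l) * (\<Sum>i\<in>{T..<N}. (norm (b i))\<^sup>2)"
      unfolding e using lr \<beta>(3) unf' by (intro lacunary_square_integral[where n = N]) auto
  qed
  have u0: "u k x0 = 0" if "x0 \<in> \<int>" for k
  proof -
    have "\<exists>m. x0 = of_int m" using that unfolding Ints_def by blast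
    then obtain m where "x0 = of_int m" by (elim exE)
    then have "real L * 16 ^ k * x0 = of_int (int L * 16 ^ k * m)" by simp
    then show ?thesis unfolding u_def using sn_of_int by metis
  qed
  \<comment> \<open>Since \<open>t \<le> s\<close>, the rows from \<open>S\<close> on are among the
    rows from \<open>T\<close> on, and the latter form a genuine corner with the columns below
    \<open>T\<close>.\<close>
  have corner: "(\<Sum>q\<in>{S..<N}. (norm (\<Sum>i<T. tri q i *\<^sub>R b i))\<^sup>2) \<le> 16 * (\<Sum>i<T. (norm (b i))\<^sup>2)" for b :: "nat \<Rightarrow> 'b"
  proof -
    have "(\<Sum>q\<in>{S..<N}. (norm (\<Sum>i<T. tri q i *\<^sub>R b i))\<^sup>2) \<le> (\<Sum>q\<in>{T..<N}. (norm (\<Sum>i<T. tri q i *\<^sub>R b i))\<^sup>2)"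
      using ts by (intro sum_mono2) (auto simp: S_def T_def)
    also have "\<dots> \<le> 16 * (\<Sum>i<T. (norm (b i))\<^sup>2)" by (rule tri_corner_bound)
    finally show ?thesis .
  qed
  have corner': "(\<Sum>q\<in>{T..<N}. (norm (\<Sum>i<S. tri i q *\<^sub>R b i))\<^sup>2) \<le> 16 * (\<Sum>i<S. (norm (b i))\<^sup>2)" for b :: "nat \<Rightarrow> 'b"
  proof -
    have "tri i q = 0" if "q \<in> {T..<N}" "i < S" for i q
      using that st by (auto simp: tri_def S_def T_def)
    then have "(\<Sum>q\<in>{T..<N}. (norm (\<Sum>i<S. tri i q *\<^sub>R b i))\<^sup>2) = 0" by simp
    also have "\<dots> \<le> 16 * (\<Sum>i<S. (norm (b i))\<^sup>2)" by (intro mult_nonneg_nonneg sum_nonneg) auto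
    finally show ?thesis .
  qed
  have fr': "(\<Sum>j<T. \<Sum>k<S. (tri k j * (v j x * u k x - v j x0 * u k x0))\<^sup>2) \<le> 1024" if "x \<in> {l..r}" for x
    using fr[OF that] by (subst sum.swap) (simp add: mult.commute)
  let ?c1 = "\<lambda>q. if q < S then \<Sum>i<T. (tri q i * (u q x0 * v i x0)) *\<^sub>R a i else 0"
  let ?c2 = "\<lambda>q. if q < T then \<Sum>i<S. (tri i q * (v q x0 * u i x0)) *\<^sub>R a i else 0"
  have "integral {l..r} (\<lambda>x. \<Sum>q<N. (norm (u q x *\<^sub>R (\<Sum>i<N. (tri q i * v i x) *\<^sub>R a i) - ?c1 q))\<^sup>2)
      \<le> 3 * (1024 + 22) * (r - l) * (\<Sum>i<N. (norm (a i))\<^sup>2)"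
    by (rule block_estimate) (use lr ST c b fr corner lac sum_tri_squares in auto)
  moreover have "x0 \<in> \<int> \<longrightarrow> ?c1 = (\<lambda>_. 0)" using u0 by auto
  ultimately show ?thesis1 by (intro exI[of _ ?c1]) (simp add: u_def v_def)
  have "integral {l..r} (\<lambda>x. \<Sum>q<N. (norm (v q x *\<^sub>R (\<Sum>i<N. (tri i q * u i x) *\<^sub>R a i) - ?c2 q))\<^sup>2)
      \<le> 3 * (1024 + 22) * (r - l) * (\<Sum>i<N. (norm (a i))\<^sup>2)"
    by (rule block_estimate[where \<kappa> = "\<lambda>q i. tri i q"]) (use lr ST c b fr' corner' lac sum_tri_squares in auto)
  moreover have "x0 \<in> \<int> \<longrightarrow> ?c2 = (\<lambda>_. 0)" using u0 by auto
  ultimately show ?thesis2 by (intro exI[of _ ?c2]) (simp add: u_def v_def)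
qed

section \<open>The operator function\<close>

text \<open>\<open>g n\<close> rounds to multiples of \<open>1 / n\<close> and cuts off at
  \<open>n\<close> in modulus, so it takes finitely many values. Composing \<open>f\<close> with it
  keeps the approximations inside \<open>range f\<close>, hence inside the carrier
  \<open>E\<close>.\<close>

lemma strongly_measurable_continuous:
  fixes f :: "real \<Rightarrow> 'e::real_normed_vector"
  assumes f: "continuous_on UNIV f" and E: "range f \<subseteq> E"
  shows "strongly_measurable E f"
proof -
  define q where "q = (\<lambda>(n::nat) x. max (- (int n)\<^sup>2) (min ((int n)\<^sup>2) \<lfloor>real n * x\<rfloor>))"
  define g where "g = (\<lambda>(n::nat) x. real_of_int (q n x) / real n)"
  have simple: "simple_function lebesgue (g n)" for n
  proof (rule simple_function_borel_measurable)
    have "g n \<in> borel_measurable lborel" unfolding g_def q_def by measurable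
    then show "g n \<in> borel_measurable lebesgue" by (rule measurable_completion)
    have "g n ` space lebesgue \<subseteq> (\<lambda>k. real_of_int k / real n) ` {- (int n)\<^sup>2..(int n)\<^sup>2}"
      by (auto simp: g_def q_def)
    then show "finite (g n ` space lebesgue)" by (rule finite_subset) simp
  qed
  have lim: "(\<lambda>n. g n x) \<longlonglongrightarrow> x" for x
  proof -
    obtain n0 :: nat where n0: "\<bar>x\<bar> \<le> real n0" using real_arch_simple by blast
    have close: "\<bar>g n x - x\<bar> \<le> 1 / real n" if n: "n \<ge> Suc n0" for n
    proof -
      have "\<bar>x\<bar> \<le> real n" using n0 n by linarith
      then have "- real n \<le> x" "x \<le> real n" by linarith+
      then have "real n * (- real n) \<le> real n * x" "real n * x \<le> real n * real n"
        by (intro mult_left_mono; simp)+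
      then have "of_int (- (int n)\<^sup>2) \<le> real n * x" "real n * x \<le> of_int ((int n)\<^sup>2)"
        by (simp_all add: power2_eq_square)
      then have "- (int n)\<^sup>2 \<le> \<lfloor>real n * x\<rfloor>" "\<lfloor>real n * x\<rfloor> \<le> (int n)\<^sup>2" by linarith+
      then have "g n x = of_int \<lfloor>real n * x\<rfloor> / real n" by (simp add: g_def q_def)
      moreover have "(of_int \<lfloor>real n * x\<rfloor> - real n * x) / real n = of_int \<lfloor>real n * x\<rfloor> / real n - x"
        using n by (simp add: diff_divide_distrib)
      moreover have "\<bar>(of_int \<lfloor>real n * x\<rfloor> - real n * x) / real n\<bar> \<le> 1 / real n"
        unfolding abs_divide by (rule frac_le) (use n in \<open>auto simp: abs_if\<close>, linarith+)
      ultimately show ?thesis by simp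
    qed
    have "(\<lambda>n. g n x - x) \<longlonglongrightarrow> 0"
      by (rule Lim_null_comparison[OF eventually_sequentiallyI[of "Suc n0"] lim_1_over_n]) (use close in simp)
    then show ?thesis by (simp add: LIM_zero_iff)
  qed
  have "simple_function lebesgue (\<lambda>x. f (g n x))" for n
    using simple by (rule simple_function_compose1)
  moreover have "(\<lambda>n. f (g n x)) \<longlonglongrightarrow> f x" for x
    using f lim by (auto intro: continuous_on_tendsto_compose)
  ultimately show ?thesis
    unfolding strongly_measurable_def using E by (intro conjI exI[of _ "\<lambda>n x. f (g n x)"]) auto
qed

lemma nn_integral_lebesgue_continuous:
  fixes h :: "real \<Rightarrow> real"
  assumes h: "continuous_on {l..r} h" and nonneg: "\<And>x. 0 \<le> h x"
  shows "(\<integral>\<^sup>+x\<in>{l..r}. ennreal (h x) \<partial>lebesgue) = ennreal (integral {l..r} h)"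
  unfolding nn_integral_completion
  by (rule nn_integral_has_integral_lebesgue'[OF _ integrable_integral[OF integrable_continuous_real[OF h]]]) (rule nonneg)

lemma bmo_norm_le:
  assumes f: "continuous_on UNIV f"
    and est: "\<And>l r. l < r \<Longrightarrow> \<exists>c\<in>E. integral {l..r} (\<lambda>x. norm (f x - c)) \<le> K * (r - l)"
  shows "bmo_norm E f \<le> ennreal K"
  unfolding bmo_norm_def
proof (rule SUP_least, clarify)
  fix l r :: real assume lr: "l < r"
  obtain c where c: "c \<in> E" "integral {l..r} (\<lambda>x. norm (f x - c)) \<le> K * (r - l)" using est[OF lr] by blast
  have cont: "continuous_on {l..r} (\<lambda>x. norm (f x - c))"
    by (intro continuous_intros continuous_on_subset[OF f]) auto
  have I: "0 \<le> integral {l..r} (\<lambda>x. norm (f x - c))"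
    by (intro integral_nonneg integrable_continuous_real cont) auto
  show "(INF c\<in>E. (\<integral>\<^sup>+x\<in>{l..r}. ennreal (norm (f x - c)) \<partial>lebesgue) / ennreal (r - l)) \<le> ennreal K"
  proof (rule INF_lower2[OF c(1)])
    have "(\<integral>\<^sup>+x\<in>{l..r}. ennreal (norm (f x - c)) \<partial>lebesgue) / ennreal (r - l) = ennreal (integral {l..r} (\<lambda>x. norm (f x - c)) / (r - l))"
      using lr I by (subst nn_integral_lebesgue_continuous[OF cont]) (auto simp: divide_ennreal)
    also have "\<dots> \<le> ennreal K" using c(2) lr by (intro ennreal_leI) (simp add: divide_le_eq)
    finally show "(\<integral>\<^sup>+x\<in>{l..r}. ennreal (norm (f x - c)) \<partial>lebesgue) / ennreal (r - l) \<le> ennreal K" .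
  qed
qed

lemma BMO_continuous:
  assumes f: "continuous_on UNIV f" and E: "range f \<subseteq> E" and bmo: "bmo_norm E f \<le> ennreal K"
  shows "f \<in> BMO E"
proof -
  have "set_integrable lebesgue {l..r} (\<lambda>x. norm (f x))" for l r
    by (intro absolutely_integrable_continuous_real continuous_intros continuous_on_subset[OF f]) auto
  moreover have "bmo_norm E f < \<infinity>" using bmo by (rule le_less_trans) simp
  ultimately show ?thesis unfolding BMO_def using strongly_measurable_continuous[OF f E] by blast
qed

text \<open>Zeros at the integers make the glued function continuous. An interval within one cell
  uses the constant of its block. An interval reaching across an integer is cut at integers; each
  piece contains an integer, so the constant 0 serves all pieces together.\<close>

lemma glued_blocks:
  fixes G :: "int \<Rightarrow> real \<Rightarrow> 'e::real_normed_vector"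
  assumes G: "\<And>m. continuous_on UNIV (G m)" and zero: "\<And>m i. G m (of_int i) = 0" and E: "0 \<in> E"
    and est: "\<And>m l r x0. l < r \<Longrightarrow> x0 \<in> {l..r} \<Longrightarrow>
      \<exists>c\<in>E. (x0 \<in> \<int> \<longrightarrow> c = 0) \<and> integral {l..r} (\<lambda>x. norm (G m x - c)) \<le> K * (r - l)"
  shows "continuous_on UNIV (\<lambda>x. G \<lfloor>x\<rfloor> x)"
    and "l < r \<Longrightarrow> \<exists>c\<in>E. integral {l..r} (\<lambda>x. norm (G \<lfloor>x\<rfloor> x - c)) \<le> K * (r - l)"
proof -
  define F where "F = (\<lambda>x. G \<lfloor>x\<rfloor> x)"
  have F: "F x = G m x" if "x \<in> {of_int m..of_int m + 1}" for x m
  proof (cases "x = of_int m + 1")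
    case True
    then have "x = of_int (m + 1)" by simp
    then show ?thesis unfolding F_def by (metis zero)
  next
    case False
    then have "\<lfloor>x\<rfloor> = m" using that by (intro floor_unique) auto
    then show ?thesis by (simp add: F_def)
  qed
  have cm: "continuous_on {of_int m..of_int m + 1} F" for m
    using continuous_on_subset[OF G[of m]] F by (subst continuous_on_cong[OF refl F]) auto
  have F_cont: "continuous_on UNIV F"
    unfolding continuous_on_eq_continuous_at[OF open_UNIV]
  proof
    fix x :: real
    define m where "m = \<lfloor>x\<rfloor>"
    have "{of_int (m - 1)..of_int m + 1} = {of_int (m - 1)..of_int (m - 1) + 1} \<union> {of_int m..of_int m + 1 :: real}"
      by auto
    moreover have "continuous_on ({of_int (m - 1)..of_int (m - 1) + 1} \<union> {of_int m..of_int m + 1 :: real}) F"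
      by (intro continuous_on_closed_Un cm) auto
    ultimately have "continuous_on {of_int (m - 1)..of_int m + 1} F" by simp
    moreover have "x \<in> interior {of_int (m - 1)..of_int m + 1}"
      unfolding interior_atLeastAtMost_real m_def by (simp add: greaterThanLessThan_iff) linarith
    ultimately show "isCont F x" by (rule continuous_on_interior)
  qed
  then show "continuous_on UNIV (\<lambda>x. G \<lfloor>x\<rfloor> x)" by (simp add: F_def)
  have Fi: "(\<lambda>x. norm (F x)) integrable_on {a..b}" for a b
    by (intro integrable_continuous_real continuous_intros continuous_on_subset[OF F_cont]) auto
  have piece: "integral {a..b} (\<lambda>x. norm (F x)) \<le> K * (b - a)"
    if ab: "of_int m \<le> a" "a \<le> b" "b \<le> of_int m + 1" and i: "a \<in> \<int> \<or> b \<in> \<int>" for a b m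
  proof (cases "a = b")
    case False
    obtain x0 where "x0 \<in> \<int>" "x0 \<in> {a..b}" using i ab by auto
    then have "integral {a..b} (\<lambda>x. norm (G m x - 0)) \<le> K * (b - a)" using est[of a b x0 m] ab False by auto
    moreover have "integral {a..b} (\<lambda>x. norm (F x)) = integral {a..b} (\<lambda>x. norm (G m x - 0))"
      by (intro integral_cong) (use F[of _ m] ab in auto)
    ultimately show ?thesis by simp
  qed simp
  have whole: "integral {of_int m..of_int m + real n} (\<lambda>x. norm (F x)) \<le> K * real n" for m n
  proof (induction n)
    case (Suc n)
    have "integral {of_int m..of_int m + real (Suc n)} (\<lambda>x. norm (F x)) =
      integral {of_int m..of_int m + real n} (\<lambda>x. norm (F x)) + integral {of_int m + real n..of_int m + real (Suc n)} (\<lambda>x. norm (F x))"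
      by (rule Henstock_Kurzweil_Integration.integral_combine[symmetric]) (auto intro: Fi)
    moreover have "integral {of_int m + real n..of_int m + real (Suc n)} (\<lambda>x. norm (F x)) \<le> K * ((of_int m + real (Suc n)) - (of_int m + real n))"
      by (rule piece[of "m + int n"]) auto
    ultimately show ?case using Suc by (simp add: algebra_simps)
  qed simp
  assume lr: "l < r"
  define m where "m = \<lfloor>l\<rfloor>"
  have ml: "of_int m \<le> l" "l < of_int m + 1" by (simp_all add: m_def)
  show "\<exists>c\<in>E. integral {l..r} (\<lambda>x. norm (G \<lfloor>x\<rfloor> x - c)) \<le> K * (r - l)"
  proof (cases "r \<le> of_int m + 1")
    case True
    obtain c where c: "c \<in> E" "integral {l..r} (\<lambda>x. norm (G m x - c)) \<le> K * (r - l)" using est[OF lr, of l m] lr by auto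
    have "integral {l..r} (\<lambda>x. norm (F x - c)) = integral {l..r} (\<lambda>x. norm (G m x - c))"
      by (intro integral_cong) (use F[of _ m] ml True in auto)
    then show ?thesis using c by (intro bexI[of _ c]) (simp_all add: F_def)
  next
    case False
    define n where "n = nat (\<lfloor>r\<rfloor> - (m + 1))"
    define p q where "p = real_of_int (m + 1)" and "q = real_of_int (m + 1) + real n"
    have "m + 1 \<le> \<lfloor>r\<rfloor>" using False by (simp add: le_floor_iff)
    then have q: "q = of_int \<lfloor>r\<rfloor>" by (simp add: q_def n_def)
    have ord: "l \<le> p" "p \<le> q" "q \<le> r" using ml by (simp_all add: p_def q) (simp_all add: q_def p_def q[symmetric])
    have "integral {l..r} (\<lambda>x. norm (F x)) = integral {l..p} (\<lambda>x. norm (F x)) + (integral {p..q} (\<lambda>x. norm (F x)) + integral {q..r} (\<lambda>x. norm (F x)))"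
      using Henstock_Kurzweil_Integration.integral_combine[OF _ _ Fi, of l p r] Henstock_Kurzweil_Integration.integral_combine[OF _ _ Fi, of p q r] ord by simp
    also have "\<dots> \<le> K * (p - l) + (K * real n + K * (r - q))"
    proof (intro add_mono)
      show "integral {l..p} (\<lambda>x. norm (F x)) \<le> K * (p - l)" using ml by (intro piece[of m]) (auto simp: p_def)
      show "integral {p..q} (\<lambda>x. norm (F x)) \<le> K * real n" unfolding p_def q_def by (rule whole)
      show "integral {q..r} (\<lambda>x. norm (F x)) \<le> K * (r - q)" unfolding q by (intro piece[of "\<lfloor>r\<rfloor>"]) (auto simp: less_imp_le)
    qed
    also have "\<dots> = K * (r - l)" by (simp add: p_def q_def algebra_simps)
    finally show ?thesis using E by (intro bexI[of _ 0]) (simp_all add: F_def)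
  qed
qed

section \<open>Oscillation of vector-valued sums\<close>

context banach_space_over
begin

lemma bounded_linear_smul_left: "bounded_linear (\<lambda>c. smul c x)"
  by (rule bounded_linear_intro[where K="norm x"])
     (simp_all add: scale_left_distrib smul_scaleR_left norm_scale)

text \<open>The upper estimate bounds the norm by the l2 norm \<open>s\<close> of the coefficients,
  and \<open>s \<le> (1 + s\<^sup>2) / 2\<close> passes to mean squares. The resulting bound is not
  homogeneous, but uniform on unit balls, as the definition of \<open>BMO_so\<close> asks.\<close>

lemma smul_sum_oscillation:
  assumes C: "0 \<le> C" and upper: "\<And>t. norm (\<Sum>k<N. smul (t k) (y k)) \<le> C * L2_set (\<lambda>k. norm (t k)) {..<N}"
    and V: "\<And>k. continuous_on {l..r} (V k)" and lr: "l \<le> r"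
    and osc: "integral {l..r} (\<lambda>x. \<Sum>k<N. (norm (V k x - c k))\<^sup>2) \<le> D * (r - l)"
  shows "integral {l..r} (\<lambda>x. norm ((\<Sum>k<N. smul (V k x) (y k)) - (\<Sum>k<N. smul (c k) (y k)))) \<le> C * (1 + D) / 2 * (r - l)"
proof -
  have cs: "continuous_on {l..r} (\<lambda>x. smul (V k x) (y k))" for k
    by (rule bounded_linear.continuous_on[OF bounded_linear_smul_left V])
  have c2: "continuous_on {l..r} (\<lambda>x. \<Sum>k<N. (norm (V k x - c k))\<^sup>2)"
    by (intro continuous_intros V)
  have pw: "norm ((\<Sum>k<N. smul (V k x) (y k)) - (\<Sum>k<N. smul (c k) (y k))) \<le> C / 2 * (1 + (\<Sum>k<N. (norm (V k x - c k))\<^sup>2))" for x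
  proof -
    define s where "s = L2_set (\<lambda>k. norm (V k x - c k)) {..<N}"
    have s2: "s\<^sup>2 = (\<Sum>k<N. (norm (V k x - c k))\<^sup>2)"
      unfolding s_def L2_set_def by (simp add: sum_nonneg)
    have "(\<Sum>k<N. smul (V k x) (y k)) - (\<Sum>k<N. smul (c k) (y k)) = (\<Sum>k<N. smul (V k x - c k) (y k))"
      by (simp add: sum_subtractf scale_left_diff_distrib)
    then have "norm ((\<Sum>k<N. smul (V k x) (y k)) - (\<Sum>k<N. smul (c k) (y k))) \<le> C * s"
      using upper[of "\<lambda>k. V k x - c k"] by (simp add: s_def)
    also have "\<dots> \<le> C * ((1 + s\<^sup>2) / 2)"
      using zero_le_power2[of "1 - s"] C by (intro mult_left_mono) (simp_all add: power2_diff)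
    finally show ?thesis by (simp add: s2)
  qed
  have "integral {l..r} (\<lambda>x. norm ((\<Sum>k<N. smul (V k x) (y k)) - (\<Sum>k<N. smul (c k) (y k))))
     \<le> integral {l..r} (\<lambda>x. C / 2 * (1 + (\<Sum>k<N. (norm (V k x - c k))\<^sup>2)))"
    by (intro integral_le integrable_continuous_real continuous_intros cs c2 pw)
  also have "\<dots> = C / 2 * ((r - l) + integral {l..r} (\<lambda>x. \<Sum>k<N. (norm (V k x - c k))\<^sup>2))"
  proof (rule integral_unique)
    have "((\<lambda>x. 1) has_integral (r - l)) {l..r}"
      using has_integral_const_real[of "1::real" l r] lr by simp
    then show "((\<lambda>x. C / 2 * (1 + (\<Sum>k<N. (norm (V k x - c k))\<^sup>2))) has_integral
       C / 2 * ((r - l) + integral {l..r} (\<lambda>x. \<Sum>k<N. (norm (V k x - c k))\<^sup>2))) {l..r}"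
      by (intro has_integral_mult_right has_integral_add integrable_integral integrable_continuous_real c2)
  qed
  also have "\<dots> \<le> C / 2 * ((r - l) + D * (r - l))" using osc C by (intro mult_left_mono add_left_mono) auto
  also have "(r - l) + D * (r - l) = (1 + D) * (r - l)" by (simp add: algebra_simps)
  finally show ?thesis by simp
qed

lemma glued_blocks_bmo:
  fixes V :: "int \<Rightarrow> nat \<Rightarrow> real \<Rightarrow> 'k" and N :: "int \<Rightarrow> nat"
  assumes C: "0 \<le> C" and upper: "\<And>m t. norm (\<Sum>k<N m. smul (t k) (y m k)) \<le> C * L2_set (\<lambda>k. norm (t k)) {..<N m}"
    and E: "0 \<in> E" "\<And>m t. (\<Sum>k<N m. smul (t k) (y m k)) \<in> E"
    and V: "\<And>m k. continuous_on UNIV (V m k)" and V0: "\<And>m k i. V m k (of_int i) = 0"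
    and osc: "\<And>m l r x0. l < r \<Longrightarrow> x0 \<in> {l..r} \<Longrightarrow>
      \<exists>c. (x0 \<in> \<int> \<longrightarrow> c = (\<lambda>_. 0)) \<and> integral {l..r} (\<lambda>x. \<Sum>k<N m. (norm (V m k x - c k))\<^sup>2) \<le> D * (r - l)"
  defines "F \<equiv> (\<lambda>x. \<Sum>k<N \<lfloor>x\<rfloor>. smul (V \<lfloor>x\<rfloor> k x) (y \<lfloor>x\<rfloor> k))"
  shows "F \<in> BMO E" "bmo_norm E F \<le> ennreal (C * (1 + D) / 2)"
proof -
  define G where "G = (\<lambda>m x. \<Sum>k<N m. smul (V m k x) (y m k))"
  have FG: "F = (\<lambda>x. G \<lfloor>x\<rfloor> x)" by (simp add: F_def G_def)
  have Gc: "continuous_on UNIV (G m)" for m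
    unfolding G_def by (intro continuous_intros bounded_linear.continuous_on[OF bounded_linear_smul_left V])
  have G0: "G m (of_int i) = 0" for m i by (simp add: G_def V0)
  have est: "\<exists>c\<in>E. (x0 \<in> \<int> \<longrightarrow> c = 0) \<and> integral {l..r} (\<lambda>x. norm (G m x - c)) \<le> C * (1 + D) / 2 * (r - l)"
    if lr: "l < r" "x0 \<in> {l..r}" for m l r x0
  proof -
    obtain c where c: "x0 \<in> \<int> \<longrightarrow> c = (\<lambda>_. 0)"
      "integral {l..r} (\<lambda>x. \<Sum>k<N m. (norm (V m k x - c k))\<^sup>2) \<le> D * (r - l)" using osc[OF lr, of m] by (elim exE conjE)
    have "integral {l..r} (\<lambda>x. norm (G m x - (\<Sum>k<N m. smul (c k) (y m k)))) \<le> C * (1 + D) / 2 * (r - l)"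
      unfolding G_def using lr c
      by (intro smul_sum_oscillation C upper continuous_on_subset[OF V]) auto
    then show ?thesis using c E(2)[where m = m and t = c] by (intro bexI[of _ "\<Sum>k<N m. smul (c k) (y m k)"]) auto
  qed
  have Fc: "continuous_on UNIV F" unfolding FG by (rule glued_blocks[OF Gc G0 E(1) est])
  show bmo: "bmo_norm E F \<le> ennreal (C * (1 + D) / 2)"
    by (rule bmo_norm_le[OF Fc]) (unfold FG, rule glued_blocks[OF Gc G0 E(1) est])
  have "range F \<subseteq> E" using E(2) by (auto simp: F_def)
  then show "F \<in> BMO E" by (rule BMO_continuous[OF Fc _ bmo])
qed

end

text \<open>Upper l2 estimates for vectors dualise to square-summability of the values of
  functionals: \<open>t k\<close> has the norm of \<open>\<alpha> k\<close> and makes each product a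
  nonnegative real. Where \<open>\<alpha> k = 0\<close>, division by zero supplies
  \<open>t k = 0\<close>.\<close>

lemma sum_norm_square_le_duality:
  fixes \<alpha> :: "nat \<Rightarrow> 'k::real_normed_field"
  assumes C: "0 \<le> C" and upper: "\<And>t. norm (\<Sum>k<N. t k * \<alpha> k) \<le> C * L2_set (\<lambda>k. norm (t k)) {..<N} * M" and M: "0 \<le> M"
  shows "(\<Sum>k<N. (norm (\<alpha> k))\<^sup>2) \<le> (C * M)\<^sup>2"
proof -
  define s where "s = L2_set (\<lambda>k. norm (\<alpha> k)) {..<N}"
  have s2: "s\<^sup>2 = (\<Sum>k<N. (norm (\<alpha> k))\<^sup>2)"
    unfolding s_def L2_set_def by (simp add: sum_nonneg)
  define t where "t = (\<lambda>k. of_real ((norm (\<alpha> k))\<^sup>2) / \<alpha> k)"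
  have t: "norm (t k) = norm (\<alpha> k)" "t k * \<alpha> k = of_real ((norm (\<alpha> k))\<^sup>2)" for k
    by (cases "\<alpha> k = 0"; simp add: t_def norm_divide power2_eq_square norm_mult)+
  have "s\<^sup>2 = norm (of_real (s\<^sup>2) :: 'k)" by (simp add: norm_power)
  also have "of_real (s\<^sup>2) = (\<Sum>k<N. t k * \<alpha> k)" by (simp add: s2 t)
  also have "norm \<dots> \<le> C * s * M" using upper[of t] by (simp add: t s_def)
  finally have "s * s \<le> (C * M) * s" by (simp add: power2_eq_square mult_ac)
  moreover have "0 \<le> s" by (simp add: s_def)
  ultimately have "s \<le> C * M" using C M by (cases "s = 0") auto
  then have "s\<^sup>2 \<le> (C * M)\<^sup>2" using \<open>0 \<le> s\<close> by (rule power_mono)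
  then show ?thesis by (simp add: s2)
qed

context banach_space_over
begin

text \<open>On \<open>[m, m + 1)\<close> the operator function is a triangular Hilbert matrix of Rademacher-like
  products acting from the span of the \<open>\<phi> m j\<close> to the span of the \<open>y m k\<close>.\<close>

definition block_operator :: "(int \<Rightarrow> nat) \<Rightarrow> (int \<Rightarrow> nat) \<Rightarrow> (int \<Rightarrow> nat \<Rightarrow> 'a) \<Rightarrow> (int \<Rightarrow> nat \<Rightarrow> 'a \<Rightarrow>\<^sub>L 'k) \<Rightarrow> real \<Rightarrow> 'a \<Rightarrow> 'a" where
  "block_operator N L y \<phi> x e = (\<Sum>k<N \<lfloor>x\<rfloor>. smul (sn (real (L \<lfloor>x\<rfloor>) * 16 ^ k * x) *\<^sub>R
     (\<Sum>j<N \<lfloor>x\<rfloor>. (tri k j * cs (4 * real (L \<lfloor>x\<rfloor>) * 16 ^ j * x)) *\<^sub>R blinfun_apply (\<phi> \<lfloor>x\<rfloor> j) e)) (y \<lfloor>x\<rfloor> k))"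

context
  fixes N L :: "int \<Rightarrow> nat" and y :: "int \<Rightarrow> nat \<Rightarrow> 'a" and \<phi> :: "int \<Rightarrow> nat \<Rightarrow> 'a \<Rightarrow>\<^sub>L 'k" and C C' :: real
  assumes L: "\<And>m. 1 \<le> L m" and C: "0 \<le> C" "0 \<le> C'"
    and upper: "\<And>m t. norm (\<Sum>k<N m. smul (t k) (y m k)) \<le> C * L2_set (\<lambda>k. norm (t k)) {..<N m}"
    and upper': "\<And>m t. norm (\<Sum>k<N m. dual_scale (t k) (\<phi> m k)) \<le> C' * L2_set (\<lambda>k. norm (t k)) {..<N m}"
    and \<phi>: "\<And>m k. k < N m \<Longrightarrow> \<phi> m k \<in> dual_space smul"
begin

lemma sum_norm_functionals_le: "(\<Sum>j<N m. (norm (blinfun_apply (\<phi> m j) e))\<^sup>2) \<le> (C' * norm e)\<^sup>2"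
proof (rule sum_norm_square_le_duality[OF C(2)])
  fix t
  have "norm (\<Sum>k<N m. t k * blinfun_apply (\<phi> m k) e) = norm (blinfun_apply (\<Sum>k<N m. dual_scale (t k) (\<phi> m k)) e)"
    by (simp add: blinfun.sum_left blinfun_apply_dual_scale)
  also have "\<dots> \<le> norm (\<Sum>k<N m. dual_scale (t k) (\<phi> m k)) * norm e" by (rule norm_blinfun)
  also have "\<dots> \<le> C' * L2_set (\<lambda>k. norm (t k)) {..<N m} * norm e" by (rule mult_right_mono[OF upper']) simp
  finally show "norm (\<Sum>k<N m. t k * blinfun_apply (\<phi> m k) e) \<le> C' * L2_set (\<lambda>k. norm (t k)) {..<N m} * norm e" .
qed simp

lemma sum_norm_vectors_le:
  assumes \<psi>: "\<psi> \<in> dual_space smul"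
  shows "(\<Sum>k<N m. (norm (blinfun_apply \<psi> (y m k)))\<^sup>2) \<le> (C * norm \<psi>)\<^sup>2"
proof (rule sum_norm_square_le_duality[OF C(1)])
  fix t
  have "norm (\<Sum>k<N m. t k * blinfun_apply \<psi> (y m k)) = norm (blinfun_apply \<psi> (\<Sum>k<N m. smul (t k) (y m k)))"
    using \<psi> by (simp add: blinfun.sum_right dual_space_smul)
  also have "\<dots> \<le> norm \<psi> * norm (\<Sum>k<N m. smul (t k) (y m k))" by (rule norm_blinfun)
  also have "\<dots> \<le> norm \<psi> * (C * L2_set (\<lambda>k. norm (t k)) {..<N m})" by (rule mult_left_mono[OF upper]) simp
  finally show "norm (\<Sum>k<N m. t k * blinfun_apply \<psi> (y m k)) \<le> C * L2_set (\<lambda>k. norm (t k)) {..<N m} * norm \<psi>"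
    by (simp add: mult_ac)
qed simp

text \<open>The numbers \<open>blinfun_apply (\<phi> m j) e\<close> have l2 norm at most
  \<open>C' * norm e\<close> in every block, whatever its dimension, so the block estimates hold
  with one constant.\<close>

lemma block_operator_BMO:
  "(\<lambda>x. block_operator N L y \<phi> x e) \<in> BMO UNIV"
  "bmo_norm UNIV (\<lambda>x. block_operator N L y \<phi> x e) \<le> ennreal (C * (1 + 3138 * (C' * norm e)\<^sup>2) / 2)"
proof -
  define V where "V = (\<lambda>m k x. sn (real (L m) * 16 ^ k * x) *\<^sub>R
     (\<Sum>j<N m. (tri k j * cs (4 * real (L m) * 16 ^ j * x)) *\<^sub>R blinfun_apply (\<phi> m j) e))"
  have V: "continuous_on UNIV (V m k)" for m k
    unfolding V_def by (intro continuous_intros continuous_on_sn_cs_mult)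
  have V0: "V m k (of_int i) = 0" for m k i
  proof -
    have "sn (real (L m) * 16 ^ k * of_int i) = sn (of_int (int (L m) * 16 ^ k * i))" by simp
    then show ?thesis unfolding V_def sn_of_int by simp
  qed
  have osc: "\<exists>c. (x0 \<in> \<int> \<longrightarrow> c = (\<lambda>_. 0)) \<and> integral {l..r} (\<lambda>x. \<Sum>k<N m. (norm (V m k x - c k))\<^sup>2) \<le> 3138 * (C' * norm e)\<^sup>2 * (r - l)"
    if lr: "l < r" "x0 \<in> {l..r}" for m l r x0
  proof -
    obtain c where c: "x0 \<in> \<int> \<longrightarrow> c = (\<lambda>_. 0)"
      "integral {l..r} (\<lambda>x. \<Sum>k<N m. (norm (V m k x - c k))\<^sup>2) \<le> 3138 * (r - l) * (\<Sum>j<N m. (norm (blinfun_apply (\<phi> m j) e))\<^sup>2)"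
      unfolding V_def using triangular_block_estimates(1)[OF L[of m] lr, where N = "N m" and a = "\<lambda>j. blinfun_apply (\<phi> m j) e"] by (elim exE conjE)
    note c(2)
    also have "3138 * (r - l) * (\<Sum>j<N m. (norm (blinfun_apply (\<phi> m j) e))\<^sup>2) \<le> 3138 * (r - l) * (C' * norm e)\<^sup>2"
      using lr by (intro mult_left_mono sum_norm_functionals_le) auto
    also have "3138 * (r - l) * (C' * norm e)\<^sup>2 = 3138 * (C' * norm e)\<^sup>2 * (r - l)" by (simp only: mult_ac)
    finally have "(x0 \<in> \<int> \<longrightarrow> c = (\<lambda>_. 0)) \<and> integral {l..r} (\<lambda>x. \<Sum>k<N m. (norm (V m k x - c k))\<^sup>2) \<le> 3138 * (C' * norm e)\<^sup>2 * (r - l)"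
      by (intro conjI c(1))
    then show ?thesis by (rule exI[of _ c])
  qed
  note * = glued_blocks_bmo[where N = N and y = y and E = UNIV and V = V, OF C(1) upper _ _ V V0 osc]
  show "(\<lambda>x. block_operator N L y \<phi> x e) \<in> BMO UNIV"
    "bmo_norm UNIV (\<lambda>x. block_operator N L y \<phi> x e) \<le> ennreal (C * (1 + 3138 * (C' * norm e)\<^sup>2) / 2)"
    using * by (simp_all add: block_operator_def V_def)
qed

lemma bounded_linear_block_operator: "bounded_linear (block_operator N L y \<phi> x)"
  unfolding block_operator_def
  by (intro bounded_linear_sum bounded_linear_compose[OF bounded_linear_smul_left]
      bounded_linear_compose[OF bounded_linear_scaleR_right] blinfun.bounded_linear_right)

lemma block_operator_smul: "block_operator N L y \<phi> x (smul c e) = smul c (block_operator N L y \<phi> x e)"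
proof -
  have "(\<Sum>j<N m. t j *\<^sub>R blinfun_apply (\<phi> m j) (smul c e)) = c * (\<Sum>j<N m. t j *\<^sub>R blinfun_apply (\<phi> m j) e)" for t m
    by (simp add: dual_space_smul \<phi> sum_distrib_left)
  then show ?thesis unfolding block_operator_def
    by (simp add: mult_scaleR_right[symmetric] scale_sum_right del: mult_scaleR_right)
qed

lemma block_operator_BMO_so: "block_operator N L y \<phi> \<in> BMO_so smul UNIV"
proof -
  have "block_operator N L y \<phi> x \<in> bounded_operators smul UNIV" for x
  proof -
    have "\<exists>K. \<forall>e. norm (block_operator N L y \<phi> x e) \<le> norm e * K"
      using bounded_linear.bounded[OF bounded_linear_block_operator] .
    then have "\<exists>K. \<forall>e\<in>UNIV. norm (block_operator N L y \<phi> x e) \<le> K * norm e" by (simp add: mult.commute)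
    then show ?thesis unfolding bounded_operators_def
      by (simp add: block_operator_smul linear_add[OF bounded_linear.linear[OF bounded_linear_block_operator]])
  qed
  moreover have "(SUP e\<in>{e\<in>UNIV. norm e \<le> 1}. bmo_norm UNIV (\<lambda>x. block_operator N L y \<phi> x e)) < \<infinity>"
  proof (rule le_less_trans[OF SUP_least])
    fix e :: 'a assume "e \<in> {e\<in>UNIV. norm e \<le> 1}"
    then have "(C' * norm e)\<^sup>2 \<le> (C' * 1)\<^sup>2" using C by (intro power_mono mult_left_mono) auto
    then have "C * (1 + 3138 * (C' * norm e)\<^sup>2) / 2 \<le> C * (1 + 3138 * (C' * 1)\<^sup>2) / 2"
      using C by (intro divide_right_mono mult_left_mono add_left_mono) auto
    then show "bmo_norm UNIV (\<lambda>x. block_operator N L y \<phi> x e) \<le> ennreal (C * (1 + 3138 * (C' * 1)\<^sup>2) / 2)"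
      by (rule order_trans[OF block_operator_BMO(2) ennreal_leI])
  qed simp
  ultimately show ?thesis unfolding BMO_so_def using block_operator_BMO(1) by simp
qed

text \<open>The transposed formula, with cosines outside and sines inside. It is bounded linear in
  \<open>\<psi>\<close> on the whole type, whereas it represents the adjoint for
  \<open>\<psi>\<close> in the dual space.\<close>

definition block_adjoint :: "real \<Rightarrow> ('a \<Rightarrow>\<^sub>L 'k) \<Rightarrow> ('a \<Rightarrow>\<^sub>L 'k)" where
  "block_adjoint x \<psi> = (\<Sum>j<N \<lfloor>x\<rfloor>. dual_scale (cs (4 * real (L \<lfloor>x\<rfloor>) * 16 ^ j * x) *\<^sub>R
     (\<Sum>k<N \<lfloor>x\<rfloor>. (tri k j * sn (real (L \<lfloor>x\<rfloor>) * 16 ^ k * x)) *\<^sub>R blinfun_apply \<psi> (y \<lfloor>x\<rfloor> k))) (\<phi> \<lfloor>x\<rfloor> j))"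

lemma adjoint_block_operator:
  assumes \<psi>: "\<psi> \<in> dual_space smul"
  shows "adjoint_operator (block_operator N L y \<phi> x) \<psi> = block_adjoint x \<psi>"
proof (rule blinfun_eqI)
  fix e
  have "blinfun_apply (adjoint_operator (block_operator N L y \<phi> x) \<psi>) e = blinfun_apply \<psi> (block_operator N L y \<phi> x e)"
    unfolding adjoint_operator_def
    by (subst bounded_linear_Blinfun_apply)
       (auto intro!: bounded_linear_compose[OF blinfun.bounded_linear_right bounded_linear_block_operator])
  also have "\<dots> = (\<Sum>k<N \<lfloor>x\<rfloor>. \<Sum>j<N \<lfloor>x\<rfloor>. (sn (real (L \<lfloor>x\<rfloor>) * 16 ^ k * x) * (tri k j * cs (4 * real (L \<lfloor>x\<rfloor>) * 16 ^ j * x))) *\<^sub>R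
      (blinfun_apply (\<phi> \<lfloor>x\<rfloor> j) e * blinfun_apply \<psi> (y \<lfloor>x\<rfloor> k)))"
    unfolding block_operator_def
    by (simp add: blinfun.sum_right dual_space_smul[OF \<psi>] scaleR_sum_right sum_distrib_right)
  also have "\<dots> = (\<Sum>j<N \<lfloor>x\<rfloor>. \<Sum>k<N \<lfloor>x\<rfloor>. (cs (4 * real (L \<lfloor>x\<rfloor>) * 16 ^ j * x) * (tri k j * sn (real (L \<lfloor>x\<rfloor>) * 16 ^ k * x))) *\<^sub>R
      (blinfun_apply \<psi> (y \<lfloor>x\<rfloor> k) * blinfun_apply (\<phi> \<lfloor>x\<rfloor> j) e))"
    by (subst sum.swap) (simp add: mult_ac)
  also have "\<dots> = blinfun_apply (block_adjoint x \<psi>) e"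
    unfolding block_adjoint_def
    by (simp add: blinfun.sum_left blinfun_apply_dual_scale scaleR_sum_right sum_distrib_right)
  finally show "blinfun_apply (adjoint_operator (block_operator N L y \<phi> x) \<psi>) e = blinfun_apply (block_adjoint x \<psi>) e" .
qed

lemma block_adjoint_sum_in_dual: "(\<Sum>k<N m. dual_scale (t k) (\<phi> m k)) \<in> dual_space smul"
  by (intro real_vector.subspace_sum dual_space_subspace dual_scale_in_dual_space \<phi>) simp

lemma block_adjoint_BMO:
  assumes \<psi>: "\<psi> \<in> dual_space smul"
  shows "(\<lambda>x. block_adjoint x \<psi>) \<in> BMO (dual_space smul)"
    "bmo_norm (dual_space smul) (\<lambda>x. block_adjoint x \<psi>) \<le> ennreal (C' * (1 + 3138 * (C * norm \<psi>)\<^sup>2) / 2)"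
proof -
  interpret dual: banach_space_over "dual_scale :: 'k \<Rightarrow> ('a \<Rightarrow>\<^sub>L 'k) \<Rightarrow> _" by (rule banach_space_over_dual_scale)
  define V where "V = (\<lambda>m j x. cs (4 * real (L m) * 16 ^ j * x) *\<^sub>R
     (\<Sum>k<N m. (tri k j * sn (real (L m) * 16 ^ k * x)) *\<^sub>R blinfun_apply \<psi> (y m k)))"
  have V: "continuous_on UNIV (V m k)" for m k
    unfolding V_def by (intro continuous_intros continuous_on_sn_cs_mult)
  \<comment> \<open>For the adjoint the zeros at integers come from the inner sines, for the
    operator itself from the outer one.\<close>
  have V0: "V m k (of_int i) = 0" for m k i
  proof -
    have "sn (real (L m) * 16 ^ k * of_int i) = sn (of_int (int (L m) * 16 ^ k * i))" for k by simp
    then show ?thesis unfolding V_def sn_of_int by simp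
  qed
  have osc: "\<exists>c. (x0 \<in> \<int> \<longrightarrow> c = (\<lambda>_. 0)) \<and> integral {l..r} (\<lambda>x. \<Sum>k<N m. (norm (V m k x - c k))\<^sup>2) \<le> 3138 * (C * norm \<psi>)\<^sup>2 * (r - l)"
    if lr: "l < r" "x0 \<in> {l..r}" for m l r x0
  proof -
    obtain c where c: "x0 \<in> \<int> \<longrightarrow> c = (\<lambda>_. 0)"
      "integral {l..r} (\<lambda>x. \<Sum>k<N m. (norm (V m k x - c k))\<^sup>2) \<le> 3138 * (r - l) * (\<Sum>k<N m. (norm (blinfun_apply \<psi> (y m k)))\<^sup>2)"
      unfolding V_def using triangular_block_estimates(2)[OF L[of m] lr, where N = "N m" and a = "\<lambda>k. blinfun_apply \<psi> (y m k)"] by (elim exE conjE)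
    note c(2)
    also have "3138 * (r - l) * (\<Sum>k<N m. (norm (blinfun_apply \<psi> (y m k)))\<^sup>2) \<le> 3138 * (r - l) * (C * norm \<psi>)\<^sup>2"
      using lr by (intro mult_left_mono sum_norm_vectors_le \<psi>) auto
    also have "3138 * (r - l) * (C * norm \<psi>)\<^sup>2 = 3138 * (C * norm \<psi>)\<^sup>2 * (r - l)" by (simp only: mult_ac)
    finally have "(x0 \<in> \<int> \<longrightarrow> c = (\<lambda>_. 0)) \<and> integral {l..r} (\<lambda>x. \<Sum>k<N m. (norm (V m k x - c k))\<^sup>2) \<le> 3138 * (C * norm \<psi>)\<^sup>2 * (r - l)"
      by (intro conjI c(1))
    then show ?thesis by (rule exI[of _ c])
  qed
  note * = dual.glued_blocks_bmo[where N = N and y = \<phi> and E = "dual_space smul" and V = V,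
      OF C(2) upper' real_vector.subspace_0[OF dual_space_subspace] block_adjoint_sum_in_dual V V0 osc]
  show "(\<lambda>x. block_adjoint x \<psi>) \<in> BMO (dual_space smul)"
    "bmo_norm (dual_space smul) (\<lambda>x. block_adjoint x \<psi>) \<le> ennreal (C' * (1 + 3138 * (C * norm \<psi>)\<^sup>2) / 2)"
    using * by (simp_all add: block_adjoint_def V_def)
qed

lemma adjoint_block_operator_BMO_so:
  "(\<lambda>x. adjoint_operator (block_operator N L y \<phi> x)) \<in> BMO_so dual_scale (dual_space smul)"
proof -
  interpret dual: banach_space_over "dual_scale :: 'k \<Rightarrow> ('a \<Rightarrow>\<^sub>L 'k) \<Rightarrow> _" by (rule banach_space_over_dual_scale)
  have bl: "bounded_linear (block_adjoint x)" for x
    unfolding block_adjoint_def[abs_def]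
    by (intro bounded_linear_sum bounded_linear_compose[OF dual.bounded_linear_smul_left]
      bounded_linear_compose[OF bounded_linear_scaleR_right] blinfun.bounded_linear_left)
  have "adjoint_operator (block_operator N L y \<phi> x) \<in> bounded_operators dual_scale (dual_space smul)" for x
  proof -
    have "\<exists>K. \<forall>\<psi>. norm (block_adjoint x \<psi>) \<le> norm \<psi> * K" using bounded_linear.bounded[OF bl] .
    then have 1: "\<exists>K. \<forall>\<psi>\<in>dual_space smul. norm (block_adjoint x \<psi>) \<le> K * norm \<psi>" by (auto simp: mult.commute)
    have 2: "block_adjoint x (dual_scale c \<psi>) = dual_scale c (block_adjoint x \<psi>)" for c \<psi>
    proof -
      have "(\<Sum>k<n. t k *\<^sub>R blinfun_apply (dual_scale c \<psi>) (z k)) = c * (\<Sum>k<n. t k *\<^sub>R blinfun_apply \<psi> (z k))" for t z and n :: nat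
        by (simp add: blinfun_apply_dual_scale sum_distrib_left)
      then show ?thesis unfolding block_adjoint_def
        by (simp add: mult_scaleR_right[symmetric] dual.scale_sum_right del: mult_scaleR_right)
    qed
    have 3: "block_adjoint x \<psi> \<in> dual_space smul" for \<psi>
      unfolding block_adjoint_def by (rule block_adjoint_sum_in_dual)
    show ?thesis unfolding bounded_operators_def mem_Collect_eq
      using 1 2 3 linear_add[OF bounded_linear.linear[OF bl]]
      by (simp add: adjoint_block_operator dual_scale_in_dual_space real_vector.subspace_add[OF dual_space_subspace])
  qed
  moreover have "(SUP \<psi>\<in>{\<psi>\<in>dual_space smul. norm \<psi> \<le> 1}. bmo_norm (dual_space smul) (\<lambda>x. adjoint_operator (block_operator N L y \<phi> x) \<psi>)) < \<infinity>"
  proof (rule le_less_trans[OF SUP_least])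
    fix \<psi> assume \<psi>: "\<psi> \<in> {\<psi>\<in>dual_space smul. norm \<psi> \<le> 1}"
    then have "(C * norm \<psi>)\<^sup>2 \<le> (C * 1)\<^sup>2" using C by (intro power_mono mult_left_mono) auto
    then have "C' * (1 + 3138 * (C * norm \<psi>)\<^sup>2) / 2 \<le> C' * (1 + 3138 * (C * 1)\<^sup>2) / 2"
      using C by (intro divide_right_mono mult_left_mono add_left_mono) auto
    then show "bmo_norm (dual_space smul) (\<lambda>x. adjoint_operator (block_operator N L y \<phi> x) \<psi>) \<le> ennreal (C' * (1 + 3138 * (C * 1)\<^sup>2) / 2)"
      using \<psi> by (simp only: adjoint_block_operator mem_Collect_eq) (rule order_trans[OF block_adjoint_BMO(2) ennreal_leI]; simp)
  qed simp
  ultimately show ?thesis unfolding BMO_so_def using block_adjoint_BMO(1) by (simp add: adjoint_block_operator)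
qed

end
end

section \<open>The commutator on Riesz products\<close>

text \<open>The frequency condition of Bedrosian's principle, with \<open>a\<close> as the top
  index.\<close>

lemma sum_16_powers_less: "(\<Sum>i\<in>{..<a}. \<mu> * 16 ^ i) < \<mu> * 16 ^ a" if "1 \<le> (\<mu>::nat)"
  using that by (induction a) auto

text \<open>The highest sine of \<open>A\<close> turns into minus a cosine, recorded in
  \<open>q\<close>. Tested against the cosine \<open>j\<close>, a nonzero mean requires that it
  meets this new cosine and that no sine is left over, that is \<open>A = {j}\<close>. Tested
  against a sine, the new cosine always leaves a factor of mean zero. For empty \<open>A\<close>
  there is no sine to turn; the amplitude is then the transform of the bump, and the tested means
  vanish as well.\<close>

lemma lacunary_hconv:
  fixes \<mu> n :: nat
  assumes h: "C1_on c h h'" and \<mu>: "1 \<le> \<mu>" and A: "A \<subseteq> {..<n}"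
  defines "w \<equiv> (\<lambda>y. \<Prod>a\<in>A. sn (real \<mu> * 16 ^ a * y))"
  shows "\<exists>\<phi> q. hconv c h h' w (deriv w) \<phi> (\<lambda>y. \<Prod>i<n. q i (real \<mu> * 16 ^ i * y)) \<and> continuous_on {c..c+1} \<phi> \<and>
    (\<forall>i. q i \<in> {\<lambda>_. 1, sn, cs}) \<and>
    (\<forall>j<n. \<exists>\<nu>. (\<forall>i<n. quarter_mean (\<lambda>x. q i x * (if i = j then cs x else 1)) (\<nu> i)) \<and>
       (A = {j} \<and> \<phi> = (\<lambda>x. - h x) \<and> (\<Prod>i<n. \<nu> i) = 1 / 2 \<or> A \<noteq> {j} \<and> (\<Prod>i<n. \<nu> i) = 0)) \<and>
    (\<forall>k<n. \<exists>\<nu>. (\<forall>i<n. quarter_mean (\<lambda>x. q i x * (if i = k then sn x else 1)) (\<nu> i)) \<and> (\<Prod>i<n. \<nu> i) = 0)"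
proof (cases "A = {}")
  case True
  define q where "q = (\<lambda>(i::nat) (y::real). 1 :: real)"
  have d: "deriv (\<lambda>_::real. 1 :: real) = (\<lambda>_. 0)" by (auto intro!: DERIV_imp_deriv derivative_eq_intros)
  have c: "continuous_on {c..c+1} (hilb h')"
    by (rule continuous_on_hilb[OF C1_onD(2)[OF h]])
  then have "compact (hilb h' ` {c..c+1})" by (intro compact_continuous_image) auto
  then have "bounded (hilb h' ` {c..c+1})" by (rule compact_imp_bounded)
  then obtain K' where K': "K' > 0" "\<forall>y\<in>hilb h' ` {c..c+1}. norm y \<le> K'" unfolding bounded_pos by (elim exE conjE)
  have "hconv c h h' w (deriv w) (hilb h') (\<lambda>y. \<Prod>i<n. q i (real \<mu> * 16 ^ i * y))"
    unfolding hconv_def w_def True using K' by (auto simp: d q_def intro!: exI[of _ K'])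
  moreover have "\<exists>\<nu>. (\<forall>i<n. quarter_mean (\<lambda>x. q i x * (if i = j then cs x else 1)) (\<nu> i)) \<and> (\<Prod>i<n. \<nu> i) = 0"
    "\<exists>\<nu>. (\<forall>i<n. quarter_mean (\<lambda>x. q i x * (if i = j then sn x else 1)) (\<nu> i)) \<and> (\<Prod>i<n. \<nu> i) = 0" if "j < n" for j
    using that by (intro exI[of _ "\<lambda>i. if i = j then 0 else 1"]; auto simp: q_def quarter_mean_trig intro!: prod_zero)+
  ultimately show ?thesis using c True
    by (intro exI[of _ "hilb h'"] exI[of _ q]) (auto simp: q_def)
next
  case False
  have fin: "finite A" using A finite_subset by blast
  define a where "a = Max A"
  have a: "a \<in> A" "A - {a} \<subseteq> {..<a}"
    using Max_in[OF fin False] Max_ge[OF fin] by (auto simp: a_def order.strict_iff_order)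
  define q where "q = (\<lambda>i. if i = a then cs else if i \<in> A then sn else (\<lambda>_. 1))"
  have "(\<Sum>i\<in>A - {a}. \<mu> * 16 ^ i) \<le> (\<Sum>i\<in>{..<a}. \<mu> * 16 ^ i)" using a by (intro sum_mono2) auto
  then have less: "(\<Sum>i\<in>A - {a}. \<mu> * 16 ^ i) < \<mu> * 16 ^ a" using sum_16_powers_less[OF \<mu>, of a] by linarith
  have shift: "cos (t + - (pi/2)) = sin t" "sin (t + - (pi/2)) = - cos t" for t :: real
    by (simp_all add: cos_diff sin_diff)
  have w_eq: "(\<lambda>y. (\<Prod>i\<in>A - {a}. sin (2 * pi * real (\<mu> * 16 ^ i) * y)) * cos (2 * pi * real (\<mu> * 16 ^ a) * y + - (pi/2))) = w"
    unfolding w_def shift using fin a by (auto simp: prod.remove[of A a] sn_def mult_ac)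
  have v_eq: "(\<lambda>y. (\<Prod>i\<in>A - {a}. sin (2 * pi * real (\<mu> * 16 ^ i) * y)) * sin (2 * pi * real (\<mu> * 16 ^ a) * y + - (pi/2)))
     = (\<lambda>y. - (\<Prod>i<n. q i (real \<mu> * 16 ^ i * y)))"
  proof
    fix y
    have "(\<Prod>i<n. q i (real \<mu> * 16 ^ i * y)) = (\<Prod>i\<in>A. q i (real \<mu> * 16 ^ i * y))"
      using A a by (intro prod.mono_neutral_right) (auto simp: q_def)
    also have "\<dots> = q a (real \<mu> * 16 ^ a * y) * (\<Prod>i\<in>A - {a}. q i (real \<mu> * 16 ^ i * y))"
      using fin a by (simp add: prod.remove)
    also have "(\<Prod>i\<in>A - {a}. q i (real \<mu> * 16 ^ i * y)) = (\<Prod>i\<in>A - {a}. sin (2 * pi * real (\<mu> * 16 ^ i) * y))"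
      by (intro prod.cong) (auto simp: q_def sn_def mult_ac)
    finally show "(\<Prod>i\<in>A - {a}. sin (2 * pi * real (\<mu> * 16 ^ i) * y)) * sin (2 * pi * real (\<mu> * 16 ^ a) * y + - (pi/2))
      = - (\<Prod>i<n. q i (real \<mu> * 16 ^ i * y))"
      unfolding shift by (simp add: q_def cs_def mult_ac)
  qed
  have "hasym c h h' w (\<lambda>y. - (\<Prod>i<n. q i (real \<mu> * 16 ^ i * y)))"
    using hasym_product[OF h _ less, of "- (pi/2)"] fin unfolding w_eq v_eq by simp
  then obtain w' K where w': "\<forall>x. (w has_real_derivative w' x) (at x)" "continuous_on UNIV w'"
     "\<forall>x\<in>{c..c+1}. (\<lambda>\<Lambda>::nat. hilb (\<lambda>y. h' y * w (\<Lambda> * y) + h y * (\<Lambda> * w' (\<Lambda> * y))) x - h x * (- (\<Prod>i<n. q i (real \<mu> * 16 ^ i * (\<Lambda> * x))))) \<longlonglongrightarrow> 0"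
     "\<forall>\<Lambda>::nat. \<forall>x\<in>{c..c+1}. \<bar>hilb (\<lambda>y. h' y * w (\<Lambda> * y) + h y * (\<Lambda> * w' (\<Lambda> * y))) x\<bar> \<le> K"
    unfolding hasym_def by (elim exE conjE)
  have "deriv w = w'" using w'(1) by (auto intro: DERIV_imp_deriv)
  moreover have "\<exists>K. \<forall>\<Lambda>::nat. \<forall>x\<in>{c..c+1}. \<bar>hilb (\<lambda>y. h' y * w (\<Lambda> * y) + h y * (\<Lambda> * w' (\<Lambda> * y))) x\<bar> \<le> K"
    using w'(4) by (rule exI[of _ K])
  ultimately have hc: "hconv c h h' w (deriv w) (\<lambda>x. - h x) (\<lambda>y. \<Prod>i<n. q i (real \<mu> * 16 ^ i * y))"
    unfolding hconv_def using w'(1-3) by simp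
  have cosine: "\<exists>\<nu>. (\<forall>i<n. quarter_mean (\<lambda>x. q i x * (if i = j then cs x else 1)) (\<nu> i)) \<and>
       (A = {j} \<and> (\<Prod>i<n. \<nu> i) = 1 / 2 \<or> A \<noteq> {j} \<and> (\<Prod>i<n. \<nu> i) = 0)" if j: "j < n" for j
  proof -
    define \<nu> :: "nat \<Rightarrow> real" where "\<nu> = (\<lambda>i. if i = j then if i = a then 1 / 2 else 0 else if i \<in> A then 0 else 1)"
    have "quarter_mean (\<lambda>x. q i x * (if i = j then cs x else 1)) (\<nu> i)" for i
      using a by (auto simp: q_def \<nu>_def quarter_mean_trig)
    moreover have "(\<Prod>i<n. \<nu> i) = 1 / 2" if "A = {j}"
    proof -
      have "(\<Prod>i<n. \<nu> i) = (\<Prod>i<n. if i = j then 1 / 2 else 1)"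
        using that a by (intro prod.cong) (auto simp: \<nu>_def)
      then show ?thesis using j by (simp add: prod.delta)
    qed
    moreover have "(\<Prod>i<n. \<nu> i) = 0" if "A \<noteq> {j}"
    proof -
      have "\<exists>i\<in>{..<n}. \<nu> i = 0"
      proof (cases "j = a")
        case True
        then have "\<not> A \<subseteq> {j}" using that a(1) by auto
        then obtain i where "i \<in> A" "i \<noteq> j" by auto
        then show ?thesis using A by (intro bexI[of _ i]) (auto simp: \<nu>_def)
      qed (use j in \<open>auto simp: \<nu>_def\<close>)
      then show ?thesis by (intro prod_zero) auto
    qed
    ultimately show ?thesis by (intro exI[of _ \<nu>]) auto
  qed
  have sine: "\<exists>\<nu>. (\<forall>i<n. quarter_mean (\<lambda>x. q i x * (if i = k then sn x else 1)) (\<nu> i)) \<and> (\<Prod>i<n. \<nu> i) = 0" if k: "k < n" for k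
  proof -
    define \<nu> :: "nat \<Rightarrow> real" where "\<nu> = (\<lambda>i. if i = k then if i = a then 0 else if i \<in> A then 1 / 2 else 0 else if i \<in> A then 0 else 1)"
    have "quarter_mean (\<lambda>x. q i x * (if i = k then sn x else 1)) (\<nu> i)" for i
      using a by (auto simp: q_def \<nu>_def quarter_mean_trig)
    moreover have "(\<Prod>i<n. \<nu> i) = 0" using a A by (intro prod_zero bexI[of _ a]) (auto simp: \<nu>_def)
    ultimately show ?thesis by (intro exI[of _ \<nu>]) auto
  qed
  have "continuous_on {c..c+1} (\<lambda>x. - h x)" by (intro continuous_intros C1_onD(4)[OF h])
  then show ?thesis using hc cosine sine
    by (intro exI[of _ "\<lambda>x. - h x"] exI[of _ q] conjI) (auto simp: q_def)
qed

lemma sn_cs_products: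
  assumes "\<And>i. q i \<in> {\<lambda>_. 1, sn, cs}"
  shows "continuous_on UNIV (\<lambda>x. \<Prod>i\<in>A. q i (real (m i) * x))"
    and "(\<Prod>i\<in>A. q i (real (m i) * (x + 1))) = (\<Prod>i\<in>A. q i (real (m i) * x))"
    and "\<bar>\<Prod>i\<in>A. q i (real (m i) * x)\<bar> \<le> 1"
proof -
  have "continuous_on UNIV (\<lambda>x. q i (real (m i) * x))" for i
    using assms[of i] continuous_on_sn_cs_mult by auto
  then show "continuous_on UNIV (\<lambda>x. \<Prod>i\<in>A. q i (real (m i) * x))" by (intro continuous_intros)
  have per: "g (t + real k) = g t" if "g \<in> {\<lambda>_. 1, sn, cs}" for t k g
  proof (induction k)
    case (Suc k)
    have e: "t + real (Suc k) = (t + real k) + 1" by simp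
    show ?case unfolding e using Suc that sn_cs_shift(1,5)[of "t + real k"] by auto
  qed simp
  show "(\<Prod>i\<in>A. q i (real (m i) * (x + 1))) = (\<Prod>i\<in>A. q i (real (m i) * x))"
    using per[OF assms] by (simp add: distrib_left)
  show "\<bar>\<Prod>i\<in>A. q i (real (m i) * x)\<bar> \<le> 1"
    unfolding abs_prod
  proof (rule prod_le_1)
    show "0 \<le> \<bar>q i (real (m i) * x)\<bar> \<and> \<bar>q i (real (m i) * x)\<bar> \<le> 1" for i
      using assms[of i] sn_cs_bounds by auto
  qed
qed

text \<open>The derivative of \<open>h y * w (\<Lambda> * y)\<close>, which is the form in which
  \<open>hilb\<close> takes its argument.\<close>

definition modulated' :: "(real \<Rightarrow> real) \<Rightarrow> (real \<Rightarrow> real) \<Rightarrow> (real \<Rightarrow> real) \<Rightarrow> nat \<Rightarrow> real \<Rightarrow> real" where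
  "modulated' h h' w \<Lambda> y = h' y * w (real \<Lambda> * y) + h y * (real \<Lambda> * deriv w (real \<Lambda> * y))"

text \<open>The Walsh terms of a Riesz product. \<open>\<mu> = 4\<close> belongs to the first test
  function and the cosines of the operator, \<open>\<mu> = 1\<close> to the second test function and
  the sines.\<close>

definition waves :: "nat \<Rightarrow> nat set \<Rightarrow> real \<Rightarrow> real" where
  "waves \<mu> A y = (\<Prod>a\<in>A. sn (real \<mu> * 16 ^ a * y))"

lemma smooth_waves: "finite A \<Longrightarrow> smooth (\<lambda>y. waves \<mu> A (\<Lambda> * y))"
proof -
  assume A: "finite A"
  have "smooth (\<lambda>y. \<Prod>a\<in>A. sin ((2 * pi * (real \<mu> * 16 ^ a * \<Lambda>)) * y + 0))" by (intro smooth_prod smooth_sin A)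
  then show ?thesis by (simp add: waves_def sn_def mult_ac)
qed

lemma C1_on_modulated:
  assumes h: "C1_on c h h'" and A: "finite A"
  shows "C1_on c (\<lambda>y. h y * waves \<mu> A (real \<Lambda> * y)) (modulated' h h' (waves \<mu> A) \<Lambda>)"
proof -
  have "smooth (waves \<mu> A)" using smooth_waves[OF A, of \<mu> 1] by simp
  then obtain D where D: "smooth D" "\<And>x. (waves \<mu> A has_real_derivative D x) (at x)" by (rule smooth_deriv) blast
  then have "deriv (waves \<mu> A) = D" by (auto intro: DERIV_imp_deriv)
  moreover have "continuous_on UNIV D"
    using D(1) by (meson DERIV_isCont continuous_at_imp_continuous_on smooth_deriv)
  ultimately show ?thesis unfolding modulated'_def[abs_def] using D(2) by (intro C1_on_dilated[OF h]) auto
qed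

definition matrix_wave :: "nat \<Rightarrow> nat \<Rightarrow> real \<Rightarrow> real" where
  "matrix_wave k j y = sn (16 ^ k * y) * cs (4 * 16 ^ j * y)"

lemma prod_if_mem: "A \<subseteq> {..<n::nat} \<Longrightarrow> (\<Prod>a\<in>A. f a) = (\<Prod>i<n. if i \<in> A then f i else (1::real))"
  by (simp add: prod.If_cases Int_absorb1)

lemma prod_if_eq: "k < (n::nat) \<Longrightarrow> f k = (\<Prod>i<n. if i = k then f i else (1::real))"
  by (simp add: prod.delta)

text \<open>All means factor over the frequencies \<open>16 ^ i\<close> and
  \<open>4 * 16 ^ i\<close>. In the first limit the sine of \<open>C\<close> has to meet the sine
  \<open>k\<close>, and the cosine made from \<open>A\<close> the cosine \<open>j\<close>; each
  match contributes 1/2, and the minus sign is that of the transform of a sine. In the second limit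
  the cosine made from \<open>C\<close> meets only sines.\<close>

lemma hilb_waves_limits:
  fixes c n :: nat
  assumes h: "C1_on (real c) h h'" and h1: "\<And>x. \<bar>h x\<bar> \<le> 1"
    and A: "A \<subseteq> {..<n}" and C: "C \<subseteq> {..<n}" and jk: "j < n" "k < n"
  shows "(\<lambda>\<Lambda>::nat. integral {real c..real c+1} (\<lambda>x. hilb (modulated' h h' (waves 4 A) \<Lambda>) x * h x * (waves 1 C (real \<Lambda> * x) * matrix_wave k j (real \<Lambda> * x))))
      \<longlonglongrightarrow> (if A = {j} \<and> C = {k} then - (1 / 4) * integral {real c..real c+1} (\<lambda>x. h x * h x) else 0)" (is ?thesis1)
    and "(\<lambda>\<Lambda>::nat. integral {real c..real c+1} (\<lambda>x. hilb (modulated' h h' (waves 1 C) \<Lambda>) x * h x * (waves 4 A (real \<Lambda> * x) * matrix_wave k j (real \<Lambda> * x))))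
      \<longlonglongrightarrow> 0" (is ?thesis2)
proof -
  have fin: "finite A" "finite C" using A C finite_subset by blast+
  have hc: "continuous_on {real c..real c+1} h" by (rule C1_onD(4)[OF h])
  have waves_eq: "waves \<mu> A = (\<lambda>y. \<Prod>a\<in>A. sn (real \<mu> * 16 ^ a * y))" for \<mu> A by (simp add: waves_def[abs_def])
  have ww: "continuous_on UNIV (waves \<mu> A)" "waves \<mu> A (x + 1) = waves \<mu> A x" "\<bar>waves \<mu> A x\<bar> \<le> 1" for \<mu> A x
    using sn_cs_products[where q = "\<lambda>_. sn" and m = "\<lambda>i. \<mu> * 16 ^ i" and A = A] by (simp_all add: waves_def[abs_def])
  have mw: "continuous_on UNIV (matrix_wave k j)" "matrix_wave k j (x + 1) = matrix_wave k j x" "\<bar>matrix_wave k j x\<bar> \<le> 1" for x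
    using sn_cs_products[where q = "\<lambda>_. sn" and m = "\<lambda>i. 16 ^ k" and A = "{0::nat}"] sn_cs_products[where q = "\<lambda>_. cs" and m = "\<lambda>i. 4 * 16 ^ j" and A = "{0::nat}"]
    by (auto simp: matrix_wave_def[abs_def] abs_mult intro!: continuous_intros mult_le_one)
  have G: "continuous_on UNIV (\<lambda>y. waves \<mu> A y * matrix_wave k j y)"
    "waves \<mu> A (x + 1) * matrix_wave k j (x + 1) = waves \<mu> A x * matrix_wave k j x"
    "\<bar>waves \<mu> A x * matrix_wave k j x\<bar> \<le> 1" for \<mu> A x
    using ww mw by (auto simp: abs_mult intro!: continuous_intros mult_le_one)
  define sC where "sC = (\<lambda>i x. (if i \<in> C then sn x else 1) * (if i = k then sn x else 1))"
  define sA where "sA = (\<lambda>i x. (if i \<in> A then sn x else 1) * (if i = j then cs x else 1))"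
  have sC: "quarter_mean (sC i) (if i \<in> C then if i = k then 1 / 2 else 0 else if i = k then 0 else 1)" for i
    unfolding sC_def by (auto simp: quarter_mean_trig)
  have sA: "quarter_mean (sA i) (if i \<in> A then 0 else if i = j then 0 else 1)" for i
    unfolding sA_def by (auto simp: quarter_mean_trig)
  have meanC: "(\<Prod>i<n. if i \<in> C then if i = k then 1 / 2 else 0 else if i = k then 0 else 1 :: real) = (if C = {k} then 1 / 2 else 0)"
  proof (cases "C = {k}")
    case True
    then have "(\<Prod>i<n. if i \<in> C then if i = k then 1 / 2 else 0 else if i = k then 0 else 1 :: real) = (\<Prod>i<n. if i = k then 1 / 2 else 1)"
      by (intro prod.cong) auto
    then show ?thesis using True jk by (simp add: prod.delta)
  next
    case False
    obtain i where "i \<in> {..<n}" "i \<in> C \<longleftrightarrow> i \<noteq> k"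
    proof (cases "k \<in> C")
      case True
      then have "\<not> C \<subseteq> {k}" using False by auto
      then obtain i where "i \<in> C" "i \<noteq> k" by auto
      then show thesis using C by (intro that[of i]) auto
    qed (use jk that[of k] in auto)
    then have "(\<Prod>i<n. if i \<in> C then if i = k then 1 / 2 else 0 else if i = k then 0 else 1 :: real) = 0"
      by (intro prod_zero bexI[of _ i]) auto
    then show ?thesis using False by simp
  qed
  have mod: "modulated' h h' w \<Lambda> = (\<lambda>y. h' y * w (real \<Lambda> * y) + h y * (real \<Lambda> * deriv w (real \<Lambda> * y)))" for w \<Lambda>
    by (simp add: modulated'_def[abs_def])
  show ?thesis1
  proof -
    have "\<exists>\<phi> q. hconv (real c) h h' (waves 4 A) (deriv (waves 4 A)) \<phi> (\<lambda>y. \<Prod>i<n. q i (real 4 * 16 ^ i * y)) \<and> continuous_on {real c..real c+1} \<phi> \<and>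
    (\<forall>i. q i \<in> {\<lambda>_. 1, sn, cs}) \<and>
    (\<forall>j<n. \<exists>\<nu>. (\<forall>i<n. quarter_mean (\<lambda>x. q i x * (if i = j then cs x else 1)) (\<nu> i)) \<and>
       (A = {j} \<and> \<phi> = (\<lambda>x. - h x) \<and> (\<Prod>i<n. \<nu> i) = 1 / 2 \<or> A \<noteq> {j} \<and> (\<Prod>i<n. \<nu> i) = 0)) \<and>
    (\<forall>k<n. \<exists>\<nu>. (\<forall>i<n. quarter_mean (\<lambda>x. q i x * (if i = k then sn x else 1)) (\<nu> i)) \<and> (\<Prod>i<n. \<nu> i) = 0)"
      using lacunary_hconv[OF h _ A, of 4] unfolding waves_eq by simp
    then obtain \<phi> q where hv: "hconv (real c) h h' (waves 4 A) (deriv (waves 4 A)) \<phi> (\<lambda>y. \<Prod>i<n. q i (real 4 * 16 ^ i * y))"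
      and \<phi>: "continuous_on {real c..real c+1} \<phi>" and q: "\<forall>i. q i \<in> {\<lambda>_. 1, sn, cs}"
      and m: "\<forall>j<n. \<exists>\<nu>. (\<forall>i<n. quarter_mean (\<lambda>x. q i x * (if i = j then cs x else 1)) (\<nu> i)) \<and>
       (A = {j} \<and> \<phi> = (\<lambda>x. - h x) \<and> (\<Prod>i<n. \<nu> i) = 1 / 2 \<or> A \<noteq> {j} \<and> (\<Prod>i<n. \<nu> i) = 0)" by (elim exE conjE)
    obtain \<nu> where \<nu>: "\<forall>i<n. quarter_mean (\<lambda>x. q i x * (if i = j then cs x else 1)) (\<nu> i)"
       "A = {j} \<and> \<phi> = (\<lambda>x. - h x) \<and> (\<Prod>i<n. \<nu> i) = 1 / 2 \<or> A \<noteq> {j} \<and> (\<Prod>i<n. \<nu> i) = 0" using m jk by blast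
    define v where "v = (\<lambda>y. \<Prod>i<n. q i (real 4 * 16 ^ i * y))"
    have v: "continuous_on UNIV v" "v (x + 1) = v x" "\<bar>v x\<bar> \<le> 1" for x
      using sn_cs_products[where q = q and m = "\<lambda>i. 4 * 16 ^ i" and A = "{..<n}"] q by (simp_all add: v_def)
    have eq: "v x * (waves 1 C x * matrix_wave k j x) = (\<Prod>i<n. sC i (16 ^ i * x)) * (\<Prod>i<n. q i (4 * 16 ^ i * x) * (if i = j then cs (4 * 16 ^ i * x) else 1))" for x
      unfolding v_def waves_def matrix_wave_def sC_def prod.distrib
      using prod_if_mem[OF C, of "\<lambda>a. sn (16 ^ a * x)"] prod_if_eq[OF jk(2), of "\<lambda>a. sn (16 ^ a * x)"]
        prod_if_eq[OF jk(1), of "\<lambda>a. cs (4 * 16 ^ a * x)"] by (simp add: mult_ac)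
    have mean: "integral {0..1} (\<lambda>x. v x * (waves 1 C x * matrix_wave k j x)) = (if C = {k} then 1 / 2 else 0) * (\<Prod>i<n. \<nu> i)"
      unfolding eq meanC[symmetric]
      by (rule integral_lacunary_product2[where q = "\<lambda>i x. q i x * (if i = j then cs x else 1)"]) (use sC \<nu>(1) in blast)+
    have "(\<lambda>\<Lambda>::nat. integral {real c..real c+1} (\<lambda>x. hilb (\<lambda>y. h' y * waves 4 A (\<Lambda> * y) + h y * (\<Lambda> * deriv (waves 4 A) (\<Lambda> * y))) x * h x * (waves 1 C (\<Lambda> * x) * matrix_wave k j (\<Lambda> * x))))
      \<longlonglongrightarrow> integral {real c..real c+1} (\<lambda>x. \<phi> x * h x) * integral {0..1} (\<lambda>x. v x * (waves 1 C x * matrix_wave k j x))"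
      by (rule hconv_limit[OF h hv[folded v_def] \<phi> v(1,2) hc G v(3) h1])
    moreover have "integral {real c..real c+1} (\<lambda>x. \<phi> x * h x) * integral {0..1} (\<lambda>x. v x * (waves 1 C x * matrix_wave k j x))
       = (if A = {j} \<and> C = {k} then - (1 / 4) * integral {real c..real c+1} (\<lambda>x. h x * h x) else 0)"
      unfolding mean using \<nu>(2)
    proof (elim disjE conjE)
      assume "A = {j}" "\<phi> = (\<lambda>x. - h x)" "(\<Prod>i<n. \<nu> i) = 1 / 2"
      then show "integral {real c..real c+1} (\<lambda>x. \<phi> x * h x) * ((if C = {k} then 1 / 2 else 0) * (\<Prod>i<n. \<nu> i))
       = (if A = {j} \<and> C = {k} then - (1 / 4) * integral {real c..real c+1} (\<lambda>x. h x * h x) else 0)" by simp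
    qed simp
    ultimately show ?thesis by (simp only: mod)
  qed
  show ?thesis2
  proof -
    have "\<exists>\<phi> q. hconv (real c) h h' (waves 1 C) (deriv (waves 1 C)) \<phi> (\<lambda>y. \<Prod>i<n. q i (real 1 * 16 ^ i * y)) \<and> continuous_on {real c..real c+1} \<phi> \<and>
    (\<forall>i. q i \<in> {\<lambda>_. 1, sn, cs}) \<and>
    (\<forall>j<n. \<exists>\<nu>. (\<forall>i<n. quarter_mean (\<lambda>x. q i x * (if i = j then cs x else 1)) (\<nu> i)) \<and>
       (C = {j} \<and> \<phi> = (\<lambda>x. - h x) \<and> (\<Prod>i<n. \<nu> i) = 1 / 2 \<or> C \<noteq> {j} \<and> (\<Prod>i<n. \<nu> i) = 0)) \<and>
    (\<forall>k<n. \<exists>\<nu>. (\<forall>i<n. quarter_mean (\<lambda>x. q i x * (if i = k then sn x else 1)) (\<nu> i)) \<and> (\<Prod>i<n. \<nu> i) = 0)"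
      using lacunary_hconv[OF h _ C, of 1] unfolding waves_eq by simp
    then obtain \<phi> q where hv: "hconv (real c) h h' (waves 1 C) (deriv (waves 1 C)) \<phi> (\<lambda>y. \<Prod>i<n. q i (real 1 * 16 ^ i * y))"
      and \<phi>: "continuous_on {real c..real c+1} \<phi>" and q: "\<forall>i. q i \<in> {\<lambda>_. 1, sn, cs}"
      and m: "\<forall>k<n. \<exists>\<nu>. (\<forall>i<n. quarter_mean (\<lambda>x. q i x * (if i = k then sn x else 1)) (\<nu> i)) \<and> (\<Prod>i<n. \<nu> i) = 0" by (elim exE conjE)
    obtain \<nu> where \<nu>: "\<forall>i<n. quarter_mean (\<lambda>x. q i x * (if i = k then sn x else 1)) (\<nu> i)" "(\<Prod>i<n. \<nu> i) = 0" using m jk by blast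
    define v where "v = (\<lambda>y. \<Prod>i<n. q i (real 1 * 16 ^ i * y))"
    have v: "continuous_on UNIV v" "v (x + 1) = v x" "\<bar>v x\<bar> \<le> 1" for x
      using sn_cs_products[where q = q and m = "\<lambda>i. 1 * 16 ^ i" and A = "{..<n}"] q by (simp_all add: v_def)
    have eq: "v x * (waves 4 A x * matrix_wave k j x) = (\<Prod>i<n. q i (16 ^ i * x) * (if i = k then sn (16 ^ i * x) else 1)) * (\<Prod>i<n. sA i (4 * 16 ^ i * x))" for x
      unfolding v_def waves_def matrix_wave_def sA_def prod.distrib
      using prod_if_mem[OF A, of "\<lambda>a. sn (4 * 16 ^ a * x)"] prod_if_eq[OF jk(2), of "\<lambda>a. sn (16 ^ a * x)"]
        prod_if_eq[OF jk(1), of "\<lambda>a. cs (4 * 16 ^ a * x)"] by (simp add: mult_ac)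
    have mean: "integral {0..1} (\<lambda>x. v x * (waves 4 A x * matrix_wave k j x)) = (\<Prod>i<n. \<nu> i) * (\<Prod>i<n. if i \<in> A then 0 else if i = j then 0 else 1)"
      unfolding eq
      by (rule integral_lacunary_product2[where p = "\<lambda>i x. q i x * (if i = k then sn x else 1)"]) (use sA \<nu>(1) in blast)+
    have "(\<lambda>\<Lambda>::nat. integral {real c..real c+1} (\<lambda>x. hilb (\<lambda>y. h' y * waves 1 C (\<Lambda> * y) + h y * (\<Lambda> * deriv (waves 1 C) (\<Lambda> * y))) x * h x * (waves 4 A (\<Lambda> * x) * matrix_wave k j (\<Lambda> * x))))
      \<longlonglongrightarrow> integral {real c..real c+1} (\<lambda>x. \<phi> x * h x) * integral {0..1} (\<lambda>x. v x * (waves 4 A x * matrix_wave k j x))"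
      by (rule hconv_limit[OF h hv[folded v_def] \<phi> v(1,2) hc G v(3) h1])
    then show ?thesis by (simp only: mod mean \<nu>(2) mult_zero_left mult_zero_right)
  qed
qed

section \<open>Walsh expansions and Riesz products\<close>

lemma cavg_prod_sg:
  assumes "finite J"
  shows "cavg J (\<lambda>\<sigma>. \<Prod>j\<in>J. 1 + sg \<sigma> j * t j) = (1 :: real)"
  using assms
proof (induction J rule: finite_induct)
  case (insert j J)
  have 1: "cavg J (\<lambda>\<sigma>. \<Prod>i\<in>insert j J. 1 + sg \<sigma> i * t i) = cavg J (\<lambda>\<sigma>. (1 - t j) * (\<Prod>i\<in>J. 1 + sg \<sigma> i * t i))"
    using insert by (intro cavg_cong) (auto simp: sg_def)
  have 2: "cavg J (\<lambda>\<sigma>. \<Prod>i\<in>insert j J. 1 + sg (insert j \<sigma>) i * t i) = cavg J (\<lambda>\<sigma>. (1 + t j) * (\<Prod>i\<in>J. 1 + sg \<sigma> i * t i))"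
  proof (rule cavg_cong)
    fix \<sigma>
    have "(\<Prod>i\<in>J. 1 + sg (insert j \<sigma>) i * t i) = (\<Prod>i\<in>J. 1 + sg \<sigma> i * t i)"
      using insert by (intro prod.cong) (auto simp: sg_def)
    then show "(\<Prod>i\<in>insert j J. 1 + sg (insert j \<sigma>) i * t i) = (1 + t j) * (\<Prod>i\<in>J. 1 + sg \<sigma> i * t i)"
      using insert by (simp add: sg_def)
  qed
  show ?case
    unfolding cavg_insert[OF insert(1,2)] 1 2 cavg_mult_left insert.IH by simp
qed simp

definition walsh_coefficient :: "'i set \<Rightarrow> ('i set \<Rightarrow> 'v::real_vector) \<Rightarrow> 'i set \<Rightarrow> 'v" where
  "walsh_coefficient J f A = cavg J (\<lambda>\<sigma>. (\<Prod>a\<in>A. sg \<sigma> a) *\<^sub>R f \<sigma>)"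

lemma walsh_expansion:
  assumes J: "finite J"
  shows "(\<Sum>A\<in>Pow J. (\<Prod>a\<in>A. t a) *\<^sub>R walsh_coefficient J f A) = cavg J (\<lambda>\<sigma>. (\<Prod>j\<in>J. 1 + sg \<sigma> j * t j) *\<^sub>R f \<sigma>)"
proof -
  have eq: "(\<Prod>j\<in>J. 1 + sg \<sigma> j * t j) *\<^sub>R f \<sigma> = (\<Sum>A\<in>Pow J. (\<Prod>a\<in>A. t a) *\<^sub>R ((\<Prod>a\<in>A. sg \<sigma> a) *\<^sub>R f \<sigma>))" for \<sigma>
    using prod_add[OF J, of "\<lambda>j. sg \<sigma> j * t j" "\<lambda>_. 1"]
    by (simp add: scaleR_sum_left prod.distrib add.commute mult.commute)
  show ?thesis unfolding walsh_coefficient_def cavg_scaleR[symmetric] eq cavg_sum ..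
qed

lemma norm_walsh_expansion_le:
  fixes f :: "'i set \<Rightarrow> 'v::real_normed_vector"
  assumes J: "finite J" and t: "\<And>j. \<bar>t j\<bar> \<le> 1" and f: "\<And>\<sigma>. norm (f \<sigma>) \<le> R"
  shows "norm (\<Sum>A\<in>Pow J. (\<Prod>a\<in>A. t a) *\<^sub>R walsh_coefficient J f A) \<le> R"
proof -
  have pos: "0 \<le> (\<Prod>j\<in>J. 1 + sg \<sigma> j * t j)" for \<sigma>
  proof (intro prod_nonneg)
    fix j assume "j \<in> J"
    show "0 \<le> 1 + sg \<sigma> j * t j" using t[of j] by (auto simp: sg_def abs_le_iff)
  qed
  have "norm (\<Sum>A\<in>Pow J. (\<Prod>a\<in>A. t a) *\<^sub>R walsh_coefficient J f A) \<le> cavg J (\<lambda>\<sigma>. norm ((\<Prod>j\<in>J. 1 + sg \<sigma> j * t j) *\<^sub>R f \<sigma>))"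
    unfolding walsh_expansion[OF J] by (rule norm_cavg_le)
  also have "\<dots> \<le> cavg J (\<lambda>\<sigma>. (\<Prod>j\<in>J. 1 + sg \<sigma> j * t j) * R)"
    using pos f by (intro cavg_mono) (simp only: norm_scaleR abs_of_nonneg mult_left_mono)
  also have "\<dots> = R" by (simp add: cavg_mult_right cavg_prod_sg[OF J])
  finally show ?thesis .
qed

text \<open>Written as a sum of Walsh terms rather than as an average of products: this shows it to
  be a finite tensor and lets the Hilbert transform act term by term.\<close>

definition riesz :: "(real \<Rightarrow> real) \<Rightarrow> nat \<Rightarrow> nat \<Rightarrow> nat \<Rightarrow> (nat set \<Rightarrow> 'v::real_vector) \<Rightarrow> real \<Rightarrow> 'v" where
  "riesz h \<mu> \<Lambda> n f x = (\<Sum>A\<in>Pow {..<n}. (h x * waves \<mu> A (real \<Lambda> * x)) *\<^sub>R walsh_coefficient {..<n} f A)"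

lemma norm_riesz_le:
  fixes f :: "nat set \<Rightarrow> 'v::real_normed_vector"
  assumes h: "\<And>x. 0 \<le> h x" "\<And>x. h x \<le> 1" "\<And>x. x \<notin> {c..c+1} \<Longrightarrow> h x = 0" and f: "\<And>\<sigma>. norm (f \<sigma>) \<le> R"
  shows "norm (riesz h \<mu> \<Lambda> n f x) \<le> R * indicator {c..c+1} x"
proof -
  have R: "0 \<le> R" using f[of "{}"] norm_ge_zero order_trans by blast
  define v where "v = (\<Sum>A\<in>Pow {..<n}. (\<Prod>a\<in>A. sn (real \<mu> * 16 ^ a * (real \<Lambda> * x))) *\<^sub>R walsh_coefficient {..<n} f A)"
  have "riesz h \<mu> \<Lambda> n f x = h x *\<^sub>R v"
    unfolding riesz_def v_def waves_def by (simp add: scaleR_sum_right)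
  moreover have "norm v \<le> R" unfolding v_def using f by (intro norm_walsh_expansion_le sn_cs_bounds) auto
  ultimately show ?thesis
    using h[of x] R mult_mono[of "h x" 1 "norm v" R] by (cases "x \<in> {c..c+1}") auto
qed

text \<open>A support of length 1 makes the bound independent of the exponent, so \<open>p\<close>
  and its conjugate are treated alike.\<close>

lemma Lp_norm_le:
  assumes f: "\<And>x. norm (f x) \<le> R * indicator {c..c+1::real} x" and R: "0 \<le> R" and p: "0 < p"
  shows "Lp_norm p f \<le> R"
proof -
  have "(LINT x|lebesgue. norm (f x) powr p) \<le> (LINT x|lebesgue. R powr p * indicator {c..c+1} x)"
  proof (rule integral_mono')
    show "integrable lebesgue (\<lambda>x. R powr p * indicator {c..c+1} x)"
      by (intro integrable_mult_right integrable_real_indicator) auto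
    show "norm (f x) powr p \<le> R powr p * indicator {c..c+1} x" for x
      using f[of x] p R by (cases "x \<in> {c..c+1}") (auto intro!: powr_mono2)
  qed simp
  also have "\<dots> = R powr p" by simp
  finally have "Lp_norm p f \<le> (R powr p) powr (1 / p)"
    unfolding Lp_norm_def using p by (intro powr_mono2 integral_nonneg_AE) auto
  also have "\<dots> = R" using p R by (simp add: powr_powr)
  finally show ?thesis .
qed

lemma smooth_C1_on:
  assumes u: "smooth u" and 0: "\<And>x. x \<notin> {c..c+1} \<Longrightarrow> u x = 0"
  shows "C1_on c u (deriv u)"
proof -
  obtain D where D: "smooth D" "\<And>x. (u has_real_derivative D x) (at x)" using u by (rule smooth_deriv) blast
  then have "deriv u = D" by (auto intro: DERIV_imp_deriv)
  moreover have "continuous_on UNIV D"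
    using D(1) by (meson DERIV_isCont continuous_at_imp_continuous_on smooth_deriv)
  ultimately show ?thesis unfolding C1_on_def using D(2) 0 by auto
qed

text \<open>Row \<open>k\<close> sums to the harmonic number \<open>harm k\<close>; with
  \<open>n = 2 * m\<close>, the last \<open>m\<close> rows already give
  \<open>m * harm m\<close>.\<close>

lemma sum_tri_unbounded: "\<exists>n\<ge>1. K * real n < (\<Sum>k<n. \<Sum>j<n. tri k j)"
proof -
  have "eventually (\<lambda>m. 2 * K < harm m \<and> 1 \<le> m) sequentially"
    using harm_at_top eventually_ge_at_top[of "1::nat"] by (intro eventually_conj) (auto simp: filterlim_at_top_dense)
  then obtain m where m: "2 * K < harm m" "1 \<le> m" by (auto simp: eventually_sequentially)
  define n where "n = 2 * m"
  have row: "(\<Sum>j<n. tri k j) = harm k" if "k < n" for k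
  proof -
    have "(\<Sum>j<n. tri k j) = (\<Sum>j<k. 1 / real (k - j))"
      using that by (intro sum.mono_neutral_cong_right) (auto simp: tri_def)
    also have "\<dots> = harm k" unfolding harm_def
      by (rule sum.reindex_bij_witness[of _ "\<lambda>i. k - i" "\<lambda>j. k - j"]) (auto simp: field_simps)
    finally show ?thesis .
  qed
  have "K * real n < real m * harm m" using m by (simp add: n_def)
  also have "\<dots> = (\<Sum>k\<in>{m..<n}. harm m)" by (simp add: n_def)
  also have "\<dots> \<le> (\<Sum>k\<in>{m..<n}. harm k)" by (intro sum_mono harm_mono) auto
  also have "\<dots> \<le> (\<Sum>k<n. harm k)" by (intro sum_mono2 harm_nonneg) auto
  also have "\<dots> = (\<Sum>k<n. \<Sum>j<n. tri k j)" by (simp add: row)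
  finally show ?thesis using m by (intro exI[of _ n]) (simp add: n_def)
qed

text \<open>The commutator pairing on one block, expanded into scalar integrals. The coefficients
  \<open>w\<close> do not involve \<open>\<Lambda>\<close>, so the limit in \<open>\<Lambda>\<close>
  can be taken term by term in a finite sum.\<close>

definition block_pairing :: "nat \<Rightarrow> (real \<Rightarrow> real) \<Rightarrow> nat \<Rightarrow> nat \<Rightarrow> (nat \<Rightarrow> nat \<Rightarrow> nat set \<Rightarrow> nat set \<Rightarrow> 'k::real_vector) \<Rightarrow> 'k" where
  "block_pairing c h \<Lambda> n w = (\<Sum>C\<in>Pow {..<n}. \<Sum>k<n. \<Sum>j<n. \<Sum>A\<in>Pow {..<n}.
     (integral {real c..real c+1} (\<lambda>x. hilb (modulated' h (deriv h) (waves 4 A) \<Lambda>) x * h x * (waves 1 C (real \<Lambda> * x) * matrix_wave k j (real \<Lambda> * x)))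
    + integral {real c..real c+1} (\<lambda>x. hilb (modulated' h (deriv h) (waves 1 C) \<Lambda>) x * h x * (waves 4 A (real \<Lambda> * x) * matrix_wave k j (real \<Lambda> * x)))) *\<^sub>R w k j A C)"

lemma block_pairing_limit:
  fixes w :: "nat \<Rightarrow> nat \<Rightarrow> nat set \<Rightarrow> nat set \<Rightarrow> 'k::real_normed_vector"
  assumes h: "C1_on (real c) h (deriv h)" and h1: "\<And>x. \<bar>h x\<bar> \<le> 1"
  shows "(\<lambda>\<Lambda>. block_pairing c h \<Lambda> n w) \<longlonglongrightarrow> (- (1 / 4) * integral {real c..real c+1} (\<lambda>x. h x * h x)) *\<^sub>R (\<Sum>k<n. \<Sum>j<n. w k j {j} {k})"
proof -
  define \<kappa> where "\<kappa> = - (1 / 4) * integral {real c..real c+1} (\<lambda>x. h x * h x)"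
  have "(\<lambda>\<Lambda>. block_pairing c h \<Lambda> n w) \<longlonglongrightarrow> (\<Sum>C\<in>Pow {..<n}. \<Sum>k<n. \<Sum>j<n. \<Sum>A\<in>Pow {..<n}.
     ((if A = {j} \<and> C = {k} then \<kappa> else 0) + 0) *\<^sub>R w k j A C)"
    unfolding block_pairing_def \<kappa>_def
    by (intro tendsto_sum tendsto_scaleR tendsto_add tendsto_const hilb_waves_limits[OF h h1]) auto
  also have "(\<Sum>C\<in>Pow {..<n}. \<Sum>k<n. \<Sum>j<n. \<Sum>A\<in>Pow {..<n}. ((if A = {j} \<and> C = {k} then \<kappa> else 0) + 0) *\<^sub>R w k j A C)
     = (\<Sum>C\<in>Pow {..<n}. \<Sum>k<n. if C = {k} then \<kappa> *\<^sub>R (\<Sum>j<n. w k j {j} {k}) else 0)"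
  proof (intro sum.cong refl)
    fix C :: "nat set" and k
    have "(\<Sum>A\<in>Pow {..<n}. (if A = {j} \<and> C = {k} then \<kappa> else 0) *\<^sub>R w k j A C) = (if C = {k} then \<kappa> *\<^sub>R w k j {j} {k} else 0)" if "j < n" for j
    proof -
      have "(\<Sum>A\<in>Pow {..<n}. (if A = {j} \<and> C = {k} then \<kappa> else 0) *\<^sub>R w k j A C)
        = (\<Sum>A\<in>Pow {..<n}. if A = {j} then (if C = {k} then \<kappa> *\<^sub>R w k j {j} {k} else 0) else 0)"
        by (intro sum.cong) auto
      then show ?thesis using that by (simp add: sum.delta)
    qed
    then show "(\<Sum>j<n. \<Sum>A\<in>Pow {..<n}. ((if A = {j} \<and> C = {k} then \<kappa> else 0) + 0) *\<^sub>R w k j A C) =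
       (if C = {k} then \<kappa> *\<^sub>R (\<Sum>j<n. w k j {j} {k}) else 0)"
      by (simp add: scaleR_sum_right)
  qed
  also have "\<dots> = (\<Sum>k<n. \<Sum>C\<in>Pow {..<n}. if C = {k} then \<kappa> *\<^sub>R (\<Sum>j<n. w k j {j} {k}) else 0)" by (rule sum.swap)
  also have "\<dots> = \<kappa> *\<^sub>R (\<Sum>k<n. \<Sum>j<n. w k j {j} {k})" by (simp add: sum.delta scaleR_sum_right)
  finally show ?thesis unfolding \<kappa>_def .
qed

section \<open>The commutator pairing of a single block\<close>

context banach_space_over
begin

lemma test_tensor_sum:
  assumes I: "finite I" and u: "\<And>i. i \<in> I \<Longrightarrow> smooth (u i)" "\<And>i x. i \<in> I \<Longrightarrow> x \<notin> {a..b} \<Longrightarrow> u i x = 0"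
    and e: "\<And>i. i \<in> I \<Longrightarrow> e i \<in> E"
  shows "(\<lambda>x. \<Sum>i\<in>I. u i x *\<^sub>R e i) \<in> test_tensor smul E"
proof -
  obtain b' where b': "bij_betw b' {0..<card I} I" using ex_bij_betw_nat_finite[OF I] by blast
  then have mem: "b' i \<in> I" if "i < card I" for i using that by (auto simp: bij_betw_def)
  have "(\<Sum>i\<in>I. u i x *\<^sub>R e i) = (\<Sum>i<card I. smul (of_real (u (b' i) x)) (e (b' i)))" for x
    using sum.reindex_bij_betw[OF b', of "\<lambda>i. u i x *\<^sub>R e i"] by (simp add: scale_of_real atLeast0LessThan)
  moreover have "test_function (\<lambda>x. of_real (u (b' i) x) :: 'k)" if "i < card I" for i
    using mem[OF that] u by (intro test_function_of_real[of _ a b]) auto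
  ultimately show ?thesis unfolding test_tensor_def mem_Collect_eq
    by (intro exI[of _ "card I"] exI[of _ "\<lambda>i x. of_real (u (b' i) x)"] exI[of _ "\<lambda>i. e (b' i)"]) (use mem e in auto)
qed

lemma riesz_in_test_tensor:
  assumes h: "smooth h" "\<And>x. x \<notin> {a..b} \<Longrightarrow> h x = 0" and e: "\<And>A. walsh_coefficient {..<n} f A \<in> E"
  shows "riesz h \<mu> \<Lambda> n f \<in> test_tensor smul E"
  unfolding riesz_def[abs_def]
  by (rule test_tensor_sum[where a = a and b = b])
     (use h e in \<open>auto intro!: smooth_mult smooth_waves intro: finite_subset\<close>)

lemma block_operator_bilinear:
  assumes g: "\<And>C. C \<in> Q \<Longrightarrow> g C \<in> dual_space smul"
    and x: "\<lfloor>x\<rfloor> = m"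
  shows "blinfun_apply (\<Sum>C\<in>Q. \<beta> C *\<^sub>R g C) (block_operator N L y \<phi> x (\<Sum>A\<in>P. \<alpha> A *\<^sub>R f A)) =
    (\<Sum>C\<in>Q. \<Sum>k<N m. \<Sum>j<N m. \<Sum>A\<in>P. (\<alpha> A * \<beta> C * matrix_wave k j (real (L m) * x)) *\<^sub>R
       (tri k j *\<^sub>R (blinfun_apply (\<phi> m j) (f A) * blinfun_apply (g C) (y m k))))"
proof -
  have "blinfun_apply (g C) (block_operator N L y \<phi> x (\<Sum>A\<in>P. \<alpha> A *\<^sub>R f A)) =
    (\<Sum>k<N m. \<Sum>j<N m. \<Sum>A\<in>P. (\<alpha> A * matrix_wave k j (real (L m) * x)) *\<^sub>R
       (tri k j *\<^sub>R (blinfun_apply (\<phi> m j) (f A) * blinfun_apply (g C) (y m k))))" if "C \<in> Q" for C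
    unfolding block_operator_def x matrix_wave_def
    by (simp only: blinfun.sum_right blinfun.scaleR_right dual_space_smul[OF g[OF that]]
        scaleR_sum_right sum_distrib_right scaleR_scaleR mult_scaleR_left) (simp add: mult_ac)
  then show ?thesis
    by (simp add: blinfun.sum_left blinfun.scaleR_left scaleR_sum_right mult_ac)
qed

text \<open>Both test functions live on the unit interval of block \<open>c\<close>, so the pairing
  sees just this block of the operator and needs the transforms just on this interval.\<close>

lemma commutator_pairing_riesz:
  assumes h: "C1_on (real c) h (deriv h)" and g: "\<And>C. walsh_coefficient {..<n} g C \<in> dual_space smul"
    and n: "N (int c) = n" "L (int c) = \<Lambda>"
  shows "commutator_pairing (block_operator N L y \<phi>) (riesz h 4 \<Lambda> n f) (riesz h 1 \<Lambda> n g) =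
    block_pairing c h \<Lambda> n (\<lambda>k j A C. tri k j *\<^sub>R (blinfun_apply (\<phi> (int c) j) (walsh_coefficient {..<n} f A) *
      blinfun_apply (walsh_coefficient {..<n} g C) (y (int c) k)))"
proof -
  define w where "w = (\<lambda>k j A C. tri k j *\<^sub>R (blinfun_apply (\<phi> (int c) j) (walsh_coefficient {..<n} f A) *
      blinfun_apply (walsh_coefficient {..<n} g C) (y (int c) k)))"
  define I where "I = {real c..real c+1}"
  define q1 where "q1 = (\<lambda>C k j A x. hilb (modulated' h (deriv h) (waves 4 A) \<Lambda>) x * h x * (waves 1 C (real \<Lambda> * x) * matrix_wave k j (real \<Lambda> * x)))"
  define q2 where "q2 = (\<lambda>C k j A x. hilb (modulated' h (deriv h) (waves 1 C) \<Lambda>) x * h x * (waves 4 A (real \<Lambda> * x) * matrix_wave k j (real \<Lambda> * x)))"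
  define R where "R = (\<lambda>x. \<Sum>C\<in>Pow {..<n}. \<Sum>k<n. \<Sum>j<n. \<Sum>A\<in>Pow {..<n}. (q1 C k j A x + q2 C k j A x) *\<^sub>R w k j A C)"
  define T where "T = (\<lambda>x. blinfun_apply (riesz h 1 \<Lambda> n g x) (block_operator N L y \<phi> x (hilbert_transform (riesz h 4 \<Lambda> n f) x)) +
     blinfun_apply (hilbert_transform (riesz h 1 \<Lambda> n g) x) (block_operator N L y \<phi> x (riesz h 4 \<Lambda> n f x)))"
  have fin: "finite A" if "A \<in> Pow {..<n}" for A :: "nat set" using that finite_subset by auto
  have TR: "T x = indicator I x *\<^sub>R R x" for x
  proof (cases "x \<in> {real c..<real c+1}")
    case True
    then have fl: "\<lfloor>x\<rfloor> = int c" and xI: "x \<in> I" by (auto simp: floor_unique I_def)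
    have H: "hilbert_transform (riesz h \<mu> \<Lambda> n F) x = (\<Sum>A\<in>Pow {..<n}. hilb (modulated' h (deriv h) (waves \<mu> A) \<Lambda>) x *\<^sub>R walsh_coefficient {..<n} F A)"
      for \<mu> and F :: "nat set \<Rightarrow> 'e::banach"
      unfolding riesz_def[abs_def]
      by (rule hilbert_transform_sum[where c = "real c"]) (use xI fin in \<open>auto simp: I_def intro!: C1_on_modulated[OF h] intro: finite_subset\<close>)
    have "T x = R x"
      unfolding T_def H riesz_def block_operator_bilinear[OF g fl] n R_def q1_def q2_def w_def
      by (simp only: sum.distrib[symmetric] scaleR_add_left[symmetric]) (simp add: mult_ac add.commute)
    then show ?thesis using xI by simp
  next
    case False
    \<comment> \<open>The right end point already belongs to the next block; the bump vanishes there
      by continuity.\<close>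
    have "h x = 0"
    proof (cases "x = real c + 1")
      case True
      have "closed {x. h x = 0}" by (intro closed_Collect_eq C1_onD(4)[OF h] continuous_on_const)
      moreover have "{real c + 1<..} \<subseteq> {x. h x = 0}" using C1_onD(3)[OF h] by auto
      ultimately have "closure {real c + 1<..} \<subseteq> {x. h x = 0}" by (rule closure_minimal[rotated])
      then show ?thesis using True by auto
    qed (use False C1_onD(3)[OF h] in auto)
    then have "T x = 0" "R x = 0"
      unfolding T_def R_def q1_def q2_def riesz_def by (simp_all add: block_operator_def)
    then show ?thesis by simp
  qed
  have hc: "continuous_on I h" by (rule C1_onD(4)[OF h])
  have wv: "continuous_on I (\<lambda>x. waves \<mu> A (real \<Lambda> * x))" "continuous_on I (\<lambda>x. matrix_wave k j (real \<Lambda> * x))" for \<mu> A k j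
    unfolding waves_def matrix_wave_def mult.assoc[symmetric] by (intro continuous_intros continuous_on_sn_cs_mult)+
  have hb: "continuous_on I (hilb (modulated' h (deriv h) (waves \<mu> A) \<Lambda>))" if "A \<in> Pow {..<n}" for \<mu> A
    by (rule continuous_on_hilb[OF C1_onD(2)[OF C1_on_modulated[OF h fin[OF that]]]])
  have q: "continuous_on I (q1 C k j A)" "continuous_on I (q2 C k j A)" if "A \<in> Pow {..<n}" "C \<in> Pow {..<n}" for A C k j
    unfolding q1_def q2_def using that by (intro continuous_intros hc wv hb; simp)+
  have "(R has_integral (\<Sum>C\<in>Pow {..<n}. \<Sum>k<n. \<Sum>j<n. \<Sum>A\<in>Pow {..<n}. (integral I (q1 C k j A) + integral I (q2 C k j A)) *\<^sub>R w k j A C)) I"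
    unfolding R_def I_def
    by (intro has_integral_sum has_integral_scaleR_left has_integral_add integrable_integral integrable_continuous_real q[unfolded I_def]) auto
  then have int: "integral I R = block_pairing c h \<Lambda> n w"
    by (simp add: integral_unique block_pairing_def q1_def q2_def I_def)
  have "continuous_on I R" unfolding R_def by (intro continuous_intros q) auto
  then have "set_integrable lebesgue I R" unfolding I_def by (rule absolutely_integrable_continuous_real)
  then have "(LINT x:I|lebesgue. R x) = integral I R" by (rule set_lebesgue_integral_eq_integral)
  then show ?thesis
    unfolding commutator_pairing_def T_def[symmetric] TR int[unfolded w_def, symmetric] set_lebesgue_integral_def w_def by simp
qed

end

context banach_space_over
begin

lemma walsh_coefficient_in_dual_space:
  assumes "\<And>A. g A \<in> dual_space smul"
  shows "walsh_coefficient J g C \<in> dual_space smul"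
  unfolding walsh_coefficient_def cavg_def
  by (intro real_vector.subspace_scale real_vector.subspace_sum dual_space_subspace assms)

lemma blinfun_apply_walsh_singleton:
  "blinfun_apply \<psi> (walsh_coefficient J f {j}) = cavg J (\<lambda>\<sigma>. sg \<sigma> j *\<^sub>R blinfun_apply \<psi> (f \<sigma>))"
  "blinfun_apply (walsh_coefficient J g {j}) v = cavg J (\<lambda>\<sigma>. sg \<sigma> j *\<^sub>R blinfun_apply (g \<sigma>) v)"
  unfolding walsh_coefficient_def
  using cavg_bounded_linear[OF blinfun.bounded_linear_right, of \<psi> J "\<lambda>\<sigma>. sg \<sigma> j *\<^sub>R f \<sigma>"]
    cavg_bounded_linear[OF blinfun.bounded_linear_left, where F = "\<lambda>\<sigma>. sg \<sigma> j *\<^sub>R g \<sigma>" and J = J]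
  by (simp_all add: blinfun.scaleR_left blinfun.scaleR_right)

text \<open>\<open>C\<close> and \<open>C'\<close> come before \<open>c\<close>, since the bounds on
  the glued operator must be uniform. For each \<open>c\<close>, first \<open>n\<close> is taken so
  large that the entries of the kernel sum to more than \<open>4 * c / \<kappa>\<close> times
  \<open>n\<close>, then \<open>\<Lambda>\<close> so large that the pairing is close to its
  limit.\<close>

lemma unbounded_block:
  assumes inf: "\<nexists>S. finite S \<and> module.span smul S = UNIV"
  shows "\<exists>C C'. 0 \<le> C \<and> 0 \<le> C' \<and> (\<forall>c. \<exists>n \<Lambda> y \<phi> f g. 1 \<le> \<Lambda> \<and>
     (\<forall>t. norm (\<Sum>k<n. smul (t k) (y k)) \<le> C * L2_set (\<lambda>k. norm (t k)) {..<n}) \<and>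
     (\<forall>t. norm (\<Sum>k<n. dual_scale (t k) (\<phi> k)) \<le> C' * L2_set (\<lambda>k. norm (t k)) {..<n}) \<and>
     (\<forall>k<n. \<phi> k \<in> dual_space smul) \<and>
     (\<forall>A. norm (f A) \<le> sqrt (real n)) \<and> (\<forall>A. g A \<in> dual_space smul \<and> norm (g A) \<le> sqrt (real n)) \<and>
     real c * real n < norm (block_pairing c (\<lambda>x. bump (x - real c)) \<Lambda> n (\<lambda>k j A Q. tri k j *\<^sub>R
       (blinfun_apply (\<phi> j) (walsh_coefficient {..<n} f A) * blinfun_apply (walsh_coefficient {..<n} g Q) (y k)))))"
proof -
  obtain C where C: "0 \<le> C" "\<forall>n. \<exists>y g.
     (\<forall>t. norm (\<Sum>k<n. smul (t k) (y k)) \<le> C * L2_set (\<lambda>k. norm (t k)) {..<n}) \<and>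
     (\<forall>A. g A \<in> dual_space smul \<and> norm (g A) \<le> sqrt (real n)) \<and>
     (\<forall>k<n. cavg {..<n} (\<lambda>A. sg A k *\<^sub>R blinfun_apply (g A) (y k)) = 1)"
    using correlated_signs_primal[OF inf] by (elim exE conjE)
  obtain C' where C': "0 \<le> C'" "\<forall>n. \<exists>\<phi> f. (\<forall>k<n. \<phi> k \<in> dual_space smul) \<and>
     (\<forall>t. norm (\<Sum>k<n. dual_scale (t k) (\<phi> k)) \<le> C' * L2_set (\<lambda>k. norm (t k)) {..<n}) \<and>
     (\<forall>A. norm (f A :: 'a) \<le> sqrt (real n)) \<and>
     (\<forall>k<n. cavg {..<n} (\<lambda>A. sg A k *\<^sub>R blinfun_apply (\<phi> k) (f A)) = 1)"
    using correlated_signs_dual[OF inf] by (elim exE conjE)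
  have main: "\<exists>n \<Lambda> y \<phi> f g. 1 \<le> \<Lambda> \<and>
     (\<forall>t. norm (\<Sum>k<n. smul (t k) (y k)) \<le> C * L2_set (\<lambda>k. norm (t k)) {..<n}) \<and>
     (\<forall>t. norm (\<Sum>k<n. dual_scale (t k) (\<phi> k)) \<le> C' * L2_set (\<lambda>k. norm (t k)) {..<n}) \<and>
     (\<forall>k<n. \<phi> k \<in> dual_space smul) \<and>
     (\<forall>A. norm (f A) \<le> sqrt (real n)) \<and> (\<forall>A. g A \<in> dual_space smul \<and> norm (g A) \<le> sqrt (real n)) \<and>
     real c * real n < norm (block_pairing c (\<lambda>x. bump (x - real c)) \<Lambda> n (\<lambda>k j A Q. tri k j *\<^sub>R
       (blinfun_apply (\<phi> j) (walsh_coefficient {..<n} f A) * blinfun_apply (walsh_coefficient {..<n} g Q) (y k))))" for c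
  proof -
    define h where "h = (\<lambda>x. bump (x - real c))"
    have h: "C1_on (real c) h (deriv h)" unfolding h_def
      by (intro smooth_C1_on smooth_bump bump_eq_0) auto
    have h1: "\<bar>h x\<bar> \<le> 1" for x using bump_bounds[of "x - real c"] by (simp add: h_def)
    define \<kappa> where "\<kappa> = integral {real c..real c+1} (\<lambda>x. h x * h x)"
    have hc: "continuous_on {real c..real c+1} (\<lambda>x. h x * h x)" by (intro continuous_intros C1_onD(4)[OF h])
    have \<kappa>: "0 < \<kappa>"
    proof -
      have "0 \<le> \<kappa>" unfolding \<kappa>_def by (intro integral_nonneg integrable_continuous_real hc) auto
      moreover have "\<kappa> \<noteq> 0"
      proof
        assume "\<kappa> = 0"
        then have "((\<lambda>x. h x * h x) has_integral 0) (cbox (real c) (real c + 1))"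
          using integrable_integral[OF integrable_continuous_real[OF hc]] by (simp add: \<kappa>_def)
        then have "h (real c + 1/2) * h (real c + 1/2) = 0"
          by (rule has_integral_0_cbox_imp_0[rotated 2]) (use hc in auto)
        then show False using bump_pos[of "1/2"] by (simp add: h_def)
      qed
      ultimately show ?thesis by simp
    qed
    obtain n where n: "n \<ge> 1" "(4 * real c / \<kappa>) * real n < (\<Sum>k<n. \<Sum>j<n. tri k j)" using sum_tri_unbounded by blast
    obtain y g where y: "\<forall>t. norm (\<Sum>k<n. smul (t k) (y k)) \<le> C * L2_set (\<lambda>k. norm (t k)) {..<n}"
      "\<forall>A. g A \<in> dual_space smul \<and> norm (g A) \<le> sqrt (real n)"
      "\<forall>k<n. cavg {..<n} (\<lambda>A. sg A k *\<^sub>R blinfun_apply (g A) (y k)) = 1"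
      using spec[OF C(2), of n] by (elim exE conjE)
    obtain \<phi> f where \<phi>: "\<forall>k<n. \<phi> k \<in> dual_space smul"
     "\<forall>t. norm (\<Sum>k<n. dual_scale (t k) (\<phi> k)) \<le> C' * L2_set (\<lambda>k. norm (t k)) {..<n}"
     "\<forall>A. norm (f A :: 'a) \<le> sqrt (real n)"
     "\<forall>k<n. cavg {..<n} (\<lambda>A. sg A k *\<^sub>R blinfun_apply (\<phi> k) (f A)) = 1"
      using spec[OF C'(2), of n] by (elim exE conjE)
    define w where "w = (\<lambda>k j A Q. tri k j *\<^sub>R
       (blinfun_apply (\<phi> j) (walsh_coefficient {..<n} f A) * blinfun_apply (walsh_coefficient {..<n} g Q) (y k)))"
    \<comment> \<open>The normalised correlations of both sign systems enter here: the linear Walsh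
      coefficients pair to 1, which leaves the bare kernel.\<close>
    have w: "w k j {j} {k} = tri k j *\<^sub>R 1" if "k < n" "j < n" for k j
      using that y(3) \<phi>(4) by (simp add: w_def blinfun_apply_walsh_singleton)
    have "(\<Sum>k<n. \<Sum>j<n. w k j {j} {k}) = (\<Sum>k<n. \<Sum>j<n. tri k j) *\<^sub>R 1"
      by (simp add: w scaleR_sum_left)
    then have "(\<lambda>\<Lambda>. block_pairing c h \<Lambda> n w) \<longlonglongrightarrow> (- (1 / 4) * \<kappa>) *\<^sub>R ((\<Sum>k<n. \<Sum>j<n. tri k j) *\<^sub>R 1)"
      using block_pairing_limit[OF h h1, of n w] by (simp add: \<kappa>_def)
    then have lim: "(\<lambda>\<Lambda>. norm (block_pairing c h \<Lambda> n w)) \<longlonglongrightarrow> norm ((- (1 / 4) * \<kappa>) *\<^sub>R ((\<Sum>k<n. \<Sum>j<n. tri k j) *\<^sub>R (1::'k)))"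
      by (rule tendsto_norm)
    have "norm ((- (1 / 4) * \<kappa>) *\<^sub>R ((\<Sum>k<n. \<Sum>j<n. tri k j) *\<^sub>R (1::'k))) = \<kappa> / 4 * (\<Sum>k<n. \<Sum>j<n. tri k j)"
      using \<kappa> by (simp add: abs_mult abs_of_nonneg[OF sum_nonneg[OF sum_nonneg]] tri_nonneg)
    moreover have "real c * real n < \<kappa> / 4 * (\<Sum>k<n. \<Sum>j<n. tri k j)"
      using mult_strict_left_mono[OF n(2), of "\<kappa> / 4"] \<kappa> by simp
    ultimately have "eventually (\<lambda>\<Lambda>. real c * real n < norm (block_pairing c h \<Lambda> n w)) sequentially"
      using lim by (intro order_tendstoD(1)) auto
    then have "eventually (\<lambda>\<Lambda>. real c * real n < norm (block_pairing c h \<Lambda> n w) \<and> 1 \<le> \<Lambda>) sequentially"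
      using eventually_ge_at_top[of "1::nat"] by (rule eventually_conj)
    then obtain \<Lambda> where \<Lambda>: "real c * real n < norm (block_pairing c h \<Lambda> n w)" "1 \<le> \<Lambda>" by (auto simp: eventually_sequentially)
    show ?thesis
      using \<Lambda>[unfolded h_def w_def] y \<phi>
      by (intro exI[of _ n] exI[of _ \<Lambda>] exI[of _ y] exI[of _ \<phi>] exI[of _ f] exI[of _ g] conjI) auto
  qed
  show ?thesis by (intro exI[of _ C] exI[of _ C'] conjI C(1) C'(1) allI main)
qed

end

theorem theorem9p1:
  fixes smul :: "'k::{real_normed_field,euclidean_space} \<Rightarrow> 'a::banach \<Rightarrow> 'a"
    and p :: real
  assumes "banach_space_over smul"
    and "\<nexists>S. finite S \<and> module.span smul S = UNIV"
    and "1 < p"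
  shows "\<exists>B. B \<in> BMO_so smul UNIV \<and>
             (\<lambda>x. adjoint_operator (B x)) \<in> BMO_so dual_scale (dual_space smul) \<and>
             \<not> commutator_bounded smul p B"
proof -
  interpret banach_space_over smul by (rule assms(1))
  interpret dual: banach_space_over "dual_scale :: 'k \<Rightarrow> ('a \<Rightarrow>\<^sub>L 'k) \<Rightarrow> _" by (rule banach_space_over_dual_scale)
  obtain C C' where C: "0 \<le> C" "0 \<le> C'" and ex: "\<forall>c. \<exists>n \<Lambda> y \<phi> f g. 1 \<le> \<Lambda> \<and>
     (\<forall>t. norm (\<Sum>k<n. smul (t k) (y k)) \<le> C * L2_set (\<lambda>k. norm (t k)) {..<n}) \<and>
     (\<forall>t. norm (\<Sum>k<n. dual_scale (t k) (\<phi> k)) \<le> C' * L2_set (\<lambda>k. norm (t k)) {..<n}) \<and>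
     (\<forall>k<n. \<phi> k \<in> dual_space smul) \<and>
     (\<forall>A. norm (f A) \<le> sqrt (real n)) \<and> (\<forall>A. g A \<in> dual_space smul \<and> norm (g A) \<le> sqrt (real n)) \<and>
     real c * real n < norm (block_pairing c (\<lambda>x. bump (x - real c)) \<Lambda> n (\<lambda>k j A Q. tri k j *\<^sub>R
       (blinfun_apply (\<phi> j) (walsh_coefficient {..<n} f A) * blinfun_apply (walsh_coefficient {..<n} g Q) (y k))))"
    using unbounded_block[OF assms(2)] by (elim exE conjE)
  obtain n \<Lambda> y \<phi> f g where dat: "\<forall>c. 1 \<le> \<Lambda> c \<and>
     (\<forall>t. norm (\<Sum>k<n c. smul (t k) (y c k)) \<le> C * L2_set (\<lambda>k. norm (t k)) {..<n c}) \<and>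
     (\<forall>t. norm (\<Sum>k<n c. dual_scale (t k) (\<phi> c k)) \<le> C' * L2_set (\<lambda>k. norm (t k)) {..<n c}) \<and>
     (\<forall>k<n c. \<phi> c k \<in> dual_space smul) \<and>
     (\<forall>A. norm (f c A) \<le> sqrt (real (n c))) \<and> (\<forall>A. g c A \<in> dual_space smul \<and> norm (g c A) \<le> sqrt (real (n c))) \<and>
     real c * real (n c) < norm (block_pairing c (\<lambda>x. bump (x - real c)) (\<Lambda> c) (n c) (\<lambda>k j A Q. tri k j *\<^sub>R
       (blinfun_apply (\<phi> c j) (walsh_coefficient {..<n c} (f c) A) * blinfun_apply (walsh_coefficient {..<n c} (g c) Q) (y c k))))"
    using ex unfolding choice_iff by (elim exE)
  \<comment> \<open>On negative cells \<open>nat m\<close> is 0, so block 0 is repeated there; the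
    uniform bounds hold on every cell.\<close>
  define B where "B = block_operator (\<lambda>m. n (nat m)) (\<lambda>m. \<Lambda> (nat m)) (\<lambda>m. y (nat m)) (\<lambda>m. \<phi> (nat m))"
  have "B \<in> BMO_so smul UNIV"
    unfolding B_def by (rule block_operator_BMO_so[of _ C C']) (use C dat in auto)
  moreover have "(\<lambda>x. adjoint_operator (B x)) \<in> BMO_so dual_scale (dual_space smul)"
    unfolding B_def by (rule adjoint_block_operator_BMO_so[of _ C C']) (use C dat in auto)
  moreover have "\<not> commutator_bounded smul p B"
  proof
    assume "commutator_bounded smul p B"
    then obtain K where K: "\<forall>f\<in>test_tensor smul UNIV. \<forall>g\<in>test_tensor dual_scale (dual_space smul).
        norm (commutator_pairing B f g) \<le> K * Lp_norm p f * Lp_norm (p / (p - 1)) g"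
      unfolding commutator_bounded_def by blast
    \<comment> \<open>On block \<open>c\<close> the pairing exceeds \<open>c * n c\<close>, whereas
      both test functions have norm at most \<open>sqrt (n c)\<close>; a block with
      \<open>c \<ge> K\<close> contradicts the bound.\<close>
    obtain c :: nat where c: "K \<le> real c" using real_arch_simple by blast
    define h where "h = (\<lambda>x. bump (x - real c))"
    have h0: "h x = 0" if "x \<notin> {real c..real c+1}" for x
      using that by (auto simp: h_def intro!: bump_eq_0)
    have smh: "smooth h" unfolding h_def by (rule smooth_bump)
    have hb: "0 \<le> h x" "h x \<le> 1" for x by (simp_all add: h_def bump_bounds)
    define F where "F = riesz h 4 (\<Lambda> c) (n c) (f c)"
    define G where "G = riesz h 1 (\<Lambda> c) (n c) (g c)"
    have dual: "walsh_coefficient {..<n c} (g c) Q \<in> dual_space smul" for Q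
      using dat by (intro walsh_coefficient_in_dual_space) auto
    have FG: "F \<in> test_tensor smul UNIV" "G \<in> test_tensor dual_scale (dual_space smul)"
      unfolding F_def G_def by (rule riesz_in_test_tensor[OF smh h0] dual.riesz_in_test_tensor[OF smh h0]; simp add: dual)+
    have FG_le: "norm (F x) \<le> sqrt (real (n c)) * indicator {real c..real c+1} x"
      "norm (G x) \<le> sqrt (real (n c)) * indicator {real c..real c+1} x" for x
      unfolding F_def G_def using dat by (intro norm_riesz_le hb h0; auto)+
    have Lp: "Lp_norm p F \<le> sqrt (real (n c))" "Lp_norm (p / (p - 1)) G \<le> sqrt (real (n c))"
      using assms(3) by (intro Lp_norm_le[OF FG_le(1)] Lp_norm_le[OF FG_le(2)]; simp)+
    have nonneg: "0 \<le> Lp_norm p F" "0 \<le> Lp_norm (p / (p - 1)) G" by (simp_all add: Lp_norm_def)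
    have "commutator_pairing B F G = block_pairing c h (\<Lambda> c) (n c) (\<lambda>k j A Q. tri k j *\<^sub>R
       (blinfun_apply (\<phi> c j) (walsh_coefficient {..<n c} (f c) A) * blinfun_apply (walsh_coefficient {..<n c} (g c) Q) (y c k)))"
      unfolding B_def F_def G_def
      using commutator_pairing_riesz[where c = c and h = h and f = "f c" and g = "g c" and n = "n c" and \<Lambda> = "\<Lambda> c",
          OF smooth_C1_on[OF smh h0] dual, where N = "\<lambda>m. n (nat m)" and L = "\<lambda>m. \<Lambda> (nat m)"
        and y = "\<lambda>m. y (nat m)" and \<phi> = "\<lambda>m. \<phi> (nat m)"] by simp
    then have "real c * real (n c) < norm (commutator_pairing B F G)" using dat by (simp add: h_def)
    also have "\<dots> \<le> K * Lp_norm p F * Lp_norm (p / (p - 1)) G" using K FG by blast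
    also have "\<dots> \<le> real c * (Lp_norm p F * Lp_norm (p / (p - 1)) G)"
      unfolding mult.assoc using c nonneg by (intro mult_right_mono) auto
    also have "\<dots> \<le> real c * (sqrt (real (n c)) * sqrt (real (n c)))"
      using Lp nonneg by (intro mult_left_mono mult_mono) auto
    finally show False by simp
  qed
  ultimately show ?thesis by blast
qed

end
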